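(* Let $T=\mathbb{C}/(\mathbb{Z}\omega_1+\mathbb{Z}\omega_2)$ be any flat torus. The Green function $G$ of $T$ has at most five critical points in $T\setminus\{0\}$.
   Context: $\omega_1,\omega_2\in\mathbb{C}$ are linearly independent over $\mathbb{R}$. The Green function is $G(z)=G(z,0)$, where $G(z,w)$ is the unique function on $T\times T$ with $-\triangle_z G(z,w)=\delta_w(z)-\frac1{|T|}$ ($\delta_w$ the Dirac measure at $w$) and $\int_T G(z,w)\,dA=0$. It is smooth on $T\setminus\{0\}$ and singular at $0$. *)

theory Defs
  imports "HOL-Analysis.Analysis"
begin

text \<open>
  Points of the torus are cosets of the lattice; functions on the torus are represented by
  lattice-periodic functions on the complex plane.
\<close>

definition lattice :: "complex \<Rightarrow> complex \<Rightarrow> complex set" where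
  "lattice \<omega>1 \<omega>2 = {of_int m * \<omega>1 + of_int n * \<omega>2 | m n :: int. True}"

definition lattice_rel :: "complex \<Rightarrow> complex \<Rightarrow> (complex \<times> complex) set" where
  "lattice_rel \<omega>1 \<omega>2 = {(z, w). z - w \<in> lattice \<omega>1 \<omega>2}"

definition torus :: "complex \<Rightarrow> complex \<Rightarrow> complex set set" where
  "torus \<omega>1 \<omega>2 = UNIV // lattice_rel \<omega>1 \<omega>2"

definition torus_zero :: "complex \<Rightarrow> complex \<Rightarrow> complex set" where
  "torus_zero \<omega>1 \<omega>2 = lattice_rel \<omega>1 \<omega>2 `` {0}"

definition periodic :: "complex \<Rightarrow> complex \<Rightarrow> (complex \<Rightarrow> 'a) \<Rightarrow> bool" where
  "periodic \<omega>1 \<omega>2 f \<longleftrightarrow> (\<forall>z. \<forall>l\<in>lattice \<omega>1 \<omega>2. f (z + l) = f z)"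

definition fund_parallelogram :: "complex \<Rightarrow> complex \<Rightarrow> complex set" where
  "fund_parallelogram \<omega>1 \<omega>2 =
     {of_real s * \<omega>1 + of_real t * \<omega>2 | s t :: real. 0 \<le> s \<and> s < 1 \<and> 0 \<le> t \<and> t < 1}"

definition torus_integral :: "complex \<Rightarrow> complex \<Rightarrow> (complex \<Rightarrow> real) \<Rightarrow> real" where
  "torus_integral \<omega>1 \<omega>2 f = (LINT z:fund_parallelogram \<omega>1 \<omega>2|lborel. f z)"

definition torus_area :: "complex \<Rightarrow> complex \<Rightarrow> real" where
  "torus_area \<omega>1 \<omega>2 = measure lborel (fund_parallelogram \<omega>1 \<omega>2)"

text \<open>Real differentiability; the sets \<^term>\<open>S\<close> used below are open.\<close>

primrec Ck_on ::
  "nat \<Rightarrow> 'a::real_normed_vector set \<Rightarrow> ('a \<Rightarrow> 'b::real_normed_vector) \<Rightarrow> bool" where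
  "Ck_on 0 S f \<longleftrightarrow> continuous_on S f"
| "Ck_on (Suc k) S f \<longleftrightarrow> (\<forall>x\<in>S. f differentiable (at x)) \<and>
     (\<forall>v. Ck_on k S (\<lambda>x. frechet_derivative f (at x) v))"

definition smooth_on ::
  "'a::real_normed_vector set \<Rightarrow> ('a \<Rightarrow> 'b::real_normed_vector) \<Rightarrow> bool" where
  "smooth_on S f \<longleftrightarrow> (\<forall>k. Ck_on k S f)"

definition dir_deriv :: "complex \<Rightarrow> (complex \<Rightarrow> real) \<Rightarrow> complex \<Rightarrow> real" where
  "dir_deriv v f z = frechet_derivative f (at z) v"

definition laplacian :: "(complex \<Rightarrow> real) \<Rightarrow> complex \<Rightarrow> real" where
  "laplacian f z = dir_deriv 1 (dir_deriv 1 f) z + dir_deriv \<i> (dir_deriv \<i> f) z"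

text \<open>
  \<open>- \<Delta> g = \<delta>\<^sub>w - 1 / |T|\<close> in the sense of distributions on the torus: the test functions
  are the smooth periodic functions.
\<close>

definition green_equation :: "complex \<Rightarrow> complex \<Rightarrow> complex \<Rightarrow> (complex \<Rightarrow> real) \<Rightarrow> bool" where
  "green_equation \<omega>1 \<omega>2 w g \<longleftrightarrow>
     (\<forall>\<phi>. periodic \<omega>1 \<omega>2 \<phi> \<and> smooth_on UNIV \<phi> \<longrightarrow>
        - torus_integral \<omega>1 \<omega>2 (\<lambda>z. g z * laplacian \<phi> z) =
        \<phi> w - (1 / torus_area \<omega>1 \<omega>2) * torus_integral \<omega>1 \<omega>2 \<phi>)"

text \<open>
  A distributional solution is determined only almost everywhere; the smoothness clause selects
  the usual representative. The function \<^term>\<open>G\<close> is thereby determined at all points off the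
  diagonal of the torus; its values on the diagonal, where the Green function is singular, are
  arbitrary and play no role.
\<close>

definition is_green_function ::
  "complex \<Rightarrow> complex \<Rightarrow> (complex \<Rightarrow> complex \<Rightarrow> real) \<Rightarrow> bool" where
  "is_green_function \<omega>1 \<omega>2 G \<longleftrightarrow>
     (\<forall>w. periodic \<omega>1 \<omega>2 (\<lambda>z. G z w)) \<and> (\<forall>z. periodic \<omega>1 \<omega>2 (\<lambda>w. G z w)) \<and>
     (\<forall>w. smooth_on {z. z - w \<notin> lattice \<omega>1 \<omega>2} (\<lambda>z. G z w) \<and>
          set_integrable lborel (fund_parallelogram \<omega>1 \<omega>2) (\<lambda>z. G z w) \<and>
          green_equation \<omega>1 \<omega>2 w (\<lambda>z. G z w) \<and>
          torus_integral \<omega>1 \<omega>2 (\<lambda>z. G z w) = 0)"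

text \<open>For periodic \<^term>\<open>g\<close> the choice of the representative \<^term>\<open>z\<close> is immaterial.\<close>

definition torus_critical_points ::
  "complex \<Rightarrow> complex \<Rightarrow> (complex \<Rightarrow> real) \<Rightarrow> complex set set" where
  "torus_critical_points \<omega>1 \<omega>2 g =
     {p \<in> torus \<omega>1 \<omega>2. \<exists>z\<in>p. (g has_derivative (\<lambda>_. 0)) (at z)}"

end

theory Submission
  imports Defs "HOL-Complex_Analysis.Complex_Analysis" "HOL-Real_Asymp.Real_Asymp"
begin

text \<open>
  Following Bergweiler and Eremenko, the critical points of \<open>G\<close> are the fixed points of an
  antiholomorphic map: since \<open>\<Delta> G = 1 / |T|\<close> off the lattice,
  \<open>F z = cnj z - 2 |T| (G\<^sub>x - \<i> G\<^sub>y)\<close> is meromorphic with simple poles at the lattice points and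
  \<open>F (z + l) = F z + cnj l\<close>, and \<open>z\<close> is critical iff \<open>cnj (F z) = z\<close>. Modulo the lattice \<open>F\<close> has
  only two critical points, and by Fatou's theorem every non-repelling fixed point of \<open>cnj \<circ> F\<close>
  attracts the orbit of one of them; the same holds for \<open>F\<close> plus a constant. Hence every point has
  at most two preimages under \<open>h z = z - cnj (F z)\<close> on the torus at which \<open>h\<close> preserves orientation
  or is degenerate. Near infinity, \<open>h\<close> takes every value at most once, so the degree of \<open>h\<close> is at
  least \<open>-1\<close>, and at most three zeros of \<open>h\<close> reverse orientation; these are the repelling fixed points.
\<close>

subsection \<open>The period lattice\<close>

text \<open>Neutral fixed points are harmless because of the conjugation: at a fixed point the
  second iterate of \<open>cnj \<circ> F\<close> has derivative |F'|^2, so a neutral point has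
  multiplier 1 and is parabolic; rotation domains cannot occur.

  Fatou's theorem is drawn from Schottky's theorem. If a convex region in the basin missed all
  critical orbits, inverse branches of every iterate would exist on it and would omit the lattice.
  These branches are lifts, so F has to be a covering over its noncritical values. This is not
  automatic, since every value has infinitely many preimages, which escape to infinity along with
  the poles.

  The degree enters only through integrals of a bump composed with \<open>h\<close>, times the
  Jacobian, for one bump at 0 and one far out. The two integrals agree. In units of the mass of the
  bump, four reversing zeros would make the first at most 2 - 4 = -2, while the second is at least 0
  - 1 = -1.

  Since G is given by a distributional equation, the holomorphy of F and the order of its poles must
  themselves be extracted from suitable test functions.\<close>

locale period_lattice =
  fixes \<omega>1 \<omega>2 :: complex
  assumes Im_nonzero: "Im (cnj \<omega>1 * \<omega>2) \<noteq> 0"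
begin

abbreviation \<Lambda> :: "complex set" where "\<Lambda> \<equiv> lattice \<omega>1 \<omega>2"

abbreviation P :: "complex set" where "P \<equiv> fund_parallelogram \<omega>1 \<omega>2"

text \<open>Cramer's rule in the real basis \<omega>1, \<omega>2; the denominator is the determinant
  of the two periods. In these coordinates membership in the lattice becomes integrality.\<close>

definition coord1 :: "complex \<Rightarrow> real" where
  "coord1 z = Im (cnj z * \<omega>2) / Im (cnj \<omega>1 * \<omega>2)"

definition coord2 :: "complex \<Rightarrow> real" where
  "coord2 z = Im (cnj \<omega>1 * z) / Im (cnj \<omega>1 * \<omega>2)"

lemma coord_decomp: "z = of_real (coord1 z) * \<omega>1 + of_real (coord2 z) * \<omega>2"
proof -
  have "of_real (Im (cnj \<omega>1 * \<omega>2)) * z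
      = of_real (Im (cnj z * \<omega>2)) * \<omega>1 + of_real (Im (cnj \<omega>1 * z)) * \<omega>2"
    by (simp add: complex_eq_iff algebra_simps)
  also have "\<dots> = of_real (Im (cnj \<omega>1 * \<omega>2)) * (of_real (coord1 z) * \<omega>1 + of_real (coord2 z) * \<omega>2)"
    using Im_nonzero unfolding coord1_def coord2_def distrib_left mult.assoc[symmetric]
        of_real_mult[symmetric] by simp
  finally show ?thesis
    using Im_nonzero by (metis mult_cancel_left of_real_eq_0_iff)
qed

lemma coord1_comb [simp]: "coord1 (of_real s * \<omega>1 + of_real t * \<omega>2) = s"
proof -
  have "Im (cnj (of_real s * \<omega>1 + of_real t * \<omega>2) * \<omega>2) = s * Im (cnj \<omega>1 * \<omega>2)"
    by (simp add: algebra_simps)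
  then show ?thesis using Im_nonzero by (simp add: coord1_def)
qed

lemma coord2_comb [simp]: "coord2 (of_real s * \<omega>1 + of_real t * \<omega>2) = t"
proof -
  have "Im (cnj \<omega>1 * (of_real s * \<omega>1 + of_real t * \<omega>2)) = t * Im (cnj \<omega>1 * \<omega>2)"
    by (simp add: algebra_simps)
  then show ?thesis using Im_nonzero by (simp add: coord2_def)
qed

lemma coord1_add: "coord1 (z + w) = coord1 z + coord1 w"
  and coord2_add: "coord2 (z + w) = coord2 z + coord2 w"
  and coord1_diff: "coord1 (z - w) = coord1 z - coord1 w"
  and coord2_diff: "coord2 (z - w) = coord2 z - coord2 w"
  by (simp_all add: coord1_def coord2_def algebra_simps add_divide_distrib diff_divide_distrib)

lemma continuous_on_coord [continuous_intros]:
  "continuous_on S coord1" "continuous_on S coord2"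
  unfolding coord1_def coord2_def using Im_nonzero by (auto intro!: continuous_intros)

lemma abs_coord1_le: "\<bar>coord1 z\<bar> \<le> norm z * norm \<omega>2 / \<bar>Im (cnj \<omega>1 * \<omega>2)\<bar>"
  using abs_Im_le_cmod[of "cnj z * \<omega>2"] Im_nonzero
  by (simp add: coord1_def norm_mult divide_right_mono)

lemma abs_coord2_le: "\<bar>coord2 z\<bar> \<le> norm z * norm \<omega>1 / \<bar>Im (cnj \<omega>1 * \<omega>2)\<bar>"
  using abs_Im_le_cmod[of "cnj \<omega>1 * z"] Im_nonzero
  by (simp add: coord2_def norm_mult divide_right_mono mult.commute)

lemma lattice_iff: "z \<in> \<Lambda> \<longleftrightarrow> coord1 z \<in> \<int> \<and> coord2 z \<in> \<int>"
proof
  assume "z \<in> \<Lambda>"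
  then obtain m n where "z = of_int m * \<omega>1 + of_int n * \<omega>2" by (auto simp: lattice_def)
  then have "z = of_real (of_int m) * \<omega>1 + of_real (of_int n) * \<omega>2" by simp
  then have "coord1 z = of_int m" "coord2 z = of_int n" by (metis coord1_comb, metis coord2_comb)
  then show "coord1 z \<in> \<int> \<and> coord2 z \<in> \<int>" by simp
next
  assume "coord1 z \<in> \<int> \<and> coord2 z \<in> \<int>"
  then obtain m n where "coord1 z = of_int m" "coord2 z = of_int n" by (auto elim!: Ints_cases)
  then have "z = of_int m * \<omega>1 + of_int n * \<omega>2" using coord_decomp[of z] by simp
  then show "z \<in> \<Lambda>" by (auto simp: lattice_def)
qed

lemma lattice_0 [simp]: "0 \<in> \<Lambda>"
  by (simp add: lattice_iff coord1_def coord2_def)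

lemma lattice_add: "z \<in> \<Lambda> \<Longrightarrow> w \<in> \<Lambda> \<Longrightarrow> z + w \<in> \<Lambda>"
  by (simp add: lattice_iff coord1_add coord2_add)

lemma lattice_diff: "z \<in> \<Lambda> \<Longrightarrow> w \<in> \<Lambda> \<Longrightarrow> z - w \<in> \<Lambda>"
  by (simp add: lattice_iff coord1_diff coord2_diff)

lemma lattice_minus [simp]: "- z \<in> \<Lambda> \<longleftrightarrow> z \<in> \<Lambda>"
  using lattice_diff[of 0 z] lattice_diff[of 0 "-z"] by auto

lemma lattice_add_cancel: "l \<in> \<Lambda> \<Longrightarrow> z + l \<in> \<Lambda> \<longleftrightarrow> z \<in> \<Lambda>"
  using lattice_add lattice_diff[of "z + l" l] by auto

lemma lattice_diff_cancel: "l \<in> \<Lambda> \<Longrightarrow> z - l \<in> \<Lambda> \<longleftrightarrow> z \<in> \<Lambda>"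
  using lattice_add_cancel[of "-l" z] by simp

lemma periods_in_lattice: "\<omega>1 \<in> \<Lambda>" "\<omega>2 \<in> \<Lambda>"
proof -
  have "\<omega>1 = of_int 1 * \<omega>1 + of_int 0 * \<omega>2" "\<omega>2 = of_int 0 * \<omega>1 + of_int 1 * \<omega>2" by auto
  then show "\<omega>1 \<in> \<Lambda>" "\<omega>2 \<in> \<Lambda>" unfolding lattice_def by blast+
qed

lemma period_nonzero: "\<omega>1 \<noteq> 0" "\<omega>2 \<noteq> 0"
  using Im_nonzero by auto

lemma fund_iff: "z \<in> P \<longleftrightarrow> 0 \<le> coord1 z \<and> coord1 z < 1 \<and> 0 \<le> coord2 z \<and> coord2 z < 1"
proof
  assume "z \<in> P" then show "0 \<le> coord1 z \<and> coord1 z < 1 \<and> 0 \<le> coord2 z \<and> coord2 z < 1"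
    by (auto simp: fund_parallelogram_def)
next
  assume "0 \<le> coord1 z \<and> coord1 z < 1 \<and> 0 \<le> coord2 z \<and> coord2 z < 1"
  then show "z \<in> P" using coord_decomp[of z] unfolding fund_parallelogram_def by blast
qed

lemma countable_lattice: "countable \<Lambda>"
proof -
  have "\<Lambda> = (\<lambda>(m::int,n::int). of_int m * \<omega>1 + of_int n * \<omega>2) ` UNIV"
    by (auto simp: lattice_def)
  then show ?thesis by simp
qed

text \<open>The coordinates of a point are bounded linearly by its norm, so a disc leaves only
  finitely many integer pairs.\<close>

lemma finite_lattice_cball: "finite (\<Lambda> \<inter> cball a R)"
proof -
  define M where "M = (norm a + R) * (norm \<omega>1 + norm \<omega>2) / \<bar>Im (cnj \<omega>1 * \<omega>2)\<bar>"
  have "\<Lambda> \<inter> cball a R \<subseteq> (\<lambda>(m::int,n::int). of_int m * \<omega>1 + of_int n * \<omega>2) `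
      ({-\<lceil>M\<rceil>..\<lceil>M\<rceil>} \<times> {-\<lceil>M\<rceil>..\<lceil>M\<rceil>})"
  proof
    fix z assume z: "z \<in> \<Lambda> \<inter> cball a R"
    then obtain m n where mn: "coord1 z = of_int m" "coord2 z = of_int n"
      by (auto simp: lattice_iff elim!: Ints_cases)
    have "norm z \<le> norm a + R" using z norm_triangle_ineq2[of z a] by (auto simp: dist_norm norm_minus_commute)
    then have "norm z * norm \<omega>2 \<le> (norm a + R) * (norm \<omega>1 + norm \<omega>2)"
      and "norm z * norm \<omega>1 \<le> (norm a + R) * (norm \<omega>1 + norm \<omega>2)"
      by (auto intro!: mult_mono order.trans[OF norm_ge_zero])
    then have "\<bar>coord1 z\<bar> \<le> M" "\<bar>coord2 z\<bar> \<le> M"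
      unfolding M_def
      by (blast intro: order.trans[OF abs_coord1_le] order.trans[OF abs_coord2_le] divide_right_mono abs_ge_zero)+
    then have "m \<in> {-\<lceil>M\<rceil>..\<lceil>M\<rceil>}" "n \<in> {-\<lceil>M\<rceil>..\<lceil>M\<rceil>}" unfolding mn by (auto; linarith)+
    moreover have "z = of_int m * \<omega>1 + of_int n * \<omega>2" using coord_decomp[of z] mn by simp
    ultimately show "z \<in> (\<lambda>(m::int,n::int). of_int m * \<omega>1 + of_int n * \<omega>2) `
      ({-\<lceil>M\<rceil>..\<lceil>M\<rceil>} \<times> {-\<lceil>M\<rceil>..\<lceil>M\<rceil>})" by (intro image_eqI[of _ _ "(m, n)"]) auto
  qed
  then show ?thesis by (rule finite_subset) auto
qed

text \<open>A lower bound for the length of a nonzero period, not the sharp one: some coordinate of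
  such a period is at least 1 in absolute value, and the bounds on the coordinates turn this into a
  bound on the norm. Discs of radius \<open>sep / 2\<close> about lattice points are
  disjoint.\<close>

definition sep :: real where
  "sep = \<bar>Im (cnj \<omega>1 * \<omega>2)\<bar> / (norm \<omega>1 + norm \<omega>2)"

lemma sep_pos: "sep > 0"
  unfolding sep_def using Im_nonzero period_nonzero by (auto intro!: divide_pos_pos add_pos_pos)

lemma norm_lattice_ge:
  assumes "l \<in> \<Lambda>" "l \<noteq> 0" shows "norm l \<ge> sep"
proof -
  have "coord1 l \<noteq> 0 \<or> coord2 l \<noteq> 0" using coord_decomp[of l] assms by auto
  moreover have "coord1 l \<noteq> 0 \<Longrightarrow> \<bar>coord1 l\<bar> \<ge> 1" "coord2 l \<noteq> 0 \<Longrightarrow> \<bar>coord2 l\<bar> \<ge> 1"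
    using assms Ints_nonzero_abs_ge1 by (auto simp: lattice_iff)
  ultimately have "1 \<le> norm l * (norm \<omega>1 + norm \<omega>2) / \<bar>Im (cnj \<omega>1 * \<omega>2)\<bar>"
  proof (elim disjE)
    assume "coord1 l \<noteq> 0" "coord1 l \<noteq> 0 \<Longrightarrow> \<bar>coord1 l\<bar> \<ge> 1"
    then have "1 \<le> norm l * norm \<omega>2 / \<bar>Im (cnj \<omega>1 * \<omega>2)\<bar>" using abs_coord1_le[of l] by linarith
    also have "\<dots> \<le> norm l * (norm \<omega>1 + norm \<omega>2) / \<bar>Im (cnj \<omega>1 * \<omega>2)\<bar>"
      by (intro divide_right_mono mult_left_mono) auto
    finally show ?thesis .
  next
    assume "coord2 l \<noteq> 0" "coord2 l \<noteq> 0 \<Longrightarrow> \<bar>coord2 l\<bar> \<ge> 1"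
    then have "1 \<le> norm l * norm \<omega>1 / \<bar>Im (cnj \<omega>1 * \<omega>2)\<bar>" using abs_coord2_le[of l] by linarith
    also have "\<dots> \<le> norm l * (norm \<omega>1 + norm \<omega>2) / \<bar>Im (cnj \<omega>1 * \<omega>2)\<bar>"
      by (intro divide_right_mono mult_left_mono) auto
    finally show ?thesis .
  qed
  moreover have "norm \<omega>1 + norm \<omega>2 > 0" using period_nonzero by (simp add: add_pos_pos)
  ultimately show ?thesis unfolding sep_def using Im_nonzero by (simp add: field_simps)
qed

lemma lattice_unique_near:
  assumes "l \<in> \<Lambda>" "l' \<in> \<Lambda>" "dist z l < sep / 2" "dist z l' < sep / 2"
  shows "l = l'"
proof (rule ccontr)
  assume "l \<noteq> l'"
  then have "norm (l - l') \<ge> sep" using assms by (intro norm_lattice_ge lattice_diff) auto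
  then show False using dist_triangle_half_r[OF assms(3,4)] by (simp add: dist_norm)
qed

lemma closed_translates: "finite A \<Longrightarrow> closed {a + l |a l. a \<in> A \<and> l \<in> \<Lambda>}" (is "_ \<Longrightarrow> closed ?S")
  and finite_translates_cball: "finite A \<Longrightarrow> finite ({a + l |a l. a \<in> A \<and> l \<in> \<Lambda>} \<inter> cball b R)"
proof -
  have fin: "finite ({a + l |a l. a \<in> A \<and> l \<in> \<Lambda>} \<inter> cball b R)" if "finite A" for b R
  proof -
    have "{a + l |a l. a \<in> A \<and> l \<in> \<Lambda>} \<inter> cball b R \<subseteq> (\<Union>a\<in>A. (\<lambda>l. a + l) ` (\<Lambda> \<inter> cball (b - a) R))"
    proof
      fix x assume "x \<in> {a + l |a l. a \<in> A \<and> l \<in> \<Lambda>} \<inter> cball b R"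
      then obtain a l where al: "a \<in> A" "l \<in> \<Lambda>" "x = a + l" and "dist b x \<le> R" by auto
      then have "l \<in> cball (b - a) R" by (simp add: dist_norm algebra_simps)
      then show "x \<in> (\<Union>a\<in>A. (\<lambda>l. a + l) ` (\<Lambda> \<inter> cball (b - a) R))" using al by blast
    qed
    moreover have "finite \<dots>" using that finite_lattice_cball by blast
    ultimately show ?thesis by (rule finite_subset)
  qed
  then show "finite A \<Longrightarrow> finite ({a + l |a l. a \<in> A \<and> l \<in> \<Lambda>} \<inter> cball b R)" .
  assume A: "finite A"
  show "closed ?S"
    unfolding closed_limpt
  proof (intro allI impI)
    fix x assume "x islimpt ?S"
    then have "infinite (?S \<inter> ball x 1)" by (simp add: islimpt_eq_infinite_ball)
    moreover have "?S \<inter> ball x 1 \<subseteq> ?S \<inter> cball x 1" by (intro Int_mono ball_subset_cball order_refl)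
    ultimately have False using fin[OF A, of x 1] finite_subset by blast
    then show "x \<in> ?S" ..
  qed
qed

lemma closed_lattice: "closed \<Lambda>"
  using closed_translates[of "{0}"] by simp

lemma open_compl_lattice: "open (- \<Lambda>)"
  using closed_lattice by (simp add: open_Compl)

lemma fund_reduce: obtains l where "l \<in> \<Lambda>" "z - l \<in> P"
proof
  let ?l = "of_int \<lfloor>coord1 z\<rfloor> * \<omega>1 + of_int \<lfloor>coord2 z\<rfloor> * \<omega>2"
  have l: "?l = of_real (of_int \<lfloor>coord1 z\<rfloor>) * \<omega>1 + of_real (of_int \<lfloor>coord2 z\<rfloor>) * \<omega>2" by simp
  show "?l \<in> \<Lambda>" by (auto simp: lattice_def)
  show "z - ?l \<in> P" unfolding fund_iff coord1_diff coord2_diff unfolding l coord1_comb coord2_comb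
    by (auto; linarith)
qed

lemma fund_unique:
  assumes "z \<in> P" "z + l \<in> P" "l \<in> \<Lambda>" shows "l = 0"
proof -
  obtain m n where mn: "coord1 l = of_int m" "coord2 l = of_int n"
    using assms by (auto simp: lattice_iff elim!: Ints_cases)
  have "-1 < real_of_int m" "real_of_int m < 1" "-1 < real_of_int n" "real_of_int n < 1"
    using assms(1,2) unfolding fund_iff coord1_add coord2_add mn by linarith+
  then have "m = 0" "n = 0" by linarith+
  then show ?thesis using coord_decomp[of l] mn by simp
qed

lemma norm_fund_le: "z \<in> P \<Longrightarrow> norm z \<le> norm \<omega>1 + norm \<omega>2"
proof -
  assume "z \<in> P"
  then obtain s t where st: "z = of_real s * \<omega>1 + of_real t * \<omega>2" "0 \<le> s" "s < 1" "0 \<le> t" "t < 1"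
    by (auto simp: fund_parallelogram_def)
  have "norm z \<le> s * norm \<omega>1 + t * norm \<omega>2"
    unfolding st(1) by (rule order.trans[OF norm_triangle_ineq]) (use st in \<open>simp add: norm_mult\<close>)
  also have "\<dots> \<le> 1 * norm \<omega>1 + 1 * norm \<omega>2" using st by (intro add_mono mult_right_mono) auto
  finally show ?thesis by simp
qed

text \<open>Subtracting a period moves a point into a bounded region without changing its distance
  to the lattice, so the bound comes from a compact set in the plane and no quotient topology is
  involved. The value \<delta> = 0 is allowed and covers functions continuous on the whole
  plane.\<close>

lemma fund_closure_bound:
  fixes p :: "complex \<Rightarrow> 'b::real_normed_vector"
  assumes cont: "continuous_on {z. \<forall>l\<in>\<Lambda>. \<delta> \<le> dist z l} p"
    and per: "\<And>z l. l \<in> \<Lambda> \<Longrightarrow> p (z + l) = p z"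
  obtains M where "\<And>z. (\<forall>l\<in>\<Lambda>. \<delta> \<le> dist z l) \<Longrightarrow> norm (p z) \<le> M"
proof -
  let ?A = "{z. \<forall>l\<in>\<Lambda>. \<delta> \<le> dist z l}"
  let ?K = "?A \<inter> cball 0 (norm \<omega>1 + norm \<omega>2)"
  have "?A = (\<Inter>l\<in>\<Lambda>. - ball l \<delta>)" by (auto simp: dist_commute not_less)
  then have "closed ?A" by (simp only:) (intro closed_INT ballI closed_Compl open_ball)
  then have "compact ?K" by (intro closed_Int_compact) auto
  then have "compact (p ` ?K)" by (intro compact_continuous_image continuous_on_subset[OF cont]) simp_all
  then obtain M where M: "\<And>x. x \<in> p ` ?K \<Longrightarrow> norm x \<le> M" using compact_imp_bounded bounded_iff by metis
  show thesis
  proof (rule that)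
    fix z assume z: "\<forall>l\<in>\<Lambda>. \<delta> \<le> dist z l"
    obtain l where l: "l \<in> \<Lambda>" "z - l \<in> P" by (rule fund_reduce)
    have "\<delta> \<le> dist (z - l) k" if "k \<in> \<Lambda>" for k
      using z lattice_add[OF that l(1)] by (auto simp: dist_norm algebra_simps)
    then have "z - l \<in> ?K" using norm_fund_le[OF l(2)] by auto
    then have "norm (p (z - l)) \<le> M" using M by blast
    then show "norm (p z) \<le> M" using per[OF l(1), of "z - l"] by simp
  qed
qed

text \<open>Conjugation does not agree with multiplication by a complex scalar on both periods;
  otherwise the periods would be real multiples of each other. This rules out entire functions whose
  quasi-periods are the conjugate periods.\<close>

lemma cnj_ratio_ne: "cnj \<omega>1 / \<omega>1 \<noteq> cnj \<omega>2 / \<omega>2"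
proof
  assume "cnj \<omega>1 / \<omega>1 = cnj \<omega>2 / \<omega>2"
  then have "cnj \<omega>1 * \<omega>2 = cnj \<omega>2 * \<omega>1" using period_nonzero by (simp add: field_simps)
  then have "cnj \<omega>1 * \<omega>2 = cnj (cnj \<omega>1 * \<omega>2)" by (simp add: mult.commute)
  then have "Im (cnj \<omega>1 * \<omega>2) = 0" by (metis Reals_cnj_iff complex_is_Real_iff)
  then show False using Im_nonzero by simp
qed

end

text \<open>For equal periods the set {\<omega>1, \<omega>2} collapses to a singleton, which may
  well be independent; distinctness is therefore a separate hypothesis.\<close>

lemma independent_imp_Im_nonzero:
  fixes \<omega>1 \<omega>2 :: complex
  assumes "\<omega>1 \<noteq> \<omega>2" "independent {\<omega>1, \<omega>2}"
  shows "Im (cnj \<omega>1 * \<omega>2) \<noteq> 0"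
proof
  assume 0: "Im (cnj \<omega>1 * \<omega>2) = 0"
  have nz: "\<omega>1 \<noteq> 0" using assms dependent_zero by blast
  have "cnj \<omega>1 * \<omega>2 = of_real (Re (cnj \<omega>1 * \<omega>2))" using 0 by (simp add: complex_eq_iff)
  then have "of_real ((norm \<omega>1)\<^sup>2) * \<omega>2 = of_real (Re (cnj \<omega>1 * \<omega>2)) * \<omega>1"
    using complex_norm_square[of \<omega>1] by (simp add: mult_ac)
  then have "\<omega>2 = (Re (cnj \<omega>1 * \<omega>2) / (norm \<omega>1)\<^sup>2) *\<^sub>R \<omega>1"
    using nz by (simp add: scaleR_conv_of_real field_simps)
  then have "\<omega>2 \<in> span {\<omega>1}" by (metis span_scale span_base insertI1)
  then have "dependent {\<omega>1, \<omega>2}" unfolding dependent_def using assms(1)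
    by (intro bexI[of _ \<omega>2]) (auto simp: insert_Diff_if)
  then show False using assms(2) by simp
qed

subsection \<open>Critical points of a quasi-periodic map\<close>

text \<open>Riemann's theorem applied at all singularities at once. The isolation condition is
  imposed at every point of the plane, so S is also closed and E is holomorphic near each point off
  S.\<close>

lemma holomorphic_extension_isolated:
  fixes E :: "complex \<Rightarrow> complex"
  assumes iso: "\<And>z. \<exists>r>0. ball z r \<inter> S \<subseteq> {z}"
    and hol: "E holomorphic_on (- S)"
    and lim: "\<And>a. a \<in> S \<Longrightarrow> \<exists>L. (E \<longlongrightarrow> L) (at a)"
  obtains H where "H holomorphic_on UNIV" "\<And>z. z \<notin> S \<Longrightarrow> H z = E z"
proof -
  define H where "H z = (if z \<in> S then Lim (at z) E else E z)" for z
  have "H field_differentiable (at z)" for z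
  proof -
    obtain r where r: "r > 0" "ball z r \<inter> S \<subseteq> {z}" using iso by blast
    have eqH: "H w = E w" if "w \<in> ball z r - {z}" for w
      using r that by (auto simp: H_def)
    have "E holomorphic_on (ball z r - {z})" using hol r by (auto intro: holomorphic_on_subset)
    then have hol': "H holomorphic_on (ball z r - {z})"
      using eqH by (metis (no_types, lifting) holomorphic_cong)
    have "H holomorphic_on ball z r"
    proof (cases "z \<in> S")
      case True
      obtain L where L: "(E \<longlongrightarrow> L) (at z)" using lim True by blast
      then have HL: "H z = L" using True by (simp add: H_def tendsto_Lim)
      have "eventually (\<lambda>w. w \<in> ball z r - {z}) (at z)"
        using r by (intro eventually_at_in_open) auto
      then have ev: "eventually (\<lambda>w. E w = H w) (at z)" by eventually_elim (use eqH in auto)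
      have "(H \<longlongrightarrow> H z) (at z)" unfolding HL using L tendsto_cong[OF ev] by blast
      then show ?thesis
        using no_isolated_singularity'[of "{z}" H "ball z r"] hol' by (simp add: Lim_at_imp_Lim_at_within)
    next
      case False
      then have "\<And>w. w \<in> ball z r \<Longrightarrow> w \<notin> S" using r by auto
      then have "E holomorphic_on ball z r" and "\<And>w. w \<in> ball z r \<Longrightarrow> H w = E w"
        using hol by (auto intro: holomorphic_on_subset simp: H_def)
      then show ?thesis by (metis (no_types, lifting) holomorphic_cong)
    qed
    then show ?thesis using r(1) by (auto intro: holomorphic_on_imp_differentiable_at)
  qed
  then have "H holomorphic_on UNIV" by (simp add: holomorphic_on_def)
  then show thesis by (rule that) (simp add: H_def)
qed

text \<open>The derivative predicates at the two points are equivalent, so the equality of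
  \<open>deriv\<close> holds even where f is not differentiable. Periodicity of F' is thus available
  at lattice points as well.\<close>

lemma deriv_shift:
  assumes "\<And>z. f (z + l) = f z + (c::complex)"
  shows "deriv f (z + l) = deriv f z"
proof -
  have "((f has_field_derivative D) (at (z + l))) = ((f has_field_derivative D) (at z))" for D
  proof -
    have "((f has_field_derivative D) (at (z + l))) = (((\<lambda>x. f x + c) has_field_derivative D) (at z))"
      by (simp only: DERIV_shift assms)
    also have "\<dots> = ((f has_field_derivative D) (at z))"
    proof
      assume "((\<lambda>x. f x + c) has_field_derivative D) (at z)"
      from DERIV_diff[OF this DERIV_const[of c]] show "(f has_field_derivative D) (at z)" by simp
    next
      assume "(f has_field_derivative D) (at z)"
      from DERIV_add[OF this DERIV_const[of c]] show "((\<lambda>x. f x + c) has_field_derivative D) (at z)" by simp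
    qed
    finally show ?thesis .
  qed
  then show ?thesis by (simp add: deriv_def)
qed

section \<open>Liouville's theorem for quasi-periodic functions\<close>

context period_lattice
begin

abbreviation translates :: "complex set \<Rightarrow> complex set" where
  "translates A \<equiv> {a + l |a l. a \<in> A \<and> l \<in> \<Lambda>}"

lemma translates_add: "l \<in> \<Lambda> \<Longrightarrow> z + l \<in> translates A \<longleftrightarrow> z \<in> translates A"
proof
  assume l: "l \<in> \<Lambda>" and "z + l \<in> translates A"
  then obtain a k where "a \<in> A" "k \<in> \<Lambda>" "z + l = a + k" by auto
  then have "z = a + (k - l)" "k - l \<in> \<Lambda>" "a \<in> A" using lattice_diff l by (auto simp: algebra_simps)
  then show "z \<in> translates A" by blast
next
  assume l: "l \<in> \<Lambda>" and "z \<in> translates A"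
  then obtain a k where "a \<in> A" "k \<in> \<Lambda>" "z = a + k" by auto
  then have "z + l = a + (k + l)" "k + l \<in> \<Lambda>" "a \<in> A" using lattice_add l by (auto simp: algebra_simps)
  then show "z + l \<in> translates A" by blast
qed

lemma countable_translates: "countable A \<Longrightarrow> countable (translates A)"
proof -
  assume "countable A"
  have "translates A = (\<lambda>(a,l). a + l) ` (A \<times> \<Lambda>)" by auto
  then show ?thesis using \<open>countable A\<close> countable_lattice by auto
qed

lemma connected_compl_countable: "countable S \<Longrightarrow> connected (- (S :: complex set))"
  using connected_open_diff_countable[of UNIV S] connected_UNIV by (simp add: Compl_eq_Diff_UNIV)

lemma translates_isolated:
  assumes "finite A" shows "\<exists>r>0. ball z r \<inter> translates A \<subseteq> {z}"
proof -
  have "finite (translates A \<inter> cball z 1)" using finite_translates_cball[OF assms] .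
  from finite_set_avoid[OF this, of z] obtain d where d: "d > 0"
    "\<And>x. x \<in> translates A \<inter> cball z 1 \<Longrightarrow> x \<noteq> z \<Longrightarrow> d \<le> dist z x" by blast
  have "ball z (min d 1) \<inter> translates A \<subseteq> {z}" using d(2) by force
  then show ?thesis using d(1) by (intro exI[of _ "min d 1"]) auto
qed

text \<open>The derivative is periodic, hence bounded, hence constant by Liouville. An affine
  function has complex linear increments, and these match \<tau> times conjugation on both periods
  only if everything vanishes.\<close>

lemma entire_quasi_periodic:
  assumes hol: "H holomorphic_on UNIV"
    and per: "\<And>z l. l \<in> \<Lambda> \<Longrightarrow> H (z + l) = H z + \<tau> * cnj l"
  shows "\<tau> = 0" "\<exists>C. \<forall>z. H z = C"
proof -
  have "deriv H holomorphic_on UNIV" using hol by (intro holomorphic_deriv) auto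
  moreover have "bounded (range (deriv H))"
  proof -
    have "continuous_on {z. \<forall>l\<in>\<Lambda>. 0 \<le> dist z l} (deriv H)"
      using \<open>deriv H holomorphic_on UNIV\<close> holomorphic_on_imp_continuous_on by (auto intro: continuous_on_subset)
    moreover have "deriv H (z + l) = deriv H z" if "l \<in> \<Lambda>" for z l
      by (rule deriv_shift[where c = "\<tau> * cnj l"]) (rule per[OF that])
    ultimately obtain M where "\<And>z. (\<forall>l\<in>\<Lambda>. 0 \<le> dist z l) \<Longrightarrow> norm (deriv H z) \<le> M"
      using fund_closure_bound[of 0 "deriv H"] by blast
    then show ?thesis by (auto simp: bounded_iff)
  qed
  ultimately obtain a where a: "\<And>z. deriv H z = a"
    using Liouville_theorem by (auto simp: constant_on_def)
  have der: "(H has_field_derivative a) (at z)" for z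
    using a[of z] hol holomorphic_derivI[of H UNIV z] by auto
  have "\<exists>C. \<forall>z\<in>UNIV. H z - a * z = C"
  proof (rule has_field_derivative_zero_constant)
    fix z show "((\<lambda>z. H z - a * z) has_field_derivative 0) (at z within UNIV)"
      using der[of z] by (auto intro!: derivative_eq_intros)
  qed auto
  then obtain b where b: "\<And>z. H z = a * z + b" by (metis UNIV_I add.commute diff_add_cancel)
  have eq: "a * l = \<tau> * cnj l" if "l \<in> \<Lambda>" for l
    using per[OF that, of 0] by (simp add: b)
  have 1: "a * \<omega>1 = \<tau> * cnj \<omega>1" and 2: "a * \<omega>2 = \<tau> * cnj \<omega>2" using eq periods_in_lattice by auto
  show t: "\<tau> = 0"
  proof (rule ccontr)
    assume "\<tau> \<noteq> 0"
    then have "cnj \<omega>1 / \<omega>1 = a / \<tau>" "cnj \<omega>2 / \<omega>2 = a / \<tau>"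
      using 1 2 period_nonzero by (auto simp: field_simps)
    then show False using cnj_ratio_ne by simp
  qed
  then have "a = 0" using 1 period_nonzero by simp
  then show "\<exists>C. \<forall>z. H z = C" using b by auto
qed

text \<open>This takes over the role of residue and zero counts: an elliptic function (\<tau> = 0)
  with removable singularities is constant, and the quasi-periods of F (\<tau> = 1) cannot occur
  without a genuine pole.\<close>

lemma quasi_periodic_const:
  assumes A: "finite A" and hol: "E holomorphic_on (- translates A)"
    and per: "\<And>z l. l \<in> \<Lambda> \<Longrightarrow> E (z + l) = E z + \<tau> * cnj l"
    and lim: "\<And>a. a \<in> A \<Longrightarrow> \<exists>L. (E \<longlongrightarrow> L) (at a)"
  shows "\<tau> = 0" "\<exists>C. \<forall>z. z \<notin> translates A \<longrightarrow> E z = C"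
proof -
  have lim': "\<exists>L. (E \<longlongrightarrow> L) (at b)" if b: "b \<in> translates A" for b
  proof -
    obtain a l where al: "a \<in> A" "l \<in> \<Lambda>" "b = a + l" using b by blast
    obtain L where L: "(E \<longlongrightarrow> L) (at a)" using lim al by blast
    have "((\<lambda>x. E (x + (- l)) + \<tau> * cnj l) \<longlongrightarrow> L + \<tau> * cnj l) (at (a - (- l)))"
      by (intro tendsto_intros LIM_offset L)
    moreover have "E (x + (- l)) + \<tau> * cnj l = E x" for x using per[OF al(2), of "x - l"] by simp
    ultimately show ?thesis using al by auto
  qed
  obtain H where H: "H holomorphic_on UNIV" "\<And>z. z \<notin> translates A \<Longrightarrow> H z = E z"
    using holomorphic_extension_isolated[OF translates_isolated[OF A] hol lim'] by blast
  have ne: "- translates A \<noteq> {}"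
  proof
    assume "- translates A = {}"
    then have "translates A = UNIV" by blast
    then have "countable (UNIV :: complex set)"
      using countable_translates[OF countable_finite[OF A]] by simp
    then show False using uncountable_UNIV_complex by simp
  qed
  have "H (z + l) = H z + \<tau> * cnj l" if l: "l \<in> \<Lambda>" for z l
  \<comment> \<open>The extension agrees with E only off the singular set, so the shift law at
    singular points has to be carried over by analytic continuation.\<close>
  proof (rule analytic_continuation_open[of "- translates A" UNIV "\<lambda>z. H (z + l)" "\<lambda>z. H z + \<tau> * cnj l"])
    show "open (- translates A)" using closed_translates[OF A] by (rule open_Compl)
    have "(H \<circ> (\<lambda>z. z + l)) holomorphic_on UNIV"
      by (rule holomorphic_on_compose) (auto intro!: holomorphic_intros holomorphic_on_subset[OF H(1)])
    then show "(\<lambda>z. H (z + l)) holomorphic_on UNIV" by (simp add: o_def)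
    fix w assume "w \<in> - translates A"
    then have w1: "w \<notin> translates A" by (rule ComplD)
    have w2: "w + l \<notin> translates A" using translates_add[OF l, of w A] w1 by blast
    show "H (w + l) = H w + \<tau> * cnj l" unfolding H(2)[OF w1] H(2)[OF w2] by (rule per[OF l])
  qed (use ne H(1) in \<open>auto intro!: holomorphic_intros\<close>)
  from entire_quasi_periodic[OF H(1) this] H(2)
  show "\<tau> = 0" "\<exists>C. \<forall>z. z \<notin> translates A \<longrightarrow> E z = C" by auto
qed

end

text \<open>A map of the type of the Weierstrass zeta function, normalised by its quasi-periods. The
  additive constant is free, which later allows F to be replaced by \<open>F + cnj w\<close>; that
  \<rho> is nonzero is a consequence. The shift law is demanded at lattice points too, where the
  value of F is arbitrary, so that it can be applied along any orbit.\<close>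

locale torus_map = period_lattice +
  fixes F :: "complex \<Rightarrow> complex" and \<rho> :: complex
  assumes hol: "F holomorphic_on (- \<Lambda>)"
    and quasi: "\<And>z l. l \<in> \<Lambda> \<Longrightarrow> F (z + l) = F z + cnj l"
    and pole: "((\<lambda>z. z * F z) \<longlongrightarrow> \<rho>) (at 0)"
begin

lemma ball_sep_lattice: "z \<in> ball 0 sep \<Longrightarrow> z \<noteq> 0 \<Longrightarrow> z \<notin> \<Lambda>"
  using norm_lattice_ge[of z] by auto

text \<open>The regular part of F at the pole 0. Its value at 0 is the derivative there of the
  holomorphic extension of z F(z).\<close>

definition kreg :: "complex \<Rightarrow> complex" where
  "kreg z = (if z = 0 then deriv (\<lambda>z. if z = 0 then \<rho> else z * F z) 0 else F z - \<rho> / z)"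

lemma F_eq: "z \<noteq> 0 \<Longrightarrow> F z = \<rho> / z + kreg z"
  by (simp add: kreg_def)

lemma kreg_holo: "kreg holomorphic_on ball 0 sep"
proof -
  let ?m = "\<lambda>z. if z = 0 then \<rho> else z * F z"
  have sub: "ball 0 sep - {0} \<subseteq> - \<Lambda>" using ball_sep_lattice by auto
  have "(\<lambda>z. z * F z) holomorphic_on (ball 0 sep - {0})"
    using holomorphic_on_subset[OF hol sub] by (intro holomorphic_intros)
  then have 1: "?m holomorphic_on (ball 0 sep - {0})"
    by (rule holomorphic_transform) auto
  have "(?m \<longlongrightarrow> \<rho>) (at 0)"
    using pole by (rule Lim_transform_eventually) (auto simp: eventually_at_filter)
  then have "?m holomorphic_on ball 0 sep"
    using 1 no_isolated_singularity'[of "{0}" ?m "ball 0 sep"] by (simp add: Lim_at_imp_Lim_at_within)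
  from pole_theorem_open[OF this open_ball, of 0 F]
  show ?thesis by (rule holomorphic_transform[where f = "\<lambda>z. if z = 0 then deriv ?m 0 else F z - ?m 0 / (z - 0)"])
      (auto simp: kreg_def)
qed

lemma isCont_F: "z \<notin> \<Lambda> \<Longrightarrow> isCont F z"
  using hol open_compl_lattice holomorphic_on_imp_continuous_on continuous_on_eq_continuous_at by blast

lemma DERIV_F: "z \<notin> \<Lambda> \<Longrightarrow> (F has_field_derivative deriv F z) (at z)"
  using hol open_compl_lattice by (auto intro: holomorphic_derivI)

lemma kreg_tendsto: "(kreg \<longlongrightarrow> kreg 0) (at 0)"
proof -
  have "isCont kreg 0"
    using holomorphic_on_imp_continuous_on[OF kreg_holo] sep_pos
    by (auto simp: continuous_on_eq_continuous_at)
  then show ?thesis by (simp add: isCont_def)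
qed

text \<open>Without a pole F would extend to an entire function with quasi-periods
  \<open>cnj l\<close>.\<close>

lemma \<rho>_nonzero: "\<rho> \<noteq> 0"
proof
  assume "\<rho> = 0"
  then have "(F \<longlongrightarrow> kreg 0) (at 0)"
    using kreg_tendsto by (rule_tac Lim_transform_eventually[of kreg]) (auto simp: eventually_at_filter F_eq)
  then have "(1::complex) = 0"
    by (intro quasi_periodic_const(1)[of "{0}" F 1]) (use hol quasi in auto)
  then show False by simp
qed

text \<open>The poles of the two summands cancel and so do their quasi-periods, so the sum is
  constant; the constant is read off at 0. Hence F is odd up to an additive constant, F' is even and
  F'' is odd.\<close>

lemma F_odd: "z \<notin> \<Lambda> \<Longrightarrow> F z + F (- z) = 2 * kreg 0"
proof -
  assume z: "z \<notin> \<Lambda>"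
  let ?E = "\<lambda>z. F z + F (- z)"
  have "(F \<circ> uminus) holomorphic_on (- \<Lambda>)"
    by (rule holomorphic_on_compose_gen[OF _ hol]) (auto intro!: holomorphic_intros)
  then have hE: "?E holomorphic_on (- \<Lambda>)" using hol by (auto simp: o_def intro!: holomorphic_intros)
  have per: "?E (z + l) = ?E z + 0 * cnj l" if "l \<in> \<Lambda>" for z l
    using quasi[OF that, of z] quasi[of "-l" "-z"] that by simp
  have "((\<lambda>z. kreg z + kreg (- z)) \<longlongrightarrow> kreg 0 + kreg 0) (at 0)"
  proof (intro tendsto_add kreg_tendsto)
    have "filterlim uminus (at 0) (at (0::complex))"
      by (auto simp: filterlim_at eventually_at_filter intro!: tendsto_eq_intros)
    then show "((\<lambda>z. kreg (- z)) \<longlongrightarrow> kreg 0) (at 0)"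
      using filterlim_compose[OF kreg_tendsto] by blast
  qed
  then have lim: "(?E \<longlongrightarrow> kreg 0 + kreg 0) (at 0)"
    by (rule Lim_transform_eventually) (auto simp: eventually_at_filter F_eq)
  then obtain C where C: "\<And>z. z \<notin> \<Lambda> \<Longrightarrow> ?E z = C"
    using quasi_periodic_const(2)[of "{0}" ?E 0] hE per by auto
  have "eventually (\<lambda>z. z \<in> ball 0 sep - {0}) (at (0::complex))"
    using sep_pos by (intro eventually_at_in_open) auto
  then have "eventually (\<lambda>z. C = ?E z) (at 0)"
    by eventually_elim (metis C ball_sep_lattice DiffE insertI1)
  from Lim_transform_eventually[OF tendsto_const this]
  have "(?E \<longlongrightarrow> C) (at 0)" .
  then have "C = kreg 0 + kreg 0" using lim tendsto_unique trivial_limit_at by blast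
  then show ?thesis using C[OF z] by simp
qed

lemma deriv_F_periodic: "l \<in> \<Lambda> \<Longrightarrow> deriv F (z + l) = deriv F z"
  using deriv_shift quasi by blast

lemma deriv2_F_periodic: "l \<in> \<Lambda> \<Longrightarrow> deriv (deriv F) (z + l) = deriv (deriv F) z"
  using deriv_shift[of "deriv F" l 0] deriv_F_periodic by simp

lemma deriv_F_holo: "deriv F holomorphic_on (- \<Lambda>)"
  using hol open_compl_lattice by (rule holomorphic_deriv)

lemma DERIV2_F: "z \<notin> \<Lambda> \<Longrightarrow> (deriv F has_field_derivative deriv (deriv F) z) (at z)"
  using deriv_F_holo open_compl_lattice by (auto intro: holomorphic_derivI)

lemma deriv_F_even: "z \<notin> \<Lambda> \<Longrightarrow> deriv F (- z) = deriv F z"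
proof -
  assume z: "z \<notin> \<Lambda>"
  have "((\<lambda>z. F (- z)) has_field_derivative deriv F (- z) * - 1) (at z)"
    by (rule DERIV_chain2[of F _ uminus]) (use DERIV_F[of "- z"] z in \<open>auto intro!: derivative_eq_intros\<close>)
  from DERIV_diff[OF DERIV_const[of "2 * kreg 0"] this]
  have "((\<lambda>z. 2 * kreg 0 - F (- z)) has_field_derivative deriv F (- z)) (at z)" by simp
  moreover have "2 * kreg 0 - F (- w) = F w" if "w \<in> - \<Lambda>" for w
    using F_odd[of w] that by (simp add: algebra_simps)
  ultimately have "(F has_field_derivative deriv F (- z)) (at z)"
    using has_field_derivative_transform_within_open[OF _ open_compl_lattice] z by (metis (no_types, lifting) ComplI)
  then show ?thesis by (simp add: DERIV_imp_deriv)
qed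

lemma deriv2_F_odd: "z \<notin> \<Lambda> \<Longrightarrow> deriv (deriv F) (- z) = - deriv (deriv F) z"
proof -
  assume z: "z \<notin> \<Lambda>"
  have "((\<lambda>z. deriv F (- z)) has_field_derivative deriv (deriv F) (- z) * - 1) (at z)"
    by (rule DERIV_chain2[of "deriv F" _ uminus]) (use DERIV2_F[of "- z"] z in \<open>auto intro!: derivative_eq_intros\<close>)
  then have "((\<lambda>z. deriv F (- z)) has_field_derivative - deriv (deriv F) (- z)) (at z)" by simp
  moreover have "deriv F (- w) = deriv F w" if "w \<in> - \<Lambda>" for w
    using deriv_F_even[of w] that by simp
  ultimately have "(deriv F has_field_derivative - deriv (deriv F) (- z)) (at z)"
    using has_field_derivative_transform_within_open[OF _ open_compl_lattice] z by (metis (no_types, lifting) ComplI)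
  then show ?thesis by (simp add: DERIV_imp_deriv)
qed

lemma deriv_F_near_0:
  assumes "z \<in> ball 0 sep" "z \<noteq> 0"
  shows "deriv F z = - \<rho> / z^2 + deriv kreg z"
    and "deriv (deriv F) z = 2 * \<rho> / z^3 + deriv (deriv kreg) z"
proof -
  have op: "open (ball 0 sep - {0::complex})" by (simp add: open_Diff)
  have *: "deriv F w = - \<rho> / w^2 + deriv kreg w" if w: "w \<in> ball 0 sep - {0}" for w
  proof -
    have "((\<lambda>w. \<rho> / w + kreg w) has_field_derivative - \<rho> / w^2 + deriv kreg w) (at w)"
      using w holomorphic_derivI[OF kreg_holo open_ball, of w]
      by (auto intro!: derivative_eq_intros simp: power2_eq_square)
    then have "(F has_field_derivative - \<rho> / w^2 + deriv kreg w) (at w)"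
      by (rule has_field_derivative_transform_within_open[OF _ op w]) (simp add: F_eq)
    then show ?thesis by (rule DERIV_imp_deriv)
  qed
  then show "deriv F z = - \<rho> / z^2 + deriv kreg z" using assms by simp
  have dk: "deriv kreg holomorphic_on ball 0 sep" using kreg_holo by (intro holomorphic_deriv) auto
  have "((\<lambda>w. - \<rho> / w^2) has_field_derivative 2 * \<rho> / z^3) (at z)"
    using assms by (auto intro!: derivative_eq_intros simp: power2_eq_square power3_eq_cube divide_simps)
  then have "((\<lambda>w. - \<rho> / w^2 + deriv kreg w) has_field_derivative 2 * \<rho> / z^3 + deriv (deriv kreg) z) (at z)"
    using assms holomorphic_derivI[OF dk open_ball, of z] by (intro DERIV_add) auto
  then have "(deriv F has_field_derivative 2 * \<rho> / z^3 + deriv (deriv kreg) z) (at z)"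
    by (rule has_field_derivative_transform_within_open[OF _ op]) (use assms * in auto)
  then show "deriv (deriv F) z = 2 * \<rho> / z^3 + deriv (deriv kreg) z" by (rule DERIV_imp_deriv)
qed

text \<open>Multiplication by z^2 exposes the double pole: a constant derivative would force \<rho>
  = 0.\<close>

lemma deriv_F_nonconst: "\<not> (deriv F) constant_on (- \<Lambda>)"
proof
  assume "(deriv F) constant_on (- \<Lambda>)"
  then obtain C where C: "\<And>z. z \<notin> \<Lambda> \<Longrightarrow> deriv F z = C" by (auto simp: constant_on_def)
  have "isCont (deriv kreg) 0"
    using holomorphic_on_imp_continuous_on[OF holomorphic_deriv[OF kreg_holo open_ball]] sep_pos
    by (auto simp: continuous_on_eq_continuous_at)
  then have "((\<lambda>z. z^2 * deriv kreg z - C * z^2) \<longlongrightarrow> 0) (at 0)"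
    by (auto simp: isCont_def intro!: tendsto_eq_intros)
  moreover have "eventually (\<lambda>z. z \<in> ball 0 sep - {0}) (at (0::complex))"
    using sep_pos by (intro eventually_at_in_open) auto
  then have "eventually (\<lambda>z. z^2 * deriv kreg z - C * z^2 = \<rho>) (at 0)"
  proof eventually_elim
    case (elim z)
    then have "C = - \<rho> / z^2 + deriv kreg z" using deriv_F_near_0[of z] C[of z] ball_sep_lattice by auto
    then show ?case using elim by (simp add: field_simps)
  qed
  ultimately have "((\<lambda>z::complex. \<rho>) \<longlongrightarrow> 0) (at 0)" by (rule Lim_transform_eventually)
  then show False using \<rho>_nonzero by (simp add: tendsto_const_iff)
qed

text \<open>If a + b is a lattice point, the simple pole of F(z + b) at a is compensated by the zero
  of F' at a; otherwise the product is continuous.\<close>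

lemma F_times_deriv_tendsto:
  assumes a: "a \<notin> \<Lambda>" "deriv F a = 0"
  shows "\<exists>L. ((\<lambda>z. F (z + b) * deriv F z) \<longlongrightarrow> L) (at a)"
proof (cases "a + b \<in> \<Lambda>")
  case False
  have "isCont (\<lambda>z. F (z + b) * deriv F z) a"
    by (intro continuous_intros isCont_o2[OF _ isCont_F] DERIV_isCont[OF DERIV2_F]) (use False a in auto)
  then show ?thesis by (auto simp: isCont_def)
next
  case True
  have "filterlim (\<lambda>z. z - a) (at 0) (at a)"
    by (auto simp: filterlim_at eventually_at_filter intro!: tendsto_eq_intros)
  then have 1: "((\<lambda>z. (z - a) * F (z - a)) \<longlongrightarrow> \<rho>) (at a)" using filterlim_compose[OF pole] by blast
  have 2: "((\<lambda>z. (deriv F z - deriv F a) / (z - a)) \<longlongrightarrow> deriv (deriv F) a) (at a)"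
    using DERIV2_F[OF a(1)] by (simp add: has_field_derivative_iff)
  have 3: "(deriv F \<longlongrightarrow> 0) (at a)" using DERIV_isCont[OF DERIV2_F[OF a(1)]] a(2) by (simp add: isCont_def)
  have "((\<lambda>z. (z - a) * F (z - a) * ((deriv F z - deriv F a) / (z - a)) + cnj (a + b) * deriv F z)
      \<longlongrightarrow> \<rho> * deriv (deriv F) a + cnj (a + b) * 0) (at a)"
    by (intro tendsto_intros 1 2 3)
  moreover have "eventually (\<lambda>z. (z - a) * F (z - a) * ((deriv F z - deriv F a) / (z - a)) + cnj (a + b) * deriv F z
      = F (z + b) * deriv F z) (at a)"
    unfolding eventually_at_filter
  proof (intro always_eventually allI impI)
    fix z assume "z \<noteq> a"
    moreover have "F (z + b) = F (z - a) + cnj (a + b)" using quasi[OF True, of "z - a"] by (simp add: add.commute)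
    ultimately show "(z - a) * F (z - a) * ((deriv F z - deriv F a) / (z - a)) + cnj (a + b) * deriv F z
      = F (z + b) * deriv F z" using a(2) by (simp add: field_simps)
  qed
  ultimately show ?thesis by (intro exI) (rule Lim_transform_eventually)
qed

lemma double_zero_quotient_tendsto:
  assumes hol: "N holomorphic_on ball 0 r" and r: "r > 0" and N: "N 0 = 0" "deriv N 0 = 0"
  shows "\<exists>L. ((\<lambda>z::complex. N z / z^2) \<longlongrightarrow> L) (at 0)"
proof -
  define M where "M = (\<lambda>z. if z = 0 then deriv N 0 else (N z - N 0) / (z - 0))"
  have M: "M holomorphic_on ball 0 r" unfolding M_def using pole_lemma_open[OF hol open_ball] .
  have "(M has_field_derivative deriv M 0) (at 0)" using r by (intro holomorphic_derivI[OF M]) auto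
  then have "((\<lambda>z. (M z - M 0) / (z - 0)) \<longlongrightarrow> deriv M 0) (at 0)" by (simp add: has_field_derivative_iff)
  then have "((\<lambda>z. N z / z^2) \<longlongrightarrow> deriv M 0) (at 0)"
    by (rule Lim_transform_eventually) (auto simp: eventually_at_filter M_def N power2_eq_square)
  then show ?thesis by blast
qed

text \<open>
  The classical identity \<open>\<zeta>(z+c) + \<zeta>(z-c) - 2 \<zeta>(z) = \<wp>'(z) / (\<wp>(z) - \<wp>(c))\<close>, in terms of \<^term>\<open>F\<close>.
\<close>

lemma critical_identity:
  assumes c: "c \<notin> \<Lambda>" "deriv F c = 0" and z: "z \<notin> translates {0, c, - c}"
  shows "(F (z + c) + F (z - c) - 2 * F z) * deriv F z = \<rho> * deriv (deriv F) z"
proof -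
  define S where "S = translates {0, c, - c}"
  have zS: "z \<notin> S" using z by (simp add: S_def)
  \<comment> \<open>The difference of the two sides is elliptic. It will turn out to have removable
    singularities, hence to be constant, and to be odd, hence zero.\<close>
  define X where "X z = (F (z + c) + F (z - c) - 2 * F z) * deriv F z - \<rho> * deriv (deriv F) z" for z
  have notS: "z \<notin> \<Lambda> \<and> z + c \<notin> \<Lambda> \<and> z - c \<notin> \<Lambda>" if "z \<notin> S" for z
  proof (intro conjI notI)
    assume "z \<in> \<Lambda>" then show False using that unfolding S_def by force
  next
    assume "z + c \<in> \<Lambda>" then have "z = - c + (z + c)" "z + c \<in> \<Lambda>" by auto
    then show False using that unfolding S_def by blast
  next
    assume "z - c \<in> \<Lambda>" then have "z = c + (z - c)" "z - c \<in> \<Lambda>" by auto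
    then show False using that unfolding S_def by blast
  qed
  have Fshift: "(\<lambda>z. F (z + b)) holomorphic_on T" if "\<And>z. z \<in> T \<Longrightarrow> z + b \<notin> \<Lambda>" for b T
  proof -
    have "(F \<circ> (\<lambda>z. z + b)) holomorphic_on T"
      by (rule holomorphic_on_compose_gen[OF _ hol]) (use that in \<open>auto intro!: holomorphic_intros\<close>)
    then show ?thesis by (simp add: o_def)
  qed
  have dF2: "deriv (deriv F) holomorphic_on (- \<Lambda>)"
    using deriv_F_holo open_compl_lattice by (rule holomorphic_deriv)
  have sub: "- S \<subseteq> - \<Lambda>" using notS by auto
  have holX: "X holomorphic_on (- S)"
  proof -
    have h1: "(\<lambda>z. F (z + c)) holomorphic_on (- S)" using notS by (intro Fshift) auto
    have h2: "(\<lambda>z. F (z - c)) holomorphic_on (- S)" using Fshift[of "- S" "- c"] notS by auto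
    show ?thesis unfolding X_def
      by (intro holomorphic_intros h1 h2 holomorphic_on_subset[OF hol sub]
          holomorphic_on_subset[OF deriv_F_holo sub] holomorphic_on_subset[OF dF2 sub])
  qed
  have per: "X (z + l) = X z + 0 * cnj l" if "l \<in> \<Lambda>" for z l
    unfolding X_def deriv_F_periodic[OF that] deriv2_F_periodic[OF that]
    using quasi[OF that, of z] quasi[OF that, of "z + c"] quasi[OF that, of "z - c"] by (simp add: algebra_simps)
  have lim_c: "\<exists>L. (X \<longlongrightarrow> L) (at a)" if a: "a \<notin> \<Lambda>" "deriv F a = 0" for a
  proof -
    from F_times_deriv_tendsto[OF a, of c]
    obtain L1 where L1: "((\<lambda>z. F (z + c) * deriv F z) \<longlongrightarrow> L1) (at a)" ..
    from F_times_deriv_tendsto[OF a, of "- c"]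
    obtain L2 where L2: "((\<lambda>z. F (z + - c) * deriv F z) \<longlongrightarrow> L2) (at a)" ..
    have "isCont (\<lambda>z. - 2 * F z * deriv F z - \<rho> * deriv (deriv F) z) a"
    proof -
      have "isCont (deriv (deriv F)) a"
        using dF2 open_compl_lattice holomorphic_on_imp_continuous_on continuous_on_eq_continuous_at a(1) by blast
      then show ?thesis using isCont_F[OF a(1)] DERIV_isCont[OF DERIV2_F[OF a(1)]] by (intro continuous_intros)
    qed
    then have "((\<lambda>z. F (z + c) * deriv F z + F (z + - c) * deriv F z + (- 2 * F z * deriv F z - \<rho> * deriv (deriv F) z))
       \<longlongrightarrow> L1 + L2 + (- 2 * F a * deriv F a - \<rho> * deriv (deriv F) a)) (at a)"
      unfolding isCont_def by (intro tendsto_add L1 L2)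
    moreover have "(\<lambda>z. F (z + c) * deriv F z + F (z + - c) * deriv F z + (- 2 * F z * deriv F z - \<rho> * deriv (deriv F) z)) = X"
      by (auto simp: X_def fun_eq_iff algebra_simps)
    ultimately show ?thesis by auto
  qed
  have lim_0: "\<exists>L. (X \<longlongrightarrow> L) (at 0)"
  proof -
    obtain r1 where r1: "r1 > 0" "ball 0 r1 \<inter> translates {c, -c} \<subseteq> {0}"
      using translates_isolated[of "{c,-c}" 0] by auto
    define r where "r = min r1 sep"
    have r: "r > 0" "r \<le> sep" using r1 sep_pos by (auto simp: r_def)
    have off: "z + c \<notin> \<Lambda> \<and> z - c \<notin> \<Lambda>" if "z \<in> ball 0 r" for z
    proof -
      have "z + c \<in> \<Lambda> \<Longrightarrow> z = - c + (z + c)" "z - c \<in> \<Lambda> \<Longrightarrow> z = c + (z - c)" by auto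
      then have "z + c \<in> \<Lambda> \<or> z - c \<in> \<Lambda> \<Longrightarrow> z \<in> translates {c, -c}" by blast
      moreover have "z \<in> ball 0 r1" using that by (auto simp: r_def)
      ultimately have "z + c \<in> \<Lambda> \<or> z - c \<in> \<Lambda> \<Longrightarrow> z = 0" using r1(2) by blast
      then show ?thesis using c(1) by auto
    qed
    define u where "u z = F (z + c) + F (z + - c)" for z
    have kh: "kreg holomorphic_on ball 0 r" by (rule holomorphic_on_subset[OF kreg_holo]) (use r in auto)
    have uh: "u holomorphic_on ball 0 r"
      unfolding u_def by (intro holomorphic_intros Fshift) (use off in auto)
    have dkh: "deriv kreg holomorphic_on ball 0 r" by (rule holomorphic_deriv[OF kh open_ball])
    have ddkh: "deriv (deriv kreg) holomorphic_on ball 0 r" by (rule holomorphic_deriv[OF dkh open_ball])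
    \<comment> \<open>On inserting the Laurent expansions at 0, the terms in z^-3 cancel and -
      \<rho> N(z) / z^2 is all that remains singular. N vanishes at 0 because F is odd up to a
      constant, and so does its derivative because c and -c are critical.\<close>
    define N where "N z = u z - 2 * kreg z + 2 * z * deriv kreg z" for z
    have Nh: "N holomorphic_on ball 0 r" unfolding N_def by (intro holomorphic_intros uh kh dkh)
    have N0: "N 0 = 0" using F_odd[OF c(1)] by (simp add: N_def u_def)
    have "((\<lambda>z. F (z + b)) has_field_derivative deriv F (0 + b)) (at 0)" if "b \<notin> \<Lambda>" for b
      using DERIV_F[of "0 + b"] that unfolding DERIV_shift by simp
    from DERIV_add[OF this[of c] this[of "- c"]]
    have "(u has_field_derivative deriv F (0 + c) + deriv F (0 + - c)) (at 0)"
      using c(1) by (simp add: u_def[abs_def])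
    moreover have "deriv F (- c) = 0" using deriv_F_even[OF c(1)] c(2) by simp
    ultimately have du: "(u has_field_derivative 0) (at 0)" using c(2) by simp
    have "(N has_field_derivative 0) (at 0)" unfolding N_def
      using du holomorphic_derivI[OF kh open_ball, of 0] holomorphic_derivI[OF dkh open_ball, of 0] r(1)
      by (auto intro!: derivative_eq_intros)
    then have N1: "deriv N 0 = 0" by (rule DERIV_imp_deriv)
    obtain L where L: "((\<lambda>z. N z / z^2) \<longlongrightarrow> L) (at 0)"
      using double_zero_quotient_tendsto[OF Nh r(1) N0 N1] by blast
    define R where "R z = (u z - 2 * kreg z) * deriv kreg z - \<rho> * deriv (deriv kreg) z" for z
    have "R holomorphic_on ball 0 r" unfolding R_def by (intro holomorphic_intros uh kh dkh ddkh)
    then have "isCont R 0" using r(1) holomorphic_on_imp_continuous_on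
      by (auto simp: continuous_on_eq_continuous_at dest!: holomorphic_on_imp_continuous_on)
    then have "((\<lambda>z. - \<rho> * (N z / z^2) + R z) \<longlongrightarrow> - \<rho> * L + R 0) (at 0)"
      unfolding isCont_def by (intro tendsto_intros L)
    moreover have "eventually (\<lambda>z. z \<in> ball 0 r - {0}) (at (0::complex))"
      using r by (intro eventually_at_in_open) auto
    then have "eventually (\<lambda>z. - \<rho> * (N z / z^2) + R z = X z) (at 0)"
    proof eventually_elim
      case (elim z)
      then have z: "z \<noteq> 0" "z \<in> ball 0 sep" using r by auto
      have "F (z - c) + F (z + c) = u z" by (simp add: u_def)
      then have X: "X z = (u z - 2 * (\<rho> / z + kreg z)) * (- \<rho> / z^2 + deriv kreg z)
          - \<rho> * (2 * \<rho> / z^3 + deriv (deriv kreg) z)"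
        unfolding X_def deriv_F_near_0[OF z(2,1)] F_eq[OF z(1), symmetric] by (simp add: add.commute)
      show ?case unfolding X N_def R_def using z(1)
        by (simp add: field_simps power2_eq_square power3_eq_cube)
    qed
    ultimately show ?thesis by (intro exI) (rule Lim_transform_eventually)
  qed
  have "\<exists>L. (X \<longlongrightarrow> L) (at a)" if "a \<in> {0, c, - c}" for a
    using that lim_0 lim_c[of c] lim_c[of "- c"] c deriv_F_even[OF c(1)] by auto
  from quasi_periodic_const(2)[OF _ holX[unfolded S_def] per this]
  obtain C where C: "\<And>z. z \<notin> S \<Longrightarrow> X z = C" unfolding S_def by auto
  have z': "- z \<notin> S"
  proof
    assume "- z \<in> S"
    then obtain a l where al: "a \<in> {0, c, - c}" "l \<in> \<Lambda>" "- z = a + l" unfolding S_def by blast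
    have "z = - (a + l)" unfolding al(3)[symmetric] by simp
    then have "z = - a + - l" by simp
    moreover have "- l \<in> \<Lambda>" "- a \<in> {0, c, - c}" using al by auto
    ultimately show False using zS unfolding S_def by blast
  qed
  have nz: "z \<notin> \<Lambda>" "z + c \<notin> \<Lambda>" "z - c \<notin> \<Lambda>" using notS[OF zS] by auto
  have m1: "F (- z + c) = 2 * kreg 0 - F (z - c)" using F_odd[OF nz(3)] by (simp add: algebra_simps)
  have "- (z + c) = - z - c" by simp
  from F_odd[OF nz(2), unfolded this]
  have m2: "F (- z - c) = 2 * kreg 0 - F (z + c)" by (simp add: eq_diff_eq add.commute)
  have m3: "F (- z) = 2 * kreg 0 - F z" using F_odd[OF nz(1)] by (simp add: algebra_simps)
  \<comment> \<open>The constants from the oddness of F cancel in the combination with coefficients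
    1, 1, -2; F' is even and F'' is odd.\<close>
  have "X (- z) = - X z"
    unfolding X_def m1 m2 m3 deriv_F_even[OF nz(1)] deriv2_F_odd[OF nz(1)] by (simp add: algebra_simps)
  then have "C = 0" using C[OF zS] C[OF z'] by simp
  then show ?thesis using C[OF zS] by (simp add: X_def)
qed

text \<open>At a zero d of F' of order n, F'' vanishes only to order n - 1. The identity writes
  \<rho> F'' as F' times a factor which is regular at d unless d is congruent to c or -c, a
  contradiction. So the critical points lie in at most two classes, without any count of zeros of
  elliptic functions.\<close>

lemma critical_points:
  assumes c: "c \<notin> \<Lambda>" "deriv F c = 0" and d: "d \<notin> \<Lambda>" "deriv F d = 0"
  shows "d - c \<in> \<Lambda> \<or> d + c \<in> \<Lambda>"
proof (rule ccontr)
  define S where "S = translates {0, c, - c}"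
  assume "\<not> (d - c \<in> \<Lambda> \<or> d + c \<in> \<Lambda>)"
  then have dS: "d \<notin> S" using d(1) unfolding S_def by auto
  obtain g r n where g: "0 < n" "0 < r" "ball d r \<subseteq> - \<Lambda>" "g holomorphic_on ball d r"
      "\<And>w. w \<in> ball d r \<Longrightarrow> deriv F w = (w - d)^n * g w" "\<And>w. w \<in> ball d r \<Longrightarrow> g w \<noteq> 0"
    using holomorphic_factor_zero_nonconstant[OF deriv_F_holo open_compl_lattice
        connected_compl_countable[OF countable_lattice] _ d(2) deriv_F_nonconst] d(1) by (metis ComplI)
  have oS: "open (- S)" unfolding S_def by (rule open_Compl, rule closed_translates) simp
  define A where "A z = F (z + c) + F (z - c) - 2 * F z" for z
  have notS: "d \<notin> \<Lambda> \<and> d + c \<notin> \<Lambda> \<and> d - c \<notin> \<Lambda>" using \<open>\<not> (d - c \<in> \<Lambda> \<or> d + c \<in> \<Lambda>)\<close> d by auto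
  have contA: "isCont A d" unfolding A_def
    by (intro continuous_intros isCont_o2[OF _ isCont_F] isCont_F) (use notS in auto)
  have contg: "isCont g d" and contg': "isCont (deriv g) d"
    using g(2) holomorphic_on_imp_continuous_on[OF g(4)]
      holomorphic_on_imp_continuous_on[OF holomorphic_deriv[OF g(4) open_ball]]
    by (auto simp: continuous_on_eq_continuous_at)
  \<comment> \<open>This is the identity divided by (w - d)^(n - 1). It vanishes near d, but its
    limit at d is - \<rho> n g(d).\<close>
  have "((\<lambda>w. A w * (w - d) * g w - \<rho> * (of_nat n * g w + (w - d) * deriv g w)) \<longlongrightarrow>
      A d * (d - d) * g d - \<rho> * (of_nat n * g d + (d - d) * deriv g d)) (at d)"
    using contA contg contg' unfolding isCont_def by (intro tendsto_intros)
  moreover have "eventually (\<lambda>w. w \<in> (ball d r \<inter> - S) - {d}) (at d)"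
    using g(2) dS oS by (intro eventually_at_in_open) auto
  then have "eventually (\<lambda>w. A w * (w - d) * g w - \<rho> * (of_nat n * g w + (w - d) * deriv g w) = 0) (at d)"
  proof eventually_elim
    case (elim w)
    then have w: "w \<in> ball d r" "w \<notin> S" "w \<noteq> d" by auto
    obtain m where m: "n = Suc m" using g(1) gr0_implies_Suc by blast
    have "((\<lambda>w. (w - d)^n * g w) has_field_derivative
        (of_nat n * (w - d)^m * g w + (w - d)^n * deriv g w)) (at w)"
    proof -
      have "((\<lambda>w. (w - d) ^ Suc m) has_field_derivative (1 + of_nat m) * (1 * (w - d) ^ m)) (at w)"
        by (rule DERIV_power_Suc) (auto intro!: derivative_eq_intros)
      from DERIV_mult[OF this holomorphic_derivI[OF g(4) open_ball w(1)]]
      show ?thesis by (simp add: m algebra_simps)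
    qed
    then have "(deriv F has_field_derivative (of_nat n * (w - d)^m * g w + (w - d)^n * deriv g w)) (at w)"
      by (rule has_field_derivative_transform_within_open[OF _ open_ball w(1)]) (simp add: g(5))
    then have dd: "deriv (deriv F) w = of_nat n * (w - d)^m * g w + (w - d)^n * deriv g w"
      by (rule DERIV_imp_deriv)
    have "A w * deriv F w = \<rho> * deriv (deriv F) w"
      using critical_identity[OF c w(2)[unfolded S_def]] by (simp add: A_def)
    then have "(w - d)^m * (A w * (w - d) * g w) = (w - d)^m * (\<rho> * (of_nat n * g w + (w - d) * deriv g w))"
      unfolding dd g(5)[OF w(1)] by (simp add: m algebra_simps)
    then show ?case using w(3) by simp
  qed
  ultimately have "((\<lambda>w. 0) \<longlongrightarrow> A d * (d - d) * g d - \<rho> * (of_nat n * g d + (d - d) * deriv g d)) (at d)"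
    by (rule Lim_transform_eventually)
  then have "\<rho> * (of_nat n * g d) = 0" by (simp add: tendsto_const_iff)
  then show False using \<rho>_nonzero g(1,2) g(6)[of d] by simp
qed

end

subsection \<open>The covering away from critical values\<close>

text \<open>By continuity h stays, near each point, within a disc on which f is injective, and there
  it equals the local inverse of f composed with u.\<close>

lemma holomorphic_lift:
  assumes hF: "f holomorphic_on S" and S: "open S" and nz: "\<And>z. z \<in> S \<Longrightarrow> deriv f z \<noteq> 0"
    and V: "open V" and ch: "continuous_on V h" and hS: "h ` V \<subseteq> S"
    and hu: "u holomorphic_on V" and eq: "\<And>x. x \<in> V \<Longrightarrow> f (h x) = u x"
  shows "h holomorphic_on V"
proof -
  have "h field_differentiable (at x)" if x: "x \<in> V" for x
  proof -
    have hx: "h x \<in> S" using hS x by auto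
    obtain r where r: "r > 0" "ball (h x) r \<subseteq> S" "open (f ` ball (h x) r)" "inj_on f (ball (h x) r)"
      using has_complex_derivative_locally_invertible[OF hF hx S nz[OF hx]] by blast
    obtain k where k: "k holomorphic_on f ` ball (h x) r" "\<And>z. z \<in> ball (h x) r \<Longrightarrow> k (f z) = z"
      using holomorphic_has_inverse[OF holomorphic_on_subset[OF hF r(2)] open_ball r(4)] by metis
    define N where "N = V \<inter> h -` ball (h x) r"
    have N: "open N" unfolding N_def by (rule continuous_open_preimage[OF ch V open_ball])
    have xN: "x \<in> N" using x r(1) by (simp add: N_def)
    have "(k \<circ> u) holomorphic_on N"
    proof (rule holomorphic_on_compose_gen[OF _ k(1)])
      show "u holomorphic_on N" using hu by (rule holomorphic_on_subset) (auto simp: N_def)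
      show "u ` N \<subseteq> f ` ball (h x) r" using eq by (force simp: N_def)
    qed
    moreover have "(k \<circ> u) y = h y" if "y \<in> N" for y
      using that k(2)[of "h y"] eq[of y] by (auto simp: N_def)
    ultimately have "h holomorphic_on N" by (metis (no_types, lifting) holomorphic_cong)
    then show ?thesis using N xN by (rule holomorphic_on_imp_differentiable_at)
  qed
  then show ?thesis using V by (simp add: holomorphic_on_def at_within_open_NO_MATCH)
qed

text \<open>The points of B where the two inverse branches agree form an open set, namely the image
  of the intersection, and so do the points where they differ. Connectedness of B leaves only
  agreement.\<close>

lemma sheets_eq:
  fixes p :: "complex \<Rightarrow> complex"
  assumes N: "open N" "open N'" and hol: "p holomorphic_on N" "p holomorphic_on N'"
    and inj: "inj_on p N" "inj_on p N'" and img: "p ` N = B" "p ` N' = B" and B: "connected B"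
    and ne: "N \<inter> N' \<noteq> {}"
  shows "N = N'"
proof -
  obtain h where h: "h holomorphic_on B" "\<And>z. z \<in> N \<Longrightarrow> h (p z) = z"
    using holomorphic_has_inverse[OF hol(1) N(1) inj(1)] img by metis
  obtain h' where h': "h' holomorphic_on B" "\<And>z. z \<in> N' \<Longrightarrow> h' (p z) = z"
    using holomorphic_has_inverse[OF hol(2) N(2) inj(2)] img by metis
  have oB: "open B" using open_mapping_thm3[OF hol(1) N(1) inj(1)] img by simp
  define D where "D = B \<inter> (\<lambda>w. h w - h' w) -` (- {0})"
  have "open D" unfolding D_def
    by (intro continuous_open_preimage oB continuous_on_diff holomorphic_on_imp_continuous_on h h') auto
  have hN: "p holomorphic_on (N \<inter> N')" using hol(1) by (rule holomorphic_on_subset) auto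
  have oI: "open (p ` (N \<inter> N'))"
    using N by (intro open_mapping_thm3[OF hN] inj_on_subset[OF inj(1)]) auto
  have cover: "B \<subseteq> p ` (N \<inter> N') \<union> D"
  proof
    fix w assume w: "w \<in> B"
    show "w \<in> p ` (N \<inter> N') \<union> D"
    proof (cases "h w = h' w")
      case True
      obtain z z' where "z \<in> N" "p z = w" "z' \<in> N'" "p z' = w" using w img by (metis imageE)
      then have "z = z'" using h(2) h'(2) True by metis
      then show ?thesis using \<open>z \<in> N\<close> \<open>z' \<in> N'\<close> \<open>p z = w\<close> by blast
    next
      case False
      then show ?thesis using w by (simp add: D_def)
    qed
  qed
  have disj: "p ` (N \<inter> N') \<inter> D = {}" using h(2) h'(2) by (auto simp: D_def)
  have sub: "p ` (N \<inter> N') \<subseteq> B" using img by auto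
  have "D = {}"
  proof (rule ccontr)
    assume "D \<noteq> {}"
    then have "B \<inter> D \<noteq> {}" by (auto simp: D_def)
    moreover have "p ` (N \<inter> N') \<inter> B \<noteq> {}" using ne sub by auto
    ultimately show False
      using connectedD[OF B oI \<open>open D\<close>] cover disj by blast
  qed
  then have Bs: "B \<subseteq> p ` (N \<inter> N')" using cover by auto
  show ?thesis
  proof (intro subset_antisym subsetI)
    fix z assume z: "z \<in> N"
    then have "p z \<in> p ` (N \<inter> N')" using Bs img by blast
    then obtain y where "y \<in> N" "y \<in> N'" "p z = p y" by blast
    then show "z \<in> N'" using inj(1) z by (metis inj_onD)
  next
    fix z assume z: "z \<in> N'"
    then have "p z \<in> p ` (N \<inter> N')" using Bs img by blast
    then obtain y where "y \<in> N" "y \<in> N'" "p z = p y" by blast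
    then show "z \<in> N" using inj(2) z by (metis inj_onD)
  qed
qed

section \<open>F near its poles and over its noncritical values\<close>

context torus_map
begin

lemma filterlim_F_0: "filterlim F at_infinity (at 0)"
proof -
  have 1: "filterlim (\<lambda>z. z * F z / z) at_infinity (at 0)"
    by (rule filterlim_divide_at_infinity[OF pole _ \<rho>_nonzero]) (auto simp: filterlim_at eventually_at_filter)
  have "eventually (\<lambda>z. z * F z / z = F z) (at 0)" by (simp add: eventually_at_filter)
  from filterlim_cong[OF refl refl this] 1 show ?thesis by (rule iffD1)
qed

text \<open>The radius depends on l: the shift law adds \<open>cnj l\<close>, so near the pole at 0
  the function must exceed M + |l|.\<close>

lemma F_large_near_lattice:
  assumes l: "l \<in> \<Lambda>"
  obtains d where "d > 0" "\<And>z. dist z l < d \<Longrightarrow> z \<noteq> l \<Longrightarrow> norm (F z) > M"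
proof -
  have "eventually (\<lambda>z. norm (F z) > M + norm l) (at 0)"
    using filterlim_F_0 by (simp add: filterlim_at_infinity_conv_norm_at_top filterlim_at_top_dense)
  then obtain d where d: "d > 0" "\<And>z. z \<noteq> 0 \<Longrightarrow> dist z 0 < d \<Longrightarrow> norm (F z) > M + norm l"
    by (auto simp: eventually_at)
  show thesis
  proof (rule that[OF d(1)])
    fix z assume z: "dist z l < d" "z \<noteq> l"
    have "norm (F (z - l)) > M + norm l" using z by (intro d(2)) (auto simp: dist_norm)
    moreover have "F (z - l) = F z - cnj l" using quasi[OF l, of "z - l"] by simp
    moreover have "norm (F z - cnj l) \<le> norm (F z) + norm l" by (metis complex_mod_cnj norm_triangle_ineq4)
    ultimately show "norm (F z) > M" by simp
  qed
qed

text \<open>1/F continues as z / (\<rho> + z \<open>kreg\<close> z), which has a simple zero at 0.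
  It is therefore injective near 0 and covers a disc about 0; taking reciprocals, F covers a
  neighbourhood of infinity.\<close>

lemma near_pole_univalent:
  obtains \<delta> R where "0 < \<delta>" "\<delta> < sep / 2" "inj_on F (ball 0 \<delta> - {0})"
    "\<And>w. norm w > R \<Longrightarrow> \<exists>z\<in>ball 0 \<delta> - {0}. F z = w"
proof -
  define p where "p z = \<rho> + z * kreg z" for z
  have ph: "p holomorphic_on ball 0 sep" unfolding p_def by (intro holomorphic_intros kreg_holo)
  have "isCont p 0" using sep_pos holomorphic_on_imp_continuous_on[OF ph]
    by (auto simp: continuous_on_eq_continuous_at)
  moreover have "p 0 \<noteq> 0" using \<rho>_nonzero by (simp add: p_def)
  ultimately obtain e where e: "e > 0" "\<And>z. dist 0 z < e \<Longrightarrow> p z \<noteq> 0"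
    using continuous_at_avoid[of 0 p 0] by auto
  define r0 where "r0 = min e (sep / 2)"
  have r0: "r0 > 0" "r0 \<le> e" "r0 \<le> sep / 2" using e sep_pos by (auto simp: r0_def)
  define q where "q z = z / p z" for z
  have qh: "q holomorphic_on ball 0 r0" unfolding q_def
    by (intro holomorphic_intros holomorphic_on_subset[OF ph]) (use e r0 sep_pos in auto)
  have "(p has_field_derivative deriv p 0) (at 0)"
    using sep_pos by (intro holomorphic_derivI[OF ph open_ball]) auto
  from DERIV_divide[OF DERIV_ident this \<open>p 0 \<noteq> 0\<close>]
  have "((\<lambda>z. z / p z) has_field_derivative 1 / p 0) (at 0)" using \<open>p 0 \<noteq> 0\<close> by simp
  then have "(q has_field_derivative 1 / \<rho>) (at 0)" by (simp add: q_def[abs_def] p_def)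
  from DERIV_imp_deriv[OF this] have q1: "deriv q 0 \<noteq> 0" using \<rho>_nonzero by simp
  obtain \<delta>1 where d1: "\<delta>1 > 0" "ball 0 \<delta>1 \<subseteq> ball (0::complex) r0" "inj_on q (ball 0 \<delta>1)"
    using has_complex_derivative_locally_injective[OF qh _ open_ball q1] r0(1) by auto
  define \<delta> where "\<delta> = min \<delta>1 r0 / 2"
  have \<delta>: "\<delta> > 0" "\<delta> < \<delta>1" "\<delta> < r0" using d1 r0 by (auto simp: \<delta>_def)
  have injq: "inj_on q (ball 0 \<delta>)" by (rule inj_on_subset[OF d1(3) subset_ball]) (use \<delta> in linarith)
  have qh': "q holomorphic_on ball 0 \<delta>" by (rule holomorphic_on_subset[OF qh subset_ball]) (use \<delta> in linarith)
  have "open (q ` ball 0 \<delta>)" by (rule open_mapping_thm3[OF qh' open_ball injq])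
  moreover have "0 \<in> q ` ball 0 \<delta>" using \<delta>(1) by (intro image_eqI[of _ _ 0]) (auto simp: q_def)
  ultimately obtain \<epsilon> where eps: "\<epsilon> > 0" "ball 0 \<epsilon> \<subseteq> q ` ball 0 \<delta>" using openE by blast
  have Fq: "F z = 1 / q z" if "z \<in> ball 0 \<delta>" "z \<noteq> 0" for z
  proof -
    have "p z \<noteq> 0" using that \<delta> r0 by (intro e(2)) auto
    then show ?thesis using that unfolding F_eq[OF that(2)] by (simp add: q_def p_def field_simps)
  qed
  show thesis
  proof (rule that[of \<delta> "1 / \<epsilon>"])
    show "inj_on F (ball 0 \<delta> - {0})"
    proof (rule inj_onI)
      fix x y assume xy: "x \<in> ball 0 \<delta> - {0}" "y \<in> ball 0 \<delta> - {0}" "F x = F y"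
      then have "q x = q y" using Fq[of x] Fq[of y] by (auto simp: divide_simps split: if_splits)
      then show "x = y" using injq xy by (auto dest: inj_onD)
    qed
    fix w :: complex assume w: "norm w > 1 / \<epsilon>"
    then have "w \<noteq> 0" "norm w > 0" using eps by (auto intro: less_trans[OF divide_pos_pos])
    then have "1 / w \<in> ball 0 \<epsilon>" using w eps by (simp add: norm_divide field_simps)
    then obtain z where z: "z \<in> ball 0 \<delta>" "q z = 1 / w" using eps(2) by (metis imageE subsetD)
    then have "z \<noteq> 0" using \<open>w \<noteq> 0\<close> by (auto simp: q_def)
    then show "\<exists>z\<in>ball 0 \<delta> - {0}. F z = w" using z Fq[of z] by (intro bexI[of _ z]) auto
  qed (use \<delta> r0 in auto)
qed

definition crit :: "complex set" where "crit = {c. c \<notin> \<Lambda> \<and> deriv F c = 0}"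

text \<open>The full preimage of the noncritical values. Noncritical points lying over a critical
  value are removed as well, since the covering property is a condition on the whole fibre.\<close>

definition regular_domain :: "complex set" where
  "regular_domain = {z. z \<notin> \<Lambda> \<and> F z \<notin> F ` crit}"

text \<open>Since critical points are congruent to c or -c, the conjugates of the critical values
  are the lattice translates of two points, a closed set. The conjugation appears because F shifts
  by \<open>cnj l\<close>.\<close>

lemma closed_critical_values: "closed (F ` crit)"
proof (cases "crit = {}")
  case False
  then obtain c where c: "c \<notin> \<Lambda>" "deriv F c = 0" by (auto simp: crit_def)
  let ?A = "{cnj (F c), cnj (F (- c))}"
  have "F ` crit = cnj -` translates ?A"
  proof (intro subset_antisym subsetI)
    fix w assume "w \<in> F ` crit"
    then obtain d where d: "d \<notin> \<Lambda>" "deriv F d = 0" "w = F d" by (auto simp: crit_def)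
    from critical_points[OF c d(1,2)] show "w \<in> cnj -` translates ?A"
    proof
      assume l: "d - c \<in> \<Lambda>"
      then have "cnj w = cnj (F c) + (d - c)" using quasi[OF l, of c] d by simp
      then show ?thesis using l by (simp only: vimage_eq) blast
    next
      assume l: "d + c \<in> \<Lambda>"
      then have "cnj w = cnj (F (- c)) + (d + c)" using quasi[OF l, of "- c"] d by simp
      then show ?thesis using l by (simp only: vimage_eq) blast
    qed
  next
    fix w assume "w \<in> cnj -` translates ?A"
    then obtain a l where al: "a \<in> ?A" "l \<in> \<Lambda>" "cnj w = a + l" by auto
    then obtain b where b: "b = c \<or> b = - c" "a = cnj (F b)" by auto
    have "w = cnj (a + l)" using al(3) by (metis complex_cnj_cnj)
    then have "w = F (b + l)" using quasi[OF al(2), of b] b by simp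
    moreover have "b + l \<in> crit"
      using b(1) c deriv_F_even[OF c(1)] lattice_add_cancel[OF al(2)] deriv_F_periodic[OF al(2)]
      unfolding crit_def by auto
    ultimately show "w \<in> F ` crit" by blast
  qed
  moreover have "closed (cnj -` translates ?A)"
    by (intro closed_vimage closed_translates continuous_intros) auto
  ultimately show ?thesis by simp
qed auto

text \<open>Continuity alone gives closedness only relative to the complement of the lattice; that
  the preimage does not accumulate at the lattice follows because F is large there.\<close>

lemma closed_F_preimage: "closed {z. z \<notin> \<Lambda> \<and> F z \<in> cball v b}" (is "closed ?Z")
proof -
  have "\<exists>e>0. ball x e \<subseteq> - ?Z" if x: "x \<notin> ?Z" for x
  proof (cases "x \<in> \<Lambda>")
    case True
    obtain d where d: "d > 0" "\<And>z. dist z x < d \<Longrightarrow> z \<noteq> x \<Longrightarrow> norm (F z) > norm v + b"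
      using F_large_near_lattice[OF True] by blast
    have "ball x d \<subseteq> - ?Z"
    proof (intro subsetI ComplI notI)
      fix z assume z: "z \<in> ball x d" "z \<in> ?Z"
      then have "z \<noteq> x" using True by auto
      then have "norm (F z) > norm v + b" using z by (intro d(2)) (auto simp: dist_commute)
      moreover have "norm (F z) \<le> norm v + b" using z norm_triangle_sub[of "F z" v]
        by (auto simp: dist_norm norm_minus_commute)
      ultimately show False by simp
    qed
    then show ?thesis using d(1) by blast
  next
    case False
    have "open (- \<Lambda> \<inter> F -` (- cball v b))"
      using holomorphic_on_imp_continuous_on[OF hol] open_compl_lattice
      by (intro continuous_open_preimage) auto
    moreover have "x \<in> - \<Lambda> \<inter> F -` (- cball v b)" using x False by auto
    ultimately obtain e where "e > 0" "ball x e \<subseteq> - \<Lambda> \<inter> F -` (- cball v b)" using openE by blast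
    then show ?thesis by (intro exI[of _ e]) auto
  qed
  then have "open (- ?Z)" unfolding open_contains_ball by blast
  then show ?thesis by (simp add: closed_def)
qed

text \<open>The preimages of a small disc about v are of two kinds. Near each lattice point l with v
  - \<open>cnj l\<close> large there is exactly one sheet, obtained by translating the univalent
  neighbourhood of the pole at 0. All other preimages lie in a compact set, where finitely many
  local inverses suffice.\<close>

lemma evenly_covered:
  assumes v: "v \<notin> F ` crit"
  obtains e \<N> where "e > 0" "ball v e \<subseteq> - F ` crit" "\<N> \<noteq> {}" "\<Union>\<N> = regular_domain \<inter> F -` ball v e"
    "\<And>N. N \<in> \<N> \<Longrightarrow> open N" "\<And>N. N \<in> \<N> \<Longrightarrow> inj_on F N" "\<And>N. N \<in> \<N> \<Longrightarrow> F ` N = ball v e"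
proof -
  obtain \<delta> R where \<delta>: "0 < \<delta>" "\<delta> < sep / 2" "inj_on F (ball 0 \<delta> - {0})"
    "\<And>w. norm w > R \<Longrightarrow> \<exists>z\<in>ball 0 \<delta> - {0}. F z = w"
    by (rule near_pole_univalent, rule that)
  \<comment> \<open>The margin 1 ensures that |w - \<open>cnj l\<close>| > R for every w within
    distance 1 of v.\<close>
  define L where "L = {l\<in>\<Lambda>. norm (v - cnj l) > R + 1}"
  define K where "K = {z. z \<notin> \<Lambda> \<and> F z \<in> cball v 1 \<and> (\<forall>l\<in>L. z \<notin> ball l \<delta>)}"
  have ball_lat: "z \<notin> \<Lambda>" if "l \<in> \<Lambda>" "z \<in> ball l \<delta>" "z \<noteq> l" for z l
  proof
    assume "z \<in> \<Lambda>"
    then have "z = l" using that \<delta>(1,2) sep_pos by (intro lattice_unique_near[of z l z]) (auto simp: dist_commute)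
    then show False using that by simp
  qed
  have "compact K"
  proof -
    have "K = {z. z \<notin> \<Lambda> \<and> F z \<in> cball v 1} \<inter> (\<Inter>l\<in>L. - ball l \<delta>)" by (auto simp: K_def)
    moreover have "closed \<dots>"
      by (intro closed_Int closed_F_preimage closed_INT ballI closed_Compl open_ball)
    ultimately have "closed K" by simp
    moreover have "bounded K"
    proof -
      have sub: "{z. \<forall>l\<in>\<Lambda>. \<delta> \<le> dist z l} \<subseteq> - \<Lambda>" using \<delta>(1) by force
      \<comment> \<open>F(z) - \<open>cnj z\<close> is periodic, hence bounded away from the
        lattice; so a bound on F(z) bounds z.\<close>
      have "continuous_on {z. \<forall>l\<in>\<Lambda>. \<delta> \<le> dist z l} (\<lambda>z. F z - cnj z)"
        by (intro continuous_intros continuous_on_subset[OF holomorphic_on_imp_continuous_on[OF hol] sub])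
      moreover have "F (z + l) - cnj (z + l) = F z - cnj z" if "l \<in> \<Lambda>" for z l
        using quasi[OF that, of z] by simp
      ultimately obtain M where M: "\<And>z. (\<forall>l\<in>\<Lambda>. \<delta> \<le> dist z l) \<Longrightarrow> norm (F z - cnj z) \<le> M"
        using fund_closure_bound[of \<delta> "\<lambda>z. F z - cnj z"] by blast
      have "norm z \<le> max (norm v + 1 + M) (norm v + R + 1 + \<delta>)" if z: "z \<in> K" for z
      proof (cases "\<forall>l\<in>\<Lambda>. \<delta> \<le> dist z l")
        case True
        have "norm (F z) \<le> norm v + 1" using z norm_triangle_sub[of "F z" v]
          by (auto simp: K_def dist_norm norm_minus_commute)
        moreover have "norm (cnj z) \<le> norm (F z) + norm (F z - cnj z)"
          using norm_triangle_ineq4[of "F z" "F z - cnj z"] by simp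
        ultimately show ?thesis using M[OF True] by simp
      next
        case False
        then obtain l where l: "l \<in> \<Lambda>" "dist z l < \<delta>" by auto
        then have "l \<notin> L" using z by (auto simp: K_def dist_commute)
        then have "norm (v - cnj l) \<le> R + 1" using l by (auto simp: L_def)
        then have "norm (cnj l) \<le> norm v + R + 1" using norm_triangle_sub[of "cnj l" v]
          by (auto simp: norm_minus_commute)
        moreover have "norm z \<le> norm l + \<delta>" using l norm_triangle_sub[of z l] by (auto simp: dist_norm)
        ultimately show ?thesis by simp
      qed
      then show ?thesis unfolding bounded_iff by blast
    qed
    ultimately show ?thesis by (simp add: compact_eq_bounded_closed)
  qed
  have KL: "K \<subseteq> - \<Lambda>" by (auto simp: K_def)
  have contK: "continuous_on K F" using continuous_on_subset[OF holomorphic_on_imp_continuous_on[OF hol] KL] .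
  define K0 where "K0 = K \<inter> F -` {v}"
  have "closed K0" unfolding K0_def
    by (rule continuous_closed_preimage[OF contK]) (use \<open>compact K\<close> compact_imp_closed in auto)
  then have "compact (K \<inter> K0)" using \<open>compact K\<close> by (rule compact_Int_closed[rotated])
  moreover have "K \<inter> K0 = K0" by (auto simp: K0_def)
  ultimately have "compact K0" by simp
  have "\<exists>r>0. ball x r \<subseteq> - \<Lambda> \<and> inj_on F (ball x r)" if x: "x \<in> K0" for x
  proof -
    have "x \<notin> crit" using x v by (auto simp: K0_def)
    then have "deriv F x \<noteq> 0" "x \<in> - \<Lambda>" using x by (auto simp: crit_def K0_def K_def)
    then show ?thesis
      using has_complex_derivative_locally_injective[OF hol _ open_compl_lattice] by metis
  qed
  then obtain r where r: "\<And>x. x \<in> K0 \<Longrightarrow> r x > 0" "\<And>x. x \<in> K0 \<Longrightarrow> ball x (r x) \<subseteq> - \<Lambda>"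
      "\<And>x. x \<in> K0 \<Longrightarrow> inj_on F (ball x (r x))" by metis
  have "K0 \<subseteq> (\<Union>x\<in>K0. ball x (r x))" using r(1) by force
  then obtain X where X: "X \<subseteq> K0" "finite X" "K0 \<subseteq> (\<Union>x\<in>X. ball x (r x))"
    using compactE_image[OF \<open>compact K0\<close>, of K0 "\<lambda>x. ball x (r x)"] by (metis open_ball)
  \<comment> \<open>The compact part of K outside the chosen discs does not take the value v, so
    neither does its closed image; shrinking the disc about v avoids this image entirely.\<close>
  define K' where "K' = K - (\<Union>x\<in>X. ball x (r x))"
  have "compact K'" unfolding K'_def by (intro compact_diff \<open>compact K\<close>) auto
  then have "compact (F ` K')"
    by (intro compact_continuous_image continuous_on_subset[OF contK]) (auto simp: K'_def)
  then have cl: "closed (F ` K')" by (rule compact_imp_closed)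
  have vK': "v \<notin> F ` K'"
  proof
    assume "v \<in> F ` K'"
    then obtain z where "z \<in> K'" "F z = v" by auto
    then have "z \<in> K0" "z \<notin> (\<Union>x\<in>X. ball x (r x))" by (auto simp: K'_def K0_def)
    then show False using X(3) by blast
  qed
  have holx: "F holomorphic_on ball x (r x)" if "x \<in> K0" for x
    using holomorphic_on_subset[OF hol r(2)[OF that]] .
  define W where "W = ball v 1 \<inter> - (F ` crit) \<inter> - (F ` K') \<inter> (\<Inter>x\<in>X. F ` ball x (r x))"
  have "open W" unfolding W_def
    using X closed_critical_values cl
    by (intro open_Int open_INT open_Compl ballI open_mapping_thm3 holx r(3)) auto
  moreover have "v \<in> W"
  proof -
    have "v \<in> F ` ball x (r x)" if "x \<in> X" for x
      using that X(1) r(1)[of x] by (intro image_eqI[of _ _ x]) (auto simp: K0_def)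
    then show ?thesis using v vK' by (auto simp: W_def)
  qed
  ultimately obtain e where e: "e > 0" "ball v e \<subseteq> W" using openE by blast
  define N1 where "N1 x = ball x (r x) \<inter> F -` ball v e" for x
  define N2 where "N2 l = (ball l \<delta> - {l}) \<inter> F -` ball v e" for l
  define \<N> where "\<N> = N1 ` X \<union> N2 ` L"
  have sub2: "ball l \<delta> - {l} \<subseteq> - \<Lambda>" if "l \<in> L" for l using ball_lat that by (auto simp: L_def)
  have N1: "open (N1 x) \<and> inj_on F (N1 x) \<and> F ` N1 x = ball v e" if x: "x \<in> X" for x
  proof (intro conjI)
    have x0: "x \<in> K0" using x X by auto
    show "open (N1 x)" unfolding N1_def
      by (intro continuous_open_preimage holomorphic_on_imp_continuous_on holx x0) auto
    show "inj_on F (N1 x)" using r(3)[OF x0] by (rule inj_on_subset) (auto simp: N1_def)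
    have "ball v e \<subseteq> F ` ball x (r x)" using e x by (auto simp: W_def)
    then show "F ` N1 x = ball v e" by (auto simp: N1_def)
  qed
  have N2: "open (N2 l) \<and> inj_on F (N2 l) \<and> F ` N2 l = ball v e" if l: "l \<in> L" for l
  proof (intro conjI)
    have lL: "l \<in> \<Lambda>" using l by (simp add: L_def)
    show "open (N2 l)" unfolding N2_def
      by (intro continuous_open_preimage continuous_on_subset[OF holomorphic_on_imp_continuous_on[OF hol] sub2] l) auto
    have shift: "F z = F (z - l) + cnj l" for z using quasi[OF lL, of "z - l"] by simp
    show "inj_on F (N2 l)"
    proof (rule inj_onI)
      fix x y assume xy: "x \<in> N2 l" "y \<in> N2 l" "F x = F y"
      then have "F (x - l) = F (y - l)" using shift[of x] shift[of y] by simp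
      moreover have "x - l \<in> ball 0 \<delta> - {0}" "y - l \<in> ball 0 \<delta> - {0}"
        using xy by (auto simp: N2_def dist_norm norm_minus_commute)
      ultimately have "x - l = y - l" using \<delta>(3) by (metis inj_onD)
      then show "x = y" by simp
    qed
    have "w \<in> F ` N2 l" if w: "w \<in> ball v e" for w
    proof -
      have "w \<in> ball v 1" using w e by (auto simp: W_def)
      then have "norm (v - cnj l) \<le> norm (w - cnj l) + 1"
        using norm_triangle_ineq[of "w - cnj l" "v - w"] by (simp add: dist_norm)
      then have "norm (w - cnj l) > R" using l by (auto simp: L_def)
      then obtain z where z: "z \<in> ball 0 \<delta> - {0}" "F z = w - cnj l" using \<delta>(4) by blast
      then have "F (z + l) = w" using quasi[OF lL, of z] by simp
      moreover have "z + l \<in> ball l \<delta> - {l}" using z by (auto simp: dist_norm)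
      ultimately show ?thesis using w by (intro image_eqI[of _ _ "z + l"]) (auto simp: N2_def)
    qed
    then show "F ` N2 l = ball v e" by (auto simp: N2_def)
  qed
  have Un: "\<Union>\<N> = {z. z \<notin> \<Lambda> \<and> F z \<in> ball v e}"
  proof (intro subset_antisym subsetI)
    fix z assume "z \<in> \<Union>\<N>"
    then consider x where "x \<in> X" "z \<in> N1 x" | l where "l \<in> L" "z \<in> N2 l" by (auto simp: \<N>_def)
    then show "z \<in> {z. z \<notin> \<Lambda> \<and> F z \<in> ball v e}"
    proof cases
      case 1
      then show ?thesis using r(2)[of x] X(1) unfolding N1_def by blast
    next
      case 2
      then show ?thesis using sub2[of l] unfolding N2_def by blast
    qed
  next
    fix z assume "z \<in> {z. z \<notin> \<Lambda> \<and> F z \<in> ball v e}"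
    then have z: "z \<notin> \<Lambda>" "F z \<in> ball v e" by auto
    show "z \<in> \<Union>\<N>"
    proof (cases "\<exists>l\<in>L. z \<in> ball l \<delta>")
      case True
      then obtain l where l: "l \<in> L" "z \<in> ball l \<delta>" by auto
      moreover have "z \<noteq> l" using l z by (auto simp: L_def)
      ultimately have "z \<in> N2 l" using z by (simp add: N2_def)
      then show ?thesis using l by (auto simp: \<N>_def)
    next
      case False
      have FW: "F z \<in> W" using z e by auto
      then have "F z \<in> cball v 1" by (auto simp: W_def)
      then have "z \<in> K" using z False by (auto simp: K_def)
      moreover have "z \<notin> K'" using FW by (auto simp: W_def)
      ultimately obtain x where "x \<in> X" "z \<in> ball x (r x)" by (auto simp: K'_def)
      then have "z \<in> N1 x" using z by (simp add: N1_def)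
      then show ?thesis using \<open>x \<in> X\<close> by (auto simp: \<N>_def)
    qed
  qed
  have "L \<noteq> {}"
  proof -
    obtain n :: nat where n: "real n > (norm v + \<bar>R\<bar> + 1) / norm \<omega>1" using reals_Archimedean2 by blast
    then have "real n * norm \<omega>1 > norm v + \<bar>R\<bar> + 1" using period_nonzero by (simp add: field_simps)
    then have "norm (cnj (of_nat n * \<omega>1)) > norm v + \<bar>R\<bar> + 1" by (simp add: norm_mult)
    then have "norm (v - cnj (of_nat n * \<omega>1)) > R + 1"
      using norm_triangle_sub[of "cnj (of_nat n * \<omega>1)" v] by (simp add: norm_minus_commute)
    moreover have "of_nat n * \<omega>1 \<in> \<Lambda>"
    proof -
      have "of_nat n * \<omega>1 = of_int (int n) * \<omega>1 + of_int 0 * \<omega>2" by simp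
      then show ?thesis unfolding lattice_def by blast
    qed
    ultimately show ?thesis unfolding L_def by blast
  qed
  then have ne: "\<N> \<noteq> {}" by (auto simp: \<N>_def)
  have sub: "ball v e \<subseteq> - F ` crit" using e by (auto simp: W_def)
  have Un': "\<Union>\<N> = regular_domain \<inter> F -` ball v e"
    unfolding Un using sub by (auto simp: regular_domain_def)
  have N: "open N \<and> inj_on F N \<and> F ` N = ball v e" if "N \<in> \<N>" for N
    using that N1 N2 unfolding \<N>_def by blast
  show thesis
    by (rule that[OF e(1) sub ne Un' conjunct1[OF N] conjunct1[OF conjunct2[OF N]] conjunct2[OF conjunct2[OF N]]])
qed

lemma covering: "covering_space regular_domain F (- F ` crit)"
proof
  have sub: "regular_domain \<subseteq> - \<Lambda>" by (auto simp: regular_domain_def)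
  show cont: "continuous_on regular_domain F"
    using continuous_on_subset[OF holomorphic_on_imp_continuous_on[OF hol] sub] .
  show "F ` regular_domain = - F ` crit"
  proof (intro subset_antisym subsetI)
    fix w assume "w \<in> F ` regular_domain" then show "w \<in> - F ` crit" by (auto simp: regular_domain_def)
  next
    fix w assume w: "w \<in> - F ` crit"
    then have w': "w \<notin> F ` crit" by simp
    obtain e \<N> where e: "e > 0" "\<N> \<noteq> {}" "\<Union>\<N> = regular_domain \<inter> F -` ball w e"
      and N: "\<And>N. N \<in> \<N> \<Longrightarrow> F ` N = ball w e" by (rule evenly_covered[OF w'], rule that)
    then obtain N where "N \<in> \<N>" by blast
    then have "ball w e = F ` N" "N \<subseteq> regular_domain" using e N by auto
    then show "w \<in> F ` regular_domain" using e(1) by (metis centre_in_ball image_mono subsetD)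
  qed
  fix v assume v: "v \<in> - F ` crit"
  then have v': "v \<notin> F ` crit" by simp
  obtain e \<N> where e: "e > 0" "ball v e \<subseteq> - F ` crit" "\<N> \<noteq> {}" "\<Union>\<N> = regular_domain \<inter> F -` ball v e"
    and N: "\<And>N. N \<in> \<N> \<Longrightarrow> open N" "\<And>N. N \<in> \<N> \<Longrightarrow> inj_on F N" "\<And>N. N \<in> \<N> \<Longrightarrow> F ` N = ball v e"
    by (rule evenly_covered[OF v'], rule that)
  have N4: "N \<subseteq> regular_domain" if "N \<in> \<N>" for N using that e(4) by blast
  have holN: "F holomorphic_on N" if "N \<in> \<N>" for N
    using N4[OF that] sub by (intro holomorphic_on_subset[OF hol]) auto
  show "\<exists>T. v \<in> T \<and> openin (top_of_set (- F ` crit)) T \<and> (\<exists>\<V>. \<Union>\<V> = regular_domain \<inter> F -` T \<and>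
      (\<forall>u\<in>\<V>. openin (top_of_set regular_domain) u) \<and> pairwise disjnt \<V> \<and> (\<forall>u\<in>\<V>. \<exists>q. homeomorphism u T F q))"
  proof (rule exI[of _ "ball v e"], intro conjI exI[of _ \<N>] ballI)
    show "v \<in> ball v e" using e by simp
    show "openin (top_of_set (- F ` crit)) (ball v e)" using e(2) by (intro open_subset) auto
    show "\<Union>\<N> = regular_domain \<inter> F -` ball v e" by fact
    show "openin (top_of_set regular_domain) u" if "u \<in> \<N>" for u using N(1)[OF that] N4[OF that] by (intro open_subset)
    \<comment> \<open>Disjointness is not built into the construction of the sheets: sheets over the
      same disc that meet are equal, by \<open>sheets_eq\<close>.\<close>
    show "pairwise disjnt \<N>"
    proof (rule pairwiseI)
      fix A B assume AB: "A \<in> \<N>" "B \<in> \<N>" "A \<noteq> B"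
      show "disjnt A B"
      proof (rule ccontr)
        assume "\<not> disjnt A B"
        then have "A \<inter> B \<noteq> {}" by (simp add: disjnt_def)
        then have "A = B"
          by (rule sheets_eq[OF N(1)[OF AB(1)] N(1)[OF AB(2)] holN[OF AB(1)] holN[OF AB(2)]
                N(2)[OF AB(1)] N(2)[OF AB(2)] N(3)[OF AB(1)] N(3)[OF AB(2)] connected_ball])
        then show False using AB by simp
      qed
    qed
    fix u assume u: "u \<in> \<N>"
    obtain h where h: "h holomorphic_on F ` u" "\<And>z. z \<in> u \<Longrightarrow> h (F z) = z"
      using holomorphic_has_inverse[OF holN[OF u] N(1)[OF u] N(2)[OF u]] by metis
    have "homeomorphism u (ball v e) F h"
      unfolding N(3)[OF u, symmetric] homeomorphism_def
      using h holomorphic_on_imp_continuous_on[OF h(1)] holomorphic_on_imp_continuous_on[OF holN[OF u]]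
      by (auto simp: image_image)
    then show "\<exists>q. homeomorphism u (ball v e) F q" by blast
  qed
qed

end

subsection \<open>Antiholomorphic dynamics\<close>

text \<open>Schottky's theorem bounds \<phi> on the disc of radius 1/2 in terms of \<phi>(0) alone,
  and the Schwarz lemma converts this into a bound proportional to |z|. The constant is kept
  explicit because it must serve for infinitely many functions with the same value at 0. The 14 is 2
  + 12 t / (1 - t) at t = 1/2.\<close>

lemma schottky_displacement:
  fixes \<phi> :: "complex \<Rightarrow> complex"
  assumes hol: "\<phi> holomorphic_on cball 0 1" and avoid: "\<And>z. z \<in> cball 0 1 \<Longrightarrow> \<phi> z \<noteq> 0 \<and> \<phi> z \<noteq> 1"
    and z: "norm z < 1/2"
  shows "norm (\<phi> z - \<phi> 0) \<le> 2 * (2 * exp (pi * exp (pi * (14 + 2 * norm (\<phi> 0)))) + 1) * norm z"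
proof -
  define b where "b = exp (pi * exp (pi * (14 + 2 * norm (\<phi> 0))))"
  have b: "b > 0" by (simp add: b_def)
  have bound: "norm (\<phi> z) \<le> b" if "norm z \<le> 1/2" for z
    using Schottky[OF hol order_refl, of "1/2" z] avoid that by (auto simp: b_def)
  \<comment> \<open>The argument z / 2 rescales the disc of radius 1/2 to the unit disc; dividing by
    2 b + 1 instead of 2 b gives the strict inequality required by the Schwarz lemma.\<close>
  define f where "f = (\<lambda>z. (\<phi> (z / 2) - \<phi> 0) / (2 * b + 1))"
  have "(\<phi> \<circ> (\<lambda>z. z / 2)) holomorphic_on ball 0 1"
    by (rule holomorphic_on_compose_gen[OF _ hol]) (auto intro!: holomorphic_intros simp: norm_divide)
  then have "(\<lambda>z. \<phi> (z / 2)) holomorphic_on ball 0 1" by (simp add: o_def)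
  then have fh: "f holomorphic_on ball 0 1" unfolding f_def using b
    by (intro holomorphic_intros) (auto simp: complex_eq_iff)
  have "2 * complex_of_real b + 1 = of_real (2 * b + 1)" by simp
  then have nb: "norm (2 * complex_of_real b + 1) = 2 * b + 1" using b by (simp only: norm_of_real)
  have fb: "norm (f z) < 1" if "norm z < 1" for z
  proof -
    have "norm (\<phi> (z / 2) - \<phi> 0) \<le> b + b"
      using that by (intro order.trans[OF norm_triangle_ineq4] add_mono bound) (auto simp: norm_divide)
    then show ?thesis unfolding f_def norm_divide using b by (simp add: nb)
  qed
  have f0: "f 0 = 0" by (simp add: f_def)
  have "norm (2 * z) < 1" using z by (simp add: norm_mult)
  from Schwarz_Lemma(1)[OF fh f0 fb this] have "norm (f (2 * z)) \<le> norm (2 * z)" .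
  then have "norm (\<phi> z - \<phi> 0) / (2 * b + 1) \<le> 2 * norm z"
    by (simp add: f_def norm_divide norm_mult nb)
  then show ?thesis unfolding b_def[symmetric] using b by (simp add: field_simps)
qed

section \<open>Inverse branches of the iterates\<close>

context torus_map
begin

definition g :: "complex \<Rightarrow> complex" where "g z = cnj (F z)"

lemma g_add_lattice: "l \<in> \<Lambda> \<Longrightarrow> g (z + l) = g z + l"
  by (simp add: g_def quasi)

lemma F_cnj_g: "F z = cnj (g z)"
  by (simp add: g_def)

text \<open>The orbits start at the critical values, which are what a lift through F has to
  avoid.\<close>

definition postcritical :: "complex set" where
  "postcritical = {(g ^^ Suc k) c |k c. c \<in> crit}"

lemma postcritical_g: "x \<in> postcritical \<Longrightarrow> g x \<in> postcritical"
proof -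
  assume "x \<in> postcritical"
  then obtain k c where "c \<in> crit" "x = (g ^^ Suc k) c" by (auto simp: postcritical_def)
  then have "g x = (g ^^ Suc (Suc k)) c" by simp
  then show ?thesis using \<open>c \<in> crit\<close> unfolding postcritical_def by blast
qed

lemma postcritical_funpow: "x \<in> postcritical \<Longrightarrow> (g ^^ k) x \<in> postcritical"
  by (induction k) (auto intro: postcritical_g)

lemma critical_value_postcritical: "F x \<in> F ` crit \<Longrightarrow> g x \<in> postcritical"
proof -
  assume "F x \<in> F ` crit"
  then obtain c where "c \<in> crit" "g x = (g ^^ Suc 0) c" by (auto simp: g_def)
  then show ?thesis unfolding postcritical_def by blast
qed

lemma regular_domainI: "z \<notin> \<Lambda> \<Longrightarrow> g z \<notin> postcritical \<Longrightarrow> z \<in> regular_domain"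
  using critical_value_postcritical by (auto simp: regular_domain_def)

text \<open>The covering is by the holomorphic F, so the map actually lifted is the conjugate of u;
  convexity of V supplies simple connectedness.\<close>

lemma lift_exists:
  fixes V :: "complex set"
  assumes V: "convex V" "open V" and u: "continuous_on V u" "\<And>x. x \<in> V \<Longrightarrow> u x \<notin> postcritical"
    and q: "q \<in> V" "a \<notin> \<Lambda>" "g a = u q"
  shows "\<exists>h. continuous_on V h \<and> h ` V \<subseteq> regular_domain \<and> h q = a \<and> (\<forall>y\<in>V. g (h y) = u y)"
proof -
  have u': "cnj (u x) \<notin> F ` crit" if "x \<in> V" for x
  proof
    assume "cnj (u x) \<in> F ` crit"
    then obtain c where c: "c \<in> crit" "cnj (u x) = F c" by auto
    then have "u x = g c" by (metis complex_cnj_cnj g_def)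
    then have "u x \<in> postcritical" using critical_value_postcritical[of c] c by auto
    then show False using u(2)[OF that] by simp
  qed
  have Fa: "F a = cnj (u q)" using q(3) by (simp add: F_cnj_g)
  have "a \<in> regular_domain" using u'[OF q(1)] q(2) by (simp add: regular_domain_def Fa)
  moreover have "(\<lambda>x. cnj (u x)) \<in> V \<rightarrow> - F ` crit" using u' by auto
  ultimately obtain h where h: "continuous_on V h" "h \<in> V \<rightarrow> regular_domain" "h q = a"
      "\<And>y. y \<in> V \<Longrightarrow> F (h y) = cnj (u y)"
    using covering_space_lift_strong[OF covering _ q(1) convex_imp_simply_connected[OF V(1)]
        open_imp_locally_path_connected[OF V(2)], of a "\<lambda>x. cnj (u x)"] Fa continuous_on_cnj[OF u(1)]
    by (metis (no_types, lifting))
  then show ?thesis by (intro exI[of _ h]) (auto simp: g_def)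
qed

lemma lift_unique:
  assumes V: "connected V" and h: "continuous_on V h" "h ` V \<subseteq> regular_domain"
    and h': "continuous_on V h'" "h' ` V \<subseteq> regular_domain"
    and eq: "\<And>x. x \<in> V \<Longrightarrow> g (h x) = g (h' x)" and a: "a \<in> V" "h a = h' a" and x: "x \<in> V"
  shows "h x = h' x"
proof (rule covering_space_lift_unique[where ?g1.0 = h and ?g2.0 = h' and a = a and T = V and f = "\<lambda>x. F (h x)", OF covering])
  have sub: "regular_domain \<subseteq> - \<Lambda>" by (auto simp: regular_domain_def)
  show "continuous_on V (\<lambda>x. F (h x))"
    by (rule continuous_on_compose2[OF holomorphic_on_imp_continuous_on[OF hol] h(1)]) (use h sub in auto)
  show "(\<lambda>x. F (h x)) \<in> V \<rightarrow> - F ` crit" using h by (auto simp: regular_domain_def)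
  show "F (h x) = F (h' x)" if "x \<in> V" for x using eq[OF that] by (simp add: g_def)
qed (use assms in auto)

lemma open_noncritical: "open {z. z \<notin> \<Lambda> \<and> deriv F z \<noteq> 0}"
proof -
  have "open (- \<Lambda> \<inter> deriv F -` (- {0}))"
    by (intro continuous_open_preimage holomorphic_on_imp_continuous_on deriv_F_holo open_compl_lattice) auto
  moreover have "- \<Lambda> \<inter> deriv F -` (- {0}) = {z. z \<notin> \<Lambda> \<and> deriv F z \<noteq> 0}" by auto
  ultimately show ?thesis by simp
qed

lemma regular_domain_noncritical: "regular_domain \<subseteq> {z. z \<notin> \<Lambda> \<and> deriv F z \<noteq> 0}"
  by (auto simp: regular_domain_def crit_def)

text \<open>One lift through the antiholomorphic g turns a holomorphic map into an antiholomorphic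
  one, whose conjugate is a holomorphic lift for \<open>cnj \<circ> F \<circ> cnj\<close>; the
  second lift restores holomorphy.\<close>

lemma lift_two_holomorphic:
  assumes V: "open V" and \<psi>: "\<psi> holomorphic_on V"
    and \<eta>: "continuous_on V \<eta>" "\<eta> ` V \<subseteq> regular_domain" "\<And>x. x \<in> V \<Longrightarrow> g (\<eta> x) = \<psi> x"
    and \<psi>': "continuous_on V \<psi>'" "\<psi>' ` V \<subseteq> regular_domain" "\<And>x. x \<in> V \<Longrightarrow> g (\<psi>' x) = \<eta> x"
  shows "\<psi>' holomorphic_on V"
proof -
  let ?S = "{z. z \<notin> \<Lambda> \<and> deriv F z \<noteq> 0}"
  let ?F = "cnj \<circ> F \<circ> cnj"
  have holS: "F holomorphic_on ?S" using hol by (rule holomorphic_on_subset) auto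
  have oS: "open (cnj -` ?S)" by (rule open_vimage[OF open_noncritical]) (intro continuous_intros)
  have img: "cnj ` (cnj -` ?S) = ?S" by (force simp: image_iff intro: exI[of _ "cnj _"])
  have "(\<lambda>x. cnj (\<eta> x)) holomorphic_on V"
  proof (rule holomorphic_lift[of ?F "cnj -` ?S" V _ \<psi>])
    show "?F holomorphic_on (cnj -` ?S)"
      by (rule holomorphic_on_compose_cnj_cnj) (use holS img oS in auto)
    show "deriv ?F z \<noteq> 0" if "z \<in> cnj -` ?S" for z
    proof -
      have "(?F has_field_derivative cnj (deriv F (cnj z))) (at z)"
        using that by (intro has_field_derivative_cnj_cnj DERIV_F) auto
      then show ?thesis using that DERIV_imp_deriv by fastforce
    qed
    show "continuous_on V (\<lambda>x. cnj (\<eta> x))" using \<eta>(1) by (rule continuous_on_cnj)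
    show "(\<lambda>x. cnj (\<eta> x)) ` V \<subseteq> cnj -` ?S" using \<eta>(2) regular_domain_noncritical by force
    show "?F (cnj (\<eta> x)) = \<psi> x" if "x \<in> V" for x using \<eta>(3)[OF that] by (simp add: g_def)
  qed (use V oS \<psi> in auto)
  then show ?thesis
  proof (rule holomorphic_lift[OF holS open_noncritical _ V \<psi>'(1), rotated 2])
    show "\<psi>' ` V \<subseteq> ?S" using \<psi>'(2) regular_domain_noncritical by blast
    show "F (\<psi>' x) = cnj (\<eta> x)" if "x \<in> V" for x using \<psi>'(3)[OF that] by (simp add: F_cnj_g)
  qed auto
qed

text \<open>
  Suppose that the second iterate of \<^term>\<open>g\<close> is semiconjugate on a convex region to a self-map
  whose orbit moves by steps that are small compared with the distance to the boundary. If the region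
  met no critical orbit, the inverse iterates on the discs around the orbit would omit the lattice and
  still carry points at vanishing relative distance to two fixed distinct points, which contradicts
  Schottky's theorem.
\<close>

lemma postcritical_meets:
  assumes V: "convex V" "open V" and \<sigma>: "\<sigma> holomorphic_on V"
    and T: "continuous_on V T" "T ` V \<subseteq> V"
    and conj: "\<And>w. w \<in> V \<Longrightarrow> g (g (\<sigma> w)) = \<sigma> (T w)"
    and dom: "\<And>w. w \<in> V \<Longrightarrow> \<sigma> w \<notin> \<Lambda>" "\<And>w. w \<in> V \<Longrightarrow> g (\<sigma> w) \<notin> \<Lambda>"
    and w0: "w0 \<in> V" "\<sigma> (T w0) \<noteq> \<sigma> w0"
    and r: "\<And>n. r n > 0" "\<And>n. ball ((T ^^ n) w0) (r n) \<subseteq> V"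
    and step: "(\<lambda>n. dist ((T ^^ Suc n) w0) ((T ^^ n) w0) / r n) \<longlonglongrightarrow> 0"
  shows "\<exists>w\<in>V. \<sigma> w \<in> postcritical"
proof (rule ccontr)
  assume "\<not> (\<exists>w\<in>V. \<sigma> w \<in> postcritical)"
  then have nc: "\<sigma> w \<notin> postcritical" if "w \<in> V" for w using that by blast
  have sub: "regular_domain \<subseteq> - \<Lambda>" by (auto simp: regular_domain_def)
  have conn: "connected V" using V(1) by (rule convex_connected)
  have Tn: "(T ^^ n) x \<in> V" if "x \<in> V" for n x using that T(2) by (induction n) auto
  have cTn: "continuous_on V (T ^^ n)" for n
  proof (induction n)
    case (Suc n)
    have "(T ^^ n) ` V \<subseteq> V" using Tn by blast
    then have "continuous_on V (T \<circ> (T ^^ n))"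
      by (intro continuous_on_compose[OF Suc] continuous_on_subset[OF T(1)])
    then show ?case by simp
  qed (auto intro: continuous_on_id)
  have c\<sigma>: "continuous_on V \<sigma>" using \<sigma> by (rule holomorphic_on_imp_continuous_on)
  have cg\<sigma>: "continuous_on V (\<lambda>x. g (\<sigma> x))" unfolding g_def
    by (intro continuous_on_cnj continuous_on_compose2[OF holomorphic_on_imp_continuous_on[OF hol] c\<sigma>]) (use dom in auto)
  have rd\<sigma>: "(\<lambda>x. g (\<sigma> x)) ` V \<subseteq> regular_domain" "\<sigma> ` V \<subseteq> regular_domain"
  proof -
    have *: "g (g (\<sigma> w)) \<notin> postcritical" if "w \<in> V" for w using conj[OF that] nc[of "T w"] T(2) that by auto
    show "(\<lambda>x. g (\<sigma> x)) ` V \<subseteq> regular_domain"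
      by (intro image_subsetI regular_domainI dom *)
    have "g (\<sigma> w) \<notin> postcritical" if "w \<in> V" for w
      using *[OF that] postcritical_g[of "g (\<sigma> w)"] by blast
    then show "\<sigma> ` V \<subseteq> regular_domain"
      by (intro image_subsetI regular_domainI dom)
  qed
  \<comment> \<open>\<psi> is a branch of the inverse of the 2n-th iterate of g, applied to
    \<sigma>, normalised so that it leads the point over T^n(x) back to the point over x.\<close>
  have main: "\<exists>\<psi>. \<psi> holomorphic_on V \<and> \<psi> ` V \<subseteq> - \<Lambda> \<and> (\<forall>x\<in>V. \<psi> ((T ^^ n) x) = \<sigma> x)
      \<and> (\<forall>x\<in>V. (g ^^ (2 * n)) (\<psi> x) = \<sigma> x)" for n
  proof (induction n)
    case 0
    show ?case by (rule exI[of _ \<sigma>]) (use \<sigma> dom in auto)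
  next
    case (Suc n)
    then obtain \<psi> where \<psi>: "\<psi> holomorphic_on V" "\<And>x. x \<in> V \<Longrightarrow> \<psi> ((T ^^ n) x) = \<sigma> x"
      "\<And>x. x \<in> V \<Longrightarrow> (g ^^ (2 * n)) (\<psi> x) = \<sigma> x" by blast
    have nc\<psi>: "\<psi> x \<notin> postcritical" if "x \<in> V" for x
      using postcritical_funpow[of "\<psi> x" "2 * n"] nc[OF that] \<psi>(3)[OF that] by auto
    let ?q = "(T ^^ Suc n) w0"
    have shift: "\<psi> ((T ^^ Suc n) x) = \<sigma> (T x)" if "x \<in> V" for x
      using \<psi>(2)[of "T x"] T(2) that by (auto simp: funpow_swap1)
    have "g (g (\<sigma> w0)) = \<psi> ?q" using shift[OF w0(1)] conj[OF w0(1)] by simp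
    note lift = lift_exists[OF V holomorphic_on_imp_continuous_on[OF \<psi>(1)] nc\<psi> Tn[OF w0(1)] dom(2)[OF w0(1)] this]
    obtain \<eta> where \<eta>: "continuous_on V \<eta>" "\<eta> ` V \<subseteq> regular_domain" "\<eta> ?q = g (\<sigma> w0)"
      "\<And>y. y \<in> V \<Longrightarrow> g (\<eta> y) = \<psi> y" using lift by blast
    have nc\<eta>: "\<eta> x \<notin> postcritical" if "x \<in> V" for x
      using nc\<psi>[OF that] \<eta>(4)[OF that] postcritical_g by metis
    have cc: "continuous_on V (\<lambda>x. h ((T ^^ Suc n) x))" "(\<lambda>x. h ((T ^^ Suc n) x)) ` V \<subseteq> D"
      if "continuous_on V h" "h ` V \<subseteq> D" for h D
    proof -
      show "continuous_on V (\<lambda>x. h ((T ^^ Suc n) x))"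
        by (rule continuous_on_compose2[OF that(1) cTn]) (rule image_subsetI, rule Tn)
      show "(\<lambda>x. h ((T ^^ Suc n) x)) ` V \<subseteq> D" using that(2) Tn[of _ "Suc n"] by blast
    qed
    \<comment> \<open>The lift was normalised at the single orbit point of \<open>w0\<close>;
      uniqueness of lifts spreads the identity over all of V.\<close>
    have \<eta>5: "\<eta> ((T ^^ Suc n) x) = g (\<sigma> x)" if "x \<in> V" for x
    proof (rule lift_unique[OF conn cc[OF \<eta>(1,2)] cg\<sigma> rd\<sigma>(1) _ w0(1) \<eta>(3) that])
      show "g (\<eta> ((T ^^ Suc n) x)) = g (g (\<sigma> x))" if "x \<in> V" for x
        unfolding \<eta>(4)[OF Tn[OF that]] shift[OF that] conj[OF that] ..
    qed
    note lift' = lift_exists[OF V \<eta>(1) nc\<eta> Tn[OF w0(1)] dom(1)[OF w0(1)] \<eta>(3)[symmetric]]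
    obtain \<psi>' where \<psi>': "continuous_on V \<psi>'" "\<psi>' ` V \<subseteq> regular_domain" "\<psi>' ?q = \<sigma> w0"
      "\<And>y. y \<in> V \<Longrightarrow> g (\<psi>' y) = \<eta> y" using lift' by blast
    have \<psi>'5: "\<psi>' ((T ^^ Suc n) x) = \<sigma> x" if "x \<in> V" for x
    proof (rule lift_unique[OF conn cc[OF \<psi>'(1,2)] c\<sigma> rd\<sigma>(2) _ w0(1) \<psi>'(3) that])
      show "g (\<psi>' ((T ^^ Suc n) x)) = g (\<sigma> x)" if "x \<in> V" for x
        unfolding \<psi>'(4)[OF Tn[OF that]] \<eta>5[OF that] ..
    qed
    have "\<psi>' holomorphic_on V" by (rule lift_two_holomorphic[OF V(2) \<psi>(1) \<eta>(1,2,4) \<psi>'(1,2,4)])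
    moreover have "\<psi>' ` V \<subseteq> - \<Lambda>" using \<psi>'(2) sub by blast
    moreover have "(g ^^ (2 * Suc n)) (\<psi>' x) = \<sigma> x" if "x \<in> V" for x
    proof -
      have "(g ^^ (2 * Suc n)) (\<psi>' x) = (g ^^ (2 * n)) (g (g (\<psi>' x)))"
        by (simp add: funpow_swap1)
      then show ?thesis using \<psi>'(4)[OF that] \<eta>(4)[OF that] \<psi>(3)[OF that] by simp
    qed
    ultimately show ?case using \<psi>'5 by blast
  qed
  \<comment> \<open>The Schottky constant for the value \<sigma>(w0) / \<omega>1, which is the value
    at the centre for every n.\<close>
  define C where "C = 2 * (2 * exp (pi * exp (pi * (14 + 2 * norm (\<sigma> w0 / \<omega>1)))) + 1)"
  define \<tau> where "\<tau> n = dist ((T ^^ Suc n) w0) ((T ^^ n) w0) / r n" for n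
  \<comment> \<open>The n-th inverse branch sends T^n(w0) and T^(n+1)(w0) to the points \<sigma>(w0)
    and \<sigma>(T(w0)), which do not depend on n. Rescaling the disc of radius
    \<open>r n / 2\<close> to the unit disc puts the two arguments at distance 2 \<tau>(n), whence
    the threshold 1/4.\<close>
  have key: "norm (\<sigma> (T w0) / \<omega>1 - \<sigma> w0 / \<omega>1) \<le> C * (2 * \<tau> n)" if small: "\<tau> n < 1/4" for n
  proof -
    obtain \<psi> where \<psi>: "\<psi> holomorphic_on V" "\<psi> ` V \<subseteq> - \<Lambda>" "\<And>x. x \<in> V \<Longrightarrow> \<psi> ((T ^^ n) x) = \<sigma> x"
      using main[of n] by blast
    let ?q = "(T ^^ n) w0"
    define A where "A z = ?q + of_real (r n / 2) * z" for z
    have A: "A z \<in> V" if "z \<in> cball 0 1" for z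
    proof -
      have "dist ?q (A z) \<le> r n / 2 * 1" using that r(1)[of n]
        by (auto simp: A_def dist_norm norm_mult intro!: mult_left_mono)
      then have "A z \<in> ball ?q (r n)" using r(1)[of n] by auto
      then show ?thesis using r(2) by blast
    qed
    \<comment> \<open>Division by \<omega>1 turns the omitted lattice points 0 and \<omega>1 into
      the values 0 and 1 of Schottky's theorem.\<close>
    define \<phi> where "\<phi> = (\<lambda>z. \<psi> (A z) / \<omega>1)"
    have "(\<psi> \<circ> A) holomorphic_on cball 0 1"
      by (rule holomorphic_on_compose_gen[OF _ \<psi>(1)]) (use A in \<open>auto simp: A_def[abs_def] intro!: holomorphic_intros\<close>)
    then have h\<phi>: "\<phi> holomorphic_on cball 0 1"
      unfolding \<phi>_def using period_nonzero by (intro holomorphic_intros) (auto simp: o_def)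
    have av: "\<phi> z \<noteq> 0 \<and> \<phi> z \<noteq> 1" if "z \<in> cball 0 1" for z
    proof -
      have "\<psi> (A z) \<notin> \<Lambda>" using A[OF that] \<psi>(2) by auto
      then have "\<psi> (A z) \<noteq> 0" "\<psi> (A z) \<noteq> \<omega>1" using periods_in_lattice lattice_0 by metis+
      then show ?thesis using period_nonzero by (simp add: \<phi>_def)
    qed
    have \<phi>0: "\<phi> 0 = \<sigma> w0 / \<omega>1" using \<psi>(3)[OF w0(1)] by (simp add: \<phi>_def A_def)
    define z where "z = ((T ^^ Suc n) w0 - ?q) / of_real (r n / 2)"
    have nz: "norm z = 2 * \<tau> n" using r(1)[of n] unfolding z_def \<tau>_def norm_divide norm_of_real dist_norm by simp
    have r0: "complex_of_real (r n / 2) \<noteq> 0" using r(1)[of n] by simp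
    have "A z = (T ^^ Suc n) w0"
      unfolding A_def z_def times_divide_eq_right nonzero_mult_div_cancel_left[OF r0] by simp
    then have \<phi>z: "\<phi> z = \<sigma> (T w0) / \<omega>1" using \<psi>(3)[of "T w0"] T(2) w0(1)
      by (auto simp: \<phi>_def funpow_swap1)
    have "norm (\<phi> z - \<phi> 0) \<le> C * norm z"
      unfolding C_def \<phi>0[symmetric] using nz small by (intro schottky_displacement h\<phi> av) auto
    then show ?thesis by (simp add: \<phi>0 \<phi>z nz)
  qed
  have tau: "\<tau> \<longlonglongrightarrow> 0" using step by (simp add: \<tau>_def[abs_def])
  then have ev: "eventually (\<lambda>n. \<tau> n < 1/4) sequentially" by (rule order_tendstoD) simp
  have "(\<lambda>n. C * (2 * \<tau> n)) \<longlonglongrightarrow> C * (2 * 0)" by (intro tendsto_intros tau)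
  then have "norm (\<sigma> (T w0) / \<omega>1 - \<sigma> w0 / \<omega>1) \<le> C * (2 * 0)"
    by (rule tendsto_lowerbound) (use ev key in \<open>auto elim: eventually_mono\<close>)
  then show False using w0(2) period_nonzero by simp
qed

end

text \<open>Exhaustion by the closed sets of points at distance at least 1/(n + 1) from S. It serves
  the countability of the zeros of F - \<open>cnj l\<close> on the complement of the
  lattice.\<close>

lemma fsigma_compl_closed:
  fixes S :: "'a::metric_space set"
  assumes "closed S" shows "fsigma (- S)"
proof (cases "S = {}")
  case True
  have "fsigma (\<Union>((\<lambda>n::nat. UNIV :: 'a set) ` UNIV))" by (rule fsigma.intros) auto
  then show ?thesis using True by simp
next
  case False
  have "- S = (\<Union>n::nat. {z. 1 / real (Suc n) \<le> infdist z S})"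
  proof (intro subset_antisym subsetI)
    fix z assume "z \<in> - S"
    then have "infdist z S > 0" using in_closed_iff_infdist_zero[OF assms False, of z] infdist_nonneg[of z S] by force
    then obtain n where "1 / real (Suc n) < infdist z S" using nat_approx_posE by metis
    then show "z \<in> (\<Union>n::nat. {z. 1 / real (Suc n) \<le> infdist z S})" by (auto intro: less_imp_le)
  next
    fix z assume "z \<in> (\<Union>n::nat. {z. 1 / real (Suc n) \<le> infdist z S})"
    then obtain n where "1 / real (Suc n) \<le> infdist z S" by blast
    then have "infdist z S > 0" by (smt (verit) divide_pos_pos of_nat_0_less_iff zero_less_Suc)
    then show "z \<in> - S" by auto
  qed
  moreover have "closed {z. 1 / real (Suc n) \<le> infdist z S}" for n
    by (intro closed_Collect_le continuous_intros)
  then have "fsigma (\<Union>n::nat. {z. 1 / real (Suc n) \<le> infdist z S})" by (rule fsigma.intros)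
  ultimately show ?thesis by simp
qed

lemma LIMSEQ_even_odd:
  assumes "(\<lambda>n. f (2 * n)) \<longlonglongrightarrow> (L::'a::metric_space)" "(\<lambda>n. f (Suc (2 * n))) \<longlonglongrightarrow> L"
  shows "f \<longlonglongrightarrow> L"
proof (rule metric_LIMSEQ_I)
  fix e :: real assume "e > 0"
  then obtain N M where N: "\<And>n. n \<ge> N \<Longrightarrow> dist (f (2 * n)) L < e" and M: "\<And>n. n \<ge> M \<Longrightarrow> dist (f (Suc (2 * n))) L < e"
    using metric_LIMSEQ_D[OF assms(1)] metric_LIMSEQ_D[OF assms(2)] by meson
  have "dist (f n) L < e" if "n \<ge> 2 * (N + M) + 1" for n
  proof (cases "even n")
    case True
    then obtain k where "n = 2 * k" by (elim evenE)
    then show ?thesis using N[of k] that by auto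
  next
    case False
    then obtain k where "n = 2 * k + 1" by (elim oddE)
    then show ?thesis using M[of k] that by auto
  qed
  then show "\<exists>no. \<forall>n\<ge>no. dist (f n) L < e" by blast
qed

section \<open>The second iterate at its nonrepelling fixed points\<close>

context torus_map
begin

lemma connected_compl_lattice: "connected (- \<Lambda>)"
  by (rule connected_compl_countable[OF countable_lattice])

lemma F_nonconst: "\<not> (\<lambda>z. F z - a) constant_on (- \<Lambda>)"
proof
  assume "(\<lambda>z. F z - a) constant_on (- \<Lambda>)"
  then obtain b where b: "\<And>z. z \<notin> \<Lambda> \<Longrightarrow> F z - a = b" by (auto simp: constant_on_def)
  have "deriv F z = 0" if z: "z \<in> - \<Lambda>" for z
  proof -
    have "((\<lambda>z. a + b) has_field_derivative 0) (at z)" by simp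
    then have "(F has_field_derivative 0) (at z)"
      by (rule has_field_derivative_transform_within_open[OF _ open_compl_lattice z])
        (use b in \<open>auto simp: algebra_simps\<close>)
    then show ?thesis by (rule DERIV_imp_deriv)
  qed
  then show False using deriv_F_nonconst by (auto simp: constant_on_def)
qed

definition gg_domain :: "complex set" where "gg_domain = {z. z \<notin> \<Lambda> \<and> g z \<notin> \<Lambda>}"

lemma continuous_on_g: "continuous_on (- \<Lambda>) g"
  unfolding g_def[abs_def] by (intro continuous_on_cnj holomorphic_on_imp_continuous_on hol)

lemma open_gg_domain: "open gg_domain"
proof -
  have "open (- \<Lambda> \<inter> g -` (- \<Lambda>))"
    by (intro continuous_open_preimage continuous_on_g open_compl_lattice)
  moreover have "- \<Lambda> \<inter> g -` (- \<Lambda>) = gg_domain" by (auto simp: gg_domain_def)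
  ultimately show ?thesis by simp
qed

text \<open>As F is nonconstant, each lattice point has only countably many preimages, and the
  complement of a countable set is connected.\<close>

lemma connected_gg_domain: "connected gg_domain"
proof -
  have "countable {z \<in> - \<Lambda>. F z - cnj l = 0}" for l
    by (intro holomorphic_countable_zeros F_nonconst open_compl_lattice connected_compl_lattice
        fsigma_compl_closed closed_lattice) (intro holomorphic_intros hol)
  then have 1: "countable (\<Lambda> \<union> (\<Union>l\<in>\<Lambda>. {z \<in> - \<Lambda>. F z - cnj l = 0}))" using countable_lattice by auto
  have eq: "gg_domain = - (\<Lambda> \<union> (\<Union>l\<in>\<Lambda>. {z \<in> - \<Lambda>. F z - cnj l = 0}))"
  proof (intro set_eqI iffI)
    fix x assume "x \<in> - (\<Lambda> \<union> (\<Union>l\<in>\<Lambda>. {z \<in> - \<Lambda>. F z - cnj l = 0}))"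
    then have x: "x \<notin> \<Lambda>" "\<And>l. l \<in> \<Lambda> \<Longrightarrow> F x \<noteq> cnj l" by auto
    have "g x \<notin> \<Lambda>" using x(2)[of "g x"] by (auto simp: F_cnj_g)
    then show "x \<in> gg_domain" using x by (simp add: gg_domain_def)
  qed (auto simp: gg_domain_def g_def)
  show ?thesis unfolding eq by (rule connected_compl_countable[OF 1])
qed

lemma DERIV_gg:
  assumes "z \<in> gg_domain"
  shows "((\<lambda>z. g (g z)) has_field_derivative cnj (deriv F (g z)) * deriv F z) (at z)"
proof -
  have z: "z \<notin> \<Lambda>" "g z \<notin> \<Lambda>" using assms by (auto simp: gg_domain_def)
  have "((cnj \<circ> F \<circ> cnj) has_field_derivative cnj (deriv F (g z))) (at (F z))"
    using DERIV_F[OF z(2)] by (intro has_field_derivative_cnj_cnj) (simp add: g_def)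
  from DERIV_chain2[OF this DERIV_F[OF z(1)]] show ?thesis by (simp add: g_def[abs_def])
qed

lemma gg_holo: "(\<lambda>z. g (g z)) holomorphic_on gg_domain"
  using DERIV_gg open_gg_domain by (auto simp: holomorphic_on_open)

lemma isCont_g: "z \<notin> \<Lambda> \<Longrightarrow> isCont g z"
  using continuous_on_g open_compl_lattice continuous_on_eq_continuous_at by blast

text \<open>If g were its own inverse near one point, it would be so on the whole connected domain.
  But g takes near 0 every large value y + l, and applying g again would give g(y) + l, which is far
  from 0.\<close>

lemma gg_not_id:
  assumes "r > 0" "ball z0 r \<subseteq> gg_domain"
  shows "\<exists>z\<in>ball z0 r. g (g z) \<noteq> z"
proof (rule ccontr)
  assume "\<not> (\<exists>z\<in>ball z0 r. g (g z) \<noteq> z)"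
  then have id: "g (g z) = z" if "z \<in> ball z0 r" for z using that by blast
  have id': "g (g z) = z" if "z \<in> gg_domain" for z
    by (rule analytic_continuation_open[OF open_ball open_gg_domain _ connected_gg_domain assms(2) gg_holo holomorphic_on_ident _ that])
      (use id assms in auto)
  obtain \<delta> R where \<delta>: "0 < \<delta>" "\<delta> < sep / 2"
    "\<And>w. norm w > R \<Longrightarrow> \<exists>z\<in>ball 0 \<delta> - {0}. F z = w"
    using near_pole_univalent by metis
  \<comment> \<open>Half a period is off the lattice, and so are all its translates, so that the
    orbit of the point z found below can be followed for two steps.\<close>
  define y where "y = \<omega>1 / 2"
  have "coord1 y = 1 / 2"
    using coord1_comb[of "1/2" 0] by (simp add: y_def)
  then have y: "y \<notin> \<Lambda>"
  proof -
    have "(1/2::real) \<notin> \<int>" by (auto elim!: Ints_cases)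
    then show ?thesis using \<open>coord1 y = 1 / 2\<close> lattice_iff[of y] by metis
  qed
  obtain n :: nat where n: "real n > (\<bar>R\<bar> + norm y + \<delta> + norm (g y)) / norm \<omega>1" using reals_Archimedean2 by blast
  define l where "l = of_nat n * \<omega>1"
  have nl: "norm l > \<bar>R\<bar> + norm y + \<delta> + norm (g y)"
    using n period_nonzero by (simp add: l_def norm_mult field_simps)
  have l: "l \<in> \<Lambda>"
  proof -
    have "l = of_int (int n) * \<omega>1 + of_int 0 * \<omega>2" by (simp add: l_def)
    then show ?thesis unfolding lattice_def by blast
  qed
  have "norm (cnj (y + l)) > R" using nl \<delta>(1) norm_diff_ineq[of l y]
    by (simp only: complex_mod_cnj add.commute) (smt (verit) norm_ge_zero)
  then obtain z where z: "z \<in> ball 0 \<delta> - {0}" "F z = cnj (y + l)" using \<delta>(3) by blast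
  have gz: "g z = y + l" using z by (simp add: g_def)
  have "z \<notin> \<Lambda>" using z \<delta> by (intro ball_sep_lattice) auto
  then have "z \<in> gg_domain" using gz y lattice_add_cancel[OF l, of y] by (simp add: gg_domain_def)
  then have "g (y + l) = z" using id' gz by metis
  then have "l = z - g y" using g_add_lattice[OF l, of y] by (simp add: algebra_simps)
  then have "norm l \<le> norm z + norm (g y)" by (simp add: norm_triangle_ineq4)
  moreover have "norm z < \<delta>" using z by simp
  ultimately show False using nl norm_ge_zero[of y] abs_ge_zero[of R] by linarith
qed

lemma gg_funpow: "((\<lambda>z. g (g z)) ^^ n) x = (g ^^ (2 * n)) x"
  by (induction n) auto

lemma gg_orbit_tendsto:
  assumes z0: "z0 \<notin> \<Lambda>" "g z0 = z0" and lim: "(\<lambda>n. ((\<lambda>z. g (g z)) ^^ n) x) \<longlonglongrightarrow> z0"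
  shows "(\<lambda>n. (g ^^ n) x) \<longlonglongrightarrow> z0"
proof (rule LIMSEQ_even_odd)
  show 1: "(\<lambda>n. (g ^^ (2 * n)) x) \<longlonglongrightarrow> z0" using lim by (simp add: gg_funpow)
  have "(\<lambda>n. g ((g ^^ (2 * n)) x)) \<longlonglongrightarrow> g z0"
    by (rule isCont_tendsto_compose[OF isCont_g[OF z0(1)] 1])
  then show "(\<lambda>n. (g ^^ (Suc (2 * n))) x) \<longlonglongrightarrow> z0" using z0(2) by simp
qed

lemma postcritical_tendsto:
  assumes "x \<in> postcritical" "(\<lambda>n. (g ^^ n) x) \<longlonglongrightarrow> z0"
  shows "\<exists>c\<in>crit. (\<lambda>n. (g ^^ n) c) \<longlonglongrightarrow> z0"
proof -
  obtain k c where c: "c \<in> crit" "x = (g ^^ Suc k) c" using assms(1) by (auto simp: postcritical_def)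
  have "(\<lambda>n. (g ^^ (n + Suc k)) c) \<longlonglongrightarrow> z0" using assms(2) unfolding c(2) funpow_add o_def .
  then have "(\<lambda>n. (g ^^ n) c) \<longlonglongrightarrow> z0" by (rule LIMSEQ_offset)
  then show ?thesis using c(1) by blast
qed

text \<open>Here the semiconjugacy is the identity on a disc which g o g contracts: the steps of an
  orbit tend to 0 while its distance to the boundary stays at least r / 2. The superattracting case
  is included. Every orbit in the disc converges to the fixed point, in particular that of the
  postcritical point.\<close>

lemma attracting_fixed_point:
  assumes z0: "z0 \<notin> \<Lambda>" "g z0 = z0" and mult: "norm (deriv F z0) < 1"
  shows "\<exists>c\<in>crit. (\<lambda>n. (g ^^ n) c) \<longlonglongrightarrow> z0"
proof -
  let ?f = "\<lambda>z. g (g z)"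
  define D where "D = cnj (deriv F z0) * deriv F z0"
  have z0E: "z0 \<in> gg_domain" using z0 by (simp add: gg_domain_def)
  have D: "(?f has_field_derivative D) (at z0)" using DERIV_gg[OF z0E] z0 by (simp add: D_def)
  have "norm D < 1" unfolding D_def norm_mult using mult mult_left_le[of "norm (deriv F z0)" "norm (deriv F z0)"]
    by simp
  define q where "q = (1 + norm D) / 2"
  have q: "q < 1" "norm D < q" using \<open>norm D < 1\<close> by (auto simp: q_def)
  then have "0 < q" using norm_ge_zero[of D] by linarith
  note q = q this
  have "((\<lambda>z. norm ((?f z - ?f z0) / (z - z0))) \<longlongrightarrow> norm D) (at z0)"
    using D by (intro tendsto_norm) (simp add: has_field_derivative_iff)
  then have "eventually (\<lambda>z. norm ((?f z - ?f z0) / (z - z0)) < q) (at z0)"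
    using q(2) by (rule order_tendstoD)
  then obtain d where d: "d > 0" "\<And>z. z \<noteq> z0 \<Longrightarrow> dist z z0 < d \<Longrightarrow> norm ((?f z - ?f z0) / (z - z0)) < q"
    by (auto simp: eventually_at)
  obtain e where e: "e > 0" "ball z0 e \<subseteq> gg_domain" using open_gg_domain z0E openE by blast
  define r where "r = min d e"
  have r: "r > 0" "r \<le> d" "r \<le> e" using d e by (auto simp: r_def)
  define V where "V = ball z0 r"
  have VE: "V \<subseteq> gg_domain" using e r by (auto simp: V_def)
  have contr: "dist (?f z) z0 \<le> q * dist z z0" if "z \<in> V" for z
  proof (cases "z = z0")
    case False
    then have "norm ((?f z - ?f z0) / (z - z0)) < q" using that r by (intro d(2)) (auto simp: V_def dist_commute)
    then show ?thesis using False z0(2) by (simp add: norm_divide dist_norm field_simps)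
  qed (use z0 in simp)
  have TV: "?f ` V \<subseteq> V"
  proof (rule image_subsetI)
    fix z assume "z \<in> V"
    then have "dist z z0 < r" by (simp add: V_def dist_commute)
    moreover have "q * dist z z0 \<le> 1 * dist z z0" using q by (intro mult_right_mono) auto
    ultimately show "?f z \<in> V" using contr[OF \<open>z \<in> V\<close>] by (simp add: V_def dist_commute)
  qed
  have orb: "(?f ^^ n) z \<in> V \<and> dist ((?f ^^ n) z) z0 \<le> q ^ n * dist z z0" if "z \<in> V" for n z
  proof (induction n)
    case (Suc n)
    have "dist ((?f ^^ Suc n) z) z0 \<le> q * dist ((?f ^^ n) z) z0" using contr Suc by simp
    also have "\<dots> \<le> q * (q ^ n * dist z z0)" using Suc q by (intro mult_left_mono) auto
    finally show ?case using Suc TV by (auto simp: mult.assoc)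
  qed (use that in auto)
  have lim: "(\<lambda>n. (?f ^^ n) z) \<longlonglongrightarrow> z0" if "z \<in> V" for z
  proof (rule tendsto_dist_iff[THEN iffD2], rule tendsto_sandwich[OF _ _ tendsto_const])
    show "eventually (\<lambda>n. dist ((?f ^^ n) z) z0 \<le> q ^ n * dist z z0) sequentially" using orb[OF that] by simp
    have "(\<lambda>n. q ^ n * dist z z0) \<longlonglongrightarrow> 0 * dist z z0"
      using q by (intro tendsto_mult LIMSEQ_realpow_zero tendsto_const) auto
    then show "(\<lambda>n. q ^ n * dist z z0) \<longlonglongrightarrow> 0" by simp
  qed simp
  \<comment> \<open>The base point must be moved by the iteration, so it is taken off the
    centre.\<close>
  define w0 where "w0 = z0 + of_real (r / 2)"
  have w0: "w0 \<in> V" "dist w0 z0 = r / 2" using r(1) by (auto simp: V_def w0_def dist_norm)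
  have "\<exists>w\<in>V. w \<in> postcritical"
  proof (rule postcritical_meets[of V "\<lambda>z. z" ?f w0 "\<lambda>_. r / 2"])
    show "continuous_on V ?f"
      using holomorphic_on_imp_continuous_on[OF gg_holo] VE by (rule continuous_on_subset)
    show "?f w0 \<noteq> w0"
    proof
      assume "?f w0 = w0"
      then have "r / 2 \<le> q * (r / 2)" using contr[OF w0(1)] w0(2) by simp
      then show False using q r(1) by simp
    qed
    show "ball ((?f ^^ n) w0) (r / 2) \<subseteq> V" for n
    proof
      fix z assume "z \<in> ball ((?f ^^ n) w0) (r / 2)"
      moreover have "dist ((?f ^^ n) w0) z0 \<le> 1 * (r / 2)"
        using orb[OF w0(1), of n] w0(2) q r(1) power_le_one[of q n]
        by (intro order.trans[OF conjunct2[OF orb[OF w0(1)]]]) (auto intro!: mult_right_mono)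
      ultimately show "z \<in> V" using dist_triangle[of z0 z "(?f ^^ n) w0"] by (simp add: V_def dist_commute)
    qed
    have "(\<lambda>n. dist ((?f ^^ Suc n) w0) ((?f ^^ n) w0) / (r / 2)) \<longlonglongrightarrow> dist z0 z0 / (r / 2)"
      using r(1) lim[OF w0(1)] LIMSEQ_Suc[OF lim[OF w0(1)]] by (intro tendsto_intros) auto
    then show "(\<lambda>n. dist ((?f ^^ Suc n) w0) ((?f ^^ n) w0) / (r / 2)) \<longlonglongrightarrow> 0" by simp
  qed (use VE TV w0 r in \<open>auto simp: V_def gg_domain_def\<close>)
  then obtain w where "w \<in> V" "w \<in> postcritical" by blast
  then show ?thesis using postcritical_tendsto gg_orbit_tendsto[OF z0 lim] by blast
qed

text \<open>
  In the coordinate \<open>w\<close> with \<open>(z - z0) ^ m = - 1 / (a w)\<close>, the second iterate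
  \<open>z0 + (z - z0) + a (z - z0) ^ (m + 1) + \<dots>\<close> becomes \<open>w \<mapsto> w + m + o(1)\<close> on a half-plane.
\<close>

lemma parabolic_fixed_point:
  assumes z0: "z0 \<notin> \<Lambda>" "g z0 = z0" and mult: "norm (deriv F z0) = 1"
  shows "\<exists>c\<in>crit. (\<lambda>n. (g ^^ n) c) \<longlonglongrightarrow> z0"
proof -
  let ?f = "\<lambda>z. g (g z)"
  have z0E: "z0 \<in> gg_domain" using z0 by (simp add: gg_domain_def)
  obtain e where e: "e > 0" "ball z0 e \<subseteq> gg_domain" using open_gg_domain z0E openE by blast
  have D: "(?f has_field_derivative 1) (at z0)"
    using DERIV_gg[OF z0E] z0 mult by (simp add: mult.commute[of "cnj _"] flip: complex_norm_square)
  have hol1: "(\<lambda>z. ?f z - z) holomorphic_on ball z0 e"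
    using gg_holo e by (intro holomorphic_intros) (rule holomorphic_on_subset)
  have nonc: "\<not> (\<lambda>z. ?f z - z) constant_on ball z0 e"
  proof
    assume "(\<lambda>z. ?f z - z) constant_on ball z0 e"
    then obtain b where b: "\<And>z. z \<in> ball z0 e \<Longrightarrow> ?f z - z = b" unfolding constant_on_def by blast
    have "b = 0" using b[of z0] e z0 by simp
    then show False using gg_not_id[OF e] b by auto
  qed
  obtain A r N where A: "0 < N" "0 < r" "ball z0 r \<subseteq> ball z0 e" "A holomorphic_on ball z0 r"
      "\<And>w. w \<in> ball z0 r \<Longrightarrow> ?f w - w = (w - z0) ^ N * A w" "\<And>w. w \<in> ball z0 r \<Longrightarrow> A w \<noteq> 0"
    by (rule holomorphic_factor_zero_nonconstant[OF hol1 open_ball connected_ball _ _ nonc, of z0], use e z0 in simp,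
        use z0 in simp, rule that)
  have contA: "isCont A z0"
    using A(2) holomorphic_on_imp_continuous_on[OF A(4)] by (auto simp: continuous_on_eq_continuous_at)
  \<comment> \<open>Multiplier 1 makes the displacement of g o g vanish to order at least two, which
    leaves m = N - 1 positive.\<close>
  have "N \<noteq> 1"
  proof
    assume "N = 1"
    have "((\<lambda>z. (?f z - ?f z0) / (z - z0) - 1) \<longlongrightarrow> 1 - 1) (at z0)"
      using D by (intro tendsto_diff tendsto_const) (simp add: has_field_derivative_iff)
    moreover have "eventually (\<lambda>z. z \<in> ball z0 r - {z0}) (at z0)"
      using A(2) by (intro eventually_at_in_open) auto
    then have "eventually (\<lambda>z. (?f z - ?f z0) / (z - z0) - 1 = A z) (at z0)"
    proof eventually_elim
      case (elim z)
      then have "?f z = z + (z - z0) * A z" using A(5)[of z] \<open>N = 1\<close> by (auto simp: algebra_simps)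
      then show ?case using elim z0(2) by (simp add: field_simps)
    qed
    ultimately have "(A \<longlongrightarrow> 1 - 1) (at z0)" by (rule Lim_transform_eventually)
    then have "A z0 = 1 - 1" using contA unfolding isCont_def using tendsto_unique trivial_limit_at by blast
    then show False using A(2) A(6)[of z0] by simp
  qed
  then obtain m where m: "N = Suc m" "m > 0" using A(1) by (metis One_nat_def Suc_pred gr0I)
  define a where "a = A z0"
  have a: "a \<noteq> 0" using A(2,6) by (simp add: a_def)
  have "m \<noteq> 0" using m by simp
  then obtain \<zeta> where "- 1 / a = \<zeta> ^ m" by (rule exists_complex_root)
  then have \<zeta>: "\<zeta> ^ m = - 1 / a" by (rule sym)
  have \<zeta>0: "\<zeta> \<noteq> 0" using \<zeta> a m by (auto simp: power_0_left)
  \<comment> \<open>A branch of the m-th root of - 1 / (a w), written as an exponential so that it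
    never vanishes; it is holomorphic on the half-plane used below.\<close>
  define s where "s w = \<zeta> * exp (- Ln w / of_nat m)" for w
  have s0: "s w \<noteq> 0" for w using \<zeta>0 by (simp add: s_def)
  have spow: "s w ^ m = - 1 / (a * w)" if "w \<noteq> 0" for w
  proof -
    have "exp (- Ln w / of_nat m) ^ m = exp (- Ln w)"
      unfolding exp_of_nat_mult[symmetric] using m by simp
    then show ?thesis using that by (simp add: s_def power_mult_distrib \<zeta> exp_minus field_simps)
  qed
  have lim_inv: "((\<lambda>w::complex. 1 / w) \<longlongrightarrow> 0) at_infinity"
  proof -
    have "(\<lambda>w::complex. 1 / w) = inverse" by (simp add: fun_eq_iff divide_inverse)
    then show ?thesis using tendsto_inverse_0 by simp
  qed
  have slim: "(s \<longlongrightarrow> 0) at_infinity"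
  proof -
    have "((\<lambda>w. norm (- 1 / a * (1 / w))) \<longlongrightarrow> norm (- 1 / a * 0)) at_infinity"
      by (intro tendsto_intros lim_inv)
    then have "((\<lambda>w. root m (norm (- 1 / a * (1 / w)))) \<longlongrightarrow> root m (norm (- 1 / a * 0))) at_infinity"
      by (rule tendsto_real_root)
    moreover have "eventually (\<lambda>w. root m (norm (- 1 / a * (1 / w))) = norm (s w)) at_infinity"
    proof (rule eventually_at_infinityI[of 1])
      fix w :: complex assume "1 \<le> norm w"
      then have "w \<noteq> 0" by auto
      then have "norm (- 1 / a * (1 / w)) = norm (s w) ^ m" using spow[of w] by (simp flip: norm_power)
      then show "root m (norm (- 1 / a * (1 / w))) = norm (s w)" using m by (simp add: real_root_power_cancel)
    qed
    ultimately have "((\<lambda>w. norm (s w)) \<longlongrightarrow> 0) at_infinity"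
      by (simp add: tendsto_cong)
    then show ?thesis by (rule tendsto_norm_zero_cancel)
  qed
  define \<sigma> where "\<sigma> w = z0 + s w" for w
  have \<sigma>lim: "(\<sigma> \<longlongrightarrow> z0) at_infinity" using tendsto_add[OF tendsto_const slim, of z0] by (simp add: \<sigma>_def[abs_def])
  \<comment> \<open>The relative displacement: the second iterate multiplies s(w) by 1 +
    \<epsilon>(w), and \<epsilon>(w) is asymptotic to - 1 / w.\<close>
  define \<epsilon> where "\<epsilon> w = s w ^ m * A (\<sigma> w)" for w
  have Alim: "((\<lambda>w. A (\<sigma> w)) \<longlongrightarrow> a) at_infinity"
    unfolding a_def by (rule isCont_tendsto_compose[OF contA \<sigma>lim])
  have w\<epsilon>: "((\<lambda>w. w * \<epsilon> w) \<longlongrightarrow> - 1) at_infinity"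
  proof -
    have "((\<lambda>w. - 1 / a * A (\<sigma> w)) \<longlongrightarrow> - 1 / a * a) at_infinity" by (intro tendsto_intros Alim)
    moreover have "eventually (\<lambda>w. - 1 / a * A (\<sigma> w) = w * \<epsilon> w) at_infinity"
    proof (rule eventually_at_infinityI[of 1])
      fix w :: complex assume "1 \<le> norm w"
      then have "w \<noteq> 0" by auto
      then show "- 1 / a * A (\<sigma> w) = w * \<epsilon> w" using a by (simp add: \<epsilon>_def spow)
    qed
    ultimately show ?thesis using a by (simp add: tendsto_cong)
  qed
  have \<epsilon>lim: "(\<epsilon> \<longlongrightarrow> 0) at_infinity"
  proof -
    have "((\<lambda>w. w * \<epsilon> w * (1 / w)) \<longlongrightarrow> - 1 * 0) at_infinity" by (intro tendsto_mult w\<epsilon> lim_inv)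
    moreover have "eventually (\<lambda>w. w * \<epsilon> w * (1 / w) = \<epsilon> w) at_infinity"
      by (rule eventually_at_infinityI[of 1]) auto
    ultimately show ?thesis by (simp add: tendsto_cong)
  qed
  have ev_ball: "eventually (\<lambda>w. \<sigma> w \<in> ball z0 r) at_infinity"
    using tendstoD[OF \<sigma>lim A(2)] by (simp add: dist_commute)
  have ev\<epsilon>: "eventually (\<lambda>w. \<sigma> w \<in> ball z0 r \<and> w \<noteq> 0 \<and> \<epsilon> w \<noteq> 0) at_infinity"
  proof -
    have "eventually (\<lambda>w::complex. w \<noteq> 0) at_infinity" by (rule eventually_at_infinityI[of 1]) auto
    with ev_ball show ?thesis by eventually_elim (use A(6) s0 in \<open>auto simp: \<epsilon>_def\<close>)
  qed
  have \<epsilon>at0: "filterlim \<epsilon> (at 0) at_infinity"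
    using \<epsilon>lim ev\<epsilon> by (auto simp: filterlim_at elim: eventually_mono)
  \<comment> \<open>Since w is proportional to s(w)^(-m), multiplying s by 1 + \<epsilon> multiplies
    w by (1 + \<epsilon>)^(-m). The derivative - m at 0, together with w \<epsilon>(w) \<rightarrow>
    -1, produces the translation by m.\<close>
  define h where "h x = exp (- of_nat m * Ln (1 + x))" for x :: complex
  define T where "T w = w * h (\<epsilon> w)" for w
  have "(h has_field_derivative - of_nat m) (at 0)" unfolding h_def
    by (auto intro!: derivative_eq_intros)
  then have "((\<lambda>x. (h x - h 0) / (x - 0)) \<longlongrightarrow> - of_nat m) (at 0)" by (simp add: has_field_derivative_iff)
  then have "((\<lambda>x. (h x - 1) / x) \<longlongrightarrow> - of_nat m) (at 0)" by (simp add: h_def)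
  then have "((\<lambda>w. (h (\<epsilon> w) - 1) / \<epsilon> w) \<longlongrightarrow> - of_nat m) at_infinity" by (rule filterlim_compose[OF _ \<epsilon>at0])
  then have "((\<lambda>w. w * \<epsilon> w * ((h (\<epsilon> w) - 1) / \<epsilon> w)) \<longlongrightarrow> - 1 * - of_nat m) at_infinity"
    by (intro tendsto_mult w\<epsilon>)
  moreover have "eventually (\<lambda>w. w * \<epsilon> w * ((h (\<epsilon> w) - 1) / \<epsilon> w) = T w - w) at_infinity"
    using ev\<epsilon> by eventually_elim (simp add: T_def field_simps)
  ultimately have Tlim: "((\<lambda>w. T w - w) \<longlongrightarrow> of_nat m) at_infinity"
    by (simp add: tendsto_cong)
  have "((\<lambda>w. of_nat m * Ln (1 + \<epsilon> w)) \<longlongrightarrow> of_nat m * Ln (1 + 0)) at_infinity"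
    by (intro tendsto_intros \<epsilon>lim) auto
  then have "((\<lambda>w. of_nat m * Ln (1 + \<epsilon> w)) \<longlongrightarrow> 0) at_infinity" by simp
  from tendstoD[OF this, of 1] have evLn: "eventually (\<lambda>w. norm (of_nat m * Ln (1 + \<epsilon> w)) < 1) at_infinity" by simp
  have evT: "eventually (\<lambda>w. norm (T w - w - of_nat m) < 1/2) at_infinity"
    using tendstoD[OF Tlim, of "1/2"] by (simp add: dist_norm)
  have ev1: "eventually (\<lambda>w. norm (\<epsilon> w) < 1) at_infinity" using tendstoD[OF \<epsilon>lim, of 1] by simp
  have "eventually (\<lambda>w. \<sigma> w \<in> ball z0 r \<and> \<epsilon> w \<noteq> 0 \<and> norm (\<epsilon> w) < 1 \<and>
      norm (of_nat m * Ln (1 + \<epsilon> w)) < 1 \<and> norm (T w - w - of_nat m) < 1/2) at_infinity"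
    using ev\<epsilon> evLn evT ev1 by eventually_elim auto
  then obtain B where B: "\<And>w. B \<le> norm w \<Longrightarrow> \<sigma> w \<in> ball z0 r \<and> \<epsilon> w \<noteq> 0 \<and> norm (\<epsilon> w) < 1 \<and>
      norm (of_nat m * Ln (1 + \<epsilon> w)) < 1 \<and> norm (T w - w - of_nat m) < 1/2"
    by (auto simp: eventually_at_infinity)
  define R where "R = max B 0"
  define V where "V = {w. R < Re w}"
  have VB: "B \<le> norm w" "w \<noteq> 0" "0 < Re w" if "w \<in> V" for w
    using that complex_Re_le_cmod[of w] by (auto simp: V_def R_def)
  note VD = B[OF VB(1)]
  have ReT: "Re (T w) \<ge> Re w + 1/2" "norm (T w - w) \<le> real m + 1/2" if "w \<in> V" for w
  proof -
    have *: "norm (T w - w - of_nat m) < 1/2" using VD[OF that] by blast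
    then have "\<bar>Re (T w - w - of_nat m)\<bar> < 1/2" using abs_Re_le_cmod le_less_trans by blast
    then have "- (1/2) < Re (T w) - Re w - real m" unfolding abs_less_iff by simp
    moreover have "1 \<le> real m" using m(2) by simp
    ultimately show "Re (T w) \<ge> Re w + 1/2" by linarith
    show "norm (T w - w) \<le> real m + 1/2"
    proof -
      have "norm (T w - w) \<le> norm (T w - w - of_nat m) + norm (of_nat m :: complex)"
        using norm_triangle_ineq[of "T w - w - of_nat m" "of_nat m"] by (simp only: diff_add_cancel)
      then show ?thesis using * by (simp only: norm_of_nat)
    qed
  qed
  have TV: "T ` V \<subseteq> V"
  proof (rule image_subsetI)
    fix w assume w: "w \<in> V"
    then have "R < Re w" by (simp add: V_def)
    then have "R < Re (T w)" using ReT(1)[OF w] by linarith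
    then show "T w \<in> V" by (simp add: V_def)
  qed
  have VE: "\<sigma> w \<in> gg_domain" if "w \<in> V" for w
  proof -
    have "\<sigma> w \<in> ball z0 r" using VD[OF that] by (rule conjunct1)
    then show ?thesis using A(3) e(2) by blast
  qed
  have semi: "?f (\<sigma> w) = \<sigma> (T w)" if w: "w \<in> V" for w
  proof -
    have "?f (\<sigma> w) = \<sigma> w + s w ^ N * A (\<sigma> w)" using A(5)[of "\<sigma> w"] VD[OF w] by (simp add: \<sigma>_def algebra_simps)
    also have "\<dots> = z0 + s w * (1 + \<epsilon> w)" by (simp add: \<sigma>_def \<epsilon>_def m(1) algebra_simps)
    finally have 1: "?f (\<sigma> w) = z0 + s w * (1 + \<epsilon> w)" .
    define L where "L = of_nat m * Ln (1 + \<epsilon> w)"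
    have ne: "1 + \<epsilon> w \<noteq> 0"
    proof
      assume "1 + \<epsilon> w = 0"
      then have "\<epsilon> w = - 1" by (simp add: add_eq_0_iff)
      then show False using VD[OF w] by simp
    qed
    \<comment> \<open>The principal branch is preserved because pi / 2 + 1 < pi; this is the reason
      for the bound 1 on m Ln(1 + \<epsilon>).\<close>
    have "\<bar>Im (Ln w)\<bar> < pi / 2" using Re_Ln_pos_lt VB[OF w] by blast
    moreover have "\<bar>Im L\<bar> < 1" using VD[OF w] abs_Im_le_cmod[of L] by (simp add: L_def)
    ultimately have "- pi < Im (Ln w - L)" "Im (Ln w - L) \<le> pi" using pi_gt3 by auto
    moreover have "exp (Ln w - L) = T w" using VB[OF w] by (simp add: T_def h_def L_def exp_diff exp_minus field_simps)
    ultimately have "Ln (T w) = Ln w - L" by (rule_tac Ln_unique)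
    moreover have "- (Ln w - L) / of_nat m = - Ln w / of_nat m + Ln (1 + \<epsilon> w)"
      using m(2) by (simp add: L_def diff_divide_distrib)
    ultimately have "s (T w) = \<zeta> * exp (- Ln w / of_nat m + Ln (1 + \<epsilon> w))"
      by (simp only: s_def)
    also have "\<dots> = s w * (1 + \<epsilon> w)" unfolding exp_add exp_Ln[OF ne] s_def by (simp only: mult.assoc)
    finally show ?thesis using 1 by (simp add: \<sigma>_def)
  qed
  have orbV: "(T ^^ n) w \<in> V \<and> Re ((T ^^ n) w) \<ge> Re w + real n / 2" if "w \<in> V" for n w
  proof (induction n)
    case (Suc n)
    have "T ((T ^^ n) w) \<in> V" using conjunct1[OF Suc] TV by blast
    moreover have "Re w + real (Suc n) / 2 = Re w + real n / 2 + 1 / 2" by (simp add: field_simps)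
    then have "Re w + real (Suc n) / 2 \<le> Re (T ((T ^^ n) w))"
      using conjunct2[OF Suc] ReT(1)[OF conjunct1[OF Suc]] by linarith
    ultimately show ?case by simp
  qed (use that in auto)
  have \<sigma>orb: "(?f ^^ n) (\<sigma> w) = \<sigma> ((T ^^ n) w)" if "w \<in> V" for n w
    by (induction n) (use orbV[OF that] semi in auto)
  have limV: "(\<lambda>n. (?f ^^ n) (\<sigma> w)) \<longlonglongrightarrow> z0" if "w \<in> V" for w
  proof -
    have "filterlim (\<lambda>n. norm ((T ^^ n) w)) at_top sequentially"
    proof (rule filterlim_at_top_mono)
      show "filterlim (\<lambda>n. Re w + real n / 2) at_top sequentially"
        by real_asymp
      show "eventually (\<lambda>n. Re w + real n / 2 \<le> norm ((T ^^ n) w)) sequentially"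
        using orbV[OF that] complex_Re_le_cmod order.trans by (intro always_eventually) blast
    qed
    then have "filterlim (\<lambda>n. (T ^^ n) w) at_infinity sequentially"
      by (simp add: filterlim_at_infinity_conv_norm_at_top)
    then show ?thesis unfolding \<sigma>orb[OF that] by (rule filterlim_compose[OF \<sigma>lim])
  qed
  define w0 where "w0 = of_real (R + 1) + (0::complex)"
  have w0: "w0 \<in> V" by (simp add: w0_def V_def)
  \<comment> \<open>The steps stay below m + 1/2, while the distance Re(T^n(w0)) - R to the edge of
    the half-plane grows by at least 1/2 each time, so the relative step tends to 0.\<close>
  have "\<exists>w\<in>V. \<sigma> w \<in> postcritical"
  proof (rule postcritical_meets[of V \<sigma> T w0 "\<lambda>n. Re ((T ^^ n) w0) - R"])
    show "convex V" "open V" unfolding V_def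
      by (rule convex_halfspace_Re_gt) (intro open_Collect_less continuous_intros)
    have np: "w \<notin> \<real>\<^sub>\<le>\<^sub>0" if "w \<in> V" for w using VB(3)[OF that] by (auto simp: complex_nonpos_Reals_iff)
    show hs: "\<sigma> holomorphic_on V" unfolding \<sigma>_def[abs_def] s_def[abs_def]
      using np m(2) by (intro holomorphic_intros) auto
    show "continuous_on V T"
    proof -
      have c\<sigma>: "continuous_on V \<sigma>" using hs by (rule holomorphic_on_imp_continuous_on)
      have cA: "continuous_on V (\<lambda>w. A (\<sigma> w))"
        by (rule continuous_on_compose2[OF holomorphic_on_imp_continuous_on[OF A(4)] c\<sigma>]) (use VD in blast)
      have cs: "continuous_on V s" using continuous_on_diff[OF c\<sigma> continuous_on_const[of V z0]] by (simp add: \<sigma>_def)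
      have c\<epsilon>: "continuous_on V \<epsilon>" unfolding \<epsilon>_def[abs_def] by (intro continuous_intros cs cA)
      have "1 + \<epsilon> w \<notin> \<real>\<^sub>\<le>\<^sub>0" if "w \<in> V" for w
      proof -
        have "norm (\<epsilon> w) < 1" using VD[OF that] by blast
        then have "Re (1 + \<epsilon> w) > 0" using abs_Re_le_cmod[of "\<epsilon> w"] by auto
        then show ?thesis by (auto simp: complex_nonpos_Reals_iff)
      qed
      then show ?thesis unfolding T_def[abs_def] h_def by (intro continuous_intros c\<epsilon>) auto
    qed
    show "\<sigma> (T w0) \<noteq> \<sigma> w0"
    proof
      assume "\<sigma> (T w0) = \<sigma> w0"
      then have "?f (\<sigma> w0) - \<sigma> w0 = 0" using semi[OF w0] by simp
      then have "s w0 ^ N * A (\<sigma> w0) = 0" using A(5)[of "\<sigma> w0"] VD[OF w0] by (simp add: \<sigma>_def)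
      then show False using s0 A(6) VD[OF w0] by simp
    qed
    show "Re ((T ^^ n) w0) - R > 0" for n using orbV[OF w0, of n] by (auto simp: V_def)
    show "ball ((T ^^ n) w0) (Re ((T ^^ n) w0) - R) \<subseteq> V" for n
    proof
      fix z assume "z \<in> ball ((T ^^ n) w0) (Re ((T ^^ n) w0) - R)"
      then have "norm ((T ^^ n) w0 - z) < Re ((T ^^ n) w0) - R" by (simp add: dist_norm)
      then show "z \<in> V" using complex_Re_le_cmod[of "(T ^^ n) w0 - z"] by (simp add: V_def)
    qed
    show "(\<lambda>n. dist ((T ^^ Suc n) w0) ((T ^^ n) w0) / (Re ((T ^^ n) w0) - R)) \<longlonglongrightarrow> 0"
    proof (rule tendsto_sandwich[OF _ _ tendsto_const])
      show "eventually (\<lambda>n. dist ((T ^^ Suc n) w0) ((T ^^ n) w0) / (Re ((T ^^ n) w0) - R)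
          \<le> (real m + 1/2) / (1 + real n / 2)) sequentially"
      proof (intro always_eventually allI)
        fix n
        have "Re ((T ^^ n) w0) - R \<ge> 1 + real n / 2" using orbV[OF w0, of n] by (simp add: w0_def)
        moreover have "dist ((T ^^ Suc n) w0) ((T ^^ n) w0) \<le> real m + 1/2"
          using ReT(2)[of "(T ^^ n) w0"] orbV[OF w0, of n] by (simp add: dist_norm)
        ultimately show "dist ((T ^^ Suc n) w0) ((T ^^ n) w0) / (Re ((T ^^ n) w0) - R)
          \<le> (real m + 1/2) / (1 + real n / 2)" by (intro frac_le) auto
      qed
      show "(\<lambda>n. (real m + 1/2) / (1 + real n / 2)) \<longlonglongrightarrow> 0" by real_asymp
      show "eventually (\<lambda>n. 0 \<le> dist ((T ^^ Suc n) w0) ((T ^^ n) w0) / (Re ((T ^^ n) w0) - R)) sequentially"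
        using orbV[OF w0] by (intro always_eventually allI divide_nonneg_nonneg) (auto simp: V_def less_imp_le)
    qed
  qed (use VE TV w0 semi in \<open>auto simp: gg_domain_def\<close>)
  then obtain w where "w \<in> V" "\<sigma> w \<in> postcritical" by blast
  then show ?thesis using postcritical_tendsto gg_orbit_tendsto[OF z0 limV] by blast
qed

text \<open>A pigeonhole argument: each fixed point attracts some critical point, and two fixed
  points whose critical points are congruent are congruent themselves, because g commutes with
  lattice translations.\<close>

lemma nonrepelling_fixed_points:
  assumes Z: "finite Z" "\<And>z. z \<in> Z \<Longrightarrow> z \<notin> \<Lambda> \<and> g z = z \<and> norm (deriv F z) \<le> 1"
    and sep: "\<And>z z'. z \<in> Z \<Longrightarrow> z' \<in> Z \<Longrightarrow> z - z' \<in> \<Lambda> \<Longrightarrow> z = z'"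
  shows "card Z \<le> 2"
proof (rule ccontr)
  assume "\<not> card Z \<le> 2"
  have "\<exists>c\<in>crit. (\<lambda>n. (g ^^ n) c) \<longlonglongrightarrow> z" if "z \<in> Z" for z
    using attracting_fixed_point[of z] parabolic_fixed_point[of z] Z(2)[OF that] by force
  then obtain c where c: "\<And>z. z \<in> Z \<Longrightarrow> c z \<in> crit" "\<And>z. z \<in> Z \<Longrightarrow> (\<lambda>n. (g ^^ n) (c z)) \<longlonglongrightarrow> z" by metis
  have "Z \<noteq> {}" using \<open>\<not> card Z \<le> 2\<close> by auto
  then obtain z1 where z1: "z1 \<in> Z" by blast
  have congr: "z = z'" if zz: "z \<in> Z" "z' \<in> Z" "c z - c z' \<in> \<Lambda>" for z z'
  proof -
    \<comment> \<open>Valid even if the orbit runs into a pole, since the shift law was imposed at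
      lattice points too.\<close>
    have orb: "(g ^^ n) (c z' + (c z - c z')) = (g ^^ n) (c z') + (c z - c z')" for n
      by (induction n) (use g_add_lattice[OF zz(3)] in auto)
    have "(\<lambda>n. (g ^^ n) (c z') + (c z - c z')) \<longlonglongrightarrow> z' + (c z - c z')" by (intro tendsto_intros c zz)
    then have "(\<lambda>n. (g ^^ n) (c z)) \<longlonglongrightarrow> z' + (c z - c z')" using orb by simp
    then have "z = z' + (c z - c z')" using c(2)[OF zz(1)] LIMSEQ_unique by blast
    then have "z - z' = c z - c z'" by (simp add: algebra_simps)
    then show ?thesis using sep[OF zz(1,2)] zz(3) by simp
  qed
  \<comment> \<open>A Boolean records the class of c(z): congruent to c(z1) or, failing that, to -
    c(z1).\<close>
  have inj: "inj_on (\<lambda>z. c z - c z1 \<in> \<Lambda>) Z"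
  proof (rule inj_onI)
    fix z z' assume zz: "z \<in> Z" "z' \<in> Z" "(c z - c z1 \<in> \<Lambda>) = (c z' - c z1 \<in> \<Lambda>)"
    show "z = z'"
    proof (cases "c z - c z1 \<in> \<Lambda>")
      case True
      moreover have "c z' - c z1 \<in> \<Lambda>" using True zz by simp
      ultimately have "c z - c z1 - (c z' - c z1) \<in> \<Lambda>" by (rule lattice_diff)
      then show ?thesis using zz by (intro congr) auto
    next
      case False
      have "c z + c z1 \<in> \<Lambda>" "c z' + c z1 \<in> \<Lambda>"
        using critical_points[of "c z1" "c z"] critical_points[of "c z1" "c z'"] c(1) z1 zz False
        by (auto simp: crit_def)
      then have "c z + c z1 - (c z' + c z1) \<in> \<Lambda>" by (rule lattice_diff)
      then show ?thesis using zz by (intro congr) auto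
    qed
  qed
  have "card Z \<le> card (UNIV :: bool set)"
    using card_inj_on_le[OF inj subset_UNIV] by simp
  then show False using \<open>\<not> card Z \<le> 2\<close> by simp
qed

end

subsection \<open>Area formula and integration on the torus\<close>

text \<open>Identifies the plane with \<open>real^2\<close>, the setting of the change of variables
  theorem with determinants.\<close>

definition vcx :: "real^2 \<Rightarrow> complex" where "vcx x = Complex (x $ 1) (x $ 2)"

definition cvx :: "complex \<Rightarrow> real^2" where "cvx z = vector [Re z, Im z]"

lemma vcx_cvx [simp]: "vcx (cvx z) = z" and cvx_vcx [simp]: "cvx (vcx x) = x"
  and Re_vcx [simp]: "Re (vcx x) = x $ 1" and Im_vcx [simp]: "Im (vcx x) = x $ 2"
  and cvx_nth [simp]: "cvx z $ 1 = Re z" "cvx z $ 2 = Im z"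
  by (auto simp: vcx_def cvx_def vec_eq_iff forall_2)

lemma linear_vcx: "linear vcx" and linear_cvx: "linear cvx"
  by (auto intro!: linearI simp: complex_eq_iff vec_eq_iff forall_2)

lemma bounded_linear_vcx: "bounded_linear vcx" and bounded_linear_cvx: "bounded_linear cvx"
  using linear_vcx linear_cvx by (simp_all add: linear_conv_bounded_linear)

lemma vcx_axis: "vcx (axis 1 1) = 1" "vcx (axis 2 1) = \<i>"
  by (auto simp: complex_eq_iff axis_def)

lemma borel_measurable_vcx [measurable]: "vcx \<in> borel_measurable borel"
  by (intro borel_measurable_continuous_onI bounded_linear.continuous_on[OF bounded_linear_vcx] continuous_on_id)

lemma emeasure_box_real2:
  fixes l u :: "real^2"
  assumes "l $ 1 \<le> u $ 1" "l $ 2 \<le> u $ 2"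
  shows "emeasure lborel (box l u :: (real^2) set) = ennreal ((u $ 1 - l $ 1) * (u $ 2 - l $ 2))"
proof -
  have ne: "cbox l u \<noteq> {}" using assms by (auto simp: interval_ne_empty_cart forall_2)
  have le: "\<And>b. b \<in> Basis \<Longrightarrow> l \<bullet> b \<le> u \<bullet> b" using ne by (simp add: box_ne_empty)
  have "emeasure lborel (box l u) = ennreal (measure lborel (cbox l u))"
    using emeasure_lborel_box[OF le] emeasure_lborel_cbox[OF le] by (simp add: measure_def le prod_nonneg)
  also have "\<dots> = ennreal ((u $ 1 - l $ 1) * (u $ 2 - l $ 2))"
    using ne by (simp add: content_cbox_cart UNIV_2)
  finally show ?thesis .
qed

lemma lborel_complex_real2: "lborel = distr lborel borel vcx"
proof (rule lborel_eqI)
  fix l u :: complex assume le: "\<And>b. b \<in> Basis \<Longrightarrow> l \<bullet> b \<le> u \<bullet> b"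
  have le': "Re l \<le> Re u" "Im l \<le> Im u"
    using le[of 1] le[of \<i>] by (simp_all add: Basis_complex_def)
  have "vcx -` box l u = box (cvx l) (cvx u)"
    by (auto simp: mem_box_cart forall_2 in_box_complex_iff)
  then have "emeasure (distr lborel borel vcx) (box l u) = emeasure lborel (box (cvx l) (cvx u))"
    by (subst emeasure_distr) auto
  also have "\<dots> = ennreal ((Re u - Re l) * (Im u - Im l))"
    using le' by (subst emeasure_box_real2) auto
  also have "\<dots> = ennreal (\<Prod>b\<in>Basis. (u - l) \<bullet> b)" by (simp add: Basis_complex_def)
  finally show "emeasure (distr lborel borel vcx) (box l u) = ennreal (\<Prod>b\<in>Basis. (u - l) \<bullet> b)" .
qed simp

lemma lborel_complex_prod: "(lborel :: complex measure) = distr lborel borel (\<lambda>(x, y). Complex x y)"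
proof (rule lborel_eqI)
  fix l u :: complex assume le: "\<And>b. b \<in> Basis \<Longrightarrow> l \<bullet> b \<le> u \<bullet> b"
  have le': "Re l \<le> Re u" "Im l \<le> Im u"
    using le[of 1] le[of \<i>] by (simp_all add: Basis_complex_def)
  have m: "(\<lambda>(x, y). Complex x y) \<in> borel_measurable (borel :: (real \<times> real) measure)"
    by (intro borel_measurable_continuous_onI) (auto simp: Complex_eq case_prod_beta intro!: continuous_intros)
  have "(\<lambda>(x, y). Complex x y) -` box l u = box (Re l, Im l) (Re u, Im u)"
    by (auto simp: in_box_complex_iff mem_box Basis_prod_def)
  then have "emeasure (distr lborel borel (\<lambda>(x, y). Complex x y)) (box l u) = emeasure lborel (box (Re l, Im l) (Re u, Im u))"
    using m by (subst emeasure_distr) auto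
  also have "\<dots> = ennreal ((Re u - Re l) * (Im u - Im l))"
    using le' by (subst emeasure_lborel_box) (auto simp: Basis_prod_def prod.union_disjoint prod.reindex inj_on_def)
  also have "\<dots> = ennreal (\<Prod>b\<in>Basis. (u - l) \<bullet> b)" by (simp add: Basis_complex_def)
  finally show "emeasure (distr lborel borel (\<lambda>(x, y). Complex x y)) (box l u) = ennreal (\<Prod>b\<in>Basis. (u - l) \<bullet> b)" .
qed simp

lemma nn_integral_complex_real2:
  "f \<in> borel_measurable borel \<Longrightarrow> (\<integral>\<^sup>+ z. f z \<partial>lborel) = (\<integral>\<^sup>+ x. f (vcx x) \<partial>lborel)"
  by (subst lborel_complex_real2) (simp add: nn_integral_distr)

text \<open>The area formula: the integral of f(h) times the absolute Jacobian over S equals the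
  integral of f times the number of preimages in S. It appears as two inequalities because the
  fibres are only known to have at most, or at least, k points.\<close>

lemma area_bounds_real2:
  fixes h :: "real^2 \<Rightarrow> real^2" and f :: "real^2 \<Rightarrow> real"
  assumes S: "S \<in> sets borel"
    and der: "\<And>x. x \<in> S \<Longrightarrow> (h has_derivative h' x) (at x)"
    and inj: "\<And>x. x \<in> S \<Longrightarrow> \<exists>r>0. inj_on h (ball x r)"
    and f: "integrable lborel f" "\<And>x. 0 \<le> f x"
  shows area_le_real2: "(\<And>w. f w \<noteq> 0 \<Longrightarrow> finite {x\<in>S. h x = w} \<and> card {x\<in>S. h x = w} \<le> k) \<Longrightarrow>
      (\<integral>\<^sup>+x. ennreal (\<bar>det (matrix (h' x))\<bar> * f (h x)) * indicator S x \<partial>lborel) \<le> of_nat k * (\<integral>\<^sup>+w. ennreal (f w) \<partial>lborel)"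
    and area_ge_real2: "(\<And>w. f w \<noteq> 0 \<Longrightarrow> \<exists>A. A \<subseteq> {x\<in>S. h x = w} \<and> finite A \<and> card A = k) \<Longrightarrow>
      of_nat k * (\<integral>\<^sup>+w. ennreal (f w) \<partial>lborel) \<le> (\<integral>\<^sup>+x. ennreal (\<bar>det (matrix (h' x))\<bar> * f (h x)) * indicator S x \<partial>lborel)"
proof -
  obtain r where r: "\<And>x. x \<in> S \<Longrightarrow> r x > 0" "\<And>x. x \<in> S \<Longrightarrow> inj_on h (ball x (r x))" using inj by metis
  \<comment> \<open>Countably many discs on which h is injective already cover S; made disjoint,
    they cut S into pieces to which the injective change of variables applies.\<close>
  obtain \<F> where \<F>: "\<F> \<subseteq> (\<lambda>x. ball x (r x)) ` S" "countable \<F>" "\<Union>\<F> = \<Union>((\<lambda>x. ball x (r x)) ` S)"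
    using Lindelof[of "(\<lambda>x. ball x (r x)) ` S"] by blast
  define B where "B = (\<lambda>n. from_nat_into (insert {} \<F>) n)"
  have rB: "range B = insert {} \<F>" unfolding B_def using \<F>(2) by (simp add: range_from_nat_into)
  have oB: "open (B n)" and iB: "inj_on h (B n)" for n
  proof -
    have "B n \<in> insert {} \<F>" using rB by blast
    then consider "B n = {}" | x where "x \<in> S" "B n = ball x (r x)" using \<F>(1) by blast
    then have "open (B n) \<and> inj_on h (B n)" by cases (auto simp: r)
    then show "open (B n)" "inj_on h (B n)" by auto
  qed
  have SB: "S \<subseteq> (\<Union>n. B n)"
  proof
    fix x assume "x \<in> S"
    then have "x \<in> \<Union>\<F>" using \<F>(3) r(1) by force
    then show "x \<in> (\<Union>n. B n)" using rB by blast
  qed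
  define Q where "Q n = S \<inter> disjointed B n" for n
  have QB: "Q n \<subseteq> B n" and QS: "Q n \<subseteq> S" for n using disjointed_subset[of B n] by (auto simp: Q_def)
  have SQ: "S = (\<Union>n. Q n)" using SB UN_disjointed_eq[of B] by (auto simp: Q_def)
  have disj: "disjoint_family Q" using disjoint_family_disjointed[of B]
    unfolding disjoint_family_on_def Q_def by blast
  have mQ: "Q n \<in> sets borel" for n
  proof -
    have "range B \<subseteq> sets borel" using oB by auto
    then have "range (disjointed B) \<subseteq> sets borel" by (rule sets.range_disjointed_sets)
    then show ?thesis using S by (auto simp: Q_def)
  qed
  have iQ: "inj_on h (Q n)" for n using iB QB by (rule inj_on_subset)
  define D where "D x = \<bar>det (matrix (h' x))\<bar> * f (h x)" for x
  have D0: "D x \<ge> 0" for x using f(2) by (simp add: D_def)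
  have mf: "f \<in> borel_measurable lborel" using f(1) by (rule borel_measurable_integrable)
  have leb: "integrable lebesgue f" using f(1) mf by (simp add: integrable_completion)
  have der': "(h has_derivative h' x) (at x within Q n)" if "x \<in> Q n" for x n
    using der QS that by (meson has_derivative_at_withinI subsetD)
  have mh: "h ` Q n \<in> sets lebesgue" for n
    by (rule differentiable_image_in_sets_lebesgue)
      (use mQ der' in \<open>auto simp: differentiable_on_def differentiable_def\<close>)
  have fin: "f absolutely_integrable_on (h ` Q n)" for n
    unfolding set_integrable_def using leb mh[of n] by (rule integrable_mult_indicator[rotated])
  \<comment> \<open>The change of variables theorem concerns vector-valued integrands, so f is
    wrapped into \<open>real^1\<close>.\<close>
  define f1 where "f1 x = (vec (f x) :: real^1)" for x
  have cov: "D absolutely_integrable_on Q n \<and> integral (Q n) D = integral (h ` Q n) f" for n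
  proof -
    have QL: "Q n \<in> sets lebesgue" using mQ by simp
    have f1: "f1 absolutely_integrable_on (h ` Q n)"
      using fin[of n] unfolding f1_def absolutely_integrable_on_1_iff by simp
    have "(\<lambda>x. \<bar>det (matrix (h' x))\<bar> *\<^sub>R f1 (h x)) absolutely_integrable_on Q n \<and>
      integral (Q n) (\<lambda>x. \<bar>det (matrix (h' x))\<bar> *\<^sub>R f1 (h x)) = integral (h ` Q n) f1"
      using has_absolute_integral_change_of_variables[OF QL der' iQ, where f = f1 and b = "integral (h ` Q n) f1"] f1 by auto
    moreover have "(\<lambda>x. \<bar>det (matrix (h' x))\<bar> *\<^sub>R f1 (h x)) = (\<lambda>x. vec (D x))"
      by (auto simp: f1_def D_def fun_eq_iff vec_eq_iff)
    ultimately have 1: "(\<lambda>x. vec (D x) :: real^1) absolutely_integrable_on Q n"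
      and 2: "integral (Q n) (\<lambda>x. vec (D x) :: real^1) = integral (h ` Q n) f1" by auto
    have "D absolutely_integrable_on Q n" using 1 unfolding absolutely_integrable_on_1_iff by simp
    moreover have "integral (Q n) D = integral (h ` Q n) f"
      using arg_cong[OF 2, of "\<lambda>v::real^1. v $ 1"] unfolding f1_def integral_on_1_eq by simp
    ultimately show ?thesis by simp
  qed
  have piece: "(\<integral>\<^sup>+x. ennreal (D x) * indicator (Q n) x \<partial>lebesgue) = (\<integral>\<^sup>+w. ennreal (f w) * indicator (h ` Q n) w \<partial>lebesgue)" for n
  proof -
    have "(D has_integral integral (Q n) D) (Q n)"
      using cov[of n] absolutely_integrable_on_def by (intro integrable_integral) blast
    then have "(\<integral>\<^sup>+x. ennreal (D x) * indicator (Q n) x \<partial>lborel) = ennreal (integral (Q n) D)"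
      by (intro nn_integral_has_integral_lebesgue') (auto simp: D0)
    moreover have "(f has_integral integral (h ` Q n) f) (h ` Q n)"
      using fin[of n] absolutely_integrable_on_def by (intro integrable_integral) blast
    then have "(\<integral>\<^sup>+x. ennreal (f x) * indicator (h ` Q n) x \<partial>lborel) = ennreal (integral (h ` Q n) f)"
      by (intro nn_integral_has_integral_lebesgue') (auto simp: f)
    ultimately show ?thesis using cov[of n] by (simp add: nn_integral_completion)
  qed
  have mD: "(\<lambda>x. ennreal (D x) * indicator (Q n) x) \<in> borel_measurable lebesgue" for n
  proof -
    have "(\<lambda>x. indicator (Q n) x *\<^sub>R D x) \<in> borel_measurable lebesgue"
      using cov[of n] unfolding set_integrable_def by (auto dest: borel_measurable_integrable)
    then have "(\<lambda>x. ennreal (indicator (Q n) x *\<^sub>R D x)) \<in> borel_measurable lebesgue" by measurable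
    moreover have "(\<lambda>x. ennreal (indicator (Q n) x *\<^sub>R D x)) = (\<lambda>x. ennreal (D x) * indicator (Q n) x)"
      by (auto simp: fun_eq_iff indicator_def)
    ultimately show ?thesis by simp
  qed
  have mfL: "f \<in> borel_measurable lebesgue" using leb by (rule borel_measurable_integrable)
  have mF: "(\<lambda>w. ennreal (f w) * indicator (h ` Q n) w) \<in> borel_measurable lebesgue" for n
    using mfL mh[of n] by measurable
  \<comment> \<open>The sum of the indicators of the images is the number of preimages of w in S, as
    each piece contributes at most one.\<close>
  have total: "(\<integral>\<^sup>+x. ennreal (D x) * indicator S x \<partial>lborel)
      = (\<integral>\<^sup>+w. ennreal (f w) * (\<Sum>n. indicator (h ` Q n) w) \<partial>lebesgue)"
  proof -
    have "(\<integral>\<^sup>+x. ennreal (D x) * indicator S x \<partial>lborel) = (\<integral>\<^sup>+x. (\<Sum>n. ennreal (D x) * indicator (Q n) x) \<partial>lebesgue)"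
      unfolding SQ by (simp add: nn_integral_completion suminf_indicator[OF disj])
    also have "\<dots> = (\<Sum>n. \<integral>\<^sup>+x. ennreal (D x) * indicator (Q n) x \<partial>lebesgue)"
      by (rule nn_integral_suminf[OF mD])
    also have "\<dots> = (\<Sum>n. \<integral>\<^sup>+w. ennreal (f w) * indicator (h ` Q n) w \<partial>lebesgue)"
      by (simp add: piece)
    also have "\<dots> = (\<integral>\<^sup>+w. (\<Sum>n. ennreal (f w) * indicator (h ` Q n) w) \<partial>lebesgue)"
      by (rule nn_integral_suminf[symmetric, OF mF])
    finally show ?thesis by simp
  qed
  have mass: "of_nat k * (\<integral>\<^sup>+w. ennreal (f w) \<partial>lborel) = (\<integral>\<^sup>+w. ennreal (f w) * of_nat k \<partial>lebesgue)"
    using mfL by (subst nn_integral_multc) (auto simp: nn_integral_completion mult.commute)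
  \<comment> \<open>One preimage per piece; disjointness of the pieces makes the choice injective in
    n, so the number of pieces hitting w is at most the size of the fibre.\<close>
  define pt where "pt w n = (SOME x. x \<in> Q n \<and> h x = w)" for w n
  have pt: "pt w n \<in> Q n \<and> h (pt w n) = w" if "w \<in> h ` Q n" for w n
    unfolding pt_def by (rule someI_ex) (use that in blast)
  show "(\<integral>\<^sup>+x. ennreal (\<bar>det (matrix (h' x))\<bar> * f (h x)) * indicator S x \<partial>lborel) \<le> of_nat k * (\<integral>\<^sup>+w. ennreal (f w) \<partial>lborel)"
    if k: "\<And>w. f w \<noteq> 0 \<Longrightarrow> finite {x\<in>S. h x = w} \<and> card {x\<in>S. h x = w} \<le> k"
    unfolding D_def[symmetric] total mass
  proof (rule nn_integral_mono)
    fix w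
    show "ennreal (f w) * (\<Sum>n. indicator (h ` Q n) w) \<le> ennreal (f w) * of_nat k"
    proof (cases "f w = 0")
      case False
      have "(\<Sum>n. indicator (h ` Q n) w) \<le> (of_nat k :: ennreal)"
      proof (rule suminf_le_const)
        fix N
        define I where "I = {n\<in>{..<N}. w \<in> h ` Q n}"
        have sum: "(\<Sum>n<N. indicator (h ` Q n) w) = (of_nat (card I) :: ennreal)"
          unfolding I_def by (simp add: indicator_def of_bool_def sum.If_cases Int_def)
        have "card I \<le> card {x\<in>S. h x = w}"
        proof (rule card_inj_on_le[of "pt w"])
          show "inj_on (pt w) I"
          proof (rule inj_onI)
            fix m n assume mn: "m \<in> I" "n \<in> I" "pt w m = pt w n"
            then have "pt w m \<in> Q m \<inter> Q n" using pt[of w m] pt[of w n] by (auto simp: I_def)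
            then show "m = n" using disj by (auto simp: disjoint_family_on_def)
          qed
          show "pt w ` I \<subseteq> {x\<in>S. h x = w}" using pt QS by (force simp: I_def)
        qed (use k[OF False] in auto)
        then have "card I \<le> k" using k[OF False] by linarith
        then show "(\<Sum>n<N. indicator (h ` Q n) w) \<le> (of_nat k :: ennreal)"
          unfolding sum by (rule of_nat_mono)
      qed auto
      then show ?thesis by (rule mult_left_mono) auto
    qed simp
  qed
  show "of_nat k * (\<integral>\<^sup>+w. ennreal (f w) \<partial>lborel) \<le> (\<integral>\<^sup>+x. ennreal (\<bar>det (matrix (h' x))\<bar> * f (h x)) * indicator S x \<partial>lborel)"
    if k: "\<And>w. f w \<noteq> 0 \<Longrightarrow> \<exists>A. A \<subseteq> {x\<in>S. h x = w} \<and> finite A \<and> card A = k"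
    unfolding D_def[symmetric] total mass
  proof (rule nn_integral_mono)
    fix w
    show "ennreal (f w) * of_nat k \<le> ennreal (f w) * (\<Sum>n. indicator (h ` Q n) w)"
    proof (cases "f w = 0")
      case False
      obtain A where A: "A \<subseteq> {x\<in>S. h x = w}" "finite A" "card A = k" using k[OF False] by blast
      have "\<exists>n. x \<in> Q n" if "x \<in> A" for x using that A(1) SQ by blast
      then obtain ix where ix: "\<And>x. x \<in> A \<Longrightarrow> x \<in> Q (ix x)" by metis
      have "inj_on ix A"
      proof (rule inj_onI)
        fix x y assume xy: "x \<in> A" "y \<in> A" "ix x = ix y"
        then have "x \<in> Q (ix x)" "y \<in> Q (ix x)" "h x = h y" using ix[of x] ix[of y] A(1) by auto
        then show "x = y" using iQ by (meson inj_onD)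
      qed
      then have "of_nat k = (\<Sum>n\<in>ix ` A. indicator (h ` Q n) w :: ennreal)"
      proof -
        have "(\<Sum>n\<in>ix ` A. indicator (h ` Q n) w :: ennreal) = (\<Sum>n\<in>ix ` A. 1)"
        proof (rule sum.cong)
          fix n assume "n \<in> ix ` A"
          then obtain x where "x \<in> A" "n = ix x" by blast
          then have "w \<in> h ` Q n" using ix[of x] A(1) by blast
          then show "indicator (h ` Q n) w = (1 :: ennreal)" by simp
        qed simp
        then show ?thesis using \<open>inj_on ix A\<close> A by (simp add: card_image)
      qed
      also have "\<dots> \<le> (\<Sum>n. indicator (h ` Q n) w)"
        using A by (intro sum_le_suminf) auto
      finally show ?thesis by (rule mult_left_mono) auto
    qed simp
  qed
qed

text \<open>The determinant of a real-linear map in the basis 1, \<i>.\<close>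

definition jac :: "(complex \<Rightarrow> complex) \<Rightarrow> real" where
  "jac L = Re (L 1) * Im (L \<i>) - Im (L 1) * Re (L \<i>)"

lemma area_bounds_complex:
  fixes h :: "complex \<Rightarrow> complex" and f :: "complex \<Rightarrow> real"
  assumes S: "S \<in> sets borel"
    and der: "\<And>x. x \<in> S \<Longrightarrow> (h has_derivative h' x) (at x)"
    and inj: "\<And>x. x \<in> S \<Longrightarrow> \<exists>r>0. inj_on h (ball x r)"
    and f: "integrable lborel f" "\<And>x. 0 \<le> f x"
    and meas: "(\<lambda>x. ennreal (\<bar>jac (h' x)\<bar> * f (h x)) * indicator S x) \<in> borel_measurable borel"
  shows area_le_complex: "(\<And>w. f w \<noteq> 0 \<Longrightarrow> finite {x\<in>S. h x = w} \<and> card {x\<in>S. h x = w} \<le> k) \<Longrightarrow>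
      (\<integral>\<^sup>+x. ennreal (\<bar>jac (h' x)\<bar> * f (h x)) * indicator S x \<partial>lborel) \<le> of_nat k * (\<integral>\<^sup>+w. ennreal (f w) \<partial>lborel)"
    and area_ge_complex: "(\<And>w. f w \<noteq> 0 \<Longrightarrow> \<exists>A. A \<subseteq> {x\<in>S. h x = w} \<and> finite A \<and> card A = k) \<Longrightarrow>
      of_nat k * (\<integral>\<^sup>+w. ennreal (f w) \<partial>lborel) \<le> (\<integral>\<^sup>+x. ennreal (\<bar>jac (h' x)\<bar> * f (h x)) * indicator S x \<partial>lborel)"
proof -
  define S2 where "S2 = vcx -` S"
  define h2 where "h2 = cvx \<circ> h \<circ> vcx"
  define h2' where "h2' x = cvx \<circ> h' (vcx x) \<circ> vcx" for x
  define f2 where "f2 = f \<circ> vcx"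
  have S2: "S2 \<in> sets borel" unfolding S2_def using measurable_sets_borel[OF borel_measurable_vcx S] by simp
  have der2: "(h2 has_derivative h2' x) (at x)" if "x \<in> S2" for x
  proof -
    have 1: "(vcx has_derivative vcx) (at x)" by (rule bounded_linear_imp_has_derivative[OF bounded_linear_vcx])
    have 2: "(h has_derivative h' (vcx x)) (at (vcx x))" using that by (intro der) (simp add: S2_def)
    have 3: "(cvx has_derivative cvx) (at (h (vcx x)))" by (rule bounded_linear_imp_has_derivative[OF bounded_linear_cvx])
    show ?thesis unfolding h2_def h2'_def using diff_chain_at[OF diff_chain_at[OF 1 2] ] 3 by (simp add: o_assoc)
  qed
  have norm_vcx: "dist (vcx x) (vcx y) = dist x y" for x y
    by (simp add: dist_norm linear_diff[OF linear_vcx, symmetric] cmod_def norm_vec_def L2_set_def UNIV_2 vcx_def)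
  have inj2: "\<exists>r>0. inj_on h2 (ball x r)" if x: "x \<in> S2" for x
  proof -
    obtain r where r: "r > 0" "inj_on h (ball (vcx x) r)" using inj[of "vcx x"] x by (auto simp: S2_def)
    have "inj_on h2 (ball x r)"
    proof (rule inj_onI)
      fix a b assume ab: "a \<in> ball x r" "b \<in> ball x r" "h2 a = h2 b"
      then have "h (vcx a) = h (vcx b)" unfolding h2_def o_def by (metis vcx_cvx)
      moreover have "vcx a \<in> ball (vcx x) r" "vcx b \<in> ball (vcx x) r" using ab by (auto simp: norm_vcx)
      ultimately have "vcx a = vcx b" using r(2) by (meson inj_onD)
      then show "a = b" by (metis cvx_vcx)
    qed
    then show ?thesis using r(1) by blast
  qed
  have f2: "integrable lborel f2" unfolding f2_def o_def
    using f(1) by (subst (asm) lborel_complex_real2, subst (asm) integrable_distr_eq) (use f(1) in auto)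
  have jac2: "det (matrix (h2' x)) = jac (h' (vcx x))" for x
    by (simp add: det_2 matrix_def h2'_def vcx_axis jac_def mult.commute)
  have int: "(\<integral>\<^sup>+x. ennreal (\<bar>jac (h' x)\<bar> * f (h x)) * indicator S x \<partial>lborel)
      = (\<integral>\<^sup>+x. ennreal (\<bar>det (matrix (h2' x))\<bar> * f2 (h2 x)) * indicator S2 x \<partial>lborel)"
    unfolding nn_integral_complex_real2[OF meas] jac2 by (simp add: f2_def h2_def S2_def indicator_def)
  have mf: "(\<lambda>w. ennreal (f w)) \<in> borel_measurable borel" using f(1) by measurable
  have intf: "(\<integral>\<^sup>+w. ennreal (f w) \<partial>lborel) = (\<integral>\<^sup>+w. ennreal (f2 w) \<partial>lborel)"
    unfolding nn_integral_complex_real2[OF mf] by (simp add: f2_def)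
  have fib: "{x\<in>S2. h2 x = w} = cvx ` {x\<in>S. h x = vcx w}" for w
  proof (intro set_eqI iffI)
    fix x assume "x \<in> {x\<in>S2. h2 x = w}"
    then show "x \<in> cvx ` {x\<in>S. h x = vcx w}"
      by (intro image_eqI[of _ _ "vcx x"]) (auto simp: S2_def h2_def)
  qed (auto simp: S2_def h2_def)
  have injc: "inj_on cvx A" for A by (metis inj_on_def vcx_cvx)
  show "(\<integral>\<^sup>+x. ennreal (\<bar>jac (h' x)\<bar> * f (h x)) * indicator S x \<partial>lborel) \<le> of_nat k * (\<integral>\<^sup>+w. ennreal (f w) \<partial>lborel)"
    if k: "\<And>w. f w \<noteq> 0 \<Longrightarrow> finite {x\<in>S. h x = w} \<and> card {x\<in>S. h x = w} \<le> k"
    unfolding int intf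
    by (rule area_le_real2[OF S2 der2 inj2 f2]) (use f(2) k injc in \<open>auto simp: f2_def fib card_image\<close>)
  show "of_nat k * (\<integral>\<^sup>+w. ennreal (f w) \<partial>lborel) \<le> (\<integral>\<^sup>+x. ennreal (\<bar>jac (h' x)\<bar> * f (h x)) * indicator S x \<partial>lborel)"
    if k: "\<And>w. f w \<noteq> 0 \<Longrightarrow> \<exists>A. A \<subseteq> {x\<in>S. h x = w} \<and> finite A \<and> card A = k"
    unfolding int intf
  proof (rule area_ge_real2[OF S2 der2 inj2 f2])
    fix w assume "f2 w \<noteq> 0"
    then obtain A where "A \<subseteq> {x\<in>S. h x = vcx w}" "finite A" "card A = k" using k[of "vcx w"] by (auto simp: f2_def)
    then show "\<exists>A. A \<subseteq> {x\<in>S2. h2 x = w} \<and> finite A \<and> card A = k"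
      unfolding fib by (intro exI[of _ "cvx ` A"]) (auto simp: card_image injc)
  qed (use f(2) in \<open>auto simp: f2_def\<close>)
qed

text \<open>With an antiderivative A, both sides are increments of A over unit intervals, and A(1 +
  x) - A(x) has derivative p(x + 1) - p(x) = 0. The interval of radius |\<alpha>| + 2 leaves room
  for both.\<close>

lemma integral_periodic_shift:
  fixes p :: "real \<Rightarrow> real"
  assumes cont: "continuous_on UNIV p" and per: "\<And>x. p (x + 1) = p x"
  shows "integral {0..1} (\<lambda>s. p (s + \<alpha>)) = integral {0..1} p"
proof -
  define b where "b = \<bar>\<alpha>\<bar> + 2"
  obtain A where A: "\<And>x. x \<in> {-b..b} \<Longrightarrow> (A has_vector_derivative p x) (at x within {-b..b})"
    using antiderivative_continuous[of "-b" b p] cont continuous_on_subset by (metis subset_UNIV)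
  have A': "(A has_real_derivative p x) (at x)" if "x \<in> {-b<..<b}" for x
  proof -
    have "at x within {-b..b} = at x" using that by (intro at_within_interior) auto
    then show ?thesis using A[of x] that by (simp add: has_real_derivative_iff_has_vector_derivative)
  qed
  have int: "integral {0..1} (\<lambda>s. p (s + \<beta>)) = A (1 + \<beta>) - A (0 + \<beta>)" if "\<bar>\<beta>\<bar> \<le> \<bar>\<alpha>\<bar>" for \<beta>
  proof (rule integral_unique, rule fundamental_theorem_of_calculus)
    fix x :: real assume x: "x \<in> {0..1}"
    then have "x + \<beta> \<in> {-b<..<b}" using that by (auto simp: b_def)
    then have "(A has_real_derivative p (x + \<beta>)) (at (x + \<beta>))" by (rule A')
    then have "((\<lambda>s. A (s + \<beta>)) has_real_derivative p (x + \<beta>)) (at x)" by (simp add: DERIV_shift)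
    then show "((\<lambda>s. A (s + \<beta>)) has_vector_derivative p (x + \<beta>)) (at x within {0..1})"
      using has_field_derivative_at_within has_real_derivative_iff_has_vector_derivative by blast
  qed simp
  have "A (1 + \<alpha>) - A (0 + \<alpha>) = A (1 + 0) - A (0 + 0)"
  proof -
    have der: "((\<lambda>x. A (1 + x) - A (0 + x)) has_real_derivative 0) (at x within {-\<bar>\<alpha>\<bar>..\<bar>\<alpha>\<bar>})" if "x \<in> {-\<bar>\<alpha>\<bar>..\<bar>\<alpha>\<bar>}" for x
    proof -
      have "(A has_real_derivative p (x + 1)) (at (x + 1))" "(A has_real_derivative p x) (at x)"
        using that by (auto intro!: A' simp: b_def)
      then have "((\<lambda>x. A (x + 1) - A x) has_real_derivative p (x + 1) - p x) (at x)"
        by (intro DERIV_diff) (simp_all add: DERIV_shift)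
      then have "((\<lambda>x. A (1 + x) - A (0 + x)) has_real_derivative 0) (at x)" unfolding per by (simp add: add.commute)
      then show ?thesis by (rule has_field_derivative_at_within)
    qed
    have "\<exists>c. \<forall>x\<in>{-\<bar>\<alpha>\<bar>..\<bar>\<alpha>\<bar>}. A (1 + x) - A (0 + x) = c"
      by (rule has_field_derivative_zero_constant[OF _ der]) auto
    then obtain c where c: "\<And>x. x \<in> {-\<bar>\<alpha>\<bar>..\<bar>\<alpha>\<bar>} \<Longrightarrow> A (1 + x) - A (0 + x) = c" by blast
    have "\<alpha> \<in> {-\<bar>\<alpha>\<bar>..\<bar>\<alpha>\<bar>}" "0 \<in> {-\<bar>\<alpha>\<bar>..\<bar>\<alpha>\<bar>}" by auto
    then show ?thesis using c by metis
  qed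
  then show ?thesis using int[of \<alpha>] int[of 0] by simp
qed

section \<open>Integrals over the torus in lattice coordinates\<close>

context period_lattice
begin

definition covolume :: real where "covolume = \<bar>Im (cnj \<omega>1 * \<omega>2)\<bar>"

lemma covolume_pos: "covolume > 0" using Im_nonzero by (simp add: covolume_def)

definition param :: "real \<Rightarrow> real \<Rightarrow> complex" where "param s t = of_real s * \<omega>1 + of_real t * \<omega>2"

lemma param_coord: "param (coord1 z) (coord2 z) = z"
  unfolding param_def by (rule coord_decomp[symmetric])

lemma borel_P [measurable]: "P \<in> sets borel"
proof -
  have [measurable]: "coord1 \<in> borel_measurable borel" "coord2 \<in> borel_measurable borel"
    using continuous_on_coord by (auto intro: borel_measurable_continuous_onI)
  have "P = {z \<in> space borel. 0 \<le> coord1 z \<and> coord1 z < 1 \<and> 0 \<le> coord2 z \<and> coord2 z < 1}"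
    by (auto simp: fund_iff)
  also have "\<dots> \<in> sets borel" by measurable
  finally show ?thesis .
qed

lemma P_subset_cball: "P \<subseteq> cball 0 (norm \<omega>1 + norm \<omega>2)"
  using norm_fund_le by auto

lemma set_integrable_P:
  fixes u :: "complex \<Rightarrow> real"
  assumes "continuous_on UNIV u" shows "set_integrable lborel P u"
proof -
  have "set_integrable lborel (cball 0 (norm \<omega>1 + norm \<omega>2)) u"
    unfolding set_integrable_def
    by (rule borel_integrable_compact) (use assms in \<open>auto intro: continuous_on_subset\<close>)
  then show ?thesis by (rule set_integrable_subset) (use P_subset_cball in auto)
qed

definition unit_square :: "complex set" where
  "unit_square = {z. 0 \<le> Re z \<and> Re z < 1 \<and> 0 \<le> Im z \<and> Im z < 1}"

lemma borel_unit_square [measurable]: "unit_square \<in> sets borel"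
proof -
  have "unit_square = {z \<in> space borel. 0 \<le> Re z \<and> Re z < 1 \<and> 0 \<le> Im z \<and> Im z < 1}"
    by (auto simp: unit_square_def)
  also have "\<dots> \<in> sets borel" by measurable
  finally show ?thesis .
qed

lemma set_integrable_unit_square:
  fixes u :: "complex \<Rightarrow> real"
  assumes "continuous_on UNIV u" shows "set_integrable lborel unit_square u"
proof -
  have sub: "unit_square \<subseteq> cbox 0 (1 + \<i>)" by (auto simp: unit_square_def in_cbox_complex_iff)
  have "set_integrable lborel (cbox 0 (1 + \<i>)) u"
    unfolding set_integrable_def
    by (rule borel_integrable_compact) (use assms in \<open>auto intro: continuous_on_subset\<close>)
  then show ?thesis by (rule set_integrable_subset) (use sub in auto)
qed

text \<open>The area formula with exactly one preimage, for the linear map taking the unit square to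
  the fundamental parallelogram.\<close>

lemma torus_integral_unit_square:
  assumes cont: "continuous_on UNIV u"
  shows "torus_integral \<omega>1 \<omega>2 u = covolume * (LINT z:unit_square|lborel. u (param (Re z) (Im z)))"
proof -
  let ?lin = "\<lambda>z. param (Re z) (Im z)"
  have lin_cont: "continuous_on UNIV ?lin" unfolding param_def by (intro continuous_intros)
  have pos: "(LINT z:P|lborel. v z) = covolume * (LINT z:unit_square|lborel. v (?lin z))"
    if v: "continuous_on UNIV v" "\<And>z. z \<in> P \<Longrightarrow> 0 \<le> v z" for v :: "complex \<Rightarrow> real"
  proof -
    define f where "f z = indicator P z *\<^sub>R v z" for z
    have fint: "integrable lborel f" using set_integrable_P[OF v(1)] by (simp add: set_integrable_def f_def[abs_def])
    have f0: "f z \<ge> 0" for z using v(2) by (simp add: f_def indicator_def)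
    have vl: "continuous_on UNIV (\<lambda>z. v (?lin z))" by (rule continuous_on_compose2[OF v(1) lin_cont]) auto
    have [measurable]: "(\<lambda>z. v (?lin z)) \<in> borel_measurable borel" using vl by (rule borel_measurable_continuous_onI)
    have inP: "?lin z \<in> P \<longleftrightarrow> z \<in> unit_square" for z
      unfolding fund_iff by (simp add: unit_square_def param_def)
    have der: "(?lin has_derivative ?lin) (at z)" for z
      unfolding param_def by (auto intro!: derivative_eq_intros)
    have inj: "inj ?lin"
    proof (rule injI)
      fix x y assume "?lin x = ?lin y"
      then have "coord1 (?lin x) = coord1 (?lin y)" "coord2 (?lin x) = coord2 (?lin y)" by simp_all
      then show "x = y" by (simp add: param_def complex_eq_iff)
    qed
    have jac: "\<bar>jac ?lin\<bar> = covolume" by (simp add: jac_def param_def covolume_def mult.commute)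
    have meas: "(\<lambda>z. ennreal (\<bar>jac ?lin\<bar> * f (?lin z)) * indicator unit_square z) \<in> borel_measurable borel"
    proof -
      have "(\<lambda>z. ennreal (\<bar>jac ?lin\<bar> * f (?lin z)) * indicator unit_square z)
        = (\<lambda>z. ennreal (covolume * v (?lin z)) * indicator unit_square z)"
        unfolding jac by (auto simp: fun_eq_iff f_def inP indicator_def)
      then show ?thesis by simp
    qed
    have fib: "{x \<in> unit_square. ?lin x = w} = (if w \<in> P then {Complex (coord1 w) (coord2 w)} else {})" for w
    proof -
      have "x = Complex (coord1 w) (coord2 w)" if "?lin x = w" for x
        unfolding that[symmetric] by (simp add: param_def)
      moreover have "?lin (Complex (coord1 w) (coord2 w)) = w" by (simp add: param_coord)
      moreover have "Complex (coord1 w) (coord2 w) \<in> unit_square \<longleftrightarrow> w \<in> P" by (simp add: unit_square_def fund_iff)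
      ultimately show ?thesis using inP by auto
    qed
    note area = area_bounds_complex[OF borel_unit_square der exI[of _ "1::real"] fint f0 meas, where k = 1]
    have inj1: "0 < (1::real) \<and> inj_on ?lin (ball x 1)" for x using inj by (auto intro: inj_on_subset)
    have "(\<integral>\<^sup>+z. ennreal (f z) \<partial>lborel) = (\<integral>\<^sup>+z. ennreal (\<bar>jac ?lin\<bar> * f (?lin z)) * indicator unit_square z \<partial>lborel)"
    proof (rule antisym)
      have "of_nat 1 * (\<integral>\<^sup>+z. ennreal (f z) \<partial>lborel) \<le> (\<integral>\<^sup>+z. ennreal (\<bar>jac ?lin\<bar> * f (?lin z)) * indicator unit_square z \<partial>lborel)"
      proof (rule area(2))
        fix w assume "f w \<noteq> 0"
        then have "w \<in> P" by (auto simp: f_def indicator_def split: if_splits)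
        then show "\<exists>A. A \<subseteq> {x \<in> unit_square. ?lin x = w} \<and> finite A \<and> card A = 1"
          unfolding fib by (intro exI[of _ "{Complex (coord1 w) (coord2 w)}"]) auto
      qed (use inj1 in auto)
      then show "(\<integral>\<^sup>+z. ennreal (f z) \<partial>lborel) \<le> (\<integral>\<^sup>+z. ennreal (\<bar>jac ?lin\<bar> * f (?lin z)) * indicator unit_square z \<partial>lborel)" by simp
      have "(\<integral>\<^sup>+z. ennreal (\<bar>jac ?lin\<bar> * f (?lin z)) * indicator unit_square z \<partial>lborel) \<le> of_nat 1 * (\<integral>\<^sup>+z. ennreal (f z) \<partial>lborel)"
        by (rule area(1)) (use inj1 in \<open>auto simp: fib\<close>)
      then show "(\<integral>\<^sup>+z. ennreal (\<bar>jac ?lin\<bar> * f (?lin z)) * indicator unit_square z \<partial>lborel) \<le> (\<integral>\<^sup>+z. ennreal (f z) \<partial>lborel)" by simp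
    qed
    also have "\<dots> = (\<integral>\<^sup>+z. ennreal (covolume * (indicator unit_square z *\<^sub>R v (?lin z))) \<partial>lborel)"
      unfolding jac by (intro nn_integral_cong) (auto simp: f_def inP indicator_def)
    finally have "(\<integral>z. f z \<partial>lborel) = (\<integral>z. covolume * (indicator unit_square z *\<^sub>R v (?lin z)) \<partial>lborel)"
      using fint f0 set_integrable_unit_square[OF vl] covolume_pos v(2) inP
      by (subst (1 2) integral_eq_nn_integral) (auto simp: indicator_def)
    then show ?thesis by (simp add: set_lebesgue_integral_def f_def)
  qed
  have ul: "continuous_on UNIV (\<lambda>z. u (?lin z))" by (rule continuous_on_compose2[OF cont lin_cont]) auto
  \<comment> \<open>The area formula treats nonnegative functions, so a constant M that makes u + M
    nonnegative on the parallelogram is added and afterwards subtracted.\<close>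
  have "compact (u ` cball 0 (norm \<omega>1 + norm \<omega>2))"
    using cont by (intro compact_continuous_image) (auto intro: continuous_on_subset)
  then obtain M where M: "\<And>z. z \<in> cball 0 (norm \<omega>1 + norm \<omega>2) \<Longrightarrow> \<bar>u z\<bar> \<le> M"
    using compact_imp_bounded bounded_iff by (metis image_eqI real_norm_def)
  have nn: "0 \<le> u z + M" if "z \<in> P" for z using M[of z] that P_subset_cball by force
  have M0: "0 \<le> M" using M[of 0] by (smt (verit) centre_in_cball norm_ge_zero)
  have 1: "(LINT z:P|lborel. u z + M) = covolume * (LINT z:unit_square|lborel. u (?lin z) + M)"
    by (rule pos) (use cont nn in \<open>auto intro!: continuous_intros\<close>)
  have 2: "(LINT z:P|lborel. M) = covolume * (LINT z:unit_square|lborel. M)"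
    by (rule pos) (use M0 in auto)
  have "(LINT z:P|lborel. u z + M) = (LINT z:P|lborel. u z) + (LINT z:P|lborel. M)"
    by (intro set_integral_add set_integrable_P cont continuous_on_const)
  moreover have "(LINT z:unit_square|lborel. u (?lin z) + M) = (LINT z:unit_square|lborel. u (?lin z)) + (LINT z:unit_square|lborel. M)"
    by (intro set_integral_add set_integrable_unit_square ul continuous_on_const)
  ultimately show ?thesis using 1 2 by (simp add: torus_integral_def algebra_simps)
qed

lemma unit_square_cbox:
  fixes w :: "complex \<Rightarrow> real"
  assumes cont: "continuous_on UNIV w"
  shows "(LINT z:unit_square|lborel. w z) = integral (cbox (0, 0) (1, 1)) (\<lambda>(s, t). w (Complex s t))"
proof -
  let ?c = "\<lambda>(s, t). Complex s t"
  have cc: "continuous_on UNIV ?c" by (auto simp: Complex_eq case_prod_beta intro!: continuous_intros)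
  then have m: "?c \<in> borel_measurable borel" by (rule borel_measurable_continuous_onI)
  have wc: "continuous_on UNIV (\<lambda>x. w (?c x))" by (rule continuous_on_compose2[OF cont cc]) auto
  have [measurable]: "w \<in> borel_measurable borel" using cont by (rule borel_measurable_continuous_onI)
  define Q where "Q = {(s, t). 0 \<le> s \<and> s < (1::real) \<and> 0 \<le> t \<and> t < (1::real)}"
  have sub: "Q \<subseteq> cbox (0, 0) (1, 1)" by (auto simp: Q_def)
  have Qb: "Q \<in> sets borel"
  proof -
    have "Q = {x \<in> space borel. 0 \<le> fst x \<and> fst x < 1 \<and> 0 \<le> snd x \<and> snd x < 1}" by (auto simp: Q_def)
    also have "\<dots> \<in> sets borel" unfolding borel_prod[symmetric] by measurable
    finally show ?thesis .
  qed
  have "set_integrable lborel (cbox (0, 0) (1, 1)) (\<lambda>x. w (?c x))"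
    unfolding set_integrable_def
    by (rule borel_integrable_compact) (use wc in \<open>auto intro: continuous_on_subset\<close>)
  then have Qi: "set_integrable lborel Q (\<lambda>x. w (?c x))"
    by (rule set_integrable_subset) (use sub Qb in auto)
  have "(LINT z:unit_square|lborel. w z) = (\<integral>x. indicator unit_square (?c x) *\<^sub>R w (?c x) \<partial>lborel)"
    unfolding set_lebesgue_integral_def using m
    by (subst lborel_complex_prod, subst integral_distr) auto
  also have "\<dots> = (LINT x:Q|lborel. w (?c x))"
    unfolding set_lebesgue_integral_def
    by (intro Bochner_Integration.integral_cong) (auto simp: Q_def unit_square_def indicator_def)
  also have "\<dots> = integral Q (\<lambda>x. w (?c x))" using Qi by (rule set_borel_integral_eq_integral)
  also have "\<dots> = integral (cbox (0, 0) (1, 1)) (\<lambda>x. w (?c x))"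
  proof (rule integral_subset_negligible[OF sub])
    have "box (0, 0) (1, 1) \<subseteq> Q" by (auto simp: Q_def mem_box Basis_prod_def)
    then show "negligible (cbox (0, 0) (1, 1) - Q)"
      using negligible_subset[OF negligible_frontier_interval[of "(0::real, 0::real)" "(1, 1)"]] by blast
  qed
  also have "(\<lambda>x. w (?c x)) = (\<lambda>(s, t). w (Complex s t))" by auto
  finally show ?thesis .
qed

lemma continuous_param_compose:
  assumes "continuous_on UNIV u"
  shows "continuous_on S (\<lambda>(s, t). u (param s t))"
  unfolding case_prod_beta param_def
  by (rule continuous_on_compose2[OF assms]) (auto intro!: continuous_intros)

lemma torus_integral_iterated:
  assumes cont: "continuous_on UNIV u"
  shows "torus_integral \<omega>1 \<omega>2 u = covolume * integral (cbox 0 1) (\<lambda>s. integral (cbox 0 1) (\<lambda>t. u (param s t)))"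
    and "torus_integral \<omega>1 \<omega>2 u = covolume * integral (cbox 0 1) (\<lambda>t. integral (cbox 0 1) (\<lambda>s. u (param s t)))"
    and "torus_integral \<omega>1 \<omega>2 u = covolume * integral (cbox (0, 0) (1, 1)) (\<lambda>(s, t). u (param s t))"
proof -
  have c1: "continuous_on UNIV (\<lambda>z. u (param (Re z) (Im z)))"
    unfolding param_def by (rule continuous_on_compose2[OF cont]) (auto intro!: continuous_intros)
  show 1: "torus_integral \<omega>1 \<omega>2 u = covolume * integral (cbox (0, 0) (1, 1)) (\<lambda>(s, t). u (param s t))"
    unfolding torus_integral_unit_square[OF cont] unit_square_cbox[OF c1] by simp
  note cp = continuous_param_compose[OF cont, of "cbox (0, 0) (1, 1)"]
  show 2: "torus_integral \<omega>1 \<omega>2 u = covolume * integral (cbox 0 1) (\<lambda>s. integral (cbox 0 1) (\<lambda>t. u (param s t)))"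
    unfolding 1 using integral_prod_continuous[OF cp] by simp
  show "torus_integral \<omega>1 \<omega>2 u = covolume * integral (cbox 0 1) (\<lambda>t. integral (cbox 0 1) (\<lambda>s. u (param s t)))"
    unfolding 2 using integral_swap_continuous[OF cp] by simp
qed

lemma torus_area_eq: "torus_area \<omega>1 \<omega>2 = covolume"
proof -
  have "torus_integral \<omega>1 \<omega>2 (\<lambda>_. 1) = measure lborel P"
    by (simp add: torus_integral_def set_lebesgue_integral_def)
  moreover have "torus_integral \<omega>1 \<omega>2 (\<lambda>_. 1) = covolume"
    by (subst torus_integral_iterated(1)) auto
  ultimately show ?thesis by (simp add: torus_area_def)
qed

lemma param_shift: "param (s + 1) t = param s t + \<omega>1" "param s (t + 1) = param s t + \<omega>2"
  by (simp_all add: param_def algebra_simps)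

text \<open>Along either period the inner integral is an increment of u over a full period and
  vanishes; a general direction is a real combination of the two. This is the divergence theorem on
  the torus.\<close>

lemma torus_integral_derivative:
  fixes u :: "complex \<Rightarrow> real"
  assumes der: "\<And>z. (u has_derivative u' z) (at z)"
    and cont: "\<And>v. continuous_on UNIV (\<lambda>z. u' z v)"
    and per: "periodic \<omega>1 \<omega>2 u"
  shows "torus_integral \<omega>1 \<omega>2 (\<lambda>z. u' z v) = 0"
proof -
  have perz: "u (z + \<omega>1) = u z" "u (z + \<omega>2) = u z" for z
    using per periods_in_lattice by (auto simp: periodic_def)
  have 1: "torus_integral \<omega>1 \<omega>2 (\<lambda>z. u' z \<omega>1) = 0"
  proof -
    have "integral (cbox 0 1) (\<lambda>s. u' (param s t) \<omega>1) = u (param 1 t) - u (param 0 t)" for t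
    proof (rule integral_unique, unfold box_real, rule fundamental_theorem_of_calculus)
      fix s
      have "((\<lambda>s. param s t) has_derivative (\<lambda>h. of_real h * \<omega>1)) (at s within {0..1})"
        unfolding param_def by (auto intro!: derivative_eq_intros)
      from has_derivative_compose[OF this der[of "param s t"]]
      have "((\<lambda>s. u (param s t)) has_derivative (\<lambda>h. u' (param s t) (of_real h * \<omega>1))) (at s within {0..1})" .
      moreover have "u' (param s t) (of_real h * \<omega>1) = h *\<^sub>R u' (param s t) \<omega>1" for h
        using linear_scale[OF has_derivative_linear[OF der[of "param s t"]], of h \<omega>1] by (simp add: scaleR_conv_of_real)
      ultimately show "((\<lambda>s. u (param s t)) has_vector_derivative u' (param s t) \<omega>1) (at s within {0..1})"
        by (simp add: has_vector_derivative_def)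
    qed simp
    moreover have "u (param 1 t) = u (param 0 t)" for t using perz(1)[of "param 0 t"] param_shift(1)[of 0 t] by simp
    ultimately show ?thesis by (subst torus_integral_iterated(2)[OF cont]) simp
  qed
  have 2: "torus_integral \<omega>1 \<omega>2 (\<lambda>z. u' z \<omega>2) = 0"
  proof -
    have "integral (cbox 0 1) (\<lambda>t. u' (param s t) \<omega>2) = u (param s 1) - u (param s 0)" for s
    proof (rule integral_unique, unfold box_real, rule fundamental_theorem_of_calculus)
      fix t
      have "((\<lambda>t. param s t) has_derivative (\<lambda>h. of_real h * \<omega>2)) (at t within {0..1})"
        unfolding param_def by (auto intro!: derivative_eq_intros)
      from has_derivative_compose[OF this der[of "param s t"]]
      have "((\<lambda>t. u (param s t)) has_derivative (\<lambda>h. u' (param s t) (of_real h * \<omega>2))) (at t within {0..1})" .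
      moreover have "u' (param s t) (of_real h * \<omega>2) = h *\<^sub>R u' (param s t) \<omega>2" for h
        using linear_scale[OF has_derivative_linear[OF der[of "param s t"]], of h \<omega>2] by (simp add: scaleR_conv_of_real)
      ultimately show "((\<lambda>t. u (param s t)) has_vector_derivative u' (param s t) \<omega>2) (at t within {0..1})"
        by (simp add: has_vector_derivative_def)
    qed simp
    moreover have "u (param s 1) = u (param s 0)" for s using perz(2)[of "param s 0"] param_shift(2)[of s 0] by simp
    ultimately show ?thesis by (subst torus_integral_iterated(1)[OF cont]) simp
  qed
  have lin: "u' z v = coord1 v * u' z \<omega>1 + coord2 v * u' z \<omega>2" for z
  proof -
    have l: "linear (u' z)" using der by (rule has_derivative_linear)
    have "u' z v = u' z (coord1 v *\<^sub>R \<omega>1 + coord2 v *\<^sub>R \<omega>2)"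
      using coord_decomp[of v] by (simp add: scaleR_conv_of_real)
    then show ?thesis by (simp add: linear_add[OF l] linear_scale[OF l])
  qed
  have "torus_integral \<omega>1 \<omega>2 (\<lambda>z. u' z v) = coord1 v * torus_integral \<omega>1 \<omega>2 (\<lambda>z. u' z \<omega>1)
      + coord2 v * torus_integral \<omega>1 \<omega>2 (\<lambda>z. u' z \<omega>2)"
    unfolding lin torus_integral_def
    by (subst set_integral_add(2)) (auto intro!: set_integrable_P continuous_intros cont)
  then show ?thesis by (simp add: 1 2)
qed

text \<open>A translation splits into shifts along the two periods, each of which is a one-variable
  shift in the inner integral of a suitable iterated integral.\<close>

lemma torus_integral_translate:
  assumes cont: "continuous_on UNIV u" and per: "periodic \<omega>1 \<omega>2 u"
  shows "torus_integral \<omega>1 \<omega>2 (\<lambda>z. u (z + a)) = torus_integral \<omega>1 \<omega>2 u"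
proof -
  have ca: "continuous_on UNIV (\<lambda>z. u (z + b))" for b
    by (rule continuous_on_compose2[OF cont]) (auto intro!: continuous_intros)
  have perz: "u (z + \<omega>1) = u z" "u (z + \<omega>2) = u z" for z
    using per periods_in_lattice by (auto simp: periodic_def)
  have s1: "torus_integral \<omega>1 \<omega>2 (\<lambda>z. u (z + of_real \<alpha> * \<omega>1)) = torus_integral \<omega>1 \<omega>2 u" for \<alpha>
  proof -
    have "integral (cbox 0 1) (\<lambda>s. u (param s t + of_real \<alpha> * \<omega>1)) = integral (cbox 0 1) (\<lambda>s. u (param s t))" for t
    proof -
      have "continuous_on UNIV (\<lambda>s. u (param s t))" unfolding param_def
        by (rule continuous_on_compose2[OF cont]) (auto intro!: continuous_intros)
      from integral_periodic_shift[OF this, of \<alpha>] perz(1)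
      have "integral {0..1} (\<lambda>s. u (param (s + \<alpha>) t)) = integral {0..1} (\<lambda>s. u (param s t))"
        by (simp add: param_shift)
      moreover have "param (s + \<alpha>) t = param s t + of_real \<alpha> * \<omega>1" for s by (simp add: param_def algebra_simps)
      ultimately show ?thesis by simp
    qed
    then show ?thesis by (simp add: torus_integral_iterated(2)[OF cont] torus_integral_iterated(2)[OF ca])
  qed
  have s2: "torus_integral \<omega>1 \<omega>2 (\<lambda>z. u (z + b + of_real \<alpha> * \<omega>2)) = torus_integral \<omega>1 \<omega>2 (\<lambda>z. u (z + b))" for \<alpha> b
  proof -
    have "integral (cbox 0 1) (\<lambda>t. u (param s t + b + of_real \<alpha> * \<omega>2)) = integral (cbox 0 1) (\<lambda>t. u (param s t + b))" for s
    proof -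
      have "continuous_on UNIV (\<lambda>t. u (param s t + b))" unfolding param_def
        by (rule continuous_on_compose2[OF cont]) (auto intro!: continuous_intros)
      moreover have "u (param s (t + 1) + b) = u (param s t + b)" for t
        using perz(2)[of "param s t + b"] unfolding param_shift by (simp add: add_ac)
      ultimately have "integral {0..1} (\<lambda>t. u (param s (t + \<alpha>) + b)) = integral {0..1} (\<lambda>t. u (param s t + b))"
        by (rule integral_periodic_shift)
      moreover have "param s (t + \<alpha>) + b = param s t + b + of_real \<alpha> * \<omega>2" for t by (simp add: param_def algebra_simps)
      ultimately show ?thesis by simp
    qed
    moreover have "continuous_on UNIV (\<lambda>z. u (z + b + of_real \<alpha> * \<omega>2))" using ca[of "b + of_real \<alpha> * \<omega>2"] by (simp add: add.assoc)
    ultimately show ?thesis by (simp add: torus_integral_iterated(1)[OF ca] torus_integral_iterated(1))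
  qed
  have "torus_integral \<omega>1 \<omega>2 (\<lambda>z. u (z + a)) = torus_integral \<omega>1 \<omega>2 (\<lambda>z. u (z + of_real (coord1 a) * \<omega>1 + of_real (coord2 a) * \<omega>2))"
    using coord_decomp[of a] by (simp add: add.assoc)
  then show ?thesis unfolding s2 s1 .
qed

lemma torus_integral_nonneg_eq_0:
  assumes cont: "continuous_on UNIV u" and nn: "\<And>z. u z \<ge> 0" and per: "periodic \<omega>1 \<omega>2 u"
    and zero: "torus_integral \<omega>1 \<omega>2 u = 0"
  shows "u z = 0"
proof -
  have "integral (cbox (0, 0) (1, 1)) (\<lambda>(s, t). u (param s t)) = 0"
    using zero torus_integral_iterated(3)[OF cont] covolume_pos by simp
  then have 0: "\<forall>x\<in>cbox (0, 0) (1, 1). (\<lambda>(s, t). u (param s t)) x = 0"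
  proof (subst (asm) integral_cbox_eq_0_iff[OF continuous_param_compose[OF cont]])
    show "box (0::real, 0::real) (1, 1) \<noteq> {}" by (auto simp: box_eq_empty Basis_prod_def)
    show "0 \<le> (case x of (s, t) \<Rightarrow> u (param s t))" for x using nn by (cases x) simp
  qed
  obtain l where l: "l \<in> \<Lambda>" "z - l \<in> P" by (rule fund_reduce)
  then have "(coord1 (z - l), coord2 (z - l)) \<in> cbox (0, 0) (1, 1)" by (simp add: fund_iff)
  from bspec[OF 0 this] have "u (param (coord1 (z - l)) (coord2 (z - l))) = 0" by simp
  then have "u (z - l) = 0" by (simp add: param_coord)
  then show ?thesis using per l(1) unfolding periodic_def by (metis diff_add_cancel)
qed

lemma torus_integral_nonneg: "(\<And>z. v z \<ge> 0) \<Longrightarrow> torus_integral \<omega>1 \<omega>2 v \<ge> 0"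
  unfolding torus_integral_def set_lebesgue_integral_def by (intro Bochner_Integration.integral_nonneg) auto

end

subsection \<open>Degree and the repelling fixed points\<close>

lemma DERIV_max_0_square: "((\<lambda>x::real. (max 0 x)\<^sup>2) has_real_derivative 2 * max 0 x) (at x)"
proof -
  consider "x < 0" | "x = 0" | "x > 0" by linarith
  then show ?thesis
  proof cases
    case 1
    have "((\<lambda>x::real. 0) has_real_derivative 2 * max 0 x) (at x)" using 1 by simp
    then show ?thesis by (rule has_field_derivative_transform_within_open[of _ _ _ "{..<0}"]) (use 1 in auto)
  next
    case 3
    have "((\<lambda>x::real. x\<^sup>2) has_real_derivative 2 * max 0 x) (at x)" using 3 by (auto intro!: derivative_eq_intros)
    then show ?thesis by (rule has_field_derivative_transform_within_open[of _ _ _ "{0<..}"]) (use 3 in auto)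
  next
    case 2
    have "((\<lambda>y::real. (max 0 y)\<^sup>2 / y) \<longlongrightarrow> 0) (at 0)"
    proof (rule Lim_null_comparison)
      show "eventually (\<lambda>y::real. norm ((max 0 y)\<^sup>2 / y) \<le> \<bar>y\<bar>) (at 0)"
        by (intro always_eventually allI) (auto simp: max_def power2_eq_square)
      show "((\<lambda>y::real. \<bar>y\<bar>) \<longlongrightarrow> 0) (at 0)" by (auto intro!: tendsto_eq_intros)
    qed
    then show ?thesis using 2 by (simp add: has_field_derivative_iff)
  qed
qed

text \<open>The bump is a product of one-variable profiles supported on [-e, e]. In this form the
  difference of two translates along the real axis has an explicit primitive in x.\<close>

locale bump =
  fixes e :: real
  assumes e_pos: "e > 0"
begin

definition \<beta> :: "real \<Rightarrow> real" where "\<beta> t = (max 0 (e\<^sup>2 - t\<^sup>2))\<^sup>2"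
definition \<beta>' :: "real \<Rightarrow> real" where "\<beta>' t = 2 * max 0 (e\<^sup>2 - t\<^sup>2) * (- 2 * t)"
text \<open>An antiderivative of \<beta>, constant on either side of [-e, e]; differences of its
  shifts have compact support. The lower limit lies strictly left of the support, so that every t
  \<ge> -e is interior to the interval on which the fundamental theorem is applied.\<close>

definition B :: "real \<Rightarrow> real" where "B t = integral {- e - 1..t} \<beta>"

lemma \<beta>_nonneg: "\<beta> t \<ge> 0" by (simp add: \<beta>_def)

lemma DERIV_\<beta>: "(\<beta> has_real_derivative \<beta>' t) (at t)"
  unfolding \<beta>_def \<beta>'_def by (rule DERIV_chain2[OF DERIV_max_0_square]) (auto intro!: derivative_eq_intros)

lemma continuous_\<beta>: "continuous_on S \<beta>" and continuous_\<beta>': "continuous_on S \<beta>'"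
  unfolding \<beta>_def[abs_def] \<beta>'_def[abs_def] by (auto intro!: continuous_intros)

lemma \<beta>_eq_0: "\<bar>t\<bar> \<ge> e \<Longrightarrow> \<beta> t = 0"
proof -
  assume "\<bar>t\<bar> \<ge> e"
  then have "e\<^sup>2 \<le> \<bar>t\<bar>\<^sup>2" using e_pos by (intro power_mono) auto
  then show ?thesis by (simp add: \<beta>_def)
qed

lemma B_left: "t \<le> - e \<Longrightarrow> B t = 0"
proof -
  assume "t \<le> - e"
  then have "B t = integral {- e - 1..t} (\<lambda>_. 0)" unfolding B_def
    using e_pos by (intro integral_cong \<beta>_eq_0) auto
  then show ?thesis by simp
qed

lemma DERIV_B: "(B has_real_derivative \<beta> t) (at t)"
proof (cases "t < - e")
  case True
  have "((\<lambda>_. 0) has_real_derivative \<beta> t) (at t)" using True e_pos \<beta>_eq_0[of t] by simp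
  then show ?thesis
    by (rule has_field_derivative_transform_within_open[of _ _ _ "{..<- e}"]) (use True B_left in auto)
next
  case False
  have "(B has_real_derivative \<beta> t) (at t within {- e - 1..t + 1})"
    unfolding B_def by (rule integral_has_real_derivative[OF continuous_\<beta>]) (use False in auto)
  moreover have "at t within {- e - 1..t + 1} = at t" using False by (intro at_within_interior) auto
  ultimately show ?thesis by simp
qed

lemma B_right: "t \<ge> e \<Longrightarrow> B t = B e"
proof -
  assume t: "t \<ge> e"
  have "\<exists>c. \<forall>x\<in>{e..}. B x = c"
  proof (rule has_field_derivative_zero_constant)
    fix x assume "x \<in> {e..}"
    then have "\<beta> x = 0" using e_pos by (intro \<beta>_eq_0) auto
    then show "(B has_real_derivative 0) (at x within {e..})"
      using DERIV_B[of x] has_field_derivative_at_within by metis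
  qed auto
  then show ?thesis using t by auto
qed

definition \<eta> :: "complex \<Rightarrow> real" where "\<eta> w = \<beta> (Re w) * \<beta> (Im w)"

lemma \<eta>_nonneg: "\<eta> w \<ge> 0" by (simp add: \<eta>_def \<beta>_nonneg)

lemma \<eta>_eq_0: "norm w \<ge> 2 * e \<Longrightarrow> \<eta> w = 0"
proof -
  assume "norm w \<ge> 2 * e"
  then have "\<bar>Re w\<bar> \<ge> e \<or> \<bar>Im w\<bar> \<ge> e" using cmod_le[of w] by linarith
  then show ?thesis using \<beta>_eq_0 by (auto simp: \<eta>_def)
qed

lemma continuous_\<eta>: "continuous_on S \<eta>"
  unfolding \<eta>_def[abs_def]
  by (intro continuous_on_mult continuous_on_compose2[OF continuous_\<beta>[of UNIV]]) (auto intro!: continuous_intros)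

lemma integrable_\<eta>: "integrable lborel (\<lambda>w. \<eta> (w - c))"
proof -
  have c: "continuous_on (cball c (2 * e)) (\<lambda>w. \<eta> (w - c))"
    by (rule continuous_on_compose2[OF continuous_\<eta>[of UNIV]]) (auto intro!: continuous_intros)
  have "integrable lborel (\<lambda>w. indicator (cball c (2 * e)) w *\<^sub>R \<eta> (w - c))"
    by (rule borel_integrable_compact[OF compact_cball c])
  moreover have "(\<lambda>w. indicator (cball c (2 * e)) w *\<^sub>R \<eta> (w - c)) = (\<lambda>w. \<eta> (w - c))"
    using \<eta>_eq_0 by (auto simp: fun_eq_iff indicator_def dist_norm norm_minus_commute)
  ultimately show ?thesis by simp
qed

definition mass :: real where "mass = (\<integral>w. \<eta> w \<partial>lborel)"

lemma nn_integral_\<eta>: "(\<integral>\<^sup>+w. ennreal (\<eta> (w - c)) \<partial>lborel) = ennreal mass"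
proof -
  have m: "\<eta> \<in> borel_measurable borel" using continuous_\<eta> by (rule borel_measurable_continuous_onI)
  have "(\<integral>\<^sup>+w. ennreal (\<eta> (w - c)) \<partial>lborel) = (\<integral>\<^sup>+w. ennreal (\<eta> (w - c)) \<partial>(distr lborel borel ((+) c)))"
    by (simp add: lborel_distr_plus)
  also have "\<dots> = (\<integral>\<^sup>+w. ennreal (\<eta> w) \<partial>lborel)"
    using m by (subst nn_integral_distr) auto
  also have "\<dots> = ennreal mass"
    unfolding mass_def using integrable_\<eta>[of 0] \<eta>_nonneg by (subst nn_integral_eq_integral) auto
  finally show ?thesis .
qed

lemma mass_pos: "mass > 0"
proof -
  let ?a = "Complex (e / 2) (e / 2)"
  let ?k = "((3 / 4 * e\<^sup>2)\<^sup>2)\<^sup>2"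
  have "?k * indicator (cbox (- ?a) ?a) w \<le> \<eta> w" for w
  proof (cases "w \<in> cbox (- ?a) ?a")
    case True
    then have "\<bar>Re w\<bar> \<le> e / 2" "\<bar>Im w\<bar> \<le> e / 2" by (auto simp: in_cbox_complex_iff abs_le_iff)
    then have "(Re w)\<^sup>2 \<le> (e / 2)\<^sup>2" "(Im w)\<^sup>2 \<le> (e / 2)\<^sup>2" using abs_le_square_iff e_pos by fastforce+
    then have "3 / 4 * e\<^sup>2 \<le> e\<^sup>2 - (Re w)\<^sup>2" "3 / 4 * e\<^sup>2 \<le> e\<^sup>2 - (Im w)\<^sup>2"
      by (simp_all add: power_divide)
    then have "3 / 4 * e\<^sup>2 \<le> max 0 (e\<^sup>2 - (Re w)\<^sup>2)" "3 / 4 * e\<^sup>2 \<le> max 0 (e\<^sup>2 - (Im w)\<^sup>2)"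
      by (simp_all only: max.coboundedI2)
    then have "(3 / 4 * e\<^sup>2)\<^sup>2 \<le> \<beta> (Re w)" "(3 / 4 * e\<^sup>2)\<^sup>2 \<le> \<beta> (Im w)"
      unfolding \<beta>_def by (auto intro!: power_mono)
    then have "(3 / 4 * e\<^sup>2)\<^sup>2 * (3 / 4 * e\<^sup>2)\<^sup>2 \<le> \<eta> w" unfolding \<eta>_def by (intro mult_mono) (auto simp: \<beta>_nonneg)
    then show ?thesis using True by (simp add: power2_eq_square)
  qed (simp add: \<eta>_nonneg)
  then have "(\<integral>\<^sup>+w. ennreal (?k * indicator (cbox (- ?a) ?a) w) \<partial>lborel) \<le> ennreal mass"
    unfolding nn_integral_\<eta>[of 0, symmetric] by (intro nn_integral_mono) (simp add: ennreal_leI)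
  moreover have "(\<integral>\<^sup>+w. ennreal (?k * indicator (cbox (- ?a) ?a) w) \<partial>lborel) = ennreal (?k * (e * e))"
  proof -
    have "emeasure lborel (cbox (- ?a) ?a) = ennreal (e * e)"
      using e_pos by (subst emeasure_lborel_cbox) (auto simp: Basis_complex_def)
    then show ?thesis using e_pos
      by (simp add: ennreal_mult'' ennreal_indicator nn_integral_cmult_indicator ennreal_mult)
  qed
  moreover have "?k * (e * e) > 0" using e_pos by simp
  ultimately have X: "ennreal (?k * (e * e)) \<le> ennreal mass" "?k * (e * e) > 0" by simp_all
  show ?thesis
  proof (rule ccontr)
    assume "\<not> mass > 0"
    then have "ennreal mass = 0" by (simp add: ennreal_neg)
    then have "ennreal (?k * (e * e)) = 0" using X(1) by simp
    then have "?k * (e * e) \<le> 0" by (simp only: ennreal_eq_0_iff)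
    then show False using X(2) by linarith
  qed
qed

end

section \<open>Counting the preimages under \<open>h\<close> with orientation\<close>

context torus_map
begin

definition h :: "complex \<Rightarrow> complex" where "h z = z - g z"

definition J :: "complex \<Rightarrow> real" where "J z = 1 - (norm (deriv F z))\<^sup>2"

lemma h_periodic: "l \<in> \<Lambda> \<Longrightarrow> h (z + l) = h z"
  by (simp add: h_def g_add_lattice)

lemma J_periodic: "l \<in> \<Lambda> \<Longrightarrow> J (z + l) = J z"
  by (simp add: J_def deriv_F_periodic)

lemma continuous_on_h: "continuous_on (- \<Lambda>) h"
  unfolding h_def[abs_def] by (intro continuous_intros continuous_on_g)

lemma continuous_on_deriv_F: "continuous_on (- \<Lambda>) (deriv F)"
  by (rule holomorphic_on_imp_continuous_on[OF deriv_F_holo])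

lemma continuous_on_J: "continuous_on (- \<Lambda>) J"
  unfolding J_def[abs_def] by (intro continuous_intros continuous_on_deriv_F)

lemma h_has_derivative:
  assumes "z \<notin> \<Lambda>" shows "(h has_derivative (\<lambda>v. v - cnj (deriv F z * v))) (at z)"
proof -
  have "(F has_derivative (\<lambda>v. deriv F z * v)) (at z)"
    using DERIV_F[OF assms] by (simp add: has_field_derivative_def)
  from bounded_linear.has_derivative[OF bounded_linear_cnj this]
  have "(g has_derivative (\<lambda>v. cnj (deriv F z * v))) (at z)" by (simp add: g_def[abs_def])
  then show ?thesis unfolding h_def[abs_def] by (intro derivative_intros)
qed

lemma jac_h: "jac (\<lambda>v. v - cnj (a * v)) = 1 - (norm a)\<^sup>2"
  unfolding cmod_power2 by (simp add: jac_def power2_eq_square algebra_simps)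

lemma h_locally_injective:
  assumes z: "z \<notin> \<Lambda>" "J z \<noteq> 0"
  obtains r where "r > 0" "ball z r \<subseteq> - \<Lambda>" "inj_on h (ball z r)"
proof -
  define a where "a = deriv F z"
  define k where "k = 1 - (norm a)\<^sup>2"
  have k: "k \<noteq> 0" using z by (simp add: k_def a_def J_def)
  \<comment> \<open>The inverse of the derivative of \<open>h\<close>: with u = v -
    \<open>cnj (a * v)\<close>, the combination u + \<open>cnj a\<close> \<open>cnj u\<close> equals
    (1 - |a|^2) v.\<close>
  define L where "L w = (1 / k) *\<^sub>R (w + cnj a * cnj w)" for w :: complex
  have bl: "bounded_linear L"
    unfolding L_def[abs_def] by (intro bounded_linear_scaleR_right bounded_linear_add bounded_linear_ident
        bounded_linear_mult_right[THEN bounded_linear_compose] bounded_linear_cnj bounded_linear_compose[OF bounded_linear_scaleR_right])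
  have inv: "L \<circ> (\<lambda>v. v - cnj (deriv F z * v)) = id"
  proof (rule ext)
    fix v
    have n: "cnj a * a = of_real ((norm a)\<^sup>2)" by (metis complex_norm_square mult.commute)
    have "(v - cnj (a * v)) + cnj a * cnj (v - cnj (a * v)) = v - (cnj a * a) * v" by (simp add: algebra_simps)
    also have "\<dots> = of_real k * v" unfolding n k_def by (simp add: algebra_simps)
    finally have "L (v - cnj (a * v)) = v" using k by (simp add: L_def scaleR_conv_of_real)
    then show "(L \<circ> (\<lambda>v. v - cnj (deriv F z * v))) v = id v" by (simp add: a_def)
  qed
  have on: "\<exists>d>0. \<forall>x. dist z x < d \<longrightarrow> onorm (\<lambda>v. (v - cnj (deriv F x * v)) - (v - cnj (deriv F z * v))) < \<epsilon>"
    if eps: "\<epsilon> > 0" for \<epsilon> :: real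
  proof -
    have "isCont (deriv F) z" using DERIV_isCont[OF DERIV2_F[OF z(1)]] .
    then obtain d where d: "d > 0" "\<And>x. dist x z < d \<Longrightarrow> dist (deriv F x) (deriv F z) < \<epsilon> / 2"
      using eps unfolding continuous_at_eps_delta by (metis half_gt_zero)
    have "onorm (\<lambda>v. (v - cnj (deriv F x * v)) - (v - cnj (deriv F z * v))) < \<epsilon>" if x: "dist z x < d" for x
    proof -
      have "onorm (\<lambda>v. (v - cnj (deriv F x * v)) - (v - cnj (deriv F z * v))) \<le> \<epsilon> / 2"
      proof (rule onorm_le)
        fix v
        have "(v - cnj (deriv F x * v)) - (v - cnj (deriv F z * v)) = cnj ((deriv F z - deriv F x) * v)"
          by (simp add: algebra_simps)
        then have "norm ((v - cnj (deriv F x * v)) - (v - cnj (deriv F z * v))) = norm (deriv F z - deriv F x) * norm v"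
          by (simp only: complex_mod_cnj norm_mult)
        also have "\<dots> \<le> \<epsilon> / 2 * norm v"
          using d(2)[of x] x by (intro mult_right_mono) (auto simp: dist_commute dist_norm norm_minus_commute)
        finally show "norm ((v - cnj (deriv F x * v)) - (v - cnj (deriv F z * v))) \<le> \<epsilon> / 2 * norm v" .
      qed
      then show ?thesis using \<open>\<epsilon> > 0\<close> by simp
    qed
    then show ?thesis using d(1) by blast
  qed
  have z': "z \<in> - \<Lambda>" using z by simp
  show thesis
    by (rule has_derivative_locally_injective[OF z' open_compl_lattice bl inv _ on, of h]) (use h_has_derivative that in auto)
qed

text \<open>Unlike F, \<open>h\<close> is periodic, so a single radius serves all lattice
  points.\<close>

lemma h_large_near_lattice:
  obtains d where "d > 0" "\<And>z l. l \<in> \<Lambda> \<Longrightarrow> dist z l < d \<Longrightarrow> z \<noteq> l \<Longrightarrow> norm (h z) > M"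
proof -
  obtain d where d: "d > 0" "\<And>z. dist z 0 < d \<Longrightarrow> z \<noteq> 0 \<Longrightarrow> norm (F z) > \<bar>M\<bar> + 1"
    using F_large_near_lattice[of 0 "\<bar>M\<bar> + 1"] by auto
  show thesis
  proof (rule that[of "min d 1"])
    fix z l assume zl: "l \<in> \<Lambda>" "dist z l < min d 1" "z \<noteq> l"
    have "norm (F (z - l)) > \<bar>M\<bar> + 1" using zl by (intro d) (auto simp: dist_norm)
    moreover have "norm (g (z - l)) \<le> norm (z - l) + norm (h (z - l))"
      using norm_triangle_ineq4[of "z - l" "h (z - l)"] by (simp add: h_def)
    moreover have "norm (z - l) < 1" using zl by (simp add: dist_norm)
    moreover have "norm (g (z - l)) = norm (F (z - l))" by (simp add: g_def)
    moreover have "h (z - l) = h z" using h_periodic[OF zl(1), of "z - l"] by simp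
    ultimately show "norm (h z) > M" by simp
  qed (use d in auto)
qed

text \<open>As \<open>h\<close> tends to infinity at the lattice, a compactly supported \<phi> makes
  the product vanish near each lattice point. Extension by 0 is therefore as regular as the product
  elsewhere, however singular k may be.\<close>

definition pullback :: "(complex \<Rightarrow> real) \<Rightarrow> (complex \<Rightarrow> real) \<Rightarrow> complex \<Rightarrow> real" where
  "pullback \<phi> k z = (if z \<in> \<Lambda> then 0 else \<phi> (h z) * k z)"

lemma pullback_vanishes:
  assumes supp: "\<And>w. norm w > M \<Longrightarrow> \<phi> w = 0"
  obtains d where "d > 0" "\<And>z l. l \<in> \<Lambda> \<Longrightarrow> z \<in> ball l d \<Longrightarrow> pullback \<phi> k z = 0"
proof -
  obtain d where d: "d > 0" "\<And>z l. l \<in> \<Lambda> \<Longrightarrow> dist z l < d \<Longrightarrow> z \<noteq> l \<Longrightarrow> norm (h z) > M"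
    using h_large_near_lattice[of M] by metis
  show thesis
  proof (rule that[OF d(1)])
    fix z l assume "l \<in> \<Lambda>" "z \<in> ball l d"
    then show "pullback \<phi> k z = 0"
      using d(2)[of l z] supp[of "h z"] by (auto simp: pullback_def dist_commute)
  qed
qed

lemma continuous_on_vanishing:
  fixes v :: "complex \<Rightarrow> real"
  assumes cont: "continuous_on (- \<Lambda>) v" and d: "d > 0" "\<And>z l. l \<in> \<Lambda> \<Longrightarrow> z \<in> ball l d \<Longrightarrow> v z = 0"
  shows "continuous_on UNIV v"
proof -
  have "continuous_on (\<Union>l\<in>\<Lambda>. ball l d) v"
    by (rule continuous_on_eq[of _ "\<lambda>_. 0"]) (use d(2) in auto)
  then have "continuous_on (- \<Lambda> \<union> (\<Union>l\<in>\<Lambda>. ball l d)) v"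
    using cont open_compl_lattice by (intro continuous_on_open_Un) auto
  moreover have "- \<Lambda> \<union> (\<Union>l\<in>\<Lambda>. ball l d) = UNIV" using d(1) by force
  ultimately show ?thesis by simp
qed

lemma continuous_pullback:
  assumes supp: "\<And>w. norm w > M \<Longrightarrow> \<phi> w = 0" and \<phi>: "continuous_on UNIV \<phi>" and k: "continuous_on (- \<Lambda>) k"
  shows "continuous_on UNIV (pullback \<phi> k)"
proof -
  obtain d where d: "d > 0" "\<And>z l. l \<in> \<Lambda> \<Longrightarrow> z \<in> ball l d \<Longrightarrow> pullback \<phi> k z = 0"
    using pullback_vanishes[of M \<phi> k] supp by metis
  have "continuous_on (- \<Lambda>) (\<lambda>z. \<phi> (h z) * k z)"
    by (intro continuous_on_mult k continuous_on_compose2[OF \<phi> continuous_on_h]) auto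
  then have "continuous_on (- \<Lambda>) (pullback \<phi> k)"
    by (rule continuous_on_eq) (simp add: pullback_def)
  then show ?thesis by (rule continuous_on_vanishing[OF _ d])
qed

text \<open>The integrand is the derivative in direction v of the periodic function \<phi>(h) k, by
  the chain and product rules. Continuity is recorded so that two such integrals can be
  added.\<close>

lemma torus_integral_pullback_derivative:
  fixes \<phi> :: "complex \<Rightarrow> real"
  assumes supp: "\<And>w. norm w > M \<Longrightarrow> \<phi> w = 0"
    and \<phi>: "\<And>w. (\<phi> has_derivative (\<lambda>v. \<phi>x w * Re v + \<phi>y w * Im v)) (at w)"
    and suppx: "\<And>w. norm w > M \<Longrightarrow> \<phi>x w = 0" and suppy: "\<And>w. norm w > M \<Longrightarrow> \<phi>y w = 0"
    and contx: "continuous_on UNIV \<phi>x" and conty: "continuous_on UNIV \<phi>y"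
    and k: "\<And>z. z \<notin> \<Lambda> \<Longrightarrow> (k has_derivative k' z) (at z)" and k': "\<And>v. continuous_on (- \<Lambda>) (\<lambda>z. k' z v)"
    and kper: "\<And>z l. l \<in> \<Lambda> \<Longrightarrow> k (z + l) = k z"
  defines "Dh \<equiv> (\<lambda>z v. v - cnj (deriv F z * v))"
  shows "torus_integral \<omega>1 \<omega>2 (\<lambda>z. pullback \<phi>x (\<lambda>z. Re (Dh z v) * k z) z + pullback \<phi>y (\<lambda>z. Im (Dh z v) * k z) z
      + pullback \<phi> (\<lambda>z. k' z v) z) = 0"
    and "continuous_on UNIV (\<lambda>z. pullback \<phi>x (\<lambda>z. Re (Dh z v) * k z) z + pullback \<phi>y (\<lambda>z. Im (Dh z v) * k z) z
      + pullback \<phi> (\<lambda>z. k' z v) z)"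
proof -
  define D where "D z v = pullback \<phi>x (\<lambda>z. Re (Dh z v) * k z) z + pullback \<phi>y (\<lambda>z. Im (Dh z v) * k z) z
      + pullback \<phi> (\<lambda>z. k' z v) z" for z v
  obtain d where d: "d > 0" "\<And>z l. l \<in> \<Lambda> \<Longrightarrow> z \<in> ball l d \<Longrightarrow> pullback \<phi> k z = 0"
    using pullback_vanishes[of M \<phi> k] supp by metis
  have contk: "continuous_on (- \<Lambda>) k"
    by (intro continuous_at_imp_continuous_on ballI has_derivative_continuous[OF k]) simp
  have cont\<phi>: "continuous_on UNIV \<phi>"
    by (intro continuous_at_imp_continuous_on ballI has_derivative_continuous[OF \<phi>])
  have contDh: "continuous_on (- \<Lambda>) (\<lambda>z. Dh z v)" for v
    unfolding Dh_def by (intro continuous_intros continuous_on_deriv_F)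
  have contD: "continuous_on UNIV (\<lambda>z. D z v)" for v
    unfolding D_def
    by (intro continuous_on_add continuous_pullback[OF suppx contx] continuous_pullback[OF suppy conty]
        continuous_pullback[OF supp cont\<phi>] k' continuous_on_mult contk continuous_on_Re continuous_on_Im contDh)
  then show "continuous_on UNIV (\<lambda>z. pullback \<phi>x (\<lambda>z. Re (Dh z v) * k z) z + pullback \<phi>y (\<lambda>z. Im (Dh z v) * k z) z
      + pullback \<phi> (\<lambda>z. k' z v) z)" by (simp add: D_def)
  have der: "(pullback \<phi> k has_derivative D z) (at z)" for z
  proof (cases "z \<in> \<Lambda>")
    case True
    have "D z = (\<lambda>_. 0)" using True by (simp add: D_def fun_eq_iff pullback_def)
    moreover have "(pullback \<phi> k has_derivative (\<lambda>_. 0)) (at z)"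
      by (rule has_derivative_transform_within_open[OF has_derivative_const open_ball, of z z d 0])
        (use d True in auto)
    ultimately show ?thesis by simp
  next
    case False
    have 1: "((\<lambda>z. \<phi> (h z)) has_derivative (\<lambda>v. \<phi>x (h z) * Re (Dh z v) + \<phi>y (h z) * Im (Dh z v))) (at z)"
      unfolding Dh_def by (rule has_derivative_compose[OF h_has_derivative[OF False] \<phi>])
    have "((\<lambda>z. \<phi> (h z) * k z) has_derivative D z) (at z)"
      using has_derivative_mult[OF 1 k[OF False]]
      by (rule has_derivative_eq_rhs) (use False in \<open>auto simp: D_def fun_eq_iff pullback_def algebra_simps\<close>)
    then show ?thesis
      by (rule has_derivative_transform_within_open[OF _ open_compl_lattice]) (use False in \<open>auto simp: pullback_def\<close>)
  qed
  have per: "periodic \<omega>1 \<omega>2 (pullback \<phi> k)"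
    unfolding periodic_def by (auto simp: pullback_def h_periodic kper lattice_add_cancel)
  show "torus_integral \<omega>1 \<omega>2 (\<lambda>z. pullback \<phi>x (\<lambda>z. Re (Dh z v) * k z) z + pullback \<phi>y (\<lambda>z. Im (Dh z v) * k z) z
      + pullback \<phi> (\<lambda>z. k' z v) z) = 0"
    using torus_integral_derivative[OF der contD per, of v] by (simp add: D_def)
qed

text \<open>
  With \<open>h\<close> in place of the identity, the \<open>x\<close>-derivative of \<open>\<phi>\<close> times the Jacobian is a divergence,
  because the coefficients \<open>1 + Re F'\<close> and \<open>- Im F'\<close> satisfy the Cauchy-Riemann equations.
\<close>

lemma torus_integral_pullback_jacobian:
  fixes \<phi> :: "complex \<Rightarrow> real"
  assumes supp: "\<And>w. norm w > M \<Longrightarrow> \<phi> w = 0"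
    and \<phi>: "\<And>w. (\<phi> has_derivative (\<lambda>v. \<phi>x w * Re v + \<phi>y w * Im v)) (at w)"
    and suppx: "\<And>w. norm w > M \<Longrightarrow> \<phi>x w = 0" and suppy: "\<And>w. norm w > M \<Longrightarrow> \<phi>y w = 0"
    and contx: "continuous_on UNIV \<phi>x" and conty: "continuous_on UNIV \<phi>y"
  shows "torus_integral \<omega>1 \<omega>2 (pullback \<phi>x J) = 0"
proof -
  let ?F' = "deriv F" let ?F'' = "deriv (deriv F)"
  have derF': "(?F' has_derivative (\<lambda>v. ?F'' z * v)) (at z)" if "z \<notin> \<Lambda>" for z
    using DERIV2_F[OF that] by (simp add: has_field_derivative_def)
  have contF'': "continuous_on (- \<Lambda>) ?F''"
    by (intro holomorphic_on_imp_continuous_on holomorphic_deriv deriv_F_holo open_compl_lattice)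
  have k1: "((\<lambda>z. 1 + Re (?F' z)) has_derivative (\<lambda>v. Re (?F'' z * v))) (at z)" if "z \<notin> \<Lambda>" for z
    by (rule has_derivative_eq_rhs[OF has_derivative_add[OF has_derivative_const bounded_linear.has_derivative[OF bounded_linear_Re derF'[OF that]]]]) simp
  have k2: "((\<lambda>z. - Im (?F' z)) has_derivative (\<lambda>v. - Im (?F'' z * v))) (at z)" if "z \<notin> \<Lambda>" for z
    by (intro has_derivative_minus bounded_linear.has_derivative[OF bounded_linear_Im derF'[OF that]])
  note T = torus_integral_pullback_derivative[OF supp \<phi> suppx suppy contx conty]
  have p1: "1 + Re (?F' (z + l)) = 1 + Re (?F' z)" "- Im (?F' (z + l)) = - Im (?F' z)" if "l \<in> \<Lambda>" for z l
    using deriv_F_periodic[OF that] by simp_all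
  have c1: "continuous_on (- \<Lambda>) (\<lambda>z. Re (?F'' z * v))" "continuous_on (- \<Lambda>) (\<lambda>z. - Im (?F'' z * v))" for v
    by (intro continuous_intros contF'')+
  note T1 = T[OF _ _ _ k1 c1(1) p1(1), where v = 1]
  note T2 = T[OF _ _ _ k2 c1(2) p1(2), where v = \<i>]
  let ?Dh = "\<lambda>z v. v - cnj (?F' z * v)"
  let ?a1 = "\<lambda>z. pullback \<phi>x (\<lambda>z. Re (?Dh z 1) * (1 + Re (?F' z))) z + pullback \<phi>y (\<lambda>z. Im (?Dh z 1) * (1 + Re (?F' z))) z
      + pullback \<phi> (\<lambda>z. Re (?F'' z * 1)) z"
  let ?a2 = "\<lambda>z. pullback \<phi>x (\<lambda>z. Re (?Dh z \<i>) * - Im (?F' z)) z + pullback \<phi>y (\<lambda>z. Im (?Dh z \<i>) * - Im (?F' z)) z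
      + pullback \<phi> (\<lambda>z. - Im (?F'' z * \<i>)) z"
  have i1: "torus_integral \<omega>1 \<omega>2 ?a1 = 0" "continuous_on UNIV ?a1" by (rule T1; assumption)+
  have i2: "torus_integral \<omega>1 \<omega>2 ?a2 = 0" "continuous_on UNIV ?a2" by (rule T2; assumption)+
  \<comment> \<open>With F' = p + \<i> q the coefficient of \<phi>x is (1 - p)(1 + p) - q^2, the
    Jacobian. The terms with \<phi>y cancel, and those with \<phi> cancel by the Cauchy-Riemann
    equations for F'.\<close>
  have eq: "?a1 z + ?a2 z = pullback \<phi>x J z" for z
    unfolding pullback_def J_def cmod_power2 by (simp add: power2_eq_square algebra_simps)
  have "torus_integral \<omega>1 \<omega>2 (\<lambda>z. ?a1 z + ?a2 z) = torus_integral \<omega>1 \<omega>2 ?a1 + torus_integral \<omega>1 \<omega>2 ?a2"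
    unfolding torus_integral_def by (intro set_integral_add set_integrable_P i1 i2)
  then show ?thesis unfolding eq i1(1) i2(1) by simp
qed

text \<open>Near 0 the term \<rho> / z dominates. If h(x) = h(y), its increment |\<rho>| |x - y| /
  (|x| |y|) is at most (1 + K) |x - y|, where K is a Lipschitz constant of \<open>kreg\<close>; this
  is impossible for small distinct x and y. Away from the lattice \<open>h\<close> is bounded, so
  large values are taken only near the lattice.\<close>

lemma h_univalent_near_pole:
  obtains R where "\<And>w x y. norm w > R \<Longrightarrow> x \<notin> \<Lambda> \<Longrightarrow> y \<notin> \<Lambda> \<Longrightarrow> h x = w \<Longrightarrow> h y = w \<Longrightarrow> x - y \<in> \<Lambda>"
proof -
  have "compact (deriv kreg ` cball 0 (sep / 2))"
    using sep_pos by (intro compact_continuous_image holomorphic_on_imp_continuous_on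
        holomorphic_on_subset[OF holomorphic_deriv[OF kreg_holo open_ball]]) auto
  then obtain K where K: "\<And>z. z \<in> cball 0 (sep / 2) \<Longrightarrow> norm (deriv kreg z) \<le> K"
    using compact_imp_bounded bounded_iff by (metis image_eqI)
  have lip: "norm (kreg x - kreg y) \<le> K * norm (x - y)"
    if "x \<in> cball 0 (sep / 2)" "y \<in> cball 0 (sep / 2)" for x y
  proof (rule field_differentiable_bound[OF convex_cball _ K that])
    fix z :: complex assume "z \<in> cball 0 (sep / 2)"
    then have "z \<in> ball 0 sep" using sep_pos by simp
    then show "(kreg has_field_derivative deriv kreg z) (at z within cball 0 (sep / 2))"
      by (rule holomorphic_derivI[OF kreg_holo open_ball])
  qed
  have K0: "K \<ge> 0" using order_trans[OF norm_ge_zero K[of 0]] sep_pos by simp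
  \<comment> \<open>The bound 1 reduces |x| |y| to \<delta>, and the last entry then makes (1 + K)
    |x| |y| at most |\<rho>| / 2.\<close>
  define \<delta> where "\<delta> = min (sep / 2) (min 1 (norm \<rho> / (2 * (1 + K))))"
  have \<delta>: "\<delta> > 0" "\<delta> \<le> sep / 2" "\<delta> \<le> 1" "\<delta> \<le> norm \<rho> / (2 * (1 + K))"
  proof -
    show "\<delta> > 0" using sep_pos K0 \<rho>_nonzero by (simp add: \<delta>_def)
    show "\<delta> \<le> sep / 2" unfolding \<delta>_def by (rule min.cobounded1)
    have "\<delta> \<le> min 1 (norm \<rho> / (2 * (1 + K)))" unfolding \<delta>_def by (rule min.cobounded2)
    then show "\<delta> \<le> 1" "\<delta> \<le> norm \<rho> / (2 * (1 + K))" by (simp_all only: min.bounded_iff)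
  qed
  have near: "x = y" if xy: "norm x < \<delta>" "norm y < \<delta>" "x \<noteq> 0" "y \<noteq> 0" "h x = h y" for x y
  proof (rule ccontr)
    assume "x \<noteq> y"
    have "g x - g y = x - y" using xy(5) by (simp add: h_def algebra_simps)
    then have "norm (F x - F y) = norm (x - y)" by (metis g_def complex_cnj_diff complex_mod_cnj)
    moreover have "F x - F y = \<rho> * (y - x) / (x * y) + (kreg x - kreg y)"
      using xy by (simp add: F_eq field_simps)
    then have "\<rho> * (y - x) / (x * y) = (F x - F y) - (kreg x - kreg y)" by simp
    then have "norm (\<rho> * (y - x) / (x * y)) \<le> norm (F x - F y) + norm (kreg x - kreg y)"
      by (simp only: norm_triangle_ineq4)
    ultimately have "norm (\<rho> * (y - x) / (x * y)) \<le> (1 + K) * norm (x - y)"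
      using lip[of x y] xy \<delta> by (simp add: algebra_simps)
    then have "norm \<rho> * norm (x - y) / (norm x * norm y) \<le> (1 + K) * norm (x - y)"
      by (simp add: norm_divide norm_mult norm_minus_commute)
    then have "norm \<rho> * norm (x - y) \<le> ((1 + K) * (norm x * norm y)) * norm (x - y)"
      using xy by (simp add: field_simps)
    then have "norm \<rho> \<le> (1 + K) * (norm x * norm y)"
      by (rule mult_right_le_imp_le) (use \<open>x \<noteq> y\<close> in simp)
    also have "norm x * norm y \<le> \<delta> * 1" using xy \<delta> by (intro mult_mono) auto
    then have "(1 + K) * (norm x * norm y) \<le> (1 + K) * \<delta>" using K0 by (intro mult_left_mono) auto
    also have "(1 + K) * \<delta> \<le> norm \<rho> / 2" using \<delta>(4) K0 by (simp add: field_simps)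
    finally show False using \<rho>_nonzero by simp
  qed
  have sub: "{z. \<forall>l\<in>\<Lambda>. \<delta> \<le> dist z l} \<subseteq> - \<Lambda>" using \<delta>(1) by force
  obtain M where M: "\<And>z. (\<forall>l\<in>\<Lambda>. \<delta> \<le> dist z l) \<Longrightarrow> norm (h z) \<le> M"
    using fund_closure_bound[OF continuous_on_subset[OF continuous_on_h sub] h_periodic] by blast
  show thesis
  proof (rule that[of M])
    fix w x y assume w: "norm w > M" and xy: "x \<notin> \<Lambda>" "y \<notin> \<Lambda>" "h x = w" "h y = w"
    obtain l where l: "l \<in> \<Lambda>" "dist x l < \<delta>" using M[of x] w xy by force
    obtain k where k: "k \<in> \<Lambda>" "dist y k < \<delta>" using M[of y] w xy by force
    have hh: "h (x - l) = h x" "h (y - k) = h y" using h_periodic[OF l(1), of "x - l"] h_periodic[OF k(1), of "y - k"] by simp_all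
    have n0: "x - l \<noteq> 0" "y - k \<noteq> 0" using xy l k by auto
    have n1: "norm (x - l) < \<delta>" "norm (y - k) < \<delta>" using l k by (simp_all add: dist_norm)
    have "h (x - l) = h (y - k)" using hh xy by simp
    then have "x - l = y - k" by (rule near[OF n1 n0])
    moreover have "x - y = (x - l) - (y - k) + (l - k)" by simp
    ultimately have "x - y = l - k" by simp
    then show "x - y \<in> \<Lambda>" using lattice_diff[OF l(1) k(1)] by simp
  qed
qed

lemma nonrepelling_fibre:
  "finite {x \<in> P. x \<notin> \<Lambda> \<and> norm (deriv F x) \<le> 1 \<and> h x = w} \<and>
   card {x \<in> P. x \<notin> \<Lambda> \<and> norm (deriv F x) \<le> 1 \<and> h x = w} \<le> 2"
proof (rule finite_if_finite_subsets_card_bdd)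
  interpret Fw: torus_map \<omega>1 \<omega>2 "\<lambda>z. F z + cnj w" \<rho>
  proof
    show "(\<lambda>z. F z + cnj w) holomorphic_on - \<Lambda>" by (intro holomorphic_intros hol)
    show "F (z + l) + cnj w = F z + cnj w + cnj l" if "l \<in> \<Lambda>" for z l using quasi[OF that] by simp
    have "((\<lambda>z. z * F z + z * cnj w) \<longlongrightarrow> \<rho> + 0 * cnj w) (at 0)" by (intro tendsto_intros pole)
    then show "((\<lambda>z. z * (F z + cnj w)) \<longlongrightarrow> \<rho>) (at 0)" by (simp add: distrib_left)
  qed
  have gw: "Fw.g z = g z + w" for z by (simp add: Fw.g_def g_def)
  have dw: "deriv (\<lambda>z. F z + cnj w) z = deriv F z" if "z \<notin> \<Lambda>" for z
    using DERIV_add[OF DERIV_F[OF that] DERIV_const[of "cnj w"]] by (simp add: DERIV_imp_deriv)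
  fix Z assume Z: "Z \<subseteq> {x \<in> P. x \<notin> \<Lambda> \<and> norm (deriv F x) \<le> 1 \<and> h x = w}" "finite Z"
  show "card Z \<le> 2"
  proof (rule Fw.nonrepelling_fixed_points[OF Z(2)])
    show "z \<notin> \<Lambda> \<and> Fw.g z = z \<and> norm (deriv (\<lambda>z. F z + cnj w) z) \<le> 1" if "z \<in> Z" for z
    proof -
      have z: "z \<notin> \<Lambda>" "norm (deriv F z) \<le> 1" "h z = w" using that Z(1) by auto
      then show ?thesis unfolding gw dw[OF z(1)] by (auto simp: h_def)
    qed
    fix z z' assume zz: "z \<in> Z" "z' \<in> Z" "z - z' \<in> \<Lambda>"
    then have "z' \<in> P" "z' + (z - z') \<in> P" using Z(1) by auto
    then have "z - z' = 0" using zz(3) by (rule fund_unique)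
    then show "z = z'" by simp
  qed
qed

lemma nn_integral_torus:
  assumes "continuous_on UNIV v" "\<And>z. v z \<ge> 0"
  shows "ennreal (torus_integral \<omega>1 \<omega>2 v) = (\<integral>\<^sup>+z. ennreal (v z) * indicator P z \<partial>lborel)"
proof -
  have "(\<integral>\<^sup>+z. ennreal (indicator P z *\<^sub>R v z) \<partial>lborel) = ennreal (\<integral>z. indicator P z *\<^sub>R v z \<partial>lborel)"
    using set_integrable_P[OF assms(1)] assms(2) unfolding set_integrable_def
    by (intro nn_integral_eq_integral) auto
  moreover have "(\<integral>\<^sup>+z. ennreal (indicator P z *\<^sub>R v z) \<partial>lborel) = (\<integral>\<^sup>+z. ennreal (v z) * indicator P z \<partial>lborel)"
    by (intro nn_integral_cong) (auto simp: indicator_def)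
  ultimately show ?thesis by (simp add: torus_integral_def set_lebesgue_integral_def)
qed

text \<open>
  The parts of the fibre integral over the regions where \<open>h\<close> preserves (\<open>s = 1\<close>) or reverses
  (\<open>s = - 1\<close>) orientation.
\<close>

lemma oriented_fibre_integral:
  fixes f :: "complex \<Rightarrow> real" and s :: real
  assumes f: "continuous_on UNIV f" "\<And>w. 0 \<le> f w" "integrable lborel f" and supp: "\<And>w. norm w > M \<Longrightarrow> f w = 0"
    and s: "\<bar>s\<bar> = 1" and mass: "(\<integral>\<^sup>+w. ennreal (f w) \<partial>lborel) = ennreal m" "0 \<le> m"
  defines "X \<equiv> (\<lambda>w. {x \<in> P. x \<notin> \<Lambda> \<and> s * J x > 0 \<and> h x = w})"
    and "I \<equiv> torus_integral \<omega>1 \<omega>2 (\<lambda>z. max 0 (s * pullback f J z))"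
  shows "(\<And>w. f w \<noteq> 0 \<Longrightarrow> finite (X w) \<and> card (X w) \<le> k) \<Longrightarrow> I \<le> real k * m"
    and "(\<And>w. f w \<noteq> 0 \<Longrightarrow> \<exists>A. A \<subseteq> X w \<and> finite A \<and> card A = k) \<Longrightarrow> real k * m \<le> I"
proof -
  define S where "S = {x \<in> P. x \<notin> \<Lambda> \<and> s * J x > 0}"
  have cp: "continuous_on UNIV (pullback f J)" by (rule continuous_pullback[OF supp f(1) continuous_on_J])
  have cm: "continuous_on UNIV (\<lambda>z. max 0 (s * pullback f J z))" by (intro continuous_intros cp)
  have oS: "open (- \<Lambda> \<inter> (\<lambda>x. s * J x) -` {0<..})"
    by (intro continuous_open_preimage continuous_on_mult_left continuous_on_J open_compl_lattice) auto
  have "S = P \<inter> (- \<Lambda> \<inter> (\<lambda>x. s * J x) -` {0<..})" by (auto simp: S_def)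
  then have S: "S \<in> sets borel" by (simp only:) (intro sets.Int borel_P borel_open oS)
  have der: "(h has_derivative (\<lambda>v. v - cnj (deriv F x * v))) (at x)" if "x \<in> S" for x
    using that by (intro h_has_derivative) (simp add: S_def)
  have inj: "\<exists>r>0. inj_on h (ball x r)" if x: "x \<in> S" for x
  proof -
    have "x \<notin> \<Lambda>" "J x \<noteq> 0" using x by (auto simp: S_def)
    then show ?thesis using h_locally_injective[of x] by metis
  qed
  have jeq: "jac (\<lambda>v. v - cnj (deriv F x * v)) = J x" for x by (simp only: jac_h J_def)
  \<comment> \<open>Writing the oriented part as a maximum with 0 of a continuous function disposes
    of measurability and expresses it as a torus integral.\<close>
  have eq: "ennreal (\<bar>J x\<bar> * f (h x)) * indicator S x
      = ennreal (max 0 (s * pullback f J x)) * indicator P x" for x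
  proof (cases "x \<in> S")
    case True
    then have "\<bar>J x\<bar> = s * J x" using s by (auto simp: S_def abs_mult abs_if split: if_splits)
    moreover have "0 \<le> s * J x * f (h x)" using True f(2) by (auto simp: S_def)
    ultimately have "\<bar>J x\<bar> * f (h x) = max 0 (s * pullback f J x)"
      using True by (simp add: pullback_def S_def max_def mult_ac)
    then show ?thesis using True by (simp add: S_def)
  next
    case False
    show ?thesis
    proof (cases "x \<in> P \<and> x \<notin> \<Lambda>")
      case True
      then have "s * J x \<le> 0" using False by (auto simp: S_def)
      then have "s * J x * f (h x) \<le> 0" using f(2) by (rule mult_nonpos_nonneg)
      then have "max 0 (s * pullback f J x) = 0" using True by (simp add: pullback_def max_def mult_ac)
      then show ?thesis using False by simp
    qed (use False in \<open>auto simp: pullback_def indicator_def\<close>)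
  qed
  have meas: "(\<lambda>x. ennreal (\<bar>jac (\<lambda>v. v - cnj (deriv F x * v))\<bar> * f (h x)) * indicator S x) \<in> borel_measurable borel"
  proof -
    have [measurable]: "(\<lambda>z. max 0 (s * pullback f J z)) \<in> borel_measurable borel"
      using cm by (rule borel_measurable_continuous_onI)
    show ?thesis unfolding jeq eq by measurable
  qed
  have I: "ennreal I = (\<integral>\<^sup>+x. ennreal (\<bar>jac (\<lambda>v. v - cnj (deriv F x * v))\<bar> * f (h x)) * indicator S x \<partial>lborel)"
    unfolding I_def jeq eq by (rule nn_integral_torus[OF cm]) auto
  have I0: "0 \<le> I" unfolding I_def by (rule torus_integral_nonneg) auto
  have X: "X w = {x \<in> S. h x = w}" for w by (auto simp: X_def S_def)
  have km: "of_nat k * ennreal m = ennreal (real k * m)" by (simp add: ennreal_mult'' mass(2) ennreal_of_nat_eq_real_of_nat)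
  note area = area_bounds_complex[OF S der inj f(3,2) meas, unfolded I[symmetric] mass km, folded X, of k]
  show "I \<le> real k * m" if "\<And>w. f w \<noteq> 0 \<Longrightarrow> finite (X w) \<and> card (X w) \<le> k"
  proof -
    have "ennreal I \<le> ennreal (real k * m)" unfolding km[symmetric] by (rule area(1)) (use that in auto)
    then show ?thesis using mass(2) by (simp add: ennreal_le_iff)
  qed
  show "real k * m \<le> I" if "\<And>w. f w \<noteq> 0 \<Longrightarrow> \<exists>A. A \<subseteq> X w \<and> finite A \<and> card A = k"
  proof -
    have "ennreal (real k * m) \<le> ennreal I" unfolding km[symmetric] by (rule area(2)) (use that in auto)
    then show ?thesis using I0 by (simp add: ennreal_le_iff)
  qed
qed

text \<open>Assume four of them. With m the mass of the bump, the integral for the bump at 0 is at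
  most 2m - 4m, since fibres contain at most two preserving points and nearby values have four
  reversing preimages. For the bump far out it is at least 0 - m, as such values have at most one
  preimage. The two integrals coincide because the bumps differ by an x-derivative.\<close>

lemma repelling_fixed_points:
  assumes Z: "finite Z" "\<And>z. z \<in> Z \<Longrightarrow> z \<notin> \<Lambda> \<and> g z = z \<and> norm (deriv F z) > 1"
    and sep: "\<And>z z'. z \<in> Z \<Longrightarrow> z' \<in> Z \<Longrightarrow> z - z' \<in> \<Lambda> \<Longrightarrow> z = z'"
  shows "card Z \<le> 3"
proof (rule ccontr)
  assume "\<not> card Z \<le> 3"
  then obtain Z4 where Z4: "Z4 \<subseteq> Z" "card Z4 = 4" "finite Z4"
    using obtain_subset_with_card_n[of 4 Z] by force
  \<comment> \<open>The factor 2 keeps the discs about different points disjoint even after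
    translation by periods, so the four preimages stay distinct when reduced to the
    parallelogram.\<close>
  have "\<exists>r>0. ball z r \<subseteq> {x. x \<notin> \<Lambda> \<and> J x < 0} \<and> inj_on h (ball z r) \<and>
      (\<forall>z'\<in>Z4. z' \<noteq> z \<longrightarrow> (\<forall>l\<in>\<Lambda>. 2 * r \<le> dist (z - z') l))" if z: "z \<in> Z4" for z
  proof -
    have zZ: "z \<notin> \<Lambda>" "J z < 0" using Z(2)[of z] Z4 z by (auto simp: J_def power2_eq_square intro: less_1_mult)
    obtain r1 where r1: "r1 > 0" "ball z r1 \<subseteq> - \<Lambda>" "inj_on h (ball z r1)"
      using h_locally_injective[of z] zZ by (metis less_irrefl)
    have "open (- \<Lambda> \<inter> J -` {..<0})" by (intro continuous_open_preimage continuous_on_J open_compl_lattice) auto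
    moreover have "z \<in> - \<Lambda> \<inter> J -` {..<0}" using zZ by simp
    ultimately obtain r2 where r2: "r2 > 0" "ball z r2 \<subseteq> - \<Lambda> \<inter> J -` {..<0}" using openE by blast
    have "\<exists>d>0. \<forall>l\<in>\<Lambda>. d \<le> dist (z - z') l" if z': "z' \<in> Z4" "z' \<noteq> z" for z'
    proof -
      have "z - z' \<in> - \<Lambda>" using sep[of z z'] Z4 z z' by auto
      then obtain d where "d > 0" "ball (z - z') d \<subseteq> - \<Lambda>" using open_compl_lattice openE by blast
      then show ?thesis by (intro exI[of _ d]) (auto simp: subset_eq not_less)
    qed
    then obtain d where d: "\<And>z'. z' \<in> Z4 \<Longrightarrow> z' \<noteq> z \<Longrightarrow> d z' > 0 \<and> (\<forall>l\<in>\<Lambda>. d z' \<le> dist (z - z') l)" by metis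
    define r where "r = Min (insert r1 (insert r2 ((\<lambda>z'. d z' / 2) ` (Z4 - {z}))))"
    have fin: "finite (insert r1 (insert r2 ((\<lambda>z'. d z' / 2) ` (Z4 - {z}))))" using Z4 by simp
    have "r \<le> a" if "a \<in> insert r1 (insert r2 ((\<lambda>z'. d z' / 2) ` (Z4 - {z})))" for a
      unfolding r_def by (rule Min_le[OF fin that])
    from this[of r1] this[of r2] this[of "d _ / 2"]
    have r: "r \<le> r1" "r \<le> r2" "\<And>z'. z' \<in> Z4 \<Longrightarrow> z' \<noteq> z \<Longrightarrow> r \<le> d z' / 2" by blast+
    have "r > 0" unfolding r_def using fin r1 r2 d by (subst Min_gr_iff) auto
    moreover have "ball z r \<subseteq> {x. x \<notin> \<Lambda> \<and> J x < 0}" using r2(2) subset_ball[OF r(2), of z] by auto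
    moreover have "inj_on h (ball z r)" using r1(3) subset_ball[OF r(1)] by (rule inj_on_subset)
    moreover have "\<forall>z'\<in>Z4. z' \<noteq> z \<longrightarrow> (\<forall>l\<in>\<Lambda>. 2 * r \<le> dist (z - z') l)" using r(3) d by force
    ultimately show ?thesis by blast
  qed
  then have "\<forall>z\<in>Z4. \<exists>r>0. ball z r \<subseteq> {x. x \<notin> \<Lambda> \<and> J x < 0} \<and> inj_on h (ball z r) \<and>
      (\<forall>z'\<in>Z4. z' \<noteq> z \<longrightarrow> (\<forall>l\<in>\<Lambda>. 2 * r \<le> dist (z - z') l))" by blast
  from bchoice[OF this] obtain r where r': "\<forall>z\<in>Z4. 0 < r z \<and> ball z (r z) \<subseteq> {x. x \<notin> \<Lambda> \<and> J x < 0} \<and> inj_on h (ball z (r z)) \<and>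
      (\<forall>z'\<in>Z4. z' \<noteq> z \<longrightarrow> (\<forall>l\<in>\<Lambda>. 2 * r z \<le> dist (z - z') l))" ..
  have r: "\<And>z. z \<in> Z4 \<Longrightarrow> r z > 0" "\<And>z. z \<in> Z4 \<Longrightarrow> ball z (r z) \<subseteq> {x. x \<notin> \<Lambda> \<and> J x < 0}"
      "\<And>z. z \<in> Z4 \<Longrightarrow> inj_on h (ball z (r z))"
      "\<And>z z' l. z \<in> Z4 \<Longrightarrow> z' \<in> Z4 \<Longrightarrow> z' \<noteq> z \<Longrightarrow> l \<in> \<Lambda> \<Longrightarrow> 2 * r z \<le> dist (z - z') l"
    using r' by blast+
  \<comment> \<open>Values in W are taken in all four discs; invariance of domain makes W
    open.\<close>
  define W where "W = (\<Inter>z\<in>Z4. h ` ball z (r z))"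
  have "open W" unfolding W_def
  proof (intro open_INT Z4 ballI)
    fix z assume z: "z \<in> Z4"
    have "ball z (r z) \<subseteq> - \<Lambda>" using r(2)[OF z] by auto
    then show "open (h ` ball z (r z))"
      by (intro invariance_of_domain continuous_on_subset[OF continuous_on_h] open_ball r(3) z)
  qed
  moreover have "0 \<in> W" unfolding W_def
  proof
    fix z assume z: "z \<in> Z4"
    then have "h z = 0" using Z(2)[of z] Z4 by (auto simp: h_def)
    then show "0 \<in> h ` ball z (r z)" using r(1)[OF z] by (intro image_eqI[of _ _ z]) auto
  qed
  ultimately obtain \<epsilon> where \<epsilon>: "\<epsilon> > 0" "ball 0 \<epsilon> \<subseteq> W" using openE by blast
  \<comment> \<open>The bump vanishes outside radius 2 e, so this choice confines it to the disc of
    radius \<epsilon> inside W.\<close>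
  define e where "e = \<epsilon> / 2"
  interpret bump e by standard (use \<epsilon> in \<open>simp add: e_def\<close>)
  obtain R where R: "\<And>w x y. norm w > R \<Longrightarrow> x \<notin> \<Lambda> \<Longrightarrow> y \<notin> \<Lambda> \<Longrightarrow> h x = w \<Longrightarrow> h y = w \<Longrightarrow> x - y \<in> \<Lambda>"
    using h_univalent_near_pole by metis
  \<comment> \<open>The second bump lives within 2 e of c, hence where |w| > R and \<open>h\<close>
    has at most one preimage modulo the lattice.\<close>
  define c where "c = \<bar>R\<bar> + 4 * e"
  define \<eta>c where "\<eta>c w = \<eta> (w - of_real c)" for w
  define M where "M = c + 4 * e"
  have c: "c > 0" using e_pos by (simp add: c_def)
  have supp0: "\<eta> w = 0" if "norm w > M" for w using that c e_pos by (intro \<eta>_eq_0) (auto simp: M_def)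
  have suppc: "norm w > R \<and> norm w \<le> M" if "\<eta>c w \<noteq> 0" for w
  proof -
    have "norm (w - of_real c) < 2 * e" using that \<eta>_eq_0[of "w - of_real c"] by (auto simp: \<eta>c_def not_le[symmetric])
    then have "\<bar>norm w - norm (complex_of_real c)\<bar> < 2 * e" using norm_triangle_ineq3[of w "of_real c"] by linarith
    moreover have "norm (complex_of_real c) = c" using c by simp
    ultimately have "\<bar>norm w - c\<bar> < 2 * e" by simp
    then show ?thesis using e_pos unfolding M_def c_def by linarith
  qed
  have suppc': "\<eta>c w = 0" if "norm w > M" for w using that suppc by force
  have cont0: "continuous_on UNIV \<eta>" by (rule continuous_\<eta>)
  have contc: "continuous_on UNIV \<eta>c" unfolding \<eta>c_def[abs_def]
    by (rule continuous_on_compose2[OF continuous_\<eta>[of UNIV]]) (auto intro!: continuous_intros)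
  \<comment> \<open>The x-derivative of \<phi> is the bump at c minus the bump at 0. The difference
    of the two antiderivatives vanishes on both sides of the strip, which makes \<phi> compactly
    supported.\<close>
  define \<phi> where "\<phi> w = (B (Re w - c) - B (Re w)) * \<beta> (Im w)" for w
  define \<phi>y where "\<phi>y w = (B (Re w - c) - B (Re w)) * \<beta>' (Im w)" for w
  have "torus_integral \<omega>1 \<omega>2 (pullback (\<lambda>w. \<eta>c w - \<eta> w) J) = 0"
  proof (rule torus_integral_pullback_jacobian[of M \<phi> _ \<phi>y])
    have out: "(B (Re w - c) - B (Re w) = 0) \<or> \<bar>Im w\<bar> > e" if "norm w > M" for w
    proof (rule disjCI)
      assume "\<not> \<bar>Im w\<bar> > e"
      then have "\<bar>Re w\<bar> > c + e" using cmod_le[of w] that e_pos by (simp add: M_def)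
      then consider "Re w > c + e" | "Re w < - e" using c by linarith
      then show "B (Re w - c) - B (Re w) = 0"
        using B_right[of "Re w - c"] B_right[of "Re w"] B_left[of "Re w - c"] B_left[of "Re w"] c by cases auto
    qed
    show "\<phi> w = 0" if "norm w > M" for w using out[OF that] \<beta>_eq_0[of "Im w"] by (auto simp: \<phi>_def)
    show "\<phi>y w = 0" if "norm w > M" for w
    proof -
      have "\<beta>' (Im w) = 0" if "\<bar>Im w\<bar> > e"
      proof -
        have "e\<^sup>2 \<le> \<bar>Im w\<bar>\<^sup>2" using that e_pos by (intro power_mono) auto
        then show ?thesis by (simp add: \<beta>'_def)
      qed
      then show ?thesis using out[OF that] by (auto simp: \<phi>y_def)
    qed
    show "\<eta>c w - \<eta> w = 0" if "norm w > M" for w using supp0[OF that] suppc'[OF that] by simp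
    show "continuous_on UNIV (\<lambda>w. \<eta>c w - \<eta> w)" by (intro continuous_intros cont0 contc)
    have contB: "continuous_on UNIV B" by (intro continuous_at_imp_continuous_on ballI DERIV_isCont[OF DERIV_B])
    show "continuous_on UNIV \<phi>y" unfolding \<phi>y_def[abs_def]
      by (intro continuous_on_mult continuous_on_diff continuous_on_compose2[OF contB] continuous_on_compose2[OF continuous_\<beta>'[of UNIV]])
        (auto intro!: continuous_intros)
    fix w
    have dB: "((\<lambda>w. B (Re w - a)) has_derivative (\<lambda>v. \<beta> (Re w - a) * Re v)) (at w)" for a
    proof -
      have "(B has_derivative (\<lambda>t. \<beta> (Re w - a) * t)) (at (Re w - a))"
        using DERIV_B by (simp add: has_field_derivative_def)
      moreover have "((\<lambda>w. Re w - a) has_derivative Re) (at w)" by (auto intro!: derivative_eq_intros)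
      ultimately show ?thesis by (rule has_derivative_compose[rotated])
    qed
    have "(\<beta> has_derivative (\<lambda>t. \<beta>' (Im w) * t)) (at (Im w))" using DERIV_\<beta> by (simp add: has_field_derivative_def)
    moreover have "(Im has_derivative Im) (at w)" by (rule bounded_linear_imp_has_derivative[OF bounded_linear_Im])
    ultimately have db: "((\<lambda>w. \<beta> (Im w)) has_derivative (\<lambda>v. \<beta>' (Im w) * Im v)) (at w)"
      by (rule has_derivative_compose[rotated])
    show "(\<phi> has_derivative (\<lambda>v. (\<eta>c w - \<eta> w) * Re v + \<phi>y w * Im v)) (at w)"
      unfolding \<phi>_def[abs_def]
      using has_derivative_mult[OF has_derivative_diff[OF dB[of c] dB[of 0, simplified]] db]
      by (rule has_derivative_eq_rhs) (auto simp: \<eta>c_def \<eta>_def \<phi>y_def fun_eq_iff algebra_simps)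
  qed
  moreover have cp0: "continuous_on UNIV (pullback \<eta> J)" and cpc: "continuous_on UNIV (pullback \<eta>c J)"
    by (rule continuous_pullback[OF supp0 cont0 continuous_on_J], assumption)
       (rule continuous_pullback[OF suppc' contc continuous_on_J], assumption)
  moreover have "pullback (\<lambda>w. \<eta>c w - \<eta> w) J = (\<lambda>z. pullback \<eta>c J z - pullback \<eta> J z)"
    by (auto simp: pullback_def fun_eq_iff algebra_simps)
  moreover have "torus_integral \<omega>1 \<omega>2 (\<lambda>z. pullback \<eta>c J z - pullback \<eta> J z)
      = torus_integral \<omega>1 \<omega>2 (pullback \<eta>c J) - torus_integral \<omega>1 \<omega>2 (pullback \<eta> J)"
    unfolding torus_integral_def by (intro set_integral_diff set_integrable_P cp0 cpc)
  ultimately have same: "torus_integral \<omega>1 \<omega>2 (pullback \<eta>c J) = torus_integral \<omega>1 \<omega>2 (pullback \<eta> J)" by simp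
  have split: "torus_integral \<omega>1 \<omega>2 v = torus_integral \<omega>1 \<omega>2 (\<lambda>z. max 0 (1 * v z)) - torus_integral \<omega>1 \<omega>2 (\<lambda>z. max 0 (- 1 * v z))"
    if "continuous_on UNIV v" for v :: "complex \<Rightarrow> real"
  proof -
    have "v z = max 0 (1 * v z) - max 0 (- 1 * v z)" for z by (simp add: max_def)
    then have "torus_integral \<omega>1 \<omega>2 v = torus_integral \<omega>1 \<omega>2 (\<lambda>z. max 0 (1 * v z) - max 0 (- 1 * v z))" by simp
    also have "\<dots> = torus_integral \<omega>1 \<omega>2 (\<lambda>z. max 0 (1 * v z)) - torus_integral \<omega>1 \<omega>2 (\<lambda>z. max 0 (- 1 * v z))"
      unfolding torus_integral_def by (intro set_integral_diff set_integrable_P continuous_intros that)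
    finally show ?thesis .
  qed
  have int0: "integrable lborel \<eta>" using integrable_\<eta>[of 0] by simp
  have intc: "integrable lborel \<eta>c" unfolding \<eta>c_def[abs_def] by (rule integrable_\<eta>)
  have m0: "(\<integral>\<^sup>+w. ennreal (\<eta> w) \<partial>lborel) = ennreal mass" using nn_integral_\<eta>[of 0] by simp
  have mc: "(\<integral>\<^sup>+w. ennreal (\<eta>c w) \<partial>lborel) = ennreal mass" unfolding \<eta>c_def by (rule nn_integral_\<eta>)
  have mass0: "0 \<le> mass" using mass_pos by simp
  have \<eta>c0: "0 \<le> \<eta>c w" for w by (simp add: \<eta>c_def \<eta>_nonneg)
  have plus: "torus_integral \<omega>1 \<omega>2 (\<lambda>z. max 0 (1 * pullback \<eta> J z)) \<le> real 2 * mass"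
  proof (rule oriented_fibre_integral(1)[OF cont0 \<eta>_nonneg int0 supp0 _ m0 mass0])
    fix w
    have sub: "{x \<in> P. x \<notin> \<Lambda> \<and> 1 * J x > 0 \<and> h x = w} \<subseteq> {x \<in> P. x \<notin> \<Lambda> \<and> norm (deriv F x) \<le> 1 \<and> h x = w}"
      by (auto simp: J_def abs_square_less_1 less_imp_le)
    show "finite {x \<in> P. x \<notin> \<Lambda> \<and> 1 * J x > 0 \<and> h x = w} \<and> card {x \<in> P. x \<notin> \<Lambda> \<and> 1 * J x > 0 \<and> h x = w} \<le> 2"
      using nonrepelling_fibre[of w] finite_subset[OF sub] card_mono[OF _ sub] by linarith
  qed auto
  have minus: "real 4 * mass \<le> torus_integral \<omega>1 \<omega>2 (\<lambda>z. max 0 (- 1 * pullback \<eta> J z))"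
  proof (rule oriented_fibre_integral(2)[OF cont0 \<eta>_nonneg int0 supp0 _ m0 mass0])
    fix w assume "\<eta> w \<noteq> 0"
    then have "norm w < \<epsilon>" using \<eta>_eq_0[of w] by (auto simp: e_def not_le[symmetric])
    then have "w \<in> W" using \<epsilon> by auto
    then have "\<exists>x\<in>ball z (r z). h x = w" if "z \<in> Z4" for z using that by (auto simp: W_def)
    then obtain x where x: "\<And>z. z \<in> Z4 \<Longrightarrow> x z \<in> ball z (r z)" "\<And>z. z \<in> Z4 \<Longrightarrow> h (x z) = w" by metis
    have "\<exists>l. l \<in> \<Lambda> \<and> y - l \<in> P" for y using fund_reduce by blast
    then obtain red where red: "\<And>y. red y \<in> \<Lambda>" "\<And>y. y - red y \<in> P" by metis
    define y where "y z = x z - red (x z)" for z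
    have "inj_on y Z4"
    proof (rule inj_onI, rule ccontr)
      fix z z' assume zz: "z \<in> Z4" "z' \<in> Z4" "y z = y z'" "z \<noteq> z'"
      define l where "l = red (x z) - red (x z')"
      have l: "l \<in> \<Lambda>" "x z - x z' = l" using lattice_diff red(1) zz(3) by (auto simp: l_def y_def algebra_simps)
      have "2 * r z \<le> dist (z - z') l" using zz l(1) by (intro r(4)) auto
      moreover have "2 * r z' \<le> dist (z' - z) (- l)" using zz l(1) by (intro r(4)) auto
      moreover have "dist (z' - z) (- l) = dist (z - z') l" by (simp add: dist_norm norm_minus_commute algebra_simps)
      moreover have "dist (z - z') l = norm ((z - x z) - (z' - x z'))" unfolding l(2)[symmetric] by (simp add: dist_norm algebra_simps)
      then have "dist (z - z') l \<le> norm (z - x z) + norm (z' - x z')" by (simp only: norm_triangle_ineq4)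
      moreover have "norm (z - x z) < r z" "norm (z' - x z') < r z'" using x(1) zz by (auto simp: dist_norm)
      ultimately show False by linarith
    qed
    moreover have "y z \<in> {x \<in> P. x \<notin> \<Lambda> \<and> - 1 * J x > 0 \<and> h x = w}" if z: "z \<in> Z4" for z
    proof -
      have "x z \<notin> \<Lambda>" "J (x z) < 0" using r(2)[OF z] x(1)[OF z] by auto
      moreover have "h (y z) = h (x z)" "J (y z) = J (x z)"
        using h_periodic[OF red(1)[of "x z"], of "y z"] J_periodic[OF red(1)[of "x z"], of "y z"] by (simp_all add: y_def)
      moreover have "y z \<in> P" "y z \<notin> \<Lambda>" using red calculation(1) lattice_diff_cancel by (auto simp: y_def)
      ultimately show ?thesis using x(2)[OF z] by simp
    qed
    ultimately show "\<exists>A. A \<subseteq> {x \<in> P. x \<notin> \<Lambda> \<and> - 1 * J x > 0 \<and> h x = w} \<and> finite A \<and> card A = 4"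
      using Z4 by (intro exI[of _ "y ` Z4"]) (auto simp: card_image)
  qed auto
  have minusc: "torus_integral \<omega>1 \<omega>2 (\<lambda>z. max 0 (- 1 * pullback \<eta>c J z)) \<le> real 1 * mass"
  proof (rule oriented_fibre_integral(1)[OF contc \<eta>c0 intc suppc' _ mc mass0])
    fix w assume w: "\<eta>c w \<noteq> 0"
    let ?X = "{x \<in> P. x \<notin> \<Lambda> \<and> - 1 * J x > 0 \<and> h x = w}"
    have eq: "x = y" if "x \<in> ?X" "y \<in> ?X" for x y
    proof -
      have "x - y \<in> \<Lambda>" using that suppc[OF w] by (intro R[of w]) auto
      moreover have "y \<in> P" "y + (x - y) \<in> P" using that by auto
      ultimately show ?thesis using fund_unique[of y "x - y"] by simp
    qed
    show "finite ?X \<and> card ?X \<le> 1"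
    proof (cases "?X = {}")
      case False
      then obtain x where x: "x \<in> ?X" by blast
      have "?X = {x}" using eq x by blast
      then show ?thesis by (simp only:) simp
    next
      case True
      then show ?thesis by (simp only:) simp
    qed
  qed auto
  have plusc: "0 \<le> torus_integral \<omega>1 \<omega>2 (\<lambda>z. max 0 (1 * pullback \<eta>c J z))" by (rule torus_integral_nonneg) auto
  \<comment> \<open>With m = \<open>mass\<close> and I the common integral, the estimates give - m
    \<le> I \<le> - 2 m, although m is positive.\<close>
  show False using split[OF cp0] split[OF cpc] same plus minus minusc plusc mass_pos by simp
qed

end

subsection \<open>Smooth functions\<close>

lemma frechet_derivative_eq: "(f has_derivative f') (at x) \<Longrightarrow> frechet_derivative f (at x) = f'"
  using frechet_derivative_at by metis

lemma Ck_on_cong: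
  assumes "open S" "\<And>x. x \<in> S \<Longrightarrow> f x = g x" "Ck_on k S f"
  shows "Ck_on k S g"
  using assms(2,3)
proof (induction k arbitrary: f g)
  case 0
  then show ?case by (auto intro: continuous_on_eq)
next
  case (Suc k)
  have der: "(g has_derivative frechet_derivative f (at x)) (at x)" if "x \<in> S" for x
  proof (rule has_derivative_transform_within_open[OF _ assms(1) that])
    show "(f has_derivative frechet_derivative f (at x)) (at x)"
      using Suc.prems(2) that by (simp flip: frechet_derivative_works)
  qed (rule Suc.prems(1))
  have "Ck_on k S (\<lambda>x. frechet_derivative g (at x) v)" for v
    by (rule Suc.IH[of "\<lambda>x. frechet_derivative f (at x) v"])
      (use Suc.prems frechet_derivative_eq[OF der] in auto)
  then show ?case using der by (auto simp: differentiable_def)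
qed

lemma Ck_on_Suc:
  assumes "open S" "\<And>x. x \<in> S \<Longrightarrow> (f has_derivative f' x) (at x)" "\<And>v. Ck_on k S (\<lambda>x. f' x v)"
  shows "Ck_on (Suc k) S f"
proof -
  have "Ck_on k S (\<lambda>x. frechet_derivative f (at x) v)" for v
    by (rule Ck_on_cong[OF assms(1) _ assms(3)[of v]]) (use frechet_derivative_eq[OF assms(2)] in auto)
  then show ?thesis using assms(2) by (auto simp: differentiable_def)
qed

lemma Ck_on_SucD:
  assumes "Ck_on (Suc k) S f"
  shows "\<And>x. x \<in> S \<Longrightarrow> (f has_derivative frechet_derivative f (at x)) (at x)"
    and "Ck_on k S (\<lambda>x. frechet_derivative f (at x) v)"
proof -
  show "(f has_derivative frechet_derivative f (at x)) (at x)" if "x \<in> S" for x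
    using assms that by (simp add: frechet_derivative_works[symmetric])
  show "Ck_on k S (\<lambda>x. frechet_derivative f (at x) v)" using assms by simp
qed

lemma Ck_on_lower: "Ck_on (Suc k) S f \<Longrightarrow> Ck_on k S f"
proof (induction k arbitrary: f)
  case 0
  then show ?case using differentiable_imp_continuous_within
    by (auto intro!: continuous_at_imp_continuous_on)
next
  case (Suc k)
  then show ?case by (metis Ck_on.simps(2))
qed

lemma Ck_on_subset: "T \<subseteq> S \<Longrightarrow> Ck_on k S f \<Longrightarrow> Ck_on k T f"
proof (induction k arbitrary: f)
  case 0 then show ?case by (auto intro: continuous_on_subset)
next
  case (Suc k) then show ?case by auto
qed

lemma Ck_on_local:
  assumes "\<And>x. x \<in> S \<Longrightarrow> \<exists>U. open U \<and> x \<in> U \<and> Ck_on k U f"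
  shows "Ck_on k S f"
  using assms
proof (induction k arbitrary: f)
  case 0
  show ?case
  proof (simp, rule continuous_at_imp_continuous_on, rule ballI)
    fix x assume "x \<in> S"
    then obtain U where "open U" "x \<in> U" "continuous_on U f" using 0 by auto
    then show "isCont f x" using continuous_on_eq_continuous_at by blast
  qed
next
  case (Suc k)
  have "f differentiable (at x)" if "x \<in> S" for x using Suc.prems[OF that] by auto
  moreover have "Ck_on k S (\<lambda>x. frechet_derivative f (at x) v)" for v
    by (rule Suc.IH) (use Suc.prems in \<open>metis Ck_on.simps(2)\<close>)
  ultimately show ?case by simp
qed

lemma Ck_on_const: "open S \<Longrightarrow> Ck_on k S (\<lambda>_. c)"
proof (induction k arbitrary: c)
  case (Suc k)
  show ?case by (rule Ck_on_Suc[where f' = "\<lambda>_ _. 0"]) (use Suc in auto)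
qed auto

lemma Ck_on_bounded_linear: "open S \<Longrightarrow> bounded_linear L \<Longrightarrow> Ck_on k S L"
proof (cases k)
  case 0
  assume "bounded_linear L" then show ?thesis using 0 by (simp add: linear_continuous_on)
next
  case (Suc m)
  assume "open S" "bounded_linear L"
  then show ?thesis unfolding Suc
    by (intro Ck_on_Suc[where f' = "\<lambda>_. L"] Ck_on_const bounded_linear_imp_has_derivative)
qed

lemma Ck_on_add:
  assumes "open S" "Ck_on k S f" "Ck_on k S g"
  shows "Ck_on k S (\<lambda>x. f x + g x)"
  using assms(2,3)
proof (induction k arbitrary: f g)
  case 0 then show ?case by (auto intro: continuous_on_add)
next
  case (Suc k)
  show ?case
    by (rule Ck_on_Suc[OF assms(1) has_derivative_add[OF Ck_on_SucD(1)[OF Suc.prems(1)] Ck_on_SucD(1)[OF Suc.prems(2)]]])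
      (use Suc.IH[OF Ck_on_SucD(2)[OF Suc.prems(1)] Ck_on_SucD(2)[OF Suc.prems(2)]] in auto)
qed

lemma Ck_on_mult:
  fixes f g :: "'a::real_normed_vector \<Rightarrow> real"
  assumes "open S" "Ck_on k S f" "Ck_on k S g"
  shows "Ck_on k S (\<lambda>x. f x * g x)"
  using assms(2,3)
proof (induction k arbitrary: f g)
  case 0 then show ?case by (auto intro: continuous_on_mult)
next
  case (Suc k)
  show ?case
    by (rule Ck_on_Suc[OF assms(1) has_derivative_mult[OF Ck_on_SucD(1)[OF Suc.prems(1)] Ck_on_SucD(1)[OF Suc.prems(2)]]])
      (auto intro!: Ck_on_add[OF assms(1)] Suc.IH Ck_on_lower[OF Suc.prems(1)] Ck_on_lower[OF Suc.prems(2)]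
        Ck_on_SucD(2)[OF Suc.prems(1)] Ck_on_SucD(2)[OF Suc.prems(2)])
qed

lemma Ck_on_compose:
  fixes f :: "real \<Rightarrow> real" and g :: "'a::real_normed_vector \<Rightarrow> real"
  assumes "open S" "open T" "\<And>x. x \<in> S \<Longrightarrow> g x \<in> T" "Ck_on k T f" "Ck_on k S g"
  shows "Ck_on k S (\<lambda>x. f (g x))"
  using assms(4,5)
proof (induction k arbitrary: f)
  case 0 then show ?case using assms(3) by (auto intro: continuous_on_compose2)
next
  case (Suc k)
  let ?f' = "\<lambda>t. frechet_derivative f (at t) 1"
  show ?case
  proof (rule Ck_on_Suc[OF assms(1)])
    fix x assume x: "x \<in> S"
    have f: "(f has_derivative frechet_derivative f (at (g x))) (at (g x))"
      using Ck_on_SucD(1)[OF Suc.prems(1)] assms(3)[OF x] by blast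
    have "frechet_derivative f (at (g x)) h = ?f' (g x) * h" for h
      using linear_scale[OF has_derivative_linear[OF f], of h 1] by (simp only: scaleR_conv_of_real of_real_eq_id id_apply mult_1_right mult.commute[of h])
    then have "frechet_derivative f (at (g x)) = (\<lambda>h. ?f' (g x) * h)" by (rule ext)
    with has_derivative_compose[OF Ck_on_SucD(1)[OF Suc.prems(2) x] f]
    show "((\<lambda>x. f (g x)) has_derivative (\<lambda>v. ?f' (g x) * frechet_derivative g (at x) v)) (at x)" by metis
  next
    fix v
    show "Ck_on k S (\<lambda>x. ?f' (g x) * frechet_derivative g (at x) v)"
      by (rule Ck_on_mult[OF assms(1) Suc.IH[OF Ck_on_SucD(2)[OF Suc.prems(1)] Ck_on_lower[OF Suc.prems(2)]]
            Ck_on_SucD(2)[OF Suc.prems(2)]])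
  qed
qed

lemma Ck_on_real_deriv:
  fixes f :: "real \<Rightarrow> real"
  assumes "open S" "\<And>x. x \<in> S \<Longrightarrow> (f has_real_derivative f' x) (at x)" "Ck_on k S f'"
  shows "Ck_on (Suc k) S f"
proof (rule Ck_on_Suc[OF assms(1)])
  show "(f has_derivative (*) (f' x)) (at x)" if "x \<in> S" for x
    using assms(2)[OF that] by (simp add: has_field_derivative_def)
  show "Ck_on k S (\<lambda>x. f' x * v)" for v by (intro Ck_on_mult assms Ck_on_const)
qed

lemma Ck_on_inverse: "Ck_on k {0<..} (inverse :: real \<Rightarrow> real)"
proof (induction k)
  case 0 then show ?case by (auto intro!: continuous_intros)
next
  case (Suc k)
  have "Ck_on k {0<..} (\<lambda>x::real. - 1 * (inverse x * inverse x))"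
    by (intro Ck_on_mult Suc Ck_on_const) auto
  then show ?case
    by (intro Ck_on_real_deriv[where f' = "\<lambda>x. - 1 * (inverse x * inverse x)"])
      (auto intro!: derivative_eq_intros simp: power2_eq_square)
qed

lemma Ck_on_ln: "Ck_on k {0<..} (ln :: real \<Rightarrow> real)"
proof (cases k)
  case 0 then show ?thesis by (auto intro!: continuous_intros)
next
  case (Suc m)
  show ?thesis unfolding Suc
    by (intro Ck_on_real_deriv[OF _ _ Ck_on_inverse]) (auto intro!: derivative_eq_intros simp: inverse_eq_divide)
qed

text \<open>Differentiating exp(-1/x) produces powers of 1/x; indexing by the power gives a family
  closed under differentiation up to linear combinations, so smoothness follows by induction over
  all n at once.\<close>

definition flat :: "nat \<Rightarrow> real \<Rightarrow> real" where
  "flat n x = (if x > 0 then exp (- 1 / x) / x ^ n else 0)"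

lemma flat_tendsto_0: "(flat n \<longlongrightarrow> 0) (at 0)"
proof -
  have "((\<lambda>x. (\<lambda>y. y ^ n / exp y) (inverse x)) \<longlongrightarrow> 0) (at_right (0::real))"
    by (rule filterlim_compose[OF tendsto_power_div_exp_0 filterlim_inverse_at_top_right])
  moreover have "eventually (\<lambda>x. (\<lambda>y. y ^ n / exp y) (inverse x) = flat n x) (at_right (0::real))"
    using eventually_at_right_less[of 0]
  proof eventually_elim
    case (elim x)
    have "exp (- 1 / x) = inverse (exp (inverse x))" by (simp add: exp_minus[symmetric] divide_inverse)
    then show ?case using elim by (simp only: flat_def if_True divide_inverse power_inverse mult.commute)
  qed
  ultimately have r: "(flat n \<longlongrightarrow> 0) (at_right 0)" by (rule Lim_transform_eventually)
  have "((\<lambda>_. 0) \<longlongrightarrow> (0::real)) (at_left 0)" by simp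
  moreover have "eventually (\<lambda>x. 0 = flat n x) (at_left (0::real))"
    by (auto simp: eventually_at_filter flat_def)
  ultimately have "(flat n \<longlongrightarrow> 0) (at_left 0)" by (rule Lim_transform_eventually)
  then show ?thesis using r by (simp add: filterlim_at_split)
qed

lemma DERIV_flat: "(flat n has_real_derivative flat (n + 2) x - real n * flat (n + 1) x) (at x)"
proof -
  consider "x < 0" | "x = 0" | "x > 0" by linarith
  then show ?thesis
  proof cases
    case 1
    have "((\<lambda>_. 0) has_real_derivative 0) (at x)" by simp
    then have "(flat n has_real_derivative 0) (at x)"
      by (rule has_field_derivative_transform_within_open[of _ _ _ "{..<0}"]) (use 1 in \<open>auto simp: flat_def\<close>)
    then show ?thesis using 1 by (simp add: flat_def)
  next
    case 2
    have "((\<lambda>y. (flat n y - flat n 0) / (y - 0)) \<longlongrightarrow> 0) (at 0)"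
      by (rule Lim_transform_eventually[OF flat_tendsto_0[of "Suc n"]])
        (auto simp: eventually_at_filter flat_def)
    then show ?thesis using 2 by (simp add: has_field_derivative_iff flat_def)
  next
    case 3
    have "((\<lambda>x. exp (- 1 / x) * inverse x ^ n) has_real_derivative
        exp (- 1 / x) * inverse x ^ (n + 2) - real n * (exp (- 1 / x) * inverse x ^ (n + 1))) (at x)"
    proof -
      have a: "((\<lambda>x. exp (- 1 / x)) has_real_derivative exp (- 1 / x) * inverse x ^ 2) (at x)"
        using 3 by (auto intro!: derivative_eq_intros simp: power2_eq_square field_simps)
      have b: "((\<lambda>x. inverse x ^ n) has_real_derivative - (real n * inverse x ^ (n + 1))) (at x)"
      proof (cases n)
        case (Suc m)
        have "((\<lambda>x. inverse x ^ Suc m) has_real_derivative (1 + real m) * (- (inverse x ^ 2) * inverse x ^ m)) (at x)"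
          using 3 by (intro DERIV_power_Suc) (auto intro!: derivative_eq_intros simp: power2_eq_square)
        then show ?thesis unfolding Suc by (simp add: power2_eq_square mult_ac)
      qed simp
      show ?thesis using DERIV_mult[OF a b] by (simp add: power_add power2_eq_square algebra_simps)
    qed
    then have "((\<lambda>x. exp (- 1 / x) * inverse x ^ n) has_real_derivative flat (n + 2) x - real n * flat (n + 1) x) (at x)"
      using 3 by (simp add: flat_def divide_inverse power_inverse power2_eq_square mult_ac)
    then show ?thesis
      by (rule has_field_derivative_transform_within_open[of _ _ _ "{0<..}"])
        (use 3 in \<open>auto simp: flat_def divide_inverse power_inverse\<close>)
  qed
qed

lemma Ck_on_flat: "Ck_on k UNIV (flat n)"
proof (induction k arbitrary: n)
  case 0
  show ?case using DERIV_isCont[OF DERIV_flat] by (auto intro: continuous_at_imp_continuous_on)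
next
  case (Suc k)
  have "Ck_on k UNIV (\<lambda>x. flat (n + 2) x + - real n * flat (n + 1) x)"
    by (intro Ck_on_add Ck_on_mult Suc Ck_on_const) auto
  then show ?case using DERIV_flat[of n] by (intro Ck_on_real_deriv) auto
qed

lemma flat_nonneg: "flat n x \<ge> 0" by (simp add: flat_def)

lemma flat_0_mono: "x \<le> y \<Longrightarrow> flat 0 x \<le> flat 0 y"
  by (auto simp: flat_def frac_le)

lemma flat_0_le_1: "flat 0 x \<le> 1" by (simp add: flat_def)

text \<open>The squared distance is a polynomial, hence smooth at the centre too; radial functions
  are therefore written as profiles of it.\<close>

definition sqd :: "complex \<Rightarrow> complex \<Rightarrow> real" where "sqd p z = (Re z - Re p)\<^sup>2 + (Im z - Im p)\<^sup>2"

lemma sqd_eq: "sqd p z = (dist z p)\<^sup>2"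
  by (simp add: sqd_def dist_norm cmod_power2)

lemma Ck_on_sqd: "open S \<Longrightarrow> Ck_on k S (sqd p)"
proof -
  assume S: "open S"
  have "Ck_on k S (\<lambda>z. (Re z + - Re p) * (Re z + - Re p) + (Im z + - Im p) * (Im z + - Im p))"
    by (intro Ck_on_add Ck_on_mult S Ck_on_const Ck_on_bounded_linear bounded_linear_Re bounded_linear_Im)
  then show ?thesis by (simp add: sqd_def[abs_def] power2_eq_square)
qed

lemma dir_deriv_eq: "(f has_derivative f') (at z) \<Longrightarrow> dir_deriv v f z = f' v"
  by (simp add: dir_deriv_def frechet_derivative_eq)

lemma dir_deriv_cong:
  assumes "open S" "z \<in> S" "\<And>x. x \<in> S \<Longrightarrow> f x = g x"
  shows "dir_deriv v f z = dir_deriv v g z"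
proof -
  have "(f has_derivative D) (at z) \<longleftrightarrow> (g has_derivative D) (at z)" for D
    using has_derivative_transform_within_open[OF _ assms(1,2), of f D UNIV g]
      has_derivative_transform_within_open[OF _ assms(1,2), of g D UNIV f] assms(3) by auto
  then have "frechet_derivative f (at z) = frechet_derivative g (at z)" by (simp add: frechet_derivative_def)
  then show ?thesis by (simp add: dir_deriv_def)
qed

lemma laplacian_cong:
  assumes "open S" "z \<in> S" "\<And>x. x \<in> S \<Longrightarrow> f x = g x"
  shows "laplacian f z = laplacian g z"
proof -
  have "dir_deriv v (dir_deriv v f) z = dir_deriv v (dir_deriv v g) z" for v
    by (rule dir_deriv_cong[OF assms(1,2)], rule dir_deriv_cong[OF assms(1)]) (use assms(3) in auto)
  then show ?thesis by (simp add: laplacian_def)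
qed

text \<open>With s the squared distance, |grad s|^2 = 4 s and the Laplacian of s is 4.\<close>

lemma laplacian_radial:
  assumes T: "open T" "\<And>s. s \<in> T \<Longrightarrow> (E has_real_derivative E' s) (at s)" "\<And>s. s \<in> T \<Longrightarrow> (E' has_real_derivative E'' s) (at s)"
    and S: "open S" "\<And>z. z \<in> S \<Longrightarrow> sqd p z \<in> T" and z: "z \<in> S"
  shows "laplacian (\<lambda>z. E (sqd p z)) z = 4 * (sqd p z * E'' (sqd p z) + E' (sqd p z))"
proof -
  have dq: "(sqd p has_derivative (\<lambda>v. 2 * (Re z - Re p) * Re v + 2 * (Im z - Im p) * Im v)) (at z)" for z
  proof -
    have "((\<lambda>z. (Re z - Re p) * (Re z - Re p) + (Im z - Im p) * (Im z - Im p)) has_derivative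
        (\<lambda>v. ((Re z - Re p) * Re v + Re v * (Re z - Re p)) + ((Im z - Im p) * Im v + Im v * (Im z - Im p)))) (at z)"
    proof -
      have d: "((\<lambda>z. Re z - Re p) has_derivative Re) (at z)" "((\<lambda>z. Im z - Im p) has_derivative Im) (at z)"
        by (auto intro!: derivative_eq_intros)
      show ?thesis by (rule has_derivative_add[OF has_derivative_mult[OF d(1) d(1)] has_derivative_mult[OF d(2) d(2)]])
    qed
    then show ?thesis by (simp add: sqd_def[abs_def] power2_eq_square algebra_simps)
  qed
  have dE: "((\<lambda>z. E (sqd p z)) has_derivative (\<lambda>v. E' (sqd p z) * (2 * (Re z - Re p) * Re v + 2 * (Im z - Im p) * Im v))) (at z)"
    if "z \<in> S" for z
    using has_derivative_compose[OF dq, of E "\<lambda>h. E' (sqd p z) * h" z] T(2)[OF S(2)[OF that]]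
    by (simp add: has_field_derivative_def)
  have dE': "((\<lambda>z. E' (sqd p z)) has_derivative (\<lambda>v. E'' (sqd p z) * (2 * (Re z - Re p) * Re v + 2 * (Im z - Im p) * Im v))) (at z)"
    if "z \<in> S" for z
    using has_derivative_compose[OF dq, of E' "\<lambda>h. E'' (sqd p z) * h" z] T(3)[OF S(2)[OF that]]
    by (simp add: has_field_derivative_def)
  have d1: "dir_deriv 1 (dir_deriv 1 (\<lambda>z. E (sqd p z))) z = dir_deriv 1 (\<lambda>z. E' (sqd p z) * (2 * (Re z - Re p))) z"
    by (rule dir_deriv_cong[OF S(1) z]) (simp add: dir_deriv_eq[OF dE])
  have d2: "dir_deriv \<i> (dir_deriv \<i> (\<lambda>z. E (sqd p z))) z = dir_deriv \<i> (\<lambda>z. E' (sqd p z) * (2 * (Im z - Im p))) z"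
    by (rule dir_deriv_cong[OF S(1) z]) (simp add: dir_deriv_eq[OF dE])
  have r: "((\<lambda>z. 2 * (Re z - Re p)) has_derivative (\<lambda>v. 2 * Re v)) (at z)"
    and i: "((\<lambda>z. 2 * (Im z - Im p)) has_derivative (\<lambda>v. 2 * Im v)) (at z)"
    by (auto intro!: derivative_eq_intros)
  show ?thesis unfolding laplacian_def d1 d2
    dir_deriv_eq[OF has_derivative_mult[OF dE'[OF z] r]] dir_deriv_eq[OF has_derivative_mult[OF dE'[OF z] i]]
    by (simp add: sqd_def power2_eq_square algebra_simps)
qed

text \<open>The mixed second difference over a small square does not depend on the order of the
  directions, and two applications of the mean value theorem express it through either mixed
  derivative at some nearby point; continuity gives equality in the limit.\<close>

lemma mixed_partials:
  fixes f :: "complex \<Rightarrow> real"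
  assumes S: "open S" "z \<in> S" and C2: "Ck_on 2 S f"
  shows "dir_deriv 1 (dir_deriv \<i> f) z = dir_deriv \<i> (dir_deriv 1 f) z"
proof -
  have C: "Ck_on (Suc (Suc 0)) S f" using C2 by (simp add: numeral_2_eq_2)
  have d1: "(f has_derivative (\<lambda>v. dir_deriv v f x)) (at x)" if "x \<in> S" for x
    using Ck_on_SucD(1)[OF C that] by (simp add: dir_deriv_def)
  have Cd: "Ck_on (Suc 0) S (dir_deriv v f)" for v
    using Ck_on_SucD(2)[OF C, of v] by (simp add: dir_deriv_def[abs_def])
  have d2: "(dir_deriv v f has_derivative (\<lambda>w. dir_deriv w (dir_deriv v f) x)) (at x)" if "x \<in> S" for x v
    using Ck_on_SucD(1)[OF Cd that, of v] by (simp add: dir_deriv_def)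
  have cont: "continuous_on S (dir_deriv w (dir_deriv v f))" for v w
    using Ck_on_SucD(2)[OF Cd, of v w] by (simp add: dir_deriv_def[abs_def])
  obtain r where r: "r > 0" "ball z r \<subseteq> S" using S openE by blast
  have line: "((\<lambda>t. k (a + of_real t * u)) has_real_derivative k' u) (at t)"
    if "(k has_derivative k') (at (a + of_real t * u))" for k :: "complex \<Rightarrow> real" and k' a u t
  proof -
    have "((\<lambda>t. a + of_real t * u) has_derivative (\<lambda>h. of_real h * u)) (at t)" by (auto intro!: derivative_eq_intros)
    from has_derivative_compose[OF this that]
    have "((\<lambda>t. k (a + of_real t * u)) has_derivative (\<lambda>h. k' (of_real h * u))) (at t)" .
    moreover have "k' (of_real h * u) = k' u * h" for h
      using linear_scale[OF has_derivative_linear[OF that], of h u] by (simp add: scaleR_conv_of_real mult.commute)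
    ultimately show ?thesis by (simp add: has_field_derivative_def)
  qed
  have mvt: "\<exists>s\<in>{0<..<t}. \<exists>s'\<in>{0<..<t}. f (z + of_real t * u + of_real t * v) - f (z + of_real t * u) - (f (z + of_real t * v) - f z)
      = t * t * dir_deriv v (dir_deriv u f) (z + of_real s * u + of_real s' * v)"
    if t: "0 < t" "2 * t < r" and uv: "norm u = 1" "norm v = 1" for t u v
  proof -
    have inS: "z + of_real s * u + of_real s' * v \<in> S" if "0 \<le> s" "s \<le> t" "0 \<le> s'" "s' \<le> t" for s s'
    proof -
      have "norm (of_real s * u + of_real s' * v) \<le> s + s'"
        using norm_triangle_ineq[of "of_real s * u" "of_real s' * v"] that uv by (simp add: norm_mult)
      then have "norm (of_real s * u + of_real s' * v) < r" using that t by linarith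
      then have "z + (of_real s * u + of_real s' * v) \<in> ball z r"
        by (simp only: mem_ball dist_norm norm_minus_commute[of z] add_diff_cancel_left')
      then have "z + of_real s * u + of_real s' * v \<in> ball z r" by (simp only: add.assoc)
      then show ?thesis using r by blast
    qed
    define a where "a s = f (z + of_real t * v + of_real s * u) - f (z + of_real s * u)" for s
    have "(a has_real_derivative dir_deriv u f (z + of_real t * v + of_real s * u) - dir_deriv u f (z + of_real s * u)) (at s)"
      if "0 \<le> s" "s \<le> t" for s
      unfolding a_def
      by (intro DERIV_diff line[where u = u] d1) (use inS[of s t] inS[of s 0] that t in \<open>simp_all add: add_ac\<close>)
    from MVT2[OF t(1), of a, OF this]
    obtain s where s: "0 < s" "s < t" "a t - a 0 = t * (dir_deriv u f (z + of_real t * v + of_real s * u) - dir_deriv u f (z + of_real s * u))"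
      by auto
    have "((\<lambda>s'. dir_deriv u f (z + of_real s * u + of_real s' * v)) has_real_derivative
        dir_deriv v (dir_deriv u f) (z + of_real s * u + of_real s' * v)) (at s')" if "0 \<le> s'" "s' \<le> t" for s'
      by (rule line[where u = v]) (use d2 inS[of s s'] s that in auto)
    from MVT2[OF t(1), of "\<lambda>s'. dir_deriv u f (z + of_real s * u + of_real s' * v)", OF this]
    obtain s' where s': "0 < s'" "s' < t" "dir_deriv u f (z + of_real s * u + of_real t * v) - dir_deriv u f (z + of_real s * u)
        = t * dir_deriv v (dir_deriv u f) (z + of_real s * u + of_real s' * v)" by auto
    have "a t - a 0 = t * (t * dir_deriv v (dir_deriv u f) (z + of_real s * u + of_real s' * v))"
      using s(3) s'(3) by (simp add: add_ac)
    then show ?thesis using s s' by (intro bexI[of _ s] bexI[of _ s']) (auto simp: a_def add_ac algebra_simps)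
  qed
  have lim: "(\<lambda>n. dir_deriv v (dir_deriv u f) (x n)) \<longlonglongrightarrow> dir_deriv v (dir_deriv u f) z" if "x \<longlonglongrightarrow> z" for x u v
  proof -
    have "isCont (dir_deriv v (dir_deriv u f)) z"
      using cont[of v u] S unfolding continuous_on_eq_continuous_at[OF S(1)] by blast
    then show ?thesis using that by (rule isCont_tendsto_compose)
  qed
  \<comment> \<open>Side lengths below r / 2 keep the whole square inside the disc of radius
    r.\<close>
  define t where "t n = r / 4 / real (Suc n)" for n
  have t: "0 < t n" "2 * t n < r" for n using r(1)
    by (auto simp: t_def field_simps) (smt (verit) mult_nonneg_nonneg of_nat_0_le_iff)
  have t0: "t \<longlonglongrightarrow> 0" unfolding t_def by real_asymp 
  let ?p = "\<lambda>s u s' v. z + complex_of_real s * u + complex_of_real s' * v"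
  have pl: "(\<lambda>n. ?p (s n) u (s' n) v) \<longlonglongrightarrow> z" if "\<And>n. s n \<in> {0<..<t n}" "\<And>n. s' n \<in> {0<..<t n}" for s s' u v
  proof -
    have "s \<longlonglongrightarrow> 0" "s' \<longlonglongrightarrow> 0"
      by (rule tendsto_sandwich[OF _ _ tendsto_const t0]; use that in \<open>auto intro!: always_eventually less_imp_le\<close>)+
    then have "(\<lambda>n. ?p (s n) u (s' n) v) \<longlonglongrightarrow> z + of_real 0 * u + of_real 0 * v" by (intro tendsto_intros)
    then show ?thesis by simp
  qed
  have "\<exists>s s'. s \<in> {0<..<t n} \<and> s' \<in> {0<..<t n} \<and> f (z + of_real (t n) * 1 + of_real (t n) * \<i>) - f (z + of_real (t n) * 1) - (f (z + of_real (t n) * \<i>) - f z)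
      = t n * t n * dir_deriv \<i> (dir_deriv 1 f) (?p s 1 s' \<i>)" for n
    using mvt[OF t, of 1 \<i> n] unfolding norm_one norm_ii by blast
  then obtain s1 s1' where s1: "\<And>n. s1 n \<in> {0<..<t n}" "\<And>n. s1' n \<in> {0<..<t n}"
    "\<And>n. f (z + of_real (t n) * 1 + of_real (t n) * \<i>) - f (z + of_real (t n) * 1) - (f (z + of_real (t n) * \<i>) - f z)
      = t n * t n * dir_deriv \<i> (dir_deriv 1 f) (?p (s1 n) 1 (s1' n) \<i>)" by metis
  have "\<exists>s s'. s \<in> {0<..<t n} \<and> s' \<in> {0<..<t n} \<and> f (z + of_real (t n) * \<i> + of_real (t n) * 1) - f (z + of_real (t n) * \<i>) - (f (z + of_real (t n) * 1) - f z)
      = t n * t n * dir_deriv 1 (dir_deriv \<i> f) (?p s \<i> s' 1)" for n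
    using mvt[OF t, of \<i> 1 n] unfolding norm_one norm_ii by blast
  then obtain s2 s2' where s2: "\<And>n. s2 n \<in> {0<..<t n}" "\<And>n. s2' n \<in> {0<..<t n}"
    "\<And>n. f (z + of_real (t n) * \<i> + of_real (t n) * 1) - f (z + of_real (t n) * \<i>) - (f (z + of_real (t n) * 1) - f z)
      = t n * t n * dir_deriv 1 (dir_deriv \<i> f) (?p (s2 n) \<i> (s2' n) 1)" by metis
  have "dir_deriv \<i> (dir_deriv 1 f) (?p (s1 n) 1 (s1' n) \<i>) = dir_deriv 1 (dir_deriv \<i> f) (?p (s2 n) \<i> (s2' n) 1)" for n
  proof -
    have "z + of_real (t n) * \<i> + of_real (t n) * 1 = z + of_real (t n) * 1 + of_real (t n) * \<i>" by simp
    then have "t n * t n * dir_deriv \<i> (dir_deriv 1 f) (?p (s1 n) 1 (s1' n) \<i>)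
        = t n * t n * dir_deriv 1 (dir_deriv \<i> f) (?p (s2 n) \<i> (s2' n) 1)"
      unfolding s1(3)[symmetric] s2(3)[symmetric] by (simp add: add_ac)
    then show ?thesis using t(1)[of n] by simp
  qed
  then have "(\<lambda>n. dir_deriv \<i> (dir_deriv 1 f) (?p (s1 n) 1 (s1' n) \<i>)) = (\<lambda>n. dir_deriv 1 (dir_deriv \<i> f) (?p (s2 n) \<i> (s2' n) 1))"
    by (rule ext)
  then have "(\<lambda>n. dir_deriv 1 (dir_deriv \<i> f) (?p (s2 n) \<i> (s2' n) 1)) \<longlonglongrightarrow> dir_deriv \<i> (dir_deriv 1 f) z"
    using lim[OF pl[OF s1(1,2), where u = 1 and v = \<i>], where v = \<i> and u = 1] by (simp only:)
  from LIMSEQ_unique[OF lim[OF pl[OF s2(1,2), where u = \<i> and v = 1], where v = 1 and u = \<i>] this] show ?thesis .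
qed

subsection \<open>Periodized radial functions\<close>

context period_lattice
begin

text \<open>Periodization through the nearest lattice translate instead of a sum. For profiles
  vanishing beyond a radius less than \<open>sep / 2\<close> at most one translate is in range, and
  local formulas carry over unchanged.\<close>

definition periodize :: "(real \<Rightarrow> real) \<Rightarrow> complex \<Rightarrow> complex \<Rightarrow> real" where
  "periodize E w z = E ((infdist (z - w) \<Lambda>)\<^sup>2)"

lemma lattice_nonempty: "\<Lambda> \<noteq> {}" using lattice_0 by blast

lemma infdist_lattice_shift: "l \<in> \<Lambda> \<Longrightarrow> infdist (z + l) \<Lambda> = infdist z \<Lambda>"
proof -
  have le: "infdist (z + l) \<Lambda> \<le> infdist z \<Lambda>" if "l \<in> \<Lambda>" for z l
  proof -
    obtain k where "k \<in> \<Lambda>" "infdist z \<Lambda> = dist z k"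
      using infdist_attains_inf[OF closed_lattice lattice_nonempty, of z] by blast
    then show ?thesis using infdist_le[of "k + l" \<Lambda> "z + l"] lattice_add that by (simp add: dist_norm)
  qed
  assume "l \<in> \<Lambda>"
  then show ?thesis using le[of l z] le[of "-l" "z + l"] by simp
qed

lemma periodic_periodize: "periodic \<omega>1 \<omega>2 (periodize E w)"
proof -
  have "infdist (z + l - w) \<Lambda> = infdist (z - w) \<Lambda>" if "l \<in> \<Lambda>" for z l
    using infdist_lattice_shift[OF that, of "z - w"] by (simp add: algebra_simps)
  then show ?thesis by (simp add: periodic_def periodize_def)
qed

lemma continuous_periodize:
  assumes "continuous_on {0..} E" shows "continuous_on UNIV (periodize E w)"
  unfolding periodize_def
  by (rule continuous_on_compose2[OF assms]) (auto intro!: continuous_intros)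

lemma infdist_lattice_near:
  assumes "l \<in> \<Lambda>" "dist z l < sep / 2" shows "infdist z \<Lambda> = dist z l"
proof -
  obtain k where k: "k \<in> \<Lambda>" "infdist z \<Lambda> = dist z k"
    using infdist_attains_inf[OF closed_lattice lattice_nonempty, of z] by blast
  then have "dist z k < sep / 2" using infdist_le[OF assms(1), of z] assms(2) by linarith
  then show ?thesis using lattice_unique_near[OF assms(1) k(1) assms(2)] k by simp
qed

lemma infdist_lattice_lt:
  assumes "infdist (z - w) \<Lambda> < \<rho>" obtains l where "l \<in> \<Lambda>" "dist z (w + l) < \<rho>"
proof -
  obtain k where "k \<in> \<Lambda>" "infdist (z - w) \<Lambda> = dist (z - w) k"
    using infdist_attains_inf[OF closed_lattice lattice_nonempty, of "z - w"] by blast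
  then show ?thesis using assms by (intro that[of k]) (auto simp: dist_norm algebra_simps)
qed

lemma infdist_lattice_ball:
  assumes "l \<in> \<Lambda>" "z \<in> ball (w + l) (sep / 2)"
  shows "(infdist (z - w) \<Lambda>)\<^sup>2 = sqd (w + l) z"
proof -
  have "dist (z - w) l = dist z (w + l)" by (simp add: dist_norm algebra_simps)
  then show ?thesis using infdist_lattice_near[OF assms(1), of "z - w"] assms(2) by (simp add: sqd_eq dist_commute)
qed

lemma periodize_translate: "periodize E w z = periodize E 0 (z - w)"
  by (simp add: periodize_def)

text \<open>Independence of the centre lets the unknown integrals at two centres cancel when test
  functions are compared.\<close>

lemma torus_integral_periodize:
  assumes "continuous_on {0..} E"
  shows "torus_integral \<omega>1 \<omega>2 (periodize E w) = torus_integral \<omega>1 \<omega>2 (periodize E w')"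
proof -
  have "periodize E w = (\<lambda>z. periodize E 0 (z + - w))" for w using periodize_translate by fastforce
  then show ?thesis using torus_integral_translate[OF continuous_periodize[OF assms] periodic_periodize] by metis
qed

lemma torus_integral_add:
  assumes "set_integrable lborel P u" "set_integrable lborel P v"
  shows "torus_integral \<omega>1 \<omega>2 (\<lambda>z. u z + v z) = torus_integral \<omega>1 \<omega>2 u + torus_integral \<omega>1 \<omega>2 v"
    and "torus_integral \<omega>1 \<omega>2 (\<lambda>z. u z - v z) = torus_integral \<omega>1 \<omega>2 u - torus_integral \<omega>1 \<omega>2 v"
  unfolding torus_integral_def by (rule set_integral_add(2)[OF assms], rule set_integral_diff(2)[OF assms])

lemma torus_integral_cmult: "torus_integral \<omega>1 \<omega>2 (\<lambda>z. c * u z) = c * torus_integral \<omega>1 \<omega>2 u"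
  unfolding torus_integral_def by simp

lemma torus_integral_mono:
  assumes "set_integrable lborel P u" "set_integrable lborel P v" "\<And>z. z \<in> P \<Longrightarrow> u z \<le> v z"
  shows "torus_integral \<omega>1 \<omega>2 u \<le> torus_integral \<omega>1 \<omega>2 v"
  unfolding torus_integral_def by (rule set_integral_mono[OF assms])

lemma set_integrable_P_mult:
  fixes u :: "complex \<Rightarrow> real"
  assumes g: "set_integrable lborel P g" and u: "continuous_on UNIV u"
  shows "set_integrable lborel P (\<lambda>z. g z * u z)"
proof -
  have "compact (u ` cball 0 (norm \<omega>1 + norm \<omega>2))"
    by (rule compact_continuous_image) (use u continuous_on_subset in auto)
  then obtain M where "\<forall>y\<in>u ` cball 0 (norm \<omega>1 + norm \<omega>2). norm y \<le> M"
    using compact_imp_bounded bounded_iff by metis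
  then have M: "\<bar>u z\<bar> \<le> M" if "z \<in> P" for z
    using subsetD[OF P_subset_cball that] by auto
  have [measurable]: "u \<in> borel_measurable borel" by (rule borel_measurable_continuous_onI[OF u])
  have "integrable lborel (\<lambda>z. M *\<^sub>R (indicat_real P z *\<^sub>R g z))"
    using g unfolding set_integrable_def by (rule integrable_scaleR_right)
  then show ?thesis unfolding set_integrable_def
  proof (rule Bochner_Integration.integrable_bound)
    have "(\<lambda>z. (indicat_real P z *\<^sub>R g z) * u z) \<in> borel_measurable lborel"
    proof (rule borel_measurable_times)
      show "(\<lambda>z. indicat_real P z *\<^sub>R g z) \<in> borel_measurable lborel"
        using g unfolding set_integrable_def by (rule borel_measurable_integrable)
    qed simp
    then show "(\<lambda>z. indicat_real P z *\<^sub>R (g z * u z)) \<in> borel_measurable lborel" by (simp add: mult.assoc)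
    show "AE z in lborel. norm (indicat_real P z *\<^sub>R (g z * u z)) \<le> norm (M *\<^sub>R (indicat_real P z *\<^sub>R g z))"
    proof (rule AE_I2)
      fix z
      have "\<bar>g z\<bar> * \<bar>u z\<bar> \<le> \<bar>M\<bar> * \<bar>g z\<bar>" if "z \<in> P" using mult_left_mono[of "\<bar>u z\<bar>" "\<bar>M\<bar>" "\<bar>g z\<bar>"] M[OF that] by (simp add: mult.commute)
      then show "norm (indicat_real P z *\<^sub>R (g z * u z)) \<le> norm (M *\<^sub>R (indicat_real P z *\<^sub>R g z))"
        by (cases "z \<in> P") (auto simp: abs_mult)
    qed
  qed
qed

lemma abs_torus_integral_le:
  assumes "set_integrable lborel P u" "set_integrable lborel P v" "\<And>z. z \<in> P \<Longrightarrow> \<bar>u z\<bar> \<le> v z"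
  shows "\<bar>torus_integral \<omega>1 \<omega>2 u\<bar> \<le> torus_integral \<omega>1 \<omega>2 v"
proof -
  have m: "set_integrable lborel P (\<lambda>z. -1 * u z)" using assms(1) by (rule set_integrable_mult_right)
  have "torus_integral \<omega>1 \<omega>2 u \<le> torus_integral \<omega>1 \<omega>2 v"
    by (rule torus_integral_mono[OF assms(1,2)]) (use assms(3) in force)
  moreover have "torus_integral \<omega>1 \<omega>2 (\<lambda>z. -1 * u z) \<le> torus_integral \<omega>1 \<omega>2 v"
    by (rule torus_integral_mono[OF m assms(2)]) (use assms(3) in force)
  ultimately show ?thesis unfolding torus_integral_cmult by linarith
qed

end

text \<open>
  The profile is evaluated at squared distances; requiring it on \<open>{-\<delta><..}\<close> provides an open
  domain around the value \<open>0\<close>.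
\<close>

locale radial_profile = period_lattice +
  fixes E E' E'' :: "real \<Rightarrow> real" and \<delta> \<rho> :: real
  assumes \<delta>: "0 < \<delta>" and \<rho>: "0 < \<rho>" "\<rho> < sep / 2"
    and E': "\<And>s. s > - \<delta> \<Longrightarrow> (E has_real_derivative E' s) (at s)"
    and E'': "\<And>s. s > - \<delta> \<Longrightarrow> (E' has_real_derivative E'' s) (at s)"
    and smooth: "\<And>k. Ck_on k {- \<delta><..} E"
    and zero: "\<And>s. s \<ge> \<rho>\<^sup>2 \<Longrightarrow> E s = 0" "\<And>s. s \<ge> \<rho>\<^sup>2 \<Longrightarrow> E' s = 0" "\<And>s. s \<ge> \<rho>\<^sup>2 \<Longrightarrow> E'' s = 0"
begin

lemma periodize_far: "\<rho> \<le> infdist (z - w) \<Lambda> \<Longrightarrow> periodize E w z = 0"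
  using zero(1)[of "(infdist (z - w) \<Lambda>)\<^sup>2"] \<rho> by (simp add: periodize_def power_mono)

lemma open_far: "open {z. \<rho> < infdist (z - w) \<Lambda>}"
  by (intro open_Collect_less continuous_intros)

lemma far_or_near:
  obtains "\<rho> < infdist (z - w) \<Lambda>" | l where "l \<in> \<Lambda>" "z \<in> ball (w + l) (sep / 2)"
proof (cases "\<rho> < infdist (z - w) \<Lambda>")
  case False
  then have "infdist (z - w) \<Lambda> < sep / 2" using \<rho> by linarith
  then obtain l where "l \<in> \<Lambda>" "dist z (w + l) < sep / 2" by (rule infdist_lattice_lt)
  then show ?thesis using that(2)[of l] by (simp add: dist_commute)
qed (rule that(1))

lemma sqd_gt: "sqd p z > - \<delta>" using \<delta> by (simp add: sqd_eq add_pos_nonneg less_le_trans[of "-\<delta>" 0])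

lemma Ck_on_periodize: "Ck_on k UNIV (periodize E w)"
proof (rule Ck_on_local)
  fix z
  show "\<exists>U. open U \<and> z \<in> U \<and> Ck_on k U (periodize E w)"
  proof (cases rule: far_or_near[of z w])
    case 1
    have "Ck_on k {z. \<rho> < infdist (z - w) \<Lambda>} (periodize E w)"
      by (rule Ck_on_cong[OF open_far _ Ck_on_const[OF open_far, of k w 0]]) (simp add: periodize_far)
    then show ?thesis using 1 open_far by blast
  next
    case (2 l)
    have "Ck_on k (ball (w + l) (sep / 2)) (\<lambda>z. E (sqd (w + l) z))"
      by (rule Ck_on_compose[OF open_ball open_greaterThan _ smooth Ck_on_sqd[OF open_ball]]) (simp add: sqd_gt)
    then have "Ck_on k (ball (w + l) (sep / 2)) (periodize E w)"
      by (rule Ck_on_cong[rotated 2]) (auto simp: periodize_def infdist_lattice_ball[OF 2(1)])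
    then show ?thesis using 2 by blast
  qed
qed

lemma laplacian_periodize:
  "laplacian (periodize E w) z = periodize (\<lambda>s. 4 * (s * E'' s + E' s)) w z"
proof (cases rule: far_or_near[of z w])
  case 1
  have "laplacian (periodize E w) z = laplacian (\<lambda>_. 0) z"
    by (rule laplacian_cong[OF open_far]) (use 1 periodize_far in auto)
  also have "\<dots> = 0"
  proof -
    have "dir_deriv v (\<lambda>_. 0) = (\<lambda>_. 0)" for v by (rule ext, rule dir_deriv_eq) simp
    then show ?thesis by (simp add: laplacian_def)
  qed
  also have "\<rho>\<^sup>2 \<le> (infdist (z - w) \<Lambda>)\<^sup>2" using 1 \<rho> by (simp add: power_mono)
  then have "0 = periodize (\<lambda>s. 4 * (s * E'' s + E' s)) w z" using zero by (simp add: periodize_def)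
  finally show ?thesis .
next
  case (2 l)
  have "laplacian (periodize E w) z = laplacian (\<lambda>z. E (sqd (w + l) z)) z"
    by (rule laplacian_cong[of "ball (w + l) (sep / 2)"]) (use 2 in \<open>auto simp: periodize_def infdist_lattice_ball[OF 2(1)]\<close>)
  also have "\<dots> = 4 * (sqd (w + l) z * E'' (sqd (w + l) z) + E' (sqd (w + l) z))"
    by (rule laplacian_radial[where T = "{- \<delta><..}" and S = UNIV]) (use E' E'' sqd_gt in auto)
  finally show ?thesis by (simp add: periodize_def infdist_lattice_ball[OF 2])
qed

end

subsection \<open>The Green function\<close>

context period_lattice
begin

lemma Ck_on_patch:
  assumes "Ck_on k (- \<Lambda>) u" "open V" "\<Lambda> \<subseteq> V" "\<And>z. z \<in> V \<Longrightarrow> u z = 0"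
  shows "Ck_on k UNIV u"
proof (rule Ck_on_local)
  fix z
  have "Ck_on k V u" by (rule Ck_on_cong[OF assms(2) _ Ck_on_const[OF assms(2), of k 0]]) (simp add: assms(4))
  then show "\<exists>U. open U \<and> z \<in> U \<and> Ck_on k U u"
    using assms(1-3) open_compl_lattice by (cases "z \<in> \<Lambda>") blast+
qed

lemma periodic_dir_deriv:
  assumes "periodic \<omega>1 \<omega>2 u" shows "periodic \<omega>1 \<omega>2 (dir_deriv v u)"
  unfolding periodic_def
proof (intro allI ballI)
  fix z l assume l: "l \<in> \<Lambda>"
  have "(u has_derivative D) (at (z + l)) \<longleftrightarrow> (u has_derivative D) (at z)" for D
  proof -
    have u: "(\<lambda>x. u (x + l)) = u" using assms l by (auto simp: periodic_def)
    have *: "((\<lambda>x. k (x + a)) has_derivative D) (at y)" if "(k has_derivative D) (at (y + a))" for k :: "complex \<Rightarrow> real" and a y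
    proof -
      have "((\<lambda>x. x + a) has_derivative (\<lambda>x. x)) (at y)" by (auto intro!: derivative_eq_intros)
      from has_derivative_compose[OF this that] show ?thesis .
    qed
    show ?thesis using *[of u z l] *[of "\<lambda>x. u (x + l)" "z + l" "-l"] unfolding u by auto
  qed
  then show "dir_deriv v u (z + l) = dir_deriv v u z" by (simp add: dir_deriv_def frechet_derivative_def)
qed

lemma torus_integral_dir_deriv:
  assumes "Ck_on 1 UNIV u" "periodic \<omega>1 \<omega>2 u"
  shows "torus_integral \<omega>1 \<omega>2 (dir_deriv v u) = 0"
proof -
  have C: "Ck_on (Suc 0) UNIV u" using assms(1) by simp
  show ?thesis unfolding dir_deriv_def
    by (rule torus_integral_derivative[OF _ _ assms(2)])
      (use Ck_on_SucD(1)[OF C] Ck_on_SucD(2)[OF C] in auto)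
qed

end

lemma DERIV_flat_shift: "((\<lambda>s. flat n (c - s)) has_real_derivative - (flat (n + 2) (c - s) - real n * flat (n + 1) (c - s))) (at s)"
proof -
  have "((\<lambda>s. c - s) has_real_derivative -1) (at s)" by (auto intro!: derivative_eq_intros)
  from DERIV_chain2[where g = "\<lambda>s. c - s", OF DERIV_flat this, of n] show ?thesis by simp
qed

lemma Ck_on_flat_shift: "open S \<Longrightarrow> Ck_on k S (\<lambda>s. flat n (c - s))"
proof (rule Ck_on_compose[OF _ open_UNIV _ Ck_on_flat])
  assume "open S"
  then have "Ck_on k S (\<lambda>s. c + - s)" by (intro Ck_on_add Ck_on_const Ck_on_bounded_linear bounded_linear_minus bounded_linear_ident)
  then show "Ck_on k S (\<lambda>s. c - s)" by simp
qed auto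

locale torus_green = period_lattice +
  fixes g :: "complex \<Rightarrow> real"
  assumes per: "periodic \<omega>1 \<omega>2 g" and smooth: "smooth_on (- \<Lambda>) g"
    and int: "set_integrable lborel P g" and green: "green_equation \<omega>1 \<omega>2 0 g"
begin

lemma Ck_g: "Ck_on k (- \<Lambda>) g" using smooth by (simp add: smooth_on_def)

lemma Ck_dir_deriv_g: "Ck_on k (- \<Lambda>) (dir_deriv v g)"
  using Ck_on_SucD(2)[OF Ck_g, of k v] by (simp add: dir_deriv_def[abs_def])

lemma Ck_dir_deriv: "(\<And>k. Ck_on k S u) \<Longrightarrow> Ck_on k S (dir_deriv v u)"
  using Ck_on_SucD(2)[of k S u v] by (simp add: dir_deriv_def[abs_def])

lemma dir_deriv_has_derivative:
  assumes "\<And>k. Ck_on k S u" "z \<in> S" shows "(u has_derivative (\<lambda>v. dir_deriv v u z)) (at z)"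
  using Ck_on_SucD(1)[OF assms(1) assms(2)] by (simp add: dir_deriv_def)

lemma green_eq:
  assumes "periodic \<omega>1 \<omega>2 \<phi>" "\<And>k. Ck_on k UNIV \<phi>"
  shows "torus_integral \<omega>1 \<omega>2 (\<lambda>z. g z * laplacian \<phi> z) = torus_integral \<omega>1 \<omega>2 \<phi> / covolume - \<phi> 0"
proof -
  have "- torus_integral \<omega>1 \<omega>2 (\<lambda>z. g z * laplacian \<phi> z) = \<phi> 0 - (1 / torus_area \<omega>1 \<omega>2) * torus_integral \<omega>1 \<omega>2 \<phi>"
    using green assms unfolding green_equation_def smooth_on_def by blast
  then show ?thesis by (simp add: torus_area_eq)
qed

lemma Ck_laplacian: "(\<And>k. Ck_on k S u) \<Longrightarrow> open S \<Longrightarrow> Ck_on k S (laplacian u)"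
  unfolding laplacian_def[abs_def] by (intro Ck_on_add Ck_dir_deriv)

text \<open>Green's second identity moves the Laplacian from \<open>\<phi>\<close> to \<^term>\<open>g\<close>.\<close>

lemma torus_integral_test:
  assumes \<phi>: "periodic \<omega>1 \<omega>2 \<phi>" "\<And>k. Ck_on k UNIV \<phi>"
    and V: "open V" "\<Lambda> \<subseteq> V" "\<And>z. z \<in> V \<Longrightarrow> \<phi> z = 0"
  shows "continuous_on UNIV (\<lambda>z. \<phi> z * (laplacian g z - 1 / covolume))"
    and "torus_integral \<omega>1 \<omega>2 (\<lambda>z. \<phi> z * (laplacian g z - 1 / covolume)) = 0"
proof -
  have D0: "dir_deriv v u z = 0" if "\<And>z. z \<in> V \<Longrightarrow> u z = 0" "z \<in> V" for u v z
    using dir_deriv_cong[OF V(1) that(2), of u "\<lambda>_. 0" v] that(1) by (simp add: dir_deriv_eq[OF has_derivative_const])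
  have \<phi>': "Ck_on k (- \<Lambda>) \<phi>" for k using \<phi>(2) Ck_on_subset by blast
  have op: "open (- \<Lambda>)" by (rule open_compl_lattice)
  \<comment> \<open>The components of Green's vector field, whose divergence is g times the
    Laplacian of \<phi> minus \<phi> times that of g. They vanish on V and hence extend across the
    singularities of g.\<close>
  define u where "u v z = g z * dir_deriv v \<phi> z - \<phi> z * dir_deriv v g z" for v z
  have Ck_u: "Ck_on 1 UNIV (u v)" for v
  proof (rule Ck_on_patch[OF _ V(1,2)])
    have "Ck_on 1 (- \<Lambda>) (\<lambda>z. g z * dir_deriv v \<phi> z + - 1 * (\<phi> z * dir_deriv v g z))"
      by (intro Ck_on_add Ck_on_mult op Ck_g Ck_dir_deriv_g \<phi>' Ck_on_const Ck_dir_deriv)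
    then show "Ck_on 1 (- \<Lambda>) (u v)" by (simp add: u_def[abs_def])
    show "u v z = 0" if "z \<in> V" for z using V(3)[OF that] D0[OF V(3) that] by (simp add: u_def)
  qed
  have per_u: "periodic \<omega>1 \<omega>2 (u v)" for v
    using per \<phi>(1) periodic_dir_deriv[OF per] periodic_dir_deriv[OF \<phi>(1)] by (simp add: periodic_def u_def)
  have du: "dir_deriv v (u v) z = g z * dir_deriv v (dir_deriv v \<phi>) z - \<phi> z * dir_deriv v (dir_deriv v g) z" for v z
  proof (cases "z \<in> \<Lambda>")
    case True
    then have z: "z \<in> V" using V(2) by blast
    have "dir_deriv v (u v) z = 0" by (rule D0[OF _ z]) (simp add: u_def V(3) D0[OF V(3)])
    moreover have "dir_deriv v (dir_deriv v \<phi>) z = 0" by (rule D0[OF _ z]) (rule D0[OF V(3)])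
    ultimately show ?thesis using V(3)[OF z] by simp
  next
    case False
    then have z: "z \<in> - \<Lambda>" by simp
    have "(u v has_derivative (\<lambda>h. (g z * dir_deriv h (dir_deriv v \<phi>) z + dir_deriv h g z * dir_deriv v \<phi> z)
        - (\<phi> z * dir_deriv h (dir_deriv v g) z + dir_deriv h \<phi> z * dir_deriv v g z))) (at z)"
      unfolding u_def[abs_def]
      by (rule has_derivative_diff[OF has_derivative_mult[OF dir_deriv_has_derivative[OF Ck_g z] dir_deriv_has_derivative[OF Ck_dir_deriv[OF \<phi>'] z]]
            has_derivative_mult[OF dir_deriv_has_derivative[OF \<phi>' z] dir_deriv_has_derivative[OF Ck_dir_deriv_g z]]])
    from dir_deriv_eq[OF this] show ?thesis by simp
  qed
  let ?W = "\<lambda>z. dir_deriv 1 (u 1) z + dir_deriv \<i> (u \<i>) z"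
  let ?X = "\<lambda>z. \<phi> z * (laplacian g z - 1 / covolume)"
  have W: "?W z = g z * laplacian \<phi> z - \<phi> z * laplacian g z" for z
    by (simp add: du laplacian_def algebra_simps)
  have cW: "continuous_on UNIV (dir_deriv v (u v))" for v
    using Ck_on_SucD(2)[of 0 UNIV "u v" v] Ck_u[of v] by (simp add: dir_deriv_def[abs_def])
  have cg: "continuous_on UNIV (\<lambda>z. g z * laplacian \<phi> z)"
  proof -
    have "Ck_on 0 UNIV (\<lambda>z. g z * laplacian \<phi> z)"
    proof (rule Ck_on_patch[OF _ V(1,2)])
      show "Ck_on 0 (- \<Lambda>) (\<lambda>z. g z * laplacian \<phi> z)"
        by (intro Ck_on_mult op Ck_g Ck_laplacian \<phi>')
      show "g z * laplacian \<phi> z = 0" if "z \<in> V" for z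
        using D0[OF D0[OF V(3)] that] by (simp add: laplacian_def)
    qed
    then show ?thesis by simp
  qed
  have c\<phi>: "continuous_on UNIV \<phi>" using \<phi>(2)[of 0] by simp
  have X: "?X = (\<lambda>z. (g z * laplacian \<phi> z - ?W z) - (1 / covolume) * \<phi> z)"
    unfolding W by (auto simp: algebra_simps)
  show "continuous_on UNIV ?X" unfolding X by (intro continuous_intros cW cg c\<phi>)
  have "torus_integral \<omega>1 \<omega>2 ?W = 0"
    using torus_integral_add(1)[OF set_integrable_P[OF cW] set_integrable_P[OF cW], of 1 \<i>]
      torus_integral_dir_deriv[OF Ck_u per_u] by simp
  moreover have "torus_integral \<omega>1 \<omega>2 ?X = (torus_integral \<omega>1 \<omega>2 (\<lambda>z. g z * laplacian \<phi> z) - torus_integral \<omega>1 \<omega>2 ?W)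
      - torus_integral \<omega>1 \<omega>2 (\<lambda>z. (1 / covolume) * \<phi> z)"
    unfolding X
    by (subst torus_integral_add(2), (rule set_integrable_P, intro continuous_intros cW cg c\<phi>)+)
      (subst torus_integral_add(2), (rule set_integrable_P, intro continuous_intros cW cg c\<phi>)+, rule refl)
  moreover have "\<phi> 0 = 0" using V(2,3) lattice_0 by blast
  ultimately show "torus_integral \<omega>1 \<omega>2 ?X = 0"
    using green_eq[OF \<phi>] torus_integral_cmult[of "1 / covolume" \<phi>] by simp
qed

text \<open>If the difference D were nonzero at \<open>z0\<close>, it would keep the sign \<sigma>
  on a small disc. A bump supported on the translates of this disc, times \<sigma> D, is nonnegative
  with integral zero, yet positive at \<open>z0\<close>.\<close>

lemma laplacian_g:
  assumes z0: "z0 \<notin> \<Lambda>" shows "laplacian g z0 = 1 / covolume"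
proof (rule ccontr)
  assume ne: "laplacian g z0 \<noteq> 1 / covolume"
  define D where "D z = laplacian g z - 1 / covolume" for z
  define \<sigma> where "\<sigma> = sgn (D z0)"
  have op: "open (- \<Lambda>)" by (rule open_compl_lattice)
  have "Ck_on 0 (- \<Lambda>) (laplacian g)" by (rule Ck_laplacian[OF Ck_g op])
  then have "continuous_on (- \<Lambda>) (\<lambda>z. \<sigma> * D z)" unfolding D_def by (intro continuous_intros) simp
  then have "open (- \<Lambda> \<inter> (\<lambda>z. \<sigma> * D z) -` {0<..})" using op by (intro continuous_open_preimage) auto
  then have "open {z \<in> - \<Lambda>. 0 < \<sigma> * D z}" by (simp add: vimage_def Int_def)
  moreover have pos0: "0 < \<sigma> * D z0" using ne by (auto simp: \<sigma>_def D_def sgn_real_def)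
  then have "z0 \<in> {z \<in> - \<Lambda>. 0 < \<sigma> * D z}" using z0 by simp
  ultimately obtain r0 where r0: "r0 > 0" "ball z0 r0 \<subseteq> {z \<in> - \<Lambda>. 0 < \<sigma> * D z}" by (meson openE)
  define r where "r = min (r0 / 2) (sep / 4)"
  have r: "0 < r" "r < r0" "r < sep / 2" using r0 sep_pos by (auto simp: r_def)
  interpret radial_profile \<omega>1 \<omega>2 "\<lambda>s. flat 0 (r\<^sup>2 - s)" "\<lambda>s. - flat 2 (r\<^sup>2 - s)"
    "\<lambda>s. flat 4 (r\<^sup>2 - s) - 2 * flat 3 (r\<^sup>2 - s)" 1 r
  proof unfold_locales
    show "((\<lambda>s. flat 0 (r\<^sup>2 - s)) has_real_derivative - flat 2 (r\<^sup>2 - s)) (at s)" for s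
      using DERIV_flat_shift[of 0 "r\<^sup>2" s] by (simp add: numeral_2_eq_2)
    show "((\<lambda>s. - flat 2 (r\<^sup>2 - s)) has_real_derivative flat 4 (r\<^sup>2 - s) - 2 * flat 3 (r\<^sup>2 - s)) (at s)" for s
      using DERIV_minus[OF DERIV_flat_shift[of 2 "r\<^sup>2" s]] by simp
    show "Ck_on k {-1<..} (\<lambda>s. flat 0 (r\<^sup>2 - s))" for k by (rule Ck_on_flat_shift) simp
  qed (use r in \<open>auto simp: flat_def\<close>)
  define \<phi> where "\<phi> = periodize (\<lambda>s. flat 0 (r\<^sup>2 - s)) z0"
  have sgn: "\<phi> z \<noteq> 0 \<Longrightarrow> z \<notin> \<Lambda> \<and> 0 < \<sigma> * D z" for z
  proof -
    assume "\<phi> z \<noteq> 0"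
    then have "infdist (z - z0) \<Lambda> < r" using periodize_far[of z z0] unfolding \<phi>_def by linarith
    then obtain l where l: "l \<in> \<Lambda>" "dist z (z0 + l) < r" by (rule infdist_lattice_lt)
    then have "z - l \<in> ball z0 r0" using r by (simp add: dist_norm norm_minus_commute algebra_simps)
    then have "z - l \<notin> \<Lambda>" "0 < \<sigma> * D (z - l)" using r0(2) by auto
    moreover have "D (x + l) = D x" for x
      using periodic_dir_deriv[OF periodic_dir_deriv[OF per]] l(1) unfolding D_def laplacian_def periodic_def by simp
    from this[of "z - l"] have "D z = D (z - l)" by simp
    ultimately show ?thesis using lattice_diff_cancel[OF l(1)] by simp
  qed
  let ?V = "{z. r < infdist (z - z0) \<Lambda>}"
  have V: "\<Lambda> \<subseteq> ?V"
  proof (rule ccontr)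
    assume "\<not> \<Lambda> \<subseteq> ?V"
    then obtain z where z: "z \<in> \<Lambda>" "infdist (z - z0) \<Lambda> < r0" using r by force
    obtain l where l: "l \<in> \<Lambda>" "dist z (z0 + l) < r0" using infdist_lattice_lt[OF z(2)] .
    then have "z - l \<in> ball z0 r0" by (simp add: dist_norm norm_minus_commute algebra_simps)
    then show False using r0(2) lattice_diff[OF z(1) l(1)] by blast
  qed
  have \<phi>: "periodic \<omega>1 \<omega>2 \<phi>" "\<And>k. Ck_on k UNIV \<phi>"
    unfolding \<phi>_def by (rule periodic_periodize, rule Ck_on_periodize)
  have "\<phi> z = 0" if "z \<in> ?V" for z using periodize_far that unfolding \<phi>_def by simp
  note test = torus_integral_test[OF \<phi> open_far V this, folded D_def]
  have "\<sigma> * (\<phi> z0 * D z0) = 0"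
  proof (rule torus_integral_nonneg_eq_0)
    show "continuous_on UNIV (\<lambda>z. \<sigma> * (\<phi> z * D z))" by (intro continuous_intros test(1))
    show "0 \<le> \<sigma> * (\<phi> z * D z)" for z
    proof -
      have "0 \<le> \<phi> z" by (simp add: \<phi>_def periodize_def flat_nonneg)
      then have "0 \<le> \<phi> z * (\<sigma> * D z)" using sgn[of z] by (cases "\<phi> z = 0") auto
      then show ?thesis by (simp add: mult_ac)
    qed
    show "periodic \<omega>1 \<omega>2 (\<lambda>z. \<sigma> * (\<phi> z * D z))"
      using \<phi>(1) periodic_dir_deriv[OF periodic_dir_deriv[OF per]] unfolding D_def laplacian_def periodic_def by simp
    show "torus_integral \<omega>1 \<omega>2 (\<lambda>z. \<sigma> * (\<phi> z * D z)) = 0" using test(2) by (simp add: torus_integral_cmult)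
  qed
  moreover have "\<phi> z0 > 0"
    using r(1) infdist_zero[OF lattice_0] by (simp add: \<phi>_def periodize_def flat_def)
  ultimately show False using pos0 by auto
qed

end

text \<open>The argument s is a squared distance, and the cutoff depends on s^2, so its derivative
  \<open>s * cutoff1 r s\<close> carries a factor s. In the Laplacian of the truncated logarithm
  every term with a derivative of the cutoff then has a factor s to compensate ln(s + e) or 1 / (s +
  e). \<open>cutoff2\<close> is the second derivative.\<close>

definition cutoff :: "real \<Rightarrow> real \<Rightarrow> real" where "cutoff r s = flat 0 (r ^ 4 - s\<^sup>2)"
definition cutoff1 :: "real \<Rightarrow> real \<Rightarrow> real" where "cutoff1 r s = - 2 * flat 2 (r ^ 4 - s\<^sup>2)"
definition cutoff2 :: "real \<Rightarrow> real \<Rightarrow> real" where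
  "cutoff2 r s = - 2 * flat 2 (r ^ 4 - s\<^sup>2) + 4 * s\<^sup>2 * (flat 4 (r ^ 4 - s\<^sup>2) - 2 * flat 3 (r ^ 4 - s\<^sup>2))"

lemma DERIV_flat_square:
  "((\<lambda>s. flat n (c - s\<^sup>2)) has_real_derivative (flat (n + 2) (c - s\<^sup>2) - real n * flat (n + 1) (c - s\<^sup>2)) * (- 2 * s)) (at s)"
proof -
  have "((\<lambda>s. c - s\<^sup>2) has_real_derivative - 2 * s) (at s)" by (auto intro!: derivative_eq_intros)
  from DERIV_chain2[where g = "\<lambda>s. c - s\<^sup>2", OF DERIV_flat this, of n] show ?thesis .
qed

lemma DERIV_cutoff: "(cutoff r has_real_derivative s * cutoff1 r s) (at s)"
  using DERIV_flat_square[of 0 "r ^ 4" s] by (simp add: cutoff_def[abs_def] cutoff1_def numeral_2_eq_2 mult_ac)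

lemma DERIV_cutoff': "((\<lambda>s. s * cutoff1 r s) has_real_derivative cutoff2 r s) (at s)"
proof -
  have "((\<lambda>s. - 2 * flat 2 (r ^ 4 - s\<^sup>2)) has_real_derivative - 2 * ((flat 4 (r ^ 4 - s\<^sup>2) - 2 * flat 3 (r ^ 4 - s\<^sup>2)) * (- 2 * s))) (at s)"
    using DERIV_cmult[OF DERIV_flat_square[of 2 "r ^ 4" s], of "-2"] by simp
  from DERIV_mult[OF DERIV_ident this]
  show ?thesis by (simp add: cutoff1_def[abs_def] cutoff2_def power2_eq_square algebra_simps)
qed

lemma continuous_cutoff: "continuous_on S (cutoff r)" "continuous_on S (cutoff1 r)" "continuous_on S (cutoff2 r)"
proof -
  have f: "continuous_on S (\<lambda>s. flat n (c - s\<^sup>2))" for n c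
    using DERIV_isCont[OF DERIV_flat_square] by (simp add: continuous_at_imp_continuous_on)
  show "continuous_on S (cutoff r)" "continuous_on S (cutoff1 r)" "continuous_on S (cutoff2 r)"
    unfolding cutoff_def[abs_def] cutoff1_def[abs_def] cutoff2_def[abs_def] by (intro continuous_intros f)+
qed

lemma cutoff_zero:
  assumes "0 < r" "r\<^sup>2 \<le> s" shows "cutoff r s = 0" "cutoff1 r s = 0" "cutoff2 r s = 0"
proof -
  have "r ^ 4 \<le> s\<^sup>2" using power_mono[OF assms(2), of 2] by simp
  then show "cutoff r s = 0" "cutoff1 r s = 0" "cutoff2 r s = 0"
    by (simp_all add: cutoff_def cutoff1_def cutoff2_def flat_def)
qed

lemma cutoff_bounds: "0 \<le> cutoff r s" "cutoff r s \<le> 1"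
  by (simp_all add: cutoff_def flat_nonneg flat_0_le_1)

lemma cutoff_antimono: "0 \<le> s \<Longrightarrow> s \<le> t \<Longrightarrow> cutoff r t \<le> cutoff r s"
  unfolding cutoff_def by (rule flat_0_mono) (simp add: power_mono)

text \<open>A regularised multiple of the fundamental solution of the Laplacian, in the variable s =
  |z|^2: the shift by e makes it smooth at 0. \<open>log_E1\<close> and \<open>log_E2\<close> are
  its first two derivatives in s.\<close>

definition log_E :: "real \<Rightarrow> real \<Rightarrow> real \<Rightarrow> real" where "log_E r e s = ln (s + e) * cutoff r s"
definition log_E1 :: "real \<Rightarrow> real \<Rightarrow> real \<Rightarrow> real" where
  "log_E1 r e s = cutoff r s / (s + e) + ln (s + e) * (s * cutoff1 r s)"
definition log_E2 :: "real \<Rightarrow> real \<Rightarrow> real \<Rightarrow> real" where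
  "log_E2 r e s = - cutoff r s / (s + e)\<^sup>2 + 2 * (s * cutoff1 r s) / (s + e) + ln (s + e) * cutoff2 r s"

text \<open>
  The Laplacian of \<open>ln (|z|\<^sup>2 + e)\<close>, cut off: an approximate identity plus a term that is
  bounded uniformly in \<open>e\<close>.
\<close>

definition log_P :: "real \<Rightarrow> real \<Rightarrow> real \<Rightarrow> real" where "log_P r e s = 4 * e * cutoff r s / (s + e)\<^sup>2"
definition log_S :: "real \<Rightarrow> real \<Rightarrow> real \<Rightarrow> real" where
  "log_S r e s = 4 * (2 * s * (s * cutoff1 r s) / (s + e) + ln (s + e) * (s * (cutoff2 r s + cutoff1 r s)))"

lemma log_split:
  assumes "0 < e" "0 \<le> s"
  shows "4 * (s * log_E2 r e s + log_E1 r e s) = log_P r e s + log_S r e s"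
proof -
  have "s * (- cutoff r s / (s + e)\<^sup>2) + cutoff r s / (s + e) = e * cutoff r s / (s + e)\<^sup>2"
  proof -
    have "cutoff r s / (s + e) = cutoff r s * (s + e) / (s + e)\<^sup>2" using assms by (simp add: power2_eq_square)
    then show ?thesis by (simp add: add_divide_distrib[symmetric] algebra_simps)
  qed
  then show ?thesis by (simp add: log_E1_def log_E2_def log_P_def log_S_def algebra_simps)
qed

lemma Ck_on_ln_shift: "Ck_on k {-e<..} (\<lambda>s::real. ln (s + e))"
proof (rule Ck_on_compose[OF open_greaterThan open_greaterThan _ Ck_on_ln])
  show "Ck_on k {-e<..} (\<lambda>s::real. s + e)"
    by (intro Ck_on_add Ck_on_const open_greaterThan Ck_on_bounded_linear bounded_linear_ident)
qed auto

lemma (in period_lattice) radial_profile_log: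
  assumes r: "0 < r" "r < sep / 2" and e: "0 < e"
  shows "radial_profile \<omega>1 \<omega>2 (log_E r e) (log_E1 r e) (log_E2 r e) e r"
proof unfold_locales
  have dl: "((\<lambda>s. ln (s + e)) has_real_derivative 1 / (s + e)) (at s)"
    and di: "((\<lambda>s. 1 / (s + e)) has_real_derivative - 1 / (s + e)\<^sup>2) (at s)" if "s > - e" for s
    using that by (auto intro!: derivative_eq_intros simp: power2_eq_square)
  show "(log_E r e has_real_derivative log_E1 r e s) (at s)" if "s > - e" for s
    using DERIV_mult[OF dl[OF that] DERIV_cutoff, of r] by (simp add: log_E_def[abs_def] log_E1_def algebra_simps)
  show "(log_E1 r e has_real_derivative log_E2 r e s) (at s)" if "s > - e" for s
    using DERIV_add[OF DERIV_mult[OF DERIV_cutoff di[OF that]] DERIV_mult[OF dl[OF that] DERIV_cutoff'], of r r]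
    by (simp add: log_E1_def[abs_def] log_E2_def algebra_simps)
  show "Ck_on k {- e<..} (log_E r e)" for k
    unfolding log_E_def[abs_def] cutoff_def
  proof (intro Ck_on_mult Ck_on_ln_shift open_greaterThan Ck_on_compose[OF open_greaterThan open_UNIV _ Ck_on_flat])
    have "Ck_on k {- e<..} (\<lambda>s. r ^ 4 + - 1 * (s * s))"
      by (intro Ck_on_add Ck_on_mult Ck_on_const open_greaterThan Ck_on_bounded_linear bounded_linear_ident)
    then show "Ck_on k {- e<..} (\<lambda>s. r ^ 4 - s\<^sup>2)" by (simp add: power2_eq_square)
  qed auto
qed (use assms in \<open>auto simp: log_E_def log_E1_def log_E2_def cutoff_zero\<close>)

lemma abs_mult_ln_le: "0 < x \<Longrightarrow> \<bar>x * ln x\<bar> \<le> x\<^sup>2 + (1::real)"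
proof -
  assume x: "0 < x"
  have "x * ln x \<le> x * x" using x ln_less_self[of x] by (intro mult_left_mono) linarith+
  moreover have "x * - ln x \<le> x * (1 / x)" proof (rule mult_left_mono)
    show "- ln x \<le> 1 / x" using x ln_less_self[of "1 / x"] by (simp add: ln_div)
  qed (use x in simp)
  moreover have "x * - ln x = - (x * ln x)" "x * (1 / x) = 1" "0 \<le> x * x" using x by auto
  ultimately show ?thesis unfolding power2_eq_square by linarith
qed

text \<open>Uniformity in e rests on s / (s + e) \<le> 1 and on |s ln(s + e)| \<le> |(s + e) ln(s +
  e)|, which stays bounded as s + e tends to 0.\<close>

lemma log_S_bounded:
  assumes r: "0 < r"
  obtains M where "0 \<le> M" "\<And>e s. 0 < e \<Longrightarrow> e \<le> 1 \<Longrightarrow> 0 \<le> s \<Longrightarrow> \<bar>log_S r e s\<bar> \<le> M"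
proof -
  have bd: "\<exists>B. \<forall>s\<in>{0..r\<^sup>2}. \<bar>u s\<bar> \<le> B" if "continuous_on {0..r\<^sup>2} u" for u :: "real \<Rightarrow> real"
    using compact_imp_bounded[OF compact_continuous_image[OF that compact_Icc]] by (auto simp: bounded_real)
  obtain B1 where B1: "\<And>s. s \<in> {0..r\<^sup>2} \<Longrightarrow> \<bar>s * cutoff1 r s\<bar> \<le> B1"
    using bd[of "\<lambda>s. s * cutoff1 r s", OF continuous_on_mult[OF continuous_on_id continuous_cutoff(2)]] by blast
  obtain B2 where B2: "\<And>s. s \<in> {0..r\<^sup>2} \<Longrightarrow> \<bar>cutoff2 r s + cutoff1 r s\<bar> \<le> B2"
    using bd[of "\<lambda>s. cutoff2 r s + cutoff1 r s", OF continuous_on_add[OF continuous_cutoff(3,2)]] by blast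
  have B0: "0 \<le> B1" "0 \<le> B2" using B1[of 0] B2[of 0] by auto
  \<comment> \<open>The bound x^2 + 1 for |x ln x| at x = s + e, where s + e is at most
    \<open>r\<^sup>2 + 1\<close>.\<close>
  define L where "L = (r\<^sup>2 + 1)\<^sup>2 + 1"
  have L0: "L \<ge> 0" by (simp add: L_def)
  have "\<bar>log_S r e s\<bar> \<le> 4 * (2 * B1 + L * B2)" if e: "0 < e" "e \<le> 1" and s: "0 \<le> s" for e s
  proof (cases "s \<le> r\<^sup>2")
    case True
    then have s': "s \<in> {0..r\<^sup>2}" using s by simp
    have "\<bar>s / (s + e)\<bar> \<le> 1" using e s by simp
    then have "\<bar>s / (s + e)\<bar> * \<bar>s * cutoff1 r s\<bar> \<le> 1 * B1" using B1[OF s'] by (intro mult_mono) auto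
    then have 1: "\<bar>2 * s * (s * cutoff1 r s) / (s + e)\<bar> \<le> 2 * B1" by (simp add: abs_mult abs_divide)
    have "\<bar>s * ln (s + e)\<bar> \<le> \<bar>(s + e) * ln (s + e)\<bar>" using e s by (simp add: abs_mult mult_right_mono)
    also have "\<dots> \<le> (s + e)\<^sup>2 + 1" using e s by (intro abs_mult_ln_le) auto
    also have "\<dots> \<le> L" unfolding L_def using e s True by (intro add_right_mono power_mono) auto
    finally have "\<bar>s * ln (s + e)\<bar> * \<bar>cutoff2 r s + cutoff1 r s\<bar> \<le> L * B2" using B2[OF s'] L0 by (intro mult_mono) auto
    then have 2: "\<bar>ln (s + e) * (s * (cutoff2 r s + cutoff1 r s))\<bar> \<le> L * B2" by (simp add: abs_mult mult_ac)
    show ?thesis using 1 2 unfolding log_S_def abs_le_iff by (simp only: distrib_left) linarith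
  next
    case False
    then show ?thesis using cutoff_zero[OF r, of s] B0 L0 by (simp add: log_S_def)
  qed
  then show ?thesis using B0 L0 by (intro that[of "4 * (2 * B1 + L * B2)"]) auto
qed

lemma continuous_log:
  assumes "0 < e" shows "continuous_on {0..} (log_P r e)" "continuous_on {0..} (log_S r e)" "continuous_on {0..} (log_E r e)"
proof -
  have p: "continuous_on {0..} (\<lambda>s. s + e)" by (intro continuous_intros)
  have ne: "\<forall>s\<in>{0..}. s + e \<noteq> 0" "\<forall>s\<in>{0..}. (s + e)\<^sup>2 \<noteq> 0" using assms by auto
  have l: "continuous_on {0..} (\<lambda>s. ln (s + e))" by (rule continuous_on_ln[OF p ne(1)])
  show "continuous_on {0..} (log_E r e)" unfolding log_E_def[abs_def] by (intro continuous_on_mult l continuous_cutoff)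
  show "continuous_on {0..} (log_P r e)" unfolding log_P_def[abs_def]
    by (intro continuous_on_divide continuous_on_mult continuous_on_const continuous_cutoff continuous_on_power p ne)
  show "continuous_on {0..} (log_S r e)" unfolding log_S_def[abs_def]
    by (intro continuous_on_divide continuous_on_add continuous_on_mult continuous_on_const continuous_on_id
        continuous_cutoff p l ne)
qed

lemma log_P_nonneg: "0 < e \<Longrightarrow> 0 \<le> log_P r e s"
  using cutoff_bounds by (simp add: log_P_def)

lemma log_P_far:
  assumes "0 < e" "0 < d" "d\<^sup>2 \<le> s" shows "log_P r e s \<le> 4 * e / d ^ 4"
  unfolding log_P_def
proof (rule frac_le)
  show "4 * e * cutoff r s \<le> 4 * e" using assms cutoff_bounds[of r s] by (simp add: mult_left_le)
  have "(d\<^sup>2)\<^sup>2 \<le> (s + e)\<^sup>2" using assms by (intro power_mono) auto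
  then show "d ^ 4 \<le> (s + e)\<^sup>2" by simp
qed (use assms in auto)

lemma log_P_near:
  assumes "0 < e" "0 \<le> s" "s \<le> e" shows "cutoff r e / e \<le> log_P r e s"
proof -
  have "(s + e)\<^sup>2 \<le> (e + e)\<^sup>2" using assms by (intro power_mono) auto
  then have "4 * e * cutoff r e / (e + e)\<^sup>2 \<le> 4 * e * cutoff r s / (s + e)\<^sup>2"
    using assms cutoff_antimono[OF assms(2,3), of r] cutoff_bounds by (intro frac_le) auto
  then show ?thesis using assms by (simp add: log_P_def power2_eq_square)
qed

section \<open>Logarithmic growth at the singularity\<close>

context torus_green
begin

lemma g_shift: "l \<in> \<Lambda> \<Longrightarrow> g (z + l) = g z" using per by (simp add: periodic_def)

definition normg :: real where "normg = torus_integral \<omega>1 \<omega>2 (\<lambda>z. \<bar>g z\<bar>)"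

lemma int_abs: "set_integrable lborel P (\<lambda>z. \<bar>g z\<bar>)" using int by (rule set_integrable_abs)

lemma normg_nonneg: "0 \<le> normg" unfolding normg_def by (rule torus_integral_nonneg) simp

lemma torus_integral_mult_le:
  assumes "continuous_on UNIV u" "\<And>z. \<bar>u z\<bar> \<le> M"
  shows "\<bar>torus_integral \<omega>1 \<omega>2 (\<lambda>z. g z * u z)\<bar> \<le> M * normg"
  unfolding normg_def torus_integral_cmult[symmetric]
proof (rule abs_torus_integral_le[OF set_integrable_P_mult[OF int assms(1)] set_integrable_mult_right])
  show "\<bar>g z * u z\<bar> \<le> M * \<bar>g z\<bar>" for z
    using mult_right_mono[OF assms(2)[of z], of "\<bar>g z\<bar>"] by (simp add: abs_mult mult.commute)
qed (rule int_abs)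

text \<open>Within distance d of w modulo the lattice, g differs from g(w) by at most 1; further
  away the kernel is at most 4 e / d^4 and the integrability of g suffices. The error need not tend
  to 0, since only the order of growth of g is wanted.\<close>

lemma concentration:
  assumes e: "0 < e" and d: "0 < d" and near: "\<And>z. z \<in> ball w d \<Longrightarrow> \<bar>g z - g w\<bar> \<le> 1"
  shows "\<bar>torus_integral \<omega>1 \<omega>2 (\<lambda>z. g z * periodize (log_P r e) w z) - g w * torus_integral \<omega>1 \<omega>2 (periodize (log_P r e) w)\<bar>
    \<le> torus_integral \<omega>1 \<omega>2 (periodize (log_P r e) w) + 4 * e / d ^ 4 * (normg + \<bar>g w\<bar> * covolume)"
proof -
  let ?p = "periodize (log_P r e) w"
  let ?v = "\<lambda>z. ?p z + 4 * e / d ^ 4 * (\<bar>g z\<bar> + \<bar>g w\<bar>)"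
  have cp: "continuous_on UNIV ?p" by (rule continuous_periodize[OF continuous_log(1)[OF e]])
  note i1 = set_integrable_P_mult[OF int cp] and i2 = set_integrable_P[OF cp]
  have i3: "set_integrable lborel P (\<lambda>z. g w * ?p z)" using i2 by (rule set_integrable_mult_right)
  have ic: "set_integrable lborel P (\<lambda>z. \<bar>g w\<bar>)" by (rule set_integrable_P) simp
  have i4: "set_integrable lborel P (\<lambda>z. 4 * e / d ^ 4 * (\<bar>g z\<bar> + \<bar>g w\<bar>))"
    by (rule set_integrable_mult_right) (rule set_integral_add(1)[OF int_abs ic])
  have c: "torus_integral \<omega>1 \<omega>2 (\<lambda>_. k) = k * covolume" for k
    by (subst torus_integral_iterated(1)) auto
  have "\<bar>torus_integral \<omega>1 \<omega>2 (\<lambda>z. g z * ?p z - g w * ?p z)\<bar> \<le> torus_integral \<omega>1 \<omega>2 ?v"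
  proof (rule abs_torus_integral_le[OF set_integral_diff(1)[OF i1 i3] set_integral_add(1)[OF i2 i4]])
    fix z
    have p0: "0 \<le> ?p z" unfolding periodize_def by (rule log_P_nonneg[OF e])
    have r0: "0 \<le> 4 * e / d ^ 4 * (\<bar>g z\<bar> + \<bar>g w\<bar>)" using e d by (intro mult_nonneg_nonneg) auto
    have eq: "\<bar>g z * ?p z - g w * ?p z\<bar> = \<bar>g z - g w\<bar> * ?p z" using p0 by (simp add: abs_mult flip: left_diff_distrib)
    show "\<bar>g z * ?p z - g w * ?p z\<bar> \<le> ?v z"
    proof (cases "infdist (z - w) \<Lambda> < d")
      case True
      then obtain l where l: "l \<in> \<Lambda>" "dist z (w + l) < d" by (rule infdist_lattice_lt)
      then have "z - l \<in> ball w d" by (simp add: dist_norm norm_minus_commute algebra_simps)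
      then have "\<bar>g z - g w\<bar> \<le> 1" using near[of "z - l"] g_shift[OF l(1), of "z - l"] by simp
      then have "\<bar>g z - g w\<bar> * ?p z \<le> 1 * ?p z" using p0 by (rule mult_right_mono)
      then show ?thesis unfolding eq using r0 by linarith
    next
      case False
      then have "d\<^sup>2 \<le> (infdist (z - w) \<Lambda>)\<^sup>2" using d by (intro power_mono) auto
      then have "?p z \<le> 4 * e / d ^ 4" unfolding periodize_def by (rule log_P_far[OF e d])
      then have "\<bar>g z - g w\<bar> * ?p z \<le> (\<bar>g z\<bar> + \<bar>g w\<bar>) * (4 * e / d ^ 4)" using p0 by (intro mult_mono) auto
      then show ?thesis unfolding eq using p0 by (simp add: mult.commute)
    qed
  qed
  moreover have "torus_integral \<omega>1 \<omega>2 (\<lambda>z. g z * ?p z - g w * ?p z)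
      = torus_integral \<omega>1 \<omega>2 (\<lambda>z. g z * ?p z) - g w * torus_integral \<omega>1 \<omega>2 ?p"
    unfolding torus_integral_add(2)[OF i1 i3] torus_integral_cmult ..
  moreover have "torus_integral \<omega>1 \<omega>2 ?v = torus_integral \<omega>1 \<omega>2 ?p + 4 * e / d ^ 4 * (normg + \<bar>g w\<bar> * covolume)"
    unfolding torus_integral_add(1)[OF i2 i4] torus_integral_cmult torus_integral_add(1)[OF int_abs ic] c normg_def ..
  ultimately show ?thesis by simp
qed

text \<open>On the disc of area pi e about the centre the kernel is at least
  \<open>cutoff r e / e\<close>, so its mass stays bounded below as e tends to 0.\<close>

lemma mass_lower_bound:
  assumes r: "0 < r"
  obtains d where "0 < d"
    "\<And>e w. 0 < e \<Longrightarrow> e \<le> d \<Longrightarrow> cutoff r (r\<^sup>2 / 2) \<le> torus_integral \<omega>1 \<omega>2 (periodize (log_P r e) w)"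
proof -
  \<comment> \<open>About the midpoint of the parallelogram a small disc lies wholly inside the
    domain of integration; independence of the centre then gives the bound for every w.\<close>
  define c where "c = of_real (1 / 2) * \<omega>1 + of_real (1 / 2) * \<omega>2"
  have "open ({z. 0 < coord1 z} \<inter> {z. coord1 z < 1} \<inter> ({z. 0 < coord2 z} \<inter> {z. coord2 z < 1}))"
    by (intro open_Int open_Collect_less continuous_intros)
  moreover have "c \<in> {z. 0 < coord1 z} \<inter> {z. coord1 z < 1} \<inter> ({z. 0 < coord2 z} \<inter> {z. coord2 z < 1})"
    unfolding c_def by (simp only: Int_iff mem_Collect_eq coord1_comb coord2_comb) simp
  ultimately obtain \<eta> where \<eta>: "0 < \<eta>" "ball c \<eta> \<subseteq> {z. 0 < coord1 z} \<inter> {z. coord1 z < 1} \<inter> ({z. 0 < coord2 z} \<inter> {z. coord2 z < 1})"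
    by (rule openE)
  have sub: "ball c \<eta> \<subseteq> P"
  proof
    fix z assume "z \<in> ball c \<eta>"
    from subsetD[OF \<eta>(2) this] show "z \<in> P" by (simp add: fund_iff)
  qed
  show ?thesis
  proof (rule that[of "min (\<eta>\<^sup>2) (r\<^sup>2 / 2)"])
    fix e :: real and w :: complex
    assume e: "0 < e" "e \<le> min (\<eta>\<^sup>2) (r\<^sup>2 / 2)"
    let ?B = "ball c (sqrt e)"
    have "sqrt e \<le> \<eta>" using e \<eta>(1) real_sqrt_le_mono[of e "\<eta>\<^sup>2"] by simp
    then have B: "?B \<subseteq> P" using sub subset_ball by blast
    define k where "k = cutoff r e / e"
    have k0: "0 \<le> k" using e cutoff_bounds by (simp add: k_def)
    have ind: "indicat_real P z *\<^sub>R (k * indicat_real ?B z) = k * indicat_real ?B z" for z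
      using B by (auto simp: indicator_def)
    have fin: "emeasure lborel ?B < \<infinity>" by (rule emeasure_bounded_finite) simp
    have iB: "set_integrable lborel P (\<lambda>z. k * indicat_real ?B z)"
      unfolding set_integrable_def ind using fin by (intro integrable_mult_right integrable_real_indicator) auto
    have cp: "continuous_on UNIV (periodize (log_P r e) c)" by (rule continuous_periodize[OF continuous_log(1)[OF e(1)]])
    have "torus_integral \<omega>1 \<omega>2 (\<lambda>z. k * indicat_real ?B z) \<le> torus_integral \<omega>1 \<omega>2 (periodize (log_P r e) c)"
    proof (rule torus_integral_mono[OF iB set_integrable_P[OF cp]])
      fix z
      show "k * indicat_real ?B z \<le> periodize (log_P r e) c z"
      proof (cases "z \<in> ?B")
        case True
        have "infdist (z - c) \<Lambda> \<le> dist (z - c) 0" by (rule infdist_le) simp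
        also have "\<dots> \<le> sqrt e" using True by (simp add: dist_norm norm_minus_commute)
        finally have "(infdist (z - c) \<Lambda>)\<^sup>2 \<le> (sqrt e)\<^sup>2" by (intro power_mono infdist_nonneg)
        then have "k \<le> periodize (log_P r e) c z"
          unfolding periodize_def k_def using e by (intro log_P_near) auto
        then show ?thesis using True by simp
      next
        case False
        then show ?thesis using log_P_nonneg[OF e(1)] by (simp add: periodize_def)
      qed
    qed
    moreover have "torus_integral \<omega>1 \<omega>2 (\<lambda>z. k * indicat_real ?B z) = k * measure lborel ?B"
      unfolding torus_integral_def set_lebesgue_integral_def ind by simp
    moreover have "measure lborel ?B = pi * e" using e(1) content_ball[of "sqrt e" c] by (simp add: unit_ball_vol_2)
    moreover have "cutoff r (r\<^sup>2 / 2) \<le> cutoff r e" using e by (intro cutoff_antimono) auto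
    moreover have "cutoff r e \<le> pi * cutoff r e" using cutoff_bounds(1)[of r e] pi_gt3 by (simp add: mult_le_cancel_right1)
    moreover have "k * (pi * e) = pi * cutoff r e" using e(1) by (simp add: k_def)
    ultimately have "cutoff r (r\<^sup>2 / 2) \<le> torus_integral \<omega>1 \<omega>2 (periodize (log_P r e) c)" by simp
    also have "\<dots> = torus_integral \<omega>1 \<omega>2 (periodize (log_P r e) w)"
      by (rule torus_integral_periodize[OF continuous_log(1)[OF e(1)]])
    finally show "cutoff r (r\<^sup>2 / 2) \<le> torus_integral \<omega>1 \<omega>2 (periodize (log_P r e) w)" .
  qed (use \<eta> r in auto)
qed

text \<open>The equation is tested with the truncated logarithm centred at w and at a fixed point
  \<open>w0\<close> off the lattice. The kernel part yields \<kappa> g(w), respectively \<kappa>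
  g(w0), up to 2 \<kappa>; the other part of the Laplacian contributes a bounded amount; the
  integrals of the test functions cancel. What remains are the values of the test functions at 0, of
  size 2 |ln |w|| for the first and bounded for the second.\<close>

lemma log_bound:
  obtains C \<eta> where "0 < \<eta>" "\<eta> \<le> 1" "\<eta> \<le> sep / 2"
    "\<And>w. 0 < norm w \<Longrightarrow> norm w < \<eta> \<Longrightarrow> \<bar>g w\<bar> \<le> C * (1 + \<bar>ln (norm w)\<bar>)"
proof -
  define r where "r = sep / 4"
  have r: "0 < r" "r < sep / 2" using sep_pos by (auto simp: r_def)
  define \<kappa>0 where "\<kappa>0 = cutoff r (r\<^sup>2 / 2)"
  have \<kappa>0: "0 < \<kappa>0"
    using r(1) by (simp add: \<kappa>0_def cutoff_def flat_def power_divide)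
  obtain d1 where d1: "0 < d1" "\<And>e w. 0 < e \<Longrightarrow> e \<le> d1 \<Longrightarrow> \<kappa>0 \<le> torus_integral \<omega>1 \<omega>2 (periodize (log_P r e) w)"
    using mass_lower_bound[OF r(1)] unfolding \<kappa>0_def by blast
  obtain M where M: "0 \<le> M" "\<And>e s. 0 < e \<Longrightarrow> e \<le> 1 \<Longrightarrow> 0 \<le> s \<Longrightarrow> \<bar>log_S r e s\<bar> \<le> M"
    by (rule log_S_bounded[OF r(1)], rule that)
  \<comment> \<open>Half a period, a reference point at a positive distance from the
    lattice.\<close>
  define w0 where "w0 = of_real (1 / 2) * \<omega>1 + of_real 0 * \<omega>2"
  have "coord1 w0 = 1 / 2" unfolding w0_def by (rule coord1_comb)
  moreover have "(1 / 2 :: real) \<notin> \<int>"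
  proof
    assume "(1 / 2 :: real) \<in> \<int>"
    then obtain k :: int where "1 / 2 = real_of_int k" by (auto elim: Ints_cases)
    then have "2 * k = 1" by linarith
    then show False by presburger
  qed
  ultimately have w0: "w0 \<notin> \<Lambda>" unfolding lattice_iff by metis
  define s where "s w = (infdist (0 - w) \<Lambda>)\<^sup>2" for w
  have s0: "0 < s w0"
    using in_closed_iff_infdist_zero[OF closed_lattice lattice_nonempty, of "- w0"] w0 by (simp add: s_def)
  define L0 where "L0 = \<bar>ln (s w0)\<bar> + s w0 + 1"
  define \<eta> where "\<eta> = min 1 (sep / 2)"
  define C where "C = 4 + \<bar>g w0\<bar> + (2 * (M * normg) + L0 + 2) / \<kappa>0"
  have cg: "\<exists>d>0. \<forall>z\<in>ball w d. \<bar>g z - g w\<bar> \<le> 1" if "w \<notin> \<Lambda>" for w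
  proof -
    have "isCont g w"
      using Ck_g[of 0] that open_compl_lattice by (auto simp: continuous_on_eq_continuous_at)
    then obtain d where "0 < d" "\<forall>z. dist z w < d \<longrightarrow> dist (g z) (g w) < 1"
      unfolding continuous_at_eps_delta using zero_less_one by blast
    then show ?thesis by (intro exI[of _ d]) (auto simp: dist_commute dist_real_def less_imp_le)
  qed
  obtain d0 where d0: "0 < d0" "\<And>z. z \<in> ball w0 d0 \<Longrightarrow> \<bar>g z - g w0\<bar> \<le> 1" using cg[OF w0] by blast
  have "\<bar>g w\<bar> \<le> C * (1 + \<bar>ln (norm w)\<bar>)" if w: "0 < norm w" "norm w < \<eta>" for w
  proof -
    have sw: "s w = (norm w)\<^sup>2" using infdist_lattice_near[OF lattice_0, of "0 - w"] w by (simp add: s_def \<eta>_def)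
    have wL: "w \<notin> \<Lambda>" using norm_lattice_ge[of w] w sep_pos by (auto simp: \<eta>_def)
    obtain d where d: "0 < d" "\<And>z. z \<in> ball w d \<Longrightarrow> \<bar>g z - g w\<bar> \<le> 1" using cg[OF wL] by blast
    have small: "eventually (\<lambda>e. e * a < b) (at_right 0)" if "0 < b" for a b :: real
    proof -
      have "((\<lambda>e. e * a) \<longlongrightarrow> 0 * a) (at_right 0)" by (intro tendsto_intros)
      then show ?thesis using order_tendstoD(2)[of _ 0 "at_right 0" b] that by simp
    qed
    have w1: "(norm w)\<^sup>2 < 1" using w power_less_one_iff[of "norm w" 2] by (simp add: \<eta>_def)
    \<comment> \<open>The parameter e depends on w through d and g(w), which does no harm as the
      final constants involve neither e nor w. The condition e < 1 - |w|^2 keeps ln(|w|^2 + e)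
      negative.\<close>
    have "eventually (\<lambda>e. 0 < e \<and> e * 1 < 1 - (norm w)\<^sup>2 \<and> e * 1 < d1 \<and>
        e * (4 / d ^ 4 * (normg + \<bar>g w\<bar> * covolume)) < \<kappa>0 \<and>
        e * (4 / d0 ^ 4 * (normg + \<bar>g w0\<bar> * covolume)) < \<kappa>0) (at_right (0::real))"
      using w1 d1(1) \<kappa>0 by (intro eventually_conj eventually_at_right_less small) auto
    from eventually_happens'[OF trivial_limit_at_right_real this]
    obtain e where e: "0 < e" "e < 1 - (norm w)\<^sup>2" "e < d1"
      "4 * e / d ^ 4 * (normg + \<bar>g w\<bar> * covolume) < \<kappa>0"
      "4 * e / d0 ^ 4 * (normg + \<bar>g w0\<bar> * covolume) < \<kappa>0" by (auto simp: mult_ac)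
    have e1: "e \<le> 1" using e(2) by (smt (verit) zero_le_power2)
    interpret radial_profile \<omega>1 \<omega>2 "log_E r e" "log_E1 r e" "log_E2 r e" e r
      by (rule radial_profile_log[OF r e(1)])
    define \<kappa> where "\<kappa> = torus_integral \<omega>1 \<omega>2 (periodize (log_P r e) w)"
    have \<kappa>: "\<kappa>0 \<le> \<kappa>" using d1(2)[OF e(1)] e(3) by (simp add: \<kappa>_def)
    have \<kappa>w0: "torus_integral \<omega>1 \<omega>2 (periodize (log_P r e) w0) = \<kappa>"
      unfolding \<kappa>_def by (rule torus_integral_periodize[OF continuous_log(1)[OF e(1)]])
    define J where "J w = torus_integral \<omega>1 \<omega>2 (\<lambda>z. g z * periodize (log_P r e) w z)" for w
    define S where "S w = torus_integral \<omega>1 \<omega>2 (\<lambda>z. g z * periodize (log_S r e) w z)" for w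
    have S: "\<bar>S w\<bar> \<le> M * normg" for w
      unfolding S_def
      by (rule torus_integral_mult_le[OF continuous_periodize[OF continuous_log(2)[OF e(1)]]])
        (simp add: periodize_def M(2)[OF e(1) e1])
    \<comment> \<open>The point mass sits at 0, so the test function centred at w is evaluated
      there, at the squared distance s(w) from 0 to the translates of w.\<close>
    have JS: "J w + S w = torus_integral \<omega>1 \<omega>2 (periodize (log_E r e) w) / covolume - log_E r e (s w)" for w
    proof -
      have "laplacian (periodize (log_E r e) w) z = periodize (log_P r e) w z + periodize (log_S r e) w z" for z
        unfolding laplacian_periodize unfolding periodize_def by (rule log_split[OF e(1)]) simp
      then have "torus_integral \<omega>1 \<omega>2 (\<lambda>z. g z * laplacian (periodize (log_E r e) w) z)
          = torus_integral \<omega>1 \<omega>2 (\<lambda>z. g z * periodize (log_P r e) w z + g z * periodize (log_S r e) w z)"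
        by (simp add: distrib_left)
      also have "\<dots> = J w + S w" unfolding J_def S_def
        by (rule torus_integral_add(1)) (rule set_integrable_P_mult[OF int] continuous_periodize continuous_log[OF e(1)])+
      finally show ?thesis using green_eq[OF periodic_periodize Ck_on_periodize, of w] by (simp add: periodize_def s_def)
    qed
    have TE: "torus_integral \<omega>1 \<omega>2 (periodize (log_E r e) w) = torus_integral \<omega>1 \<omega>2 (periodize (log_E r e) w0)"
      by (rule torus_integral_periodize[OF continuous_log(3)[OF e(1)]])
    have absE: "\<bar>log_E r e t\<bar> \<le> \<bar>ln (t + e)\<bar>" for t
      using cutoff_bounds[of r t] by (simp add: log_E_def abs_mult mult_left_le)
    have Ew: "\<bar>log_E r e (s w)\<bar> \<le> 2 * \<bar>ln (norm w)\<bar>"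
    proof -
      have "ln ((norm w)\<^sup>2) \<le> ln ((norm w)\<^sup>2 + e)" using w(1) e(1) by (intro ln_mono) auto
      moreover have "ln ((norm w)\<^sup>2 + e) \<le> 0" using w(1) e(1,2) by (intro ln_le_zero_iff[THEN iffD2]) (auto intro: add_pos_pos)
      moreover have "ln ((norm w)\<^sup>2) = 2 * ln (norm w)" using w(1) by (simp add: ln_realpow)
      ultimately show ?thesis using absE[of "s w"] unfolding sw by linarith
    qed
    have Ew0: "\<bar>log_E r e (s w0)\<bar> \<le> L0"
    proof -
      have "ln (s w0) \<le> ln (s w0 + e)" using s0 e(1) by (intro ln_mono) auto
      moreover have "ln (s w0 + e) \<le> s w0 + 1" using ln_less_self[of "s w0 + e"] s0 e(1) e1 by linarith
      ultimately show ?thesis using absE[of "s w0"] s0 unfolding L0_def by linarith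
    qed
    have \<kappa>_abs: "\<bar>x * \<kappa>\<bar> = \<bar>x\<bar> * \<kappa>" for x using \<kappa>0 \<kappa> by (auto simp: abs_mult)
    have "\<bar>J w - g w * \<kappa>\<bar> \<le> 2 * \<kappa>"
      using concentration[OF e(1) d, of r] e(4) \<kappa> unfolding J_def \<kappa>_def[symmetric] by simp
    then have 1: "\<bar>g w\<bar> * \<kappa> \<le> \<bar>J w\<bar> + 2 * \<kappa>" unfolding \<kappa>_abs[symmetric] by linarith
    have "\<bar>J w0 - g w0 * \<kappa>\<bar> \<le> 2 * \<kappa>"
      using concentration[OF e(1) d0, of r] e(5) \<kappa> unfolding J_def \<kappa>w0 by simp
    then have 2: "\<bar>J w0\<bar> \<le> \<bar>g w0\<bar> * \<kappa> + 2 * \<kappa>" unfolding \<kappa>_abs[symmetric] by linarith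
    have "J w = J w0 - S w + S w0 - log_E r e (s w) + log_E r e (s w0)"
      using JS[of w] JS[of w0] TE by simp
    then have 3: "\<bar>J w\<bar> \<le> \<bar>J w0\<bar> + \<bar>S w\<bar> + \<bar>S w0\<bar> + \<bar>log_E r e (s w)\<bar> + \<bar>log_E r e (s w0)\<bar>" by linarith
    have "a \<le> b + 4 * k + (2 * m + l + x)"
      if "a \<le> j + 2 * k" "j0 \<le> b + 2 * k" "j \<le> j0 + t + t0 + y + y0" "t \<le> m" "t0 \<le> m" "y \<le> x" "y0 \<le> l"
      for a b j j0 k t t0 y y0 m l x :: real using that by linarith
    from this[OF 1 2 3 S S Ew Ew0]
    have "\<bar>g w\<bar> * \<kappa> \<le> \<bar>g w0\<bar> * \<kappa> + 4 * \<kappa> + (2 * (M * normg) + L0 + 2 * \<bar>ln (norm w)\<bar>)" .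
    then have "(\<bar>g w\<bar> - (\<bar>g w0\<bar> + 4)) * \<kappa> \<le> 2 * (M * normg) + L0 + 2 * \<bar>ln (norm w)\<bar>" by (simp add: algebra_simps)
    then have "\<bar>g w\<bar> - (\<bar>g w0\<bar> + 4) \<le> (2 * (M * normg) + L0 + 2 * \<bar>ln (norm w)\<bar>) / \<kappa>"
      using \<kappa>0 \<kappa> by (simp add: pos_le_divide_eq)
    also have "\<dots> \<le> (2 * (M * normg) + L0 + 2 * \<bar>ln (norm w)\<bar>) / \<kappa>0"
      using \<kappa>0 \<kappa> M(1) normg_nonneg s0 by (intro divide_left_mono) (auto simp: L0_def)
    also have "\<dots> \<le> (2 * (M * normg) + L0 + 2) / \<kappa>0 * (1 + \<bar>ln (norm w)\<bar>)"
    proof -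
      have "0 \<le> (2 * (M * normg) + L0) * \<bar>ln (norm w)\<bar>"
        using M(1) normg_nonneg s0 by (intro mult_nonneg_nonneg add_nonneg_nonneg) (auto simp: L0_def)
      then have "2 * (M * normg) + L0 + 2 * \<bar>ln (norm w)\<bar> \<le> (2 * (M * normg) + L0 + 2) * (1 + \<bar>ln (norm w)\<bar>)"
        by (simp add: algebra_simps)
      then show ?thesis using \<kappa>0 by (simp add: divide_right_mono)
    qed
    moreover have "\<bar>g w0\<bar> + 4 \<le> (4 + \<bar>g w0\<bar>) * (1 + \<bar>ln (norm w)\<bar>)" by (simp add: algebra_simps)
    ultimately show ?thesis unfolding C_def distrib_right[of "4 + \<bar>g w0\<bar>"] by linarith
  qed
  then show ?thesis using sep_pos by (intro that[of \<eta> C]) (auto simp: \<eta>_def)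
qed

end

section \<open>From the gradient of the Green function to the meromorphic map\<close>

context torus_green
begin

text \<open>The F of the overview. The value \<open>cnj z\<close> at lattice points makes the shift
  law hold everywhere, as is required for following orbits that may hit a pole.\<close>

definition grad_map :: "complex \<Rightarrow> complex" where
  "grad_map z = (if z \<in> \<Lambda> then cnj z
     else cnj z - of_real (2 * covolume) * (of_real (dir_deriv 1 g z) - \<i> * of_real (dir_deriv \<i> g z)))"

lemma grad_map_shift: "l \<in> \<Lambda> \<Longrightarrow> grad_map (z + l) = grad_map z + cnj l"
  using periodic_dir_deriv[OF per] lattice_add_cancel[of l z] by (simp add: grad_map_def periodic_def)

lemma dir_deriv_linear:
  assumes "(u has_derivative (\<lambda>v. dir_deriv v u z)) (at z)"
  shows "dir_deriv h u z = Re h * dir_deriv 1 u z + Im h * dir_deriv \<i> u z"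
proof -
  have lin: "linear (\<lambda>v. dir_deriv v u z)" using assms by (rule has_derivative_linear)
  have "dir_deriv (Re h *\<^sub>R 1 + Im h *\<^sub>R \<i>) u z = Re h * dir_deriv 1 u z + Im h * dir_deriv \<i> u z"
    unfolding linear_add[OF lin] linear_scale[OF lin] by simp
  moreover have "Re h *\<^sub>R 1 + Im h *\<^sub>R \<i> = h" by (simp add: complex_eq_iff)
  ultimately show ?thesis by simp
qed

text \<open>The derivative of g_x - \<i> g_y with respect to \<open>cnj z\<close> is half the
  Laplacian, by equality of the mixed partials, that is 1 / (2 |T|). The factor 2 |T| thus cancels
  the contribution of \<open>cnj z\<close>.\<close>

lemma grad_map_derivative:
  assumes z: "z \<notin> \<Lambda>"
  shows "(grad_map has_field_derivative
    1 - of_real (2 * covolume) * (of_real (dir_deriv 1 (dir_deriv 1 g) z) - \<i> * of_real (dir_deriv 1 (dir_deriv \<i> g) z))) (at z)"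
proof -
  define a b c where "a = dir_deriv 1 (dir_deriv 1 g) z" and "b = dir_deriv 1 (dir_deriv \<i> g) z"
    and "c = dir_deriv \<i> (dir_deriv \<i> g) z"
  have z': "z \<in> - \<Lambda>" using z by simp
  have b': "dir_deriv \<i> (dir_deriv 1 g) z = b"
    using mixed_partials[OF open_compl_lattice z' Ck_g] by (simp add: b_def)
  have ac: "covolume * (a + c) = 1"
    using laplacian_g[OF z] covolume_pos by (simp add: laplacian_def a_def c_def)
  have d: "(dir_deriv v g has_derivative (\<lambda>h. dir_deriv h (dir_deriv v g) z)) (at z)" for v
    by (rule dir_deriv_has_derivative[OF Ck_dir_deriv_g z'])
  have D: "((\<lambda>z. cnj z - of_real (2 * covolume) * (of_real (dir_deriv 1 g z) - \<i> * of_real (dir_deriv \<i> g z))) has_derivative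
      (\<lambda>h. cnj h - of_real (2 * covolume) * (of_real (dir_deriv h (dir_deriv 1 g) z) - \<i> * of_real (dir_deriv h (dir_deriv \<i> g) z)))) (at z)"
    by (intro has_derivative_diff has_derivative_mult_right has_derivative_of_real d
        bounded_linear_imp_has_derivative bounded_linear_cnj)
  have "cnj h - of_real (2 * covolume) * (of_real (dir_deriv h (dir_deriv 1 g) z) - \<i> * of_real (dir_deriv h (dir_deriv \<i> g) z))
      = (1 - of_real (2 * covolume) * (of_real a - \<i> * of_real b)) * h" for h
  proof -
    have h: "dir_deriv h (dir_deriv 1 g) z = Re h * a + Im h * b" "dir_deriv h (dir_deriv \<i> g) z = Re h * b + Im h * c"
      unfolding dir_deriv_linear[OF d, of h] b' a_def b_def c_def by simp_all
    have "covolume * (a + c) * Im h = Im h" using ac by simp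
    then show ?thesis unfolding h complex_eq_iff by (simp add: algebra_simps)
  qed
  then have "((\<lambda>z. cnj z - of_real (2 * covolume) * (of_real (dir_deriv 1 g z) - \<i> * of_real (dir_deriv \<i> g z))) has_field_derivative
      1 - of_real (2 * covolume) * (of_real a - \<i> * of_real b)) (at z)"
    using D unfolding has_field_derivative_def by presburger
  then show ?thesis unfolding a_def b_def
    by (rule has_field_derivative_transform_within_open[OF _ open_compl_lattice z']) (simp add: grad_map_def)
qed

lemma grad_map_holomorphic: "grad_map holomorphic_on (- \<Lambda>)"
  unfolding holomorphic_on_open[OF open_compl_lattice] using grad_map_derivative by blast

text \<open>
  On a disc, \<open>H = g - |z|\<^sup>2 / (4 |T|)\<close> is the real part of a holomorphic function \<open>\<Phi>\<close> with derivative
  \<open>- grad_map / (2 |T|)\<close>; the Cauchy estimate for \<open>exp (\<Phi> / M)\<close> bounds \<open>\<Phi>'\<close> in terms of the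
  bound \<open>M\<close> for \<open>H\<close>.
\<close>

lemma grad_map_bound:
  assumes R: "0 < R" and sub: "ball w R \<subseteq> - \<Lambda>" and M: "0 < M"
    and bound: "\<And>z. z \<in> ball w R \<Longrightarrow> \<bar>g z - (norm z)\<^sup>2 / (4 * covolume)\<bar> \<le> M"
  shows "norm (grad_map w) \<le> 4 * covolume * M * exp 2 / R"
proof -
  \<comment> \<open>H_x - \<i> H_y equals this constant times \<open>grad_map\<close>, and for the
    real part of a holomorphic function that combination is the complex derivative.\<close>
  define k where "k = - 1 / (2 * covolume)"
  have k: "k \<noteq> 0" using covolume_pos by (simp add: k_def)
  define H where "H z = g z - (norm z)\<^sup>2 / (4 * covolume)" for z
  have "(\<lambda>z. of_real k * grad_map z) holomorphic_on ball w R"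
    using holomorphic_on_subset[OF grad_map_holomorphic sub] by (intro holomorphic_intros)
  then obtain \<Phi> where "\<And>z. z \<in> ball w R \<Longrightarrow> (\<Phi> has_field_derivative of_real k * grad_map z) (at z within ball w R)"
    using holomorphic_convex_primitive'[OF convex_ball open_ball] by blast
  then have \<Phi>: "(\<Phi> has_field_derivative of_real k * grad_map z) (at z)" if "z \<in> ball w R" for z
    using that at_within_open[OF that open_ball] by metis
  have dH: "((\<lambda>z. Re (\<Phi> z) - H z) has_derivative (\<lambda>_. 0)) (at z)" if z: "z \<in> ball w R" for z
  proof -
    have zL: "z \<in> - \<Lambda>" using sub z by blast
    have dg: "(g has_derivative (\<lambda>h. dir_deriv h g z)) (at z)" by (rule dir_deriv_has_derivative[OF Ck_g zL])
    have dq: "((\<lambda>z. (norm z)\<^sup>2 / (4 * covolume)) has_derivative (\<lambda>h. (2 * Re z * Re h + 2 * Im z * Im h) / (4 * covolume))) (at z)"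
    proof -
      have "((\<lambda>z. (Re z * Re z + Im z * Im z) * (1 / (4 * covolume))) has_derivative
          (\<lambda>h. ((Re z * Re h + Re h * Re z) + (Im z * Im h + Im h * Im z)) * (1 / (4 * covolume)))) (at z)"
        by (intro has_derivative_mult_left has_derivative_add has_derivative_mult
            bounded_linear_imp_has_derivative bounded_linear_Re bounded_linear_Im)
      moreover have "(norm z)\<^sup>2 / (4 * covolume) = (Re z * Re z + Im z * Im z) * (1 / (4 * covolume))" for z
        unfolding cmod_power2 by (simp add: power2_eq_square)
      moreover have "((Re z * Re h + Re h * Re z) + (Im z * Im h + Im h * Im z)) * (1 / (4 * covolume))
          = (2 * Re z * Re h + 2 * Im z * Im h) / (4 * covolume)" for h by simp
      ultimately show ?thesis by (simp only:)
    qed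
    have "(\<Phi> has_derivative (\<lambda>h. of_real k * grad_map z * h)) (at z)"
      using \<Phi>[OF z] unfolding has_field_derivative_def .
    from has_derivative_compose[OF this bounded_linear_imp_has_derivative[OF bounded_linear_Re]]
    have "((\<lambda>z. Re (\<Phi> z)) has_derivative (\<lambda>h. Re (of_real k * grad_map z * h))) (at z)" .
    from has_derivative_diff[OF this has_derivative_diff[OF dg dq]]
    have "((\<lambda>z. Re (\<Phi> z) - H z) has_derivative (\<lambda>h. Re (of_real k * grad_map z * h)
        - (dir_deriv h g z - (2 * Re z * Re h + 2 * Im z * Im h) / (4 * covolume)))) (at z)"
      unfolding H_def .
    moreover have "Re (of_real k * grad_map z * h) - (dir_deriv h g z - (2 * Re z * Re h + 2 * Im z * Im h) / (4 * covolume)) = 0" for h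
      unfolding dir_deriv_linear[OF dg, of h] using zL covolume_pos by (simp add: grad_map_def k_def field_simps)
    ultimately show ?thesis by (simp only:)
  qed
  have "\<exists>c. \<forall>z\<in>ball w R. Re (\<Phi> z) - H z = c"
    by (rule has_derivative_zero_constant[OF convex_ball]) (use dH has_derivative_at_withinI in blast)
  then obtain c where c: "\<And>z. z \<in> ball w R \<Longrightarrow> Re (\<Phi> z) = H z + c" by (metis diff_add_cancel add.commute)
  \<comment> \<open>Subtracting c makes |\<Psi>| = exp(H / M), and dividing by M keeps this between
    exp(-1) and exp(1). Cauchy's estimate on the closed disc of radius R / 2 bounds \<Psi>', and the
    lower bound on |\<Psi>| returns a bound on \<Phi>'; the two exponentials combine to
    exp(2).\<close>
  define \<Psi> where "\<Psi> z = exp ((\<Phi> z - of_real c) / of_real M)" for z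
  have \<Psi>': "(\<Psi> has_field_derivative \<Psi> z * (of_real k * grad_map z / of_real M)) (at z)" if "z \<in> ball w R" for z
    unfolding \<Psi>_def using \<Phi>[OF that] M by (auto intro!: derivative_eq_intros)
  have norm\<Psi>: "norm (\<Psi> z) = exp (H z / M)" if "z \<in> ball w R" for z
    using c[OF that] by (simp add: \<Psi>_def Re_divide_of_real)
  have hol: "\<Psi> holomorphic_on ball w R" unfolding holomorphic_on_open[OF open_ball] using \<Psi>' by blast
  have w: "w \<in> ball w R" using R by simp
  have "norm ((deriv ^^ 1) \<Psi> w) \<le> fact 1 * exp 1 / (R / 2) ^ 1"
  proof (rule Cauchy_inequality)
    show "\<Psi> holomorphic_on ball w (R / 2)" using R by (intro holomorphic_on_subset[OF hol] subset_ball) simp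
    show "continuous_on (cball w (R / 2)) \<Psi>"
      using R by (intro holomorphic_on_imp_continuous_on holomorphic_on_subset[OF hol]) auto
    fix x assume "norm (w - x) = R / 2"
    then have x: "x \<in> ball w R" using R by (simp add: dist_norm)
    have "H x / M \<le> 1" using bound[OF x] M by (simp add: H_def divide_le_eq)
    then show "norm (\<Psi> x) \<le> exp 1" by (simp add: norm\<Psi>[OF x])
  qed (use R in simp)
  moreover have "deriv \<Psi> w = \<Psi> w * (of_real k * grad_map w / of_real M)" using \<Psi>'[OF w] by (rule DERIV_imp_deriv)
  ultimately have "norm (\<Psi> w) * (\<bar>k\<bar> * norm (grad_map w) / M) \<le> 2 * exp 1 / R"
    using M by (simp add: norm_mult norm_divide mult_ac)
  moreover have "exp (- 1) \<le> norm (\<Psi> w)"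
  proof -
    have "- 1 \<le> H w / M" using bound[OF w] M by (simp add: H_def pos_le_divide_eq)
    then show ?thesis by (simp add: norm\<Psi>[OF w])
  qed
  then have "exp (- 1) * (\<bar>k\<bar> * norm (grad_map w) / M) \<le> norm (\<Psi> w) * (\<bar>k\<bar> * norm (grad_map w) / M)"
    using M by (intro mult_right_mono) auto
  ultimately have "exp (- 1) * (\<bar>k\<bar> * norm (grad_map w) / M) \<le> 2 * exp 1 / R" by linarith
  then have le: "exp 1 * (exp (- 1) * (\<bar>k\<bar> * norm (grad_map w) / M)) \<le> exp 1 * (2 * exp 1 / R)" by (rule mult_left_mono) simp
  have e1: "exp 1 * (exp (- 1) * x) = x" for x :: real by (simp flip: mult.assoc exp_add)
  have e2: "exp 1 * (2 * exp 1 / R) = 2 * exp 2 / R" using exp_add[of 1 "1 :: real"] by simp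
  have "\<bar>k\<bar> * norm (grad_map w) / M \<le> 2 * exp 2 / R" using le unfolding e1 e2 .
  then show ?thesis using M R covolume_pos by (simp add: k_def field_simps)
qed

text \<open>On a disc of radius |w| / 2 about w the logarithmic bound for g yields a gradient of
  order |ln |w|| / |w|. Hence w^2 times the map tends to 0, its singularity is removable with value
  0, and division by w leaves at most a simple pole.\<close>

lemma grad_map_pole: "\<exists>\<rho>. ((\<lambda>z. z * grad_map z) \<longlongrightarrow> \<rho>) (at 0)"
proof -
  obtain C \<eta> where \<eta>: "0 < \<eta>" "\<eta> \<le> 1" "\<eta> \<le> sep / 2"
    and C: "\<And>w. 0 < norm w \<Longrightarrow> norm w < \<eta> \<Longrightarrow> \<bar>g w\<bar> \<le> C * (1 + \<bar>ln (norm w)\<bar>)" by (rule log_bound, rule that)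
  define A where "A = 8 * covolume * exp 2"
  define B where "B t = A * (\<bar>C\<bar> * (1 + \<bar>ln (t / 2)\<bar>) + 1 / (4 * covolume) + 1) * t" for t
  have A: "0 \<le> A" using covolume_pos by (simp add: A_def)
  have le: "norm (w\<^sup>2 * grad_map w) \<le> B (norm w)" if w: "0 < norm w" "norm w < \<eta> / 2" for w
  proof -
    \<comment> \<open>The disc stays away from 0, with |z| > |w| / 2 on it, so |ln |z|| is
      controlled by the value at |w| / 2; and |w| < \<eta> / 2 keeps |z| below \<eta>.\<close>
    define R where "R = norm w / 2"
    define M where "M = \<bar>C\<bar> * (1 + \<bar>ln (norm w / 2)\<bar>) + 1 / (4 * covolume) + 1"
    have M: "0 < M" unfolding M_def using covolume_pos by (intro add_nonneg_pos add_nonneg_nonneg) auto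
    have z: "norm w / 2 < norm z \<and> norm z < \<eta>" if "z \<in> ball w R" for z
      using that w norm_triangle_ineq2[of w z] norm_triangle_ineq2[of z w]
      by (auto simp: R_def dist_norm norm_minus_commute)
    have "norm (grad_map w) \<le> 4 * covolume * M * exp 2 / R"
    proof (rule grad_map_bound[OF _ _ M])
      show "ball w R \<subseteq> - \<Lambda>"
      proof
        fix z assume "z \<in> ball w R"
        from z[OF this] show "z \<in> - \<Lambda>" using norm_lattice_ge[of z] \<eta> sep_pos w by fastforce
      qed
      fix z assume zb: "z \<in> ball w R"
      have nz: "0 < norm z" "norm z < 1" "norm w / 2 \<le> norm z" using z[OF zb] w \<eta> by auto
      have "ln (norm w / 2) \<le> ln (norm z)" "ln (norm z) \<le> 0" using nz w by auto
      then have "1 + \<bar>ln (norm z)\<bar> \<le> 1 + \<bar>ln (norm w / 2)\<bar>" by linarith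
      then have "\<bar>C\<bar> * (1 + \<bar>ln (norm z)\<bar>) \<le> \<bar>C\<bar> * (1 + \<bar>ln (norm w / 2)\<bar>)" by (rule mult_left_mono) simp
      moreover have "\<bar>g z\<bar> \<le> C * (1 + \<bar>ln (norm z)\<bar>)" using C[OF nz(1)] z[OF zb] by blast
      moreover have "C * (1 + \<bar>ln (norm z)\<bar>) \<le> \<bar>C\<bar> * (1 + \<bar>ln (norm z)\<bar>)" by (rule mult_right_mono) auto
      moreover have "(norm z)\<^sup>2 / (4 * covolume) \<le> 1 / (4 * covolume)" "0 \<le> (norm z)\<^sup>2 / (4 * covolume)"
        using nz covolume_pos power_le_one[of "norm z" 2] by (auto intro!: divide_right_mono)
      ultimately show "\<bar>g z - (norm z)\<^sup>2 / (4 * covolume)\<bar> \<le> M" unfolding M_def by linarith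
    qed (use w in \<open>simp add: R_def\<close>)
    then have "(norm w)\<^sup>2 * norm (grad_map w) \<le> (norm w)\<^sup>2 * (4 * covolume * M * exp 2 / R)" by (rule mult_left_mono) simp
    also have "\<dots> = B (norm w)" using w by (simp add: B_def A_def R_def M_def[symmetric] power2_eq_square)
    finally show ?thesis by (simp add: norm_mult norm_power)
  qed
  have "(B \<longlongrightarrow> 0) (at_right 0)" unfolding B_def by real_asymp
  moreover have "filterlim norm (at_right 0) (at (0 :: complex))"
    unfolding filterlim_at by (auto intro!: tendsto_norm_zero tendsto_ident_at simp: eventually_at_filter)
  ultimately have B0: "((\<lambda>w::complex. B (norm w)) \<longlongrightarrow> 0) (at 0)" by (rule filterlim_compose)
  have lim: "((\<lambda>w. w\<^sup>2 * grad_map w) \<longlongrightarrow> 0) (at 0)"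
  proof (rule Lim_null_comparison[OF _ B0])
    have "eventually (\<lambda>w. w \<in> ball 0 (\<eta> / 2) - {0 :: complex}) (at 0)" using \<eta> by (intro eventually_at_in_open) auto
    then show "eventually (\<lambda>w. norm (w\<^sup>2 * grad_map w) \<le> B (norm w)) (at 0)" by eventually_elim (use le in auto)
  qed
  define k where "k w = w\<^sup>2 * grad_map w" for w
  have k0: "k 0 = 0" by (simp add: k_def)
  have sub: "ball 0 sep - {0} \<subseteq> - \<Lambda>" using norm_lattice_ge by force
  have "k holomorphic_on (ball 0 sep - {0})"
    unfolding k_def using holomorphic_on_subset[OF grad_map_holomorphic sub] by (intro holomorphic_intros)
  then have "k holomorphic_on ball 0 sep"
    using no_isolated_singularity'[of "{0}" k "ball 0 sep"] lim k0
    by (simp add: k_def[abs_def] Lim_at_imp_Lim_at_within)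
  then have "(k has_field_derivative deriv k 0) (at 0)"
    by (rule holomorphic_derivI) (use sep_pos in auto)
  then have "((\<lambda>w. k w / w) \<longlongrightarrow> deriv k 0) (at 0)" by (simp add: has_field_derivative_iff k0)
  moreover have "eventually (\<lambda>w. k w / w = w * grad_map w) (at 0)"
    by (simp add: eventually_at_filter k_def power2_eq_square)
  ultimately have "((\<lambda>w. w * grad_map w) \<longlongrightarrow> deriv k 0) (at 0)" by (rule Lim_transform_eventually)
  then show ?thesis ..
qed

lemma critical_point_iff:
  assumes "z \<notin> \<Lambda>" shows "(g has_derivative (\<lambda>_. 0)) (at z) \<longleftrightarrow> grad_map z = cnj z"
proof -
  have d: "(g has_derivative (\<lambda>h. dir_deriv h g z)) (at z)" using dir_deriv_has_derivative[OF Ck_g] assms by simp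
  have "grad_map z = cnj z \<longleftrightarrow> dir_deriv 1 g z = 0 \<and> dir_deriv \<i> g z = 0"
    using assms covolume_pos by (auto simp: grad_map_def complex_eq_iff)
  also have "\<dots> \<longleftrightarrow> (\<forall>h. dir_deriv h g z = 0)"
    using dir_deriv_linear[OF d] by (metis mult_zero_right add_0)
  also have "\<dots> \<longleftrightarrow> (g has_derivative (\<lambda>_. 0)) (at z)"
  proof
    assume "\<forall>h. dir_deriv h g z = 0"
    then have "(\<lambda>h. dir_deriv h g z) = (\<lambda>_. 0)" by simp
    with d show "(g has_derivative (\<lambda>_. 0)) (at z)" by simp
  next
    assume "(g has_derivative (\<lambda>_. 0)) (at z)"
    then show "\<forall>h. dir_deriv h g z = 0" using dir_deriv_eq by blast
  qed
  finally show ?thesis ..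
qed

lemma card_critical_points:
  assumes Z: "finite Z" "\<And>z. z \<in> Z \<Longrightarrow> z \<notin> \<Lambda> \<and> (g has_derivative (\<lambda>_. 0)) (at z)"
    and incongruent: "\<And>z z'. z \<in> Z \<Longrightarrow> z' \<in> Z \<Longrightarrow> z - z' \<in> \<Lambda> \<Longrightarrow> z = z'"
  shows "card Z \<le> 5"
proof -
  obtain \<rho> where \<rho>: "((\<lambda>z. z * grad_map z) \<longlongrightarrow> \<rho>) (at 0)" using grad_map_pole ..
  interpret tm: torus_map \<omega>1 \<omega>2 grad_map \<rho>
    by unfold_locales (rule grad_map_holomorphic, erule grad_map_shift, rule \<rho>)
  have fixed: "z \<notin> \<Lambda> \<and> tm.g z = z" if "z \<in> Z" for z
    using Z(2)[OF that] critical_point_iff[of z] by (simp add: tm.g_def)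
  have "card {z \<in> Z. norm (deriv grad_map z) \<le> 1} \<le> 2"
    by (rule tm.nonrepelling_fixed_points) (use Z(1) fixed incongruent in auto)
  moreover have "card {z \<in> Z. norm (deriv grad_map z) > 1} \<le> 3"
    by (rule tm.repelling_fixed_points) (use Z(1) fixed incongruent in auto)
  moreover have "Z = {z \<in> Z. norm (deriv grad_map z) \<le> 1} \<union> {z \<in> Z. norm (deriv grad_map z) > 1}" by auto
  then have "card Z \<le> card {z \<in> Z. norm (deriv grad_map z) \<le> 1} + card {z \<in> Z. norm (deriv grad_map z) > 1}"
    using card_Un_le by metis
  ultimately show ?thesis by linarith
qed

end

theorem theorem1p3:
  fixes \<omega>1 \<omega>2 :: complex and G :: "complex \<Rightarrow> complex \<Rightarrow> real"
  assumes "\<omega>1 \<noteq> \<omega>2" and "independent {\<omega>1, \<omega>2}"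
    and "is_green_function \<omega>1 \<omega>2 G"
  shows "finite (torus_critical_points \<omega>1 \<omega>2 (\<lambda>z. G z 0) - {torus_zero \<omega>1 \<omega>2}) \<and>
         card (torus_critical_points \<omega>1 \<omega>2 (\<lambda>z. G z 0) - {torus_zero \<omega>1 \<omega>2}) \<le> 5"
proof -
  interpret period_lattice \<omega>1 \<omega>2
    by unfold_locales (rule independent_imp_Im_nonzero[OF assms(1,2)])
  have G: "periodic \<omega>1 \<omega>2 (\<lambda>z. G z 0)" "smooth_on {z. z - 0 \<notin> \<Lambda>} (\<lambda>z. G z 0)"
    "set_integrable lborel P (\<lambda>z. G z 0)" "green_equation \<omega>1 \<omega>2 0 (\<lambda>z. G z 0)"
    using assms(3) unfolding is_green_function_def by blast+
  moreover have "{z. z - 0 \<notin> \<Lambda>} = - \<Lambda>" by auto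
  ultimately interpret torus_green \<omega>1 \<omega>2 "\<lambda>z. G z 0" by unfold_locales simp_all
  define S where "S = torus_critical_points \<omega>1 \<omega>2 (\<lambda>z. G z 0) - {torus_zero \<omega>1 \<omega>2}"
  let ?crit = "\<lambda>z. ((\<lambda>z. G z 0) has_derivative (\<lambda>_. 0)) (at z)"
  have equiv: "equiv UNIV (lattice_rel \<omega>1 \<omega>2)"
  proof (rule equivI)
    show "lattice_rel \<omega>1 \<omega>2 \<subseteq> UNIV \<times> UNIV" by simp
    show "refl (lattice_rel \<omega>1 \<omega>2)" by (simp add: refl_on_def lattice_rel_def)
    show "sym (lattice_rel \<omega>1 \<omega>2)"
    proof (rule symI)
      fix x y assume "(x, y) \<in> lattice_rel \<omega>1 \<omega>2"
      then show "(y, x) \<in> lattice_rel \<omega>1 \<omega>2" using lattice_minus[of "x - y"] by (simp add: lattice_rel_def)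
    qed
    show "trans (lattice_rel \<omega>1 \<omega>2)"
    proof (rule transI)
      fix x y z assume "(x, y) \<in> lattice_rel \<omega>1 \<omega>2" "(y, z) \<in> lattice_rel \<omega>1 \<omega>2"
      then show "(x, z) \<in> lattice_rel \<omega>1 \<omega>2" using lattice_add[of "x - y" "y - z"] by (simp add: lattice_rel_def)
    qed
  qed
  have rep: "\<exists>z. z \<in> p \<and> ?crit z" if "p \<in> S" for p
    using that by (auto simp: S_def torus_critical_points_def)
  \<comment> \<open>A representative is chosen at which the derivative vanishes, so no transfer of
    the condition between representatives of a class is required.\<close>
  define \<zeta> where "\<zeta> p = (SOME z. z \<in> p \<and> ?crit z)" for p
  have \<zeta>: "\<zeta> p \<in> p" "?crit (\<zeta> p)" if "p \<in> S" for p
    using someI_ex[OF rep[OF that]] by (auto simp: \<zeta>_def)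
  have coset: "p = lattice_rel \<omega>1 \<omega>2 `` {z}" if "p \<in> S" "z \<in> p" for p z
  proof -
    have "p \<in> UNIV // lattice_rel \<omega>1 \<omega>2" using that(1) by (simp add: S_def torus_critical_points_def torus_def)
    then show ?thesis using that(2) equiv_class_eq_iff[OF equiv] by (auto elim!: quotientE intro!: equiv_class_eq[OF equiv])
  qed
  have notL: "\<zeta> p \<notin> \<Lambda>" if "p \<in> S" for p
  proof
    assume "\<zeta> p \<in> \<Lambda>"
    then have "(\<zeta> p, 0) \<in> lattice_rel \<omega>1 \<omega>2" by (simp add: lattice_rel_def)
    then have "p = torus_zero \<omega>1 \<omega>2"
      using coset[OF that \<zeta>(1)[OF that]] equiv_class_eq[OF equiv] by (simp add: torus_zero_def)
    then show False using that by (simp add: S_def)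
  qed
  have inj: "p = q" if "p \<in> S" "q \<in> S" "\<zeta> p - \<zeta> q \<in> \<Lambda>" for p q
  proof -
    have "(\<zeta> p, \<zeta> q) \<in> lattice_rel \<omega>1 \<omega>2" using that(3) by (simp add: lattice_rel_def)
    then show ?thesis
      using coset[OF that(1) \<zeta>(1)[OF that(1)]] coset[OF that(2) \<zeta>(1)[OF that(2)]] equiv_class_eq[OF equiv] by metis
  qed
  \<comment> \<open>A uniform bound on all finite subsets yields finiteness and the cardinality
    bound together.\<close>
  have "card A \<le> 5" if A: "A \<subseteq> S" "finite A" for A
  proof -
    have "inj_on \<zeta> A" using inj A(1) by (intro inj_onI) (metis lattice_0 diff_self subsetD)
    then have "card A = card (\<zeta> ` A)" by (simp add: card_image)
    also have "\<dots> \<le> 5"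
    proof (rule card_critical_points)
      show "finite (\<zeta> ` A)" using A(2) by simp
      show "z \<notin> \<Lambda> \<and> ?crit z" if "z \<in> \<zeta> ` A" for z using that A(1) notL \<zeta>(2) by blast
      show "z = z'" if "z \<in> \<zeta> ` A" "z' \<in> \<zeta> ` A" "z - z' \<in> \<Lambda>" for z z' using that A(1) inj by blast
    qed
    finally show ?thesis .
  qed
  then show ?thesis unfolding S_def[symmetric] using finite_if_finite_subsets_card_bdd by blast
qed

end
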